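(* Let $\mu,\lambda\in A_2$, let $\varphi\in H^2_{-}(\mathbb{T})\cap L^2(\mathbb{T},\lambda\,dm)$, and let $H_\varphi$ be the operator defined on analytic polynomials $f$ by $H_\varphi f=\mathbb{P}_{-}(\varphi f)$. For $z\in\mathbb{D}$ let $K_z(\zeta)=\frac{1}{1-\bar z\zeta}$. Then $$\sup_{z\in\mathbb{D}}\frac{\|H_\varphi K_z\|_{L^2(\lambda)}}{\|K_z\|_{L^2(\mu)}}=\Big(\sup_{z\in\mathbb{D}}\frac{1}{\mu(z)}\int_{\mathbb{T}}|\varphi-\varphi(z)|^2P_z\,\lambda\,dm\Big)^{1/2}=:\|\varphi\|_{\mathcal{G},\lambda\mu},$$ $$\sup_{z\in\mathbb{D}}\frac{\|H_\varphi K_z\|_{L^2(\mu^{-1})}}{\|K_z\|_{L^2(\lambda^{-1})}}=\Big(\sup_{z\in\mathbb{D}}\frac{1}{\lambda^{-1}(z)}\int_{\mathbb{T}}|\varphi-\varphi(z)|^2P_z\,\mu^{-1}\,dm\Big)^{1/2}=:\|\varphi\|_{\mathcal{G},\mu^{-1}\lambda^{-1}},$$ and both $\|\varphi\|_{\mathcal{G},\lambda\mu}<\infty$ and $\|\varphi\|_{\mathcal{G},\mu^{-1}\lambda^{-1}}<\infty$ if and only if $H_\varphi$ extends to a bounded operator from $H^2(\mu)$ to the closure of $H^2_{-}\cap L^2(\lambda)$ in $L^2(\lambda)$ and to a bounded operator from $H^2(\lambda^{-1})$ to the closure of $H^2_{-}\cap L^2(\mu^{-1})$ in $L^2(\mu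^{-1})$.
   Context: $\mathbb{T}$ is the unit circle, $\mathbb{D}$ the unit disc, $dm$ normalized arc length measure. A weight $w\ge 0$ is in $A_2$ if $\sup_{I}\big(\frac{1}{|I|}\int_I w\,dm\big)\big(\frac{1}{|I|}\int_I w^{-1}dm\big)<\infty$, the supremum over subarcs $I\subset\mathbb{T}$. $H^2_{-}(\mathbb{T})$ is the closed span in $L^2(\mathbb{T})$ of $\{\zeta^{-n}:n\ge1\}$ and $\mathbb{P}_{-}$ the orthogonal projection onto it. For a weight $w$, $L^2(w)=L^2(\mathbb{T},w\,dm)$, and $H^2(w)$ is the closure of analytic polynomials in $L^2(w)$. $P_z(\zeta)=\frac{1-|z|^2}{|1-\bar z\zeta|^2}$ is the Poisson kernel, and for an integrable function $u$ on $\mathbb{T}$, $u(z)=\int_{\mathbb{T}}uP_z\,dm$ denotes its harmonic (Poisson) extension; in particular $\mu(z),\lambda^{-1}(z),\varphi(z)$ are the Poisson extensions of $\mu$, $\lambda^{-1}$, $\varphi$. *)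

theory Defs
  imports "HOL-Analysis.Analysis"
begin

definition dm :: "complex measure" where
  "dm = distr (uniform_measure lborel {0..2*pi}) borel cis"

definition arcs :: "complex set set" where
  "arcs = {cis ` {a..b} | a b. a < b \<and> b \<le> a + 2*pi}"

definition A2 :: "(complex \<Rightarrow> real) \<Rightarrow> bool" where
  "A2 w \<longleftrightarrow> w \<in> borel_measurable borel \<and> (\<forall>\<zeta>\<in>sphere 0 1. 0 \<le> w \<zeta>) \<and>
     (\<exists>C::real. \<forall>I\<in>arcs.
        (\<integral>\<^sup>+\<zeta>\<in>I. ennreal (w \<zeta>) \<partial>dm) * (\<integral>\<^sup>+\<zeta>\<in>I. inverse (ennreal (w \<zeta>)) \<partial>dm)
          \<le> ennreal C * (emeasure dm I)\<^sup>2)"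

definition inv_weight :: "(complex \<Rightarrow> real) \<Rightarrow> complex \<Rightarrow> real" where
  "inv_weight w = (\<lambda>\<zeta>. inverse (w \<zeta>))"

definition ennsqrt :: "ennreal \<Rightarrow> ennreal" where
  "ennsqrt x = (if x = \<infinity> then \<infinity> else ennreal (sqrt (enn2real x)))"

definition sqnormL2 :: "(complex \<Rightarrow> real) \<Rightarrow> (complex \<Rightarrow> complex) \<Rightarrow> ennreal" where
  "sqnormL2 w f = (\<integral>\<^sup>+\<zeta>. ennreal ((cmod (f \<zeta>))\<^sup>2 * w \<zeta>) \<partial>dm)"

definition normL2 :: "(complex \<Rightarrow> real) \<Rightarrow> (complex \<Rightarrow> complex) \<Rightarrow> ennreal" where
  "normL2 w f = ennsqrt (sqnormL2 w f)"

definition L2w :: "(complex \<Rightarrow> real) \<Rightarrow> (complex \<Rightarrow> complex) set" where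
  "L2w w = {f. f \<in> borel_measurable dm \<and> sqnormL2 w f < \<infinity>}"

definition closL2 :: "(complex \<Rightarrow> real) \<Rightarrow> (complex \<Rightarrow> complex) set \<Rightarrow> (complex \<Rightarrow> complex) set" where
  "closL2 w S = {f \<in> L2w w. \<forall>\<epsilon>>0. \<exists>g\<in>S. sqnormL2 w (\<lambda>\<zeta>. f \<zeta> - g \<zeta>) < ennreal \<epsilon>}"

definition analytic_polys :: "(complex \<Rightarrow> complex) set" where
  "analytic_polys = {(\<lambda>\<zeta>. \<Sum>k<n. c k * \<zeta> ^ k) | c n. True}"

definition antianalytic_polys :: "(complex \<Rightarrow> complex) set" where
  "antianalytic_polys = {(\<lambda>\<zeta>. \<Sum>k<n. c k * inverse \<zeta> ^ Suc k) | c n. True}"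

definition H2minus :: "(complex \<Rightarrow> complex) set" where
  "H2minus = closL2 (\<lambda>_. 1) antianalytic_polys"

definition H2w :: "(complex \<Rightarrow> real) \<Rightarrow> (complex \<Rightarrow> complex) set" where
  "H2w w = closL2 w analytic_polys"

text \<open>Orthogonal projection of L2(T) onto H^2_- (a representative of the a.e. class).\<close>
definition Pminus :: "(complex \<Rightarrow> complex) \<Rightarrow> complex \<Rightarrow> complex" where
  "Pminus h = (SOME g. g \<in> H2minus \<and>
      (\<forall>u\<in>H2minus. (\<integral>\<zeta>. (h \<zeta> - g \<zeta>) * cnj (u \<zeta>) \<partial>dm) = 0))"

definition Hankel :: "(complex \<Rightarrow> complex) \<Rightarrow> (complex \<Rightarrow> complex) \<Rightarrow> complex \<Rightarrow> complex" where
  "Hankel \<phi> f = Pminus (\<lambda>\<zeta>. \<phi> \<zeta> * f \<zeta>)"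

definition Kz :: "complex \<Rightarrow> complex \<Rightarrow> complex" where
  "Kz z = (\<lambda>\<zeta>. 1 / (1 - cnj z * \<zeta>))"

definition Poisson :: "complex \<Rightarrow> complex \<Rightarrow> real" where
  "Poisson z \<zeta> = (1 - (cmod z)\<^sup>2) / (cmod (1 - cnj z * \<zeta>))\<^sup>2"

definition poisson_ext :: "(complex \<Rightarrow> 'a::{banach,second_countable_topology}) \<Rightarrow> complex \<Rightarrow> 'a" where
  "poisson_ext u z = (\<integral>\<zeta>. Poisson z \<zeta> *\<^sub>R u \<zeta> \<partial>dm)"

definition Gnorm :: "(complex \<Rightarrow> complex) \<Rightarrow> (complex \<Rightarrow> real) \<Rightarrow> (complex \<Rightarrow> real) \<Rightarrow> ennreal" where
  "Gnorm \<phi> w v = ennsqrt (SUP z\<in>ball 0 1.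
      (\<integral>\<^sup>+\<zeta>. ennreal ((cmod (\<phi> \<zeta> - poisson_ext \<phi> z))\<^sup>2 * Poisson z \<zeta> * w \<zeta>) \<partial>dm)
        / ennreal (poisson_ext v z))"

definition Hankel_extends_bounded ::
  "(complex \<Rightarrow> complex) \<Rightarrow> (complex \<Rightarrow> real) \<Rightarrow> (complex \<Rightarrow> real) \<Rightarrow> bool" where
  "Hankel_extends_bounded \<phi> w1 w2 \<longleftrightarrow>
     (\<exists>(T :: (complex \<Rightarrow> complex) \<Rightarrow> complex \<Rightarrow> complex) (C::real).
        (\<forall>f\<in>H2w w1. T f \<in> closL2 w2 (H2minus \<inter> L2w w2)) \<and>
        (\<forall>f\<in>H2w w1. \<forall>g\<in>H2w w1. \<forall>a b::complex.
            AE \<zeta> in dm. T (\<lambda>x. a * f x + b * g x) \<zeta> = a * T f \<zeta> + b * T g \<zeta>) \<and>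
        (\<forall>f\<in>H2w w1. normL2 w2 (T f) \<le> ennreal C * normL2 w1 f) \<and>
        (\<forall>p\<in>analytic_polys. AE \<zeta> in dm. T p \<zeta> = Hankel \<phi> p \<zeta>))"

end

theory Submission
  imports Defs "HOL-Complex_Analysis.Complex_Analysis" "HOL-Library.Function_Algebras"
begin

text \<open>Since \<open>\<phi>\<close> is antianalytic, \<open>H K_z = (\<phi> - \<phi>(z)) K_z\<close>, and \<open>|K_z|^2\<close> is the Poisson kernel
  divided by \<open>1 - |z|^2\<close>. This gives both identities and the necessity of the two conditions.

  For sufficiency, \<open>H\<close> is tested against products \<open>p h\<close> with \<open>h\<close> analytic, and every area
  integral of the classical argument is replaced by a comparison of Laplacians: functions \<open>F\<close> and
  \<open>B\<close> on the disc with \<open>F(0) \<le> B(0)\<close> and \<open>\<Delta>F \<le> \<Delta>B\<close> have circle means in the same order. Let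
  \<open>w, v\<close> be the Poisson extensions of an \<open>A_2\<close> weight and its inverse. The function
  \<open>U^2 (w + c / (2v - 1/w))\<close> has Laplacian at least \<open>|\<nabla>U|^2 w\<close> for harmonic \<open>U\<close>, a weighted
  Littlewood-Paley inequality, which also yields the weighted bound for the Riesz projection. From it
  one obtains \<open>G \<ge> 0\<close> with \<open>\<Delta>G \<le> - |\<nabla>\<phi>|^2 w\<close> that is dominated by the weighted oscillation of
  \<open>\<phi>\<close>, hence by the other weight; then \<open>U^2 / (2v - 1/(w + G/\<kappa>))\<close> proves the Carleson embedding
  needed for the terms where the derivative falls on \<open>\<phi>\<close>. All of this happens inside the disc;
  dilation and Fatou's lemma carry the bound to the circle. The two conditions are both needed
  because the product rule puts the derivative on either factor of \<open>p h\<close>.\<close>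

section \<open>Normalized arc length on the circle\<close>

text \<open>The Laplacian of the Hankel form is a product of two gradients. The arithmetic-geometric
  mean inequality gives one of them a weight and the other the harmonic extension of the reciprocal
  weight; these two extensions have product at least 1 in the disc, so nothing is lost. The
  resulting bounds are additive, a constant times the sum of two squared norms. Norm estimates are
  recovered by duality: the form is tested against \<epsilon> times the conjugate of the function to
  be estimated times its weight. The left side is then \<epsilon> N, the right side contains a
  multiple of \<epsilon>^2 N, and a small \<epsilon> allows absorption. Absorption needs N finite in
  advance, which is why a dilation r < 1 is kept until the end. The test function is not analytic,
  and the weighted Riesz projection repairs this. The hypotheses place \<phi> in L2(lam) but not in
  L2(1/mu); the latter comes from the second condition at z = 0, where \<phi>(0) = 0.\<close>

lemma sets_dm [simp, measurable_cong]: "sets dm = sets borel"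
  by (simp add: dm_def)

lemma space_dm [simp]: "space dm = UNIV"
  by (simp add: dm_def)

lemma cis_measurable [measurable]: "cis \<in> borel_measurable borel"
  by (intro borel_measurable_continuous_onI continuous_intros)

lemma nn_integral_dm:
  assumes [measurable]: "f \<in> borel_measurable borel"
  shows "(\<integral>\<^sup>+\<zeta>. f \<zeta> \<partial>dm) = (\<integral>\<^sup>+t\<in>{0..2*pi}. f (cis t) \<partial>lborel) / ennreal (2*pi)"
  unfolding dm_def by (subst nn_integral_distr) (auto simp: nn_integral_uniform_measure)

lemma emeasure_dm_UNIV: "emeasure dm UNIV = 1"
proof -
  have "(\<integral>\<^sup>+\<zeta>. 1 \<partial>dm) = ennreal (2*pi) / ennreal (2*pi)"
    by (subst nn_integral_dm) auto
  also have "\<dots> = 1" by (simp add: divide_ennreal)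
  finally show ?thesis by simp
qed

interpretation dm: finite_measure dm
  by standard (simp add: emeasure_dm_UNIV)

lemma measure_dm_UNIV [simp]: "measure dm UNIV = 1"
  by (simp add: measure_def emeasure_dm_UNIV)

lemma AE_dm_iff:
  assumes [measurable]: "Measurable.pred borel P"
  shows "(AE \<zeta> in dm. P \<zeta>) \<longleftrightarrow> (AE t in lborel. t \<in> {0..2*pi} \<longrightarrow> P (cis t))"
  unfolding dm_def by (subst AE_distr_iff) (auto simp: AE_uniform_measure)

lemma AE_dm_circle: "AE \<zeta> in dm. cmod \<zeta> = 1"
  by (subst AE_dm_iff) auto

lemma integral_dm:
  fixes f :: "complex \<Rightarrow> 'a::euclidean_space"
  assumes [measurable]: "f \<in> borel_measurable borel"
  shows "(\<integral>\<zeta>. f \<zeta> \<partial>dm) = (1/(2*pi)) *\<^sub>R (LINT t:{0..2*pi}|lborel. f (cis t))"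
proof -
  have "(\<integral>\<zeta>. f \<zeta> \<partial>dm) = (\<integral>t. f (cis t) \<partial>uniform_measure lborel {0..2*pi})"
    unfolding dm_def by (subst integral_distr) auto
  also have "uniform_measure lborel {0..2*pi} = density lborel (\<lambda>x. ennreal (indicator {0..2*pi} x / (2*pi)))"
    unfolding uniform_measure_def
    by (intro arg_cong2[where f=density] refl ext) (auto simp: indicator_def divide_ennreal[of 1 "2*pi", simplified])
  also have "(\<integral>t. f (cis t) \<partial>density lborel (\<lambda>x. ennreal (indicator {0..2*pi} x / (2*pi)))) =
    (\<integral>t. (indicator {0..2*pi} t / (2*pi)) *\<^sub>R f (cis t) \<partial>lborel)"
    by (subst integral_density) auto
  also have "\<dots> = (\<integral>t. (1/(2*pi)) *\<^sub>R (indicator {0..2*pi} t *\<^sub>R f (cis t)) \<partial>lborel)"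
    by (intro Bochner_Integration.integral_cong) auto
  also have "\<dots> = (1/(2*pi)) *\<^sub>R (LINT t:{0..2*pi}|lborel. f (cis t))"
    unfolding set_lebesgue_integral_def by (rule integral_scaleR_right)
  finally show ?thesis .
qed

text \<open>Bridges Lebesgue integrals over \<open>dm\<close> and gauge integrals over an angle:
  differentiation under the integral in \<open>jet_mean\<close> is done with the latter, the L2
  theory with the former.\<close>

lemma integral_dm_cont:
  fixes f :: "complex \<Rightarrow> 'a::euclidean_space"
  assumes [measurable]: "f \<in> borel_measurable borel"
  assumes "continuous_on (sphere 0 1) f"
  shows "(\<integral>\<zeta>. f \<zeta> \<partial>dm) = (1/(2*pi)) *\<^sub>R integral {0..2*pi} (\<lambda>t. f (cis t))"
proof -
  have "continuous_on {0..2*pi} (\<lambda>t. f (cis t))"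
    by (rule continuous_on_compose2[OF assms(2)]) (auto intro!: continuous_intros)
  hence "set_integrable lborel {0..2*pi} (\<lambda>t. f (cis t))"
    by (intro borel_integrable_atLeastAtMost' )
  thus ?thesis
    by (subst integral_dm) (auto simp: set_borel_integral_eq_integral)
qed

lemma integrable_dm_bounded:
  fixes f :: "complex \<Rightarrow> 'a::{banach,second_countable_topology}"
  assumes "f \<in> borel_measurable borel" "\<And>\<zeta>. cmod \<zeta> = 1 \<Longrightarrow> norm (f \<zeta>) \<le> B"
  shows "integrable dm f"
  using assms(1) AE_dm_circle assms(2)
  by (intro dm.integrable_const_bound[where B=B]) (auto elim: eventually_mono)

lemma integrable_dm_bounded_mult:
  fixes f g :: "complex \<Rightarrow> 'a::{real_normed_algebra,banach,second_countable_topology}"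
  assumes [measurable]: "f \<in> borel_measurable borel" and f: "\<And>\<zeta>. cmod \<zeta> = 1 \<Longrightarrow> norm (f \<zeta>) \<le> B"
    and g: "integrable dm g"
  shows "integrable dm (\<lambda>\<zeta>. f \<zeta> * g \<zeta>)"
proof (rule Bochner_Integration.integrable_bound)
  show "integrable dm (\<lambda>\<zeta>. B * norm (g \<zeta>))" using g by simp
  have [measurable]: "g \<in> borel_measurable borel" using g by (auto dest: borel_measurable_integrable)
  show "(\<lambda>\<zeta>. f \<zeta> * g \<zeta>) \<in> borel_measurable dm" by measurable
  show "AE x in dm. norm (f x * g x) \<le> norm (B * norm (g x))"
    using AE_dm_circle
  proof eventually_elim
    case (elim x)
    have "norm (f x * g x) \<le> norm (f x) * norm (g x)" by (rule norm_mult_ineq)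
    also have "\<dots> \<le> B * norm (g x)" using f[OF elim] by (intro mult_right_mono) auto
    also have "\<dots> \<le> norm (B * norm (g x))" by simp
    finally show ?case .
  qed
qed

lemma integral_dm_cong:
  fixes f g :: "complex \<Rightarrow> 'a::{banach,second_countable_topology}"
  assumes "f \<in> borel_measurable borel" "g \<in> borel_measurable borel" "\<And>\<zeta>. cmod \<zeta> = 1 \<Longrightarrow> f \<zeta> = g \<zeta>"
  shows "(\<integral>\<zeta>. f \<zeta> \<partial>dm) = (\<integral>\<zeta>. g \<zeta> \<partial>dm)"
  using assms(1,2) AE_dm_circle assms(3)
  by (intro integral_cong_AE) (auto elim: eventually_mono)

lemma integral_dm_power:
  assumes "n > 0" shows "(\<integral>\<zeta>. \<zeta> ^ n \<partial>dm) = 0"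
proof -
  have "(\<integral>\<zeta>. \<zeta> ^ n \<partial>dm) = (1/(2*pi)) *\<^sub>R integral {0..2*pi} (\<lambda>t. cis t ^ n)"
    by (intro integral_dm_cont) (auto intro!: continuous_intros)
  also have "((\<lambda>t. cis t ^ n) has_integral (cis (2*pi) ^ n / (\<i> * n) - cis 0 ^ n / (\<i> * n))) {0..2*pi}"
  proof (rule fundamental_theorem_of_calculus)
    fix t :: real
    have "((\<lambda>t. cis (n * t) / (\<i> * n)) has_derivative (\<lambda>h. (n * h) *\<^sub>R (\<i> * cis (n * t)) / (\<i> * n))) (at t within {0..2*pi})"
      using assms by (auto intro!: derivative_eq_intros simp: fun_eq_iff field_simps)
    also have "(\<lambda>h::real. (n * h) *\<^sub>R (\<i> * cis (n * t)) / (\<i> * n)) = (\<lambda>h. h *\<^sub>R cis (n * t))"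
      using assms by (auto simp: scaleR_conv_of_real field_simps)
    finally show "((\<lambda>t. cis t ^ n / (\<i> * n)) has_vector_derivative cis t ^ n) (at t within {0..2*pi})"
      by (simp add: Complex.DeMoivre has_vector_derivative_def)
  qed auto
  hence "integral {0..2*pi} (\<lambda>t. cis t ^ n) = 0" by (simp add: integral_unique)
  finally show ?thesis by simp
qed

section \<open>Twice differentiable functions on the disc\<close>

text \<open>For real \<open>G\<close>, \<open>jet G a l\<close> says that \<open>G\<close> is of class C2 on the disc with
  \<open>\<partial>G = a\<close> and \<open>\<partial>\<partial>\<bar>G = l\<close>, a quarter of the Laplacian; \<open>c\<close> below is \<open>\<partial>\<partial>G\<close>.\<close>

definition jetc :: "(complex \<Rightarrow> real) \<Rightarrow> (complex \<Rightarrow> complex) \<Rightarrow> (complex \<Rightarrow> real) \<Rightarrow> (complex \<Rightarrow> complex) \<Rightarrow> bool" where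
  "jetc G a l c \<longleftrightarrow> continuous_on (ball 0 1) l \<and> continuous_on (ball 0 1) c \<and>
     (\<forall>z\<in>ball 0 1. (G has_derivative (\<lambda>h. 2 * Re (a z * h))) (at z) \<and>
        (a has_derivative (\<lambda>h. c z * h + of_real (l z) * cnj h)) (at z))"

definition jet :: "(complex \<Rightarrow> real) \<Rightarrow> (complex \<Rightarrow> complex) \<Rightarrow> (complex \<Rightarrow> real) \<Rightarrow> bool" where
  "jet G a l \<longleftrightarrow> (\<exists>c. jetc G a l c)"

lemma jetI:
  assumes "continuous_on (ball 0 1) l" "continuous_on (ball 0 1) c"
    "\<And>z. z \<in> ball 0 1 \<Longrightarrow> (G has_derivative (\<lambda>h. 2 * Re (a z * h))) (at z)"
    "\<And>z. z \<in> ball 0 1 \<Longrightarrow> (a has_derivative (\<lambda>h. c z * h + of_real (l z) * cnj h)) (at z)"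
  shows "jet G a l"
  using assms unfolding jet_def jetc_def by blast

lemma jetcD:
  assumes "jetc G a l c"
  shows "continuous_on (ball 0 1) l" "continuous_on (ball 0 1) c"
    "\<And>z. z \<in> ball 0 1 \<Longrightarrow> (G has_derivative (\<lambda>h. 2 * Re (a z * h))) (at z)"
    "\<And>z. z \<in> ball 0 1 \<Longrightarrow> (a has_derivative (\<lambda>h. c z * h + of_real (l z) * cnj h)) (at z)"
    "continuous_on (ball 0 1) a" "continuous_on (ball 0 1) G"
proof -
  show 1: "continuous_on (ball 0 1) l" "continuous_on (ball 0 1) c"
    "\<And>z. z \<in> ball 0 1 \<Longrightarrow> (G has_derivative (\<lambda>h. 2 * Re (a z * h))) (at z)"
    "\<And>z. z \<in> ball 0 1 \<Longrightarrow> (a has_derivative (\<lambda>h. c z * h + of_real (l z) * cnj h)) (at z)"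
    using assms unfolding jetc_def by blast+
  show "continuous_on (ball 0 1) a" "continuous_on (ball 0 1) G"
    by (rule continuous_at_imp_continuous_on, rule ballI, rule has_derivative_continuous, erule 1)+
qed

section \<open>Calculus of jets: sums, products, reciprocals, real and imaginary parts\<close>

lemma jet_cong:
  assumes "jet G a l" "\<And>z. z \<in> ball 0 1 \<Longrightarrow> G z = G' z" "\<And>z. z \<in> ball 0 1 \<Longrightarrow> a z = a' z"
    "\<And>z. z \<in> ball 0 1 \<Longrightarrow> l z = l' z"
  shows "jet G' a' l'"
proof -
  from assms(1) obtain c where "jetc G a l c" unfolding jet_def by blast
  note 1 = jetcD[OF this]
  show ?thesis
  proof (rule jetI)
    show "continuous_on (ball 0 1) l'"
      by (rule continuous_on_eq[OF 1(1)]) (use assms(4) in auto)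
    show "continuous_on (ball 0 1) c" by (rule 1)
    fix z :: complex assume z: "z \<in> ball 0 1"
    show "(G' has_derivative (\<lambda>h. 2 * Re (a' z * h))) (at z)"
      using has_derivative_transform_within_open[OF 1(3)[OF z] open_ball z] assms(2,3) z by auto
    show "(a' has_derivative (\<lambda>h. c z * h + of_real (l' z) * cnj h)) (at z)"
      using has_derivative_transform_within_open[OF 1(4)[OF z] open_ball z] assms(3,4) z by auto
  qed
qed

lemma jet_continuous: "jet G a l \<Longrightarrow> continuous_on (ball 0 1) G"
  unfolding jet_def by (auto dest: jetcD)

lemma jet_const: "jet (\<lambda>_. k) (\<lambda>_. 0) (\<lambda>_. 0)"
  by (rule jetI[where c="\<lambda>_. 0"]) (auto intro!: derivative_eq_intros)

lemma jet_add:
  assumes "jet G a l" "jet G' a' l'"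
  shows "jet (\<lambda>z. G z + G' z) (\<lambda>z. a z + a' z) (\<lambda>z. l z + l' z)"
proof -
  from assms(1) obtain c where "jetc G a l c" unfolding jet_def by blast
  note 1 = jetcD[OF this]
  from assms(2) obtain c' where "jetc G' a' l' c'" unfolding jet_def by blast
  note 2 = jetcD[OF this]
  show ?thesis
    by (rule jetI[where c="\<lambda>z. c z + c' z"])
       (use 1 2 in \<open>auto intro!: continuous_intros derivative_eq_intros simp: algebra_simps\<close>)
qed

text \<open>For real functions \<partial>\<bar>G is the conjugate of \<partial>G, so the two mixed
  products merge into twice a real part.\<close>

lemma jet_mult:
  assumes "jet G a l" "jet G' a' l'"
  shows "jet (\<lambda>z. G z * G' z) (\<lambda>z. of_real (G z) * a' z + of_real (G' z) * a z)
    (\<lambda>z. G z * l' z + G' z * l z + 2 * Re (a z * cnj (a' z)))"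
proof -
  from assms(1) obtain c where "jetc G a l c" unfolding jet_def by blast
  note 1 = jetcD[OF this]
  from assms(2) obtain c' where "jetc G' a' l' c'" unfolding jet_def by blast
  note 2 = jetcD[OF this]
  show ?thesis
  proof (rule jetI[where c="\<lambda>z. G z * c' z + G' z * c z + 2 * a z * a' z"])
    fix z :: complex assume z: "z \<in> ball 0 1"
    show "((\<lambda>z. G z * G' z) has_derivative (\<lambda>h. 2 * Re ((of_real (G z) * a' z + of_real (G' z) * a z) * h))) (at z)"
      using 1(3)[OF z] 2(3)[OF z] by (auto intro!: derivative_eq_intros simp: fun_eq_iff algebra_simps)
    \<comment> \<open>Real parts are expressed through conjugates so that the derivative formula
      becomes a polynomial identity.\<close>
    have e1: "of_real (2 * Re (x * y)) = x * y + cnj x * cnj y" for x y :: complex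
      by (simp add: complex_eq_iff)
    have "((\<lambda>z. of_real (G z) * a' z + of_real (G' z) * a z) has_derivative
      (\<lambda>h. (of_real (G z) * (c' z * h + of_real (l' z) * cnj h) + of_real (2 * Re (a z * h)) * a' z) +
       (of_real (G' z) * (c z * h + of_real (l z) * cnj h) + of_real (2 * Re (a' z * h)) * a z))) (at z)"
      using 1(3,4)[OF z] 2(3,4)[OF z]
      by (intro has_derivative_add has_derivative_mult has_derivative_of_real)
    also have "(\<lambda>h. (of_real (G z) * (c' z * h + of_real (l' z) * cnj h) + of_real (2 * Re (a z * h)) * a' z) +
       (of_real (G' z) * (c z * h + of_real (l z) * cnj h) + of_real (2 * Re (a' z * h)) * a z)) =
      (\<lambda>h. (G z * c' z + G' z * c z + 2 * a z * a' z) * h +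
      of_real (G z * l' z + G' z * l z + 2 * Re (a z * cnj (a' z))) * cnj h)"
      unfolding of_real_add e1 of_real_mult[of "G z"] of_real_mult[of "G' z"] complex_cnj_cnj by (intro ext) algebra
    finally show "((\<lambda>z. of_real (G z) * a' z + of_real (G' z) * a z) has_derivative \<dots>) (at z)" .
  qed (use 1 2 in \<open>auto intro!: continuous_intros\<close>)
qed

lemma jet_cmult: "jet G a l \<Longrightarrow> jet (\<lambda>z. k * G z) (\<lambda>z. of_real k * a z) (\<lambda>z. k * l z)"
  using jet_mult[OF jet_const[of k]] by simp

lemma jet_diff:
  assumes "jet G a l" "jet G' a' l'"
  shows "jet (\<lambda>z. G z - G' z) (\<lambda>z. a z - a' z) (\<lambda>z. l z - l' z)"
  using jet_add[OF assms(1) jet_cmult[OF assms(2), of "-1"]] by simp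

text \<open>The term with \<open>G z ^ 3\<close> has a fixed sign: the reciprocal of a positive
  harmonic function is subharmonic, with a gain quadratic in the gradient. Subtracted, as in
  \<open>2v - 1/w\<close>, it yields superharmonicity. The Bellman functions below exploit both
  signs.\<close>

lemma jet_inverse:
  assumes "jet G a l" and pos: "\<And>z. z \<in> ball 0 1 \<Longrightarrow> G z > 0"
  shows "jet (\<lambda>z. 1 / G z) (\<lambda>z. - a z / of_real (G z ^ 2))
    (\<lambda>z. - l z / G z ^ 2 + 2 * cmod (a z) ^ 2 / G z ^ 3)"
proof -
  from assms(1) obtain c where "jetc G a l c" unfolding jet_def by blast
  note 1 = jetcD[OF this]
  define r where "r = (\<lambda>z. inverse (G z))"
  have nz: "G z \<noteq> 0" if "z \<in> ball 0 1" for z using pos[OF that] by simp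
  have dr: "(r has_derivative (\<lambda>h. - (r z)\<^sup>2 * (2 * Re (a z * h)))) (at z)" if z: "z \<in> ball 0 1" for z
    unfolding r_def by (rule derivative_eq_intros 1(3)[OF z] nz[OF z] refl)+ (simp add: power2_eq_square mult_ac)
  have "jet r (\<lambda>z. - a z * of_real ((r z)\<^sup>2)) (\<lambda>z. - l z * (r z)\<^sup>2 + 2 * (cmod (a z))\<^sup>2 * r z ^ 3)"
  proof (rule jetI[where c="\<lambda>z. - c z * of_real ((r z)\<^sup>2) + 2 * (a z)\<^sup>2 * of_real (r z ^ 3)"])
    fix z :: complex assume z: "z \<in> ball 0 1"
    have eq1: "- (r z)\<^sup>2 * (2 * Re (a z * h)) = 2 * Re (- a z * of_real ((r z)\<^sup>2) * h)" for h
      by (simp add: algebra_simps)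
    show "(r has_derivative (\<lambda>h. 2 * Re (- a z * of_real ((r z)\<^sup>2) * h))) (at z)"
      using dr[OF z] unfolding eq1 .
    have n: "(cmod (a z))\<^sup>2 = (Re (a z))\<^sup>2 + (Im (a z))\<^sup>2" by (simp add: cmod_power2)
    have "((\<lambda>z. - a z * of_real ((r z)\<^sup>2)) has_derivative (\<lambda>h. - (a z * of_real (2 * r z * (- (r z)\<^sup>2 * (2 * Re (a z * h))))
      + (c z * h + of_real (l z) * cnj h) * of_real ((r z)\<^sup>2)))) (at z)"
      by (rule derivative_eq_intros dr[OF z] 1(4)[OF z] refl)+ (simp add: fun_eq_iff algebra_simps)
    also have "(\<lambda>h. - (a z * of_real (2 * r z * (- (r z)\<^sup>2 * (2 * Re (a z * h)))) + (c z * h + of_real (l z) * cnj h)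
      * of_real ((r z)\<^sup>2)))
       = (\<lambda>h. (- c z * of_real ((r z)\<^sup>2) + 2 * (a z)\<^sup>2 * of_real (r z ^ 3)) * h +
      of_real (- l z * (r z)\<^sup>2 + 2 * (cmod (a z))\<^sup>2 * r z ^ 3) * cnj h)" (is "?L = ?R")
    proof
      fix h
      have "of_real (2 * Re (a z * h)) = a z * h + cnj (a z) * cnj h"
        by (simp add: complex_eq_iff)
      moreover have "of_real ((cmod (a z))\<^sup>2) = a z * cnj (a z)" by (metis complex_norm_square of_real_power)
      ultimately show "?L h = ?R h"
        unfolding of_real_add of_real_mult of_real_minus of_real_power
          by (simp only: of_real_numeral) (simp add: algebra_simps power2_eq_square power3_eq_cube)
    qed
    finally show "((\<lambda>z. - a z * of_real ((r z)\<^sup>2)) has_derivative \<dots>) (at z)" .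
  qed (use 1 nz in \<open>auto intro!: continuous_intros simp: r_def\<close>)
  thus ?thesis
    by (rule jet_cong) (use nz in \<open>auto simp: r_def field_simps\<close>)
qed

lemma jet_Re:
  assumes "F holomorphic_on ball 0 1"
  shows "jet (\<lambda>z. Re (F z)) (\<lambda>z. deriv F z / 2) (\<lambda>_. 0)"
proof (rule jetI[where c="\<lambda>z. deriv (deriv F) z / 2"])
  have h1: "deriv F holomorphic_on ball 0 1" using assms by (intro holomorphic_deriv) auto
  have h2: "deriv (deriv F) holomorphic_on ball 0 1" by (rule holomorphic_deriv[OF h1]) auto
  show "continuous_on (ball 0 1) (\<lambda>z. deriv (deriv F) z / 2)"
    using holomorphic_on_imp_continuous_on[OF h2] by (intro continuous_intros) auto
  fix z :: complex assume z: "z \<in> ball 0 1"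
  have "(F has_derivative (*) (deriv F z)) (at z)"
    using holomorphic_derivI[OF assms _ z] by (auto simp: has_field_derivative_def)
  thus "((\<lambda>z. Re (F z)) has_derivative (\<lambda>h. 2 * Re (deriv F z / 2 * h))) (at z)"
    by (auto intro!: derivative_eq_intros)
  have "(deriv F has_derivative (*) (deriv (deriv F) z)) (at z)"
    using holomorphic_derivI[OF h1 _ z] by (auto simp: has_field_derivative_def)
  thus "((\<lambda>z. deriv F z / 2) has_derivative (\<lambda>h. deriv (deriv F) z / 2 * h + of_real 0 * cnj h)) (at z)"
    by (auto intro!: derivative_eq_intros)
qed auto

lemma jet_Im:
  assumes "F holomorphic_on ball 0 1"
  shows "jet (\<lambda>z. Im (F z)) (\<lambda>z. - \<i> * deriv F z / 2) (\<lambda>_. 0)"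
proof -
  have "(\<lambda>z. - \<i> * F z) holomorphic_on ball 0 1" by (intro holomorphic_intros assms)
  from jet_Re[OF this] have "jet (\<lambda>z. Im (F z)) (\<lambda>z. deriv (\<lambda>z. - \<i> * F z) z / 2) (\<lambda>_. 0)" by simp
  moreover have "deriv (\<lambda>z. - \<i> * F z) z = - \<i> * deriv F z" if "z \<in> ball 0 1" for z
    using holomorphic_derivI[OF assms _ that] by (intro DERIV_imp_deriv) (auto intro!: derivative_eq_intros)
  ultimately show ?thesis
    by (auto elim!: jet_cong)
qed

section \<open>Bellman functions for a pair of harmonic weights\<close>

text \<open>In polar coordinates \<rho>^2 times the Laplacian is the square of \<rho> d/d\<rho> plus
  the second angular derivative, and the latter integrates to zero over a full turn. Hence \<rho>
  times the radial derivative of the circle mean is increasing from the value 0, so it is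
  nonnegative.\<close>

lemma jet_mean:
  assumes "jet G a l" and l: "\<And>z. z \<in> ball 0 1 \<Longrightarrow> 0 \<le> l z" and r: "0 \<le> r" "r < 1"
  shows "2 * pi * G 0 \<le> integral {0..2*pi} (\<lambda>t. G (of_real r * cis t))"
proof -
  from assms(1) obtain c where "jetc G a l c" unfolding jet_def by blast
  note J = jetcD[OF this]
  \<comment> \<open>An open interval around 0, so that derivatives in the radius are two-sided at 0
    as well.\<close>
  define U where "U = {-1<..<1::real}"
  have in_ball: "of_real \<rho> * cis t \<in> ball 0 1" if "\<rho> \<in> U" for \<rho> t
    using that by (auto simp: U_def norm_mult)
  have cont: "continuous_on (U \<times> T) (\<lambda>(\<rho>, t). f (of_real \<rho> * cis t))" if "continuous_on (ball 0 1) f"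
    for f :: "complex \<Rightarrow> 'x::topological_space" and T
    unfolding split_beta
    by (rule continuous_on_compose2[OF that]) (auto intro!: continuous_intros simp: norm_mult U_def)
  have cont1: "continuous_on {0..2*pi} (\<lambda>t. f (of_real \<rho> * cis t))" if "continuous_on (ball 0 1) f" "\<rho> \<in> U"
    for f :: "complex \<Rightarrow> 'x::topological_space" and \<rho>
    by (rule continuous_on_compose2[OF that(1)]) (use that(2) in \<open>auto intro!: continuous_intros simp: norm_mult U_def\<close>)
  note ac = cont[OF J(5), unfolded split_beta] cont[OF J(2), unfolded split_beta]
    cont[OF J(1), unfolded split_beta] cont1[OF J(5)] cont1[OF J(1)] cont1[OF J(2)] cont1[OF J(6)]
  have dG: "((\<lambda>\<rho>. G (of_real \<rho> * cis t)) has_field_derivative 2 * Re (a (of_real \<rho> * cis t) * cis t)) (at \<rho>)"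
    if "\<rho> \<in> U" for \<rho> t
  proof -
    have "((\<lambda>\<rho>. G (of_real \<rho> * cis t)) has_derivative (\<lambda>h. 2 * Re (a (of_real \<rho> * cis t) * (of_real h * cis t)))) (at \<rho>)"
      by (rule has_derivative_compose[where f="\<lambda>\<rho>. of_real \<rho> * cis t"
        and x=\<rho>, OF _ J(3)[OF in_ball[OF that, of t]]]) (auto intro!: derivative_eq_intros)
    also have "(\<lambda>h. 2 * Re (a (of_real \<rho> * cis t) * (of_real h * cis t))) = (*) (2 * Re (a (of_real \<rho> * cis t) * cis t))"
      by (auto simp: algebra_simps)
    finally show ?thesis unfolding has_field_derivative_def .
  qed
  define D where "D = (\<lambda>\<rho> t. 2 * Re ((c (of_real \<rho> * cis t) * cis t + of_real (l (of_real \<rho> * cis t)) * cnj (cis t)) * (of_real \<rho>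
    * cis t)
     + a (of_real \<rho> * cis t) * cis t))"
  have dE: "((\<lambda>\<rho>. 2 * Re (a (of_real \<rho> * cis t) * (of_real \<rho> * cis t))) has_field_derivative D \<rho> t) (at \<rho>)"
    if "\<rho> \<in> U" for \<rho> t
  proof -
    have "((\<lambda>\<rho>. a (of_real \<rho> * cis t)) has_derivative (\<lambda>h. c (of_real \<rho> * cis t) * (of_real h * cis t) +
      of_real (l (of_real \<rho> * cis t)) * cnj (of_real h * cis t))) (at \<rho>)"
      by (rule has_derivative_compose[where f="\<lambda>\<rho>. of_real \<rho> * cis t"
        and x=\<rho>, OF _ J(4)[OF in_ball[OF that, of t]]]) (auto intro!: derivative_eq_intros)
    note d0 = this
    have d1: "((\<lambda>\<rho>. of_real \<rho> * cis t) has_derivative (\<lambda>h. of_real h * cis t)) (at \<rho>)"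
      by (auto intro!: derivative_eq_intros)
    have "((\<lambda>\<rho>. a (of_real \<rho> * cis t) * (of_real \<rho> * cis t)) has_derivative
       (\<lambda>h. a (of_real \<rho> * cis t) * (of_real h * cis t) + (c (of_real \<rho> * cis t) * (of_real h * cis t) +
      of_real (l (of_real \<rho> * cis t)) * cnj (of_real h * cis t)) * (of_real \<rho> * cis t))) (at \<rho>)"
      by (rule has_derivative_mult[OF d0 d1])
    hence "((\<lambda>\<rho>. 2 * Re (a (of_real \<rho> * cis t) * (of_real \<rho> * cis t))) has_derivative
       (\<lambda>h. 2 * Re (a (of_real \<rho> * cis t) * (of_real h * cis t) + (c (of_real \<rho> * cis t) * (of_real h * cis t) +
      of_real (l (of_real \<rho> * cis t)) * cnj (of_real h * cis t)) * (of_real \<rho> * cis t)))) (at \<rho>)"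
      by (intro has_derivative_mult_right has_derivative_Re)
    also have "(\<lambda>h. 2 * Re (a (of_real \<rho> * cis t) * (of_real h * cis t) + (c (of_real \<rho> * cis t) * (of_real h * cis t) +
      of_real (l (of_real \<rho> * cis t)) * cnj (of_real h * cis t)) * (of_real \<rho> * cis t))) = (*) (D \<rho> t)"
      unfolding D_def by (auto simp: algebra_simps)
    finally show ?thesis unfolding has_field_derivative_def .
  qed
  define M where "M = (\<lambda>\<rho>. integral {0..2*pi} (\<lambda>t. G (of_real \<rho> * cis t)))"
  define N where "N = (\<lambda>\<rho>. integral {0..2*pi} (\<lambda>t. 2 * Re (a (of_real \<rho> * cis t) * cis t)))"
  \<comment> \<open>\<open>K\<close> is \<rho> times \<open>N\<close> with the factor kept inside
    the integral: it is differentiable at 0 and vanishes there. Division by the radius happens only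
    when the sign of \<open>N\<close> is read off for \<rho> > 0.\<close>
  define K where "K = (\<lambda>\<rho>. integral {0..2*pi} (\<lambda>t. 2 * Re (a (of_real \<rho> * cis t) * (of_real \<rho> * cis t))))"
  have U: "convex U" "open U" unfolding U_def by auto
  have dM: "(M has_field_derivative N \<rho>) (at \<rho>)" if "\<rho> \<in> U" for \<rho>
  proof -
    have "((\<lambda>\<rho>. integral (cbox 0 (2*pi)) (\<lambda>t. G (of_real \<rho> * cis t))) has_field_derivative
       integral (cbox 0 (2*pi)) (\<lambda>t. 2 * Re (a (of_real \<rho> * cis t) * cis t))) (at \<rho> within U)"
    proof (rule leibniz_rule_field_derivative[OF _ _ _ that U(1)])
      fix x t assume "x \<in> U"
      thus "((\<lambda>\<rho>. G (of_real \<rho> * cis t)) has_field_derivative 2 * Re (a (of_real x * cis t) * cis t)) (at x within U)"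
        by (rule has_field_derivative_at_within[OF dG])
      show "(\<lambda>t. G (of_real x * cis t)) integrable_on cbox 0 (2*pi)"
        using cont1[OF J(6) \<open>x \<in> U\<close>] by (simp add: integrable_continuous_real)
    next
      show "continuous_on (U \<times> cbox 0 (2*pi)) (\<lambda>(x, t). 2 * Re (a (of_real x * cis t) * cis t))"
        unfolding split_beta by (intro continuous_intros ac)
    qed
    thus ?thesis using at_within_open[OF that U(2)] by (simp add: M_def N_def)
  qed
  have dK: "(K has_field_derivative integral {0..2*pi} (D \<rho>)) (at \<rho>)" if "\<rho> \<in> U" for \<rho>
  proof -
    have "((\<lambda>\<rho>. integral (cbox 0 (2*pi)) (\<lambda>t. 2 * Re (a (of_real \<rho> * cis t) * (of_real \<rho> * cis t)))) has_field_derivative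
       integral (cbox 0 (2*pi)) (D \<rho>)) (at \<rho> within U)"
    proof (rule leibniz_rule_field_derivative[OF _ _ _ that U(1)])
      show "continuous_on (U \<times> cbox 0 (2*pi)) (\<lambda>(x, t). D x t)"
        unfolding D_def split_beta by (intro continuous_intros ac)
    next
      fix x t assume "x \<in> U"
      thus "((\<lambda>\<rho>. 2 * Re (a (of_real \<rho> * cis t) * (of_real \<rho> * cis t))) has_field_derivative D x t) (at x within U)"
        by (rule has_field_derivative_at_within[OF dE])
      have "continuous_on {0..2*pi} (\<lambda>t. 2 * Re (a (of_real x * cis t) * (of_real x * cis t)))"
        by (intro continuous_intros cont1[OF J(5) \<open>x \<in> U\<close>])
      thus "(\<lambda>t. 2 * Re (a (of_real x * cis t) * (of_real x * cis t))) integrable_on cbox 0 (2*pi)"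
        by (simp add: integrable_continuous_real)
    qed
    thus ?thesis using at_within_open[OF that U(2)] by (simp add: K_def)
  qed
  have K': "integral {0..2*pi} (D \<rho>) \<ge> 0" if "\<rho> \<in> U" "\<rho> > 0" for \<rho>
  proof -
    \<comment> \<open>\<open>H\<close> is the angular derivative of \<open>G\<close> on the circle
      of radius \<rho>. Its own derivative is \<open>4 * \<rho>^2 * l\<close> minus \<rho> times
      \<open>D\<close>, and periodicity makes the integral of that vanish.\<close>
    define H where "H = (\<lambda>t. 2 * Re (a (of_real \<rho> * cis t) * (\<i> * (of_real \<rho> * cis t))))"
    have dH: "(H has_vector_derivative 4 * \<rho>\<^sup>2 * l (of_real \<rho> * cis t) - \<rho> * D \<rho> t) (at t)" for t
    proof -
      have d1: "((\<lambda>t. of_real \<rho> * cis t) has_derivative (\<lambda>h. of_real h * (\<i> * (of_real \<rho> * cis t)))) (at t)"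
        by (auto intro!: derivative_eq_intros simp: scaleR_conv_of_real mult_ac)
      note d2 = has_derivative_compose[where f="\<lambda>t. of_real \<rho> * cis t" and x=t, OF d1 J(4)[OF in_ball[OF that(1), of t]]]
      have "(H has_derivative (\<lambda>h. 2 * Re (a (of_real \<rho> * cis t) * (\<i> * (of_real h * (\<i> * (of_real \<rho> * cis t)))) +
          (c (of_real \<rho> * cis t) * (of_real h * (\<i> * (of_real \<rho> * cis t))) +
           of_real (l (of_real \<rho> * cis t)) * cnj (of_real h * (\<i> * (of_real \<rho> * cis t)))) * (\<i> * (of_real \<rho> * cis t))))) (at t)"
        unfolding H_def
        by (intro has_derivative_mult_right has_derivative_Re has_derivative_mult d1 d2)
      also have "(\<lambda>h. 2 * Re (a (of_real \<rho> * cis t) * (\<i> * (of_real h * (\<i> * (of_real \<rho> * cis t)))) +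
          (c (of_real \<rho> * cis t) * (of_real h * (\<i> * (of_real \<rho> * cis t))) +
           of_real (l (of_real \<rho> * cis t)) * cnj (of_real h * (\<i> * (of_real \<rho> * cis t)))) * (\<i> * (of_real \<rho> * cis t))))
         = (\<lambda>h. h *\<^sub>R (4 * \<rho>\<^sup>2 * l (of_real \<rho> * cis t) - \<rho> * D \<rho> t))"
      proof
        fix h
        define x where "x = cis t"
        have x: "x * cnj x = 1" by (simp add: x_def cis_cnj cis_mult)
        have e1: "of_real (2 * Re u) = u + cnj u" for u by (simp add: complex_eq_iff)
        have "of_real (2 * Re (a (of_real \<rho> * x) * (\<i> * (of_real h * (\<i> * (of_real \<rho> * x)))) +
          (c (of_real \<rho> * x) * (of_real h * (\<i> * (of_real \<rho> * x))) +
           of_real (l (of_real \<rho> * x)) * cnj (of_real h * (\<i> * (of_real \<rho> * x)))) * (\<i> * (of_real \<rho> * x))))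
          = complex_of_real (h * (4 * \<rho>\<^sup>2 * l (of_real \<rho> * x) - \<rho> * (2 * Re ((c (of_real \<rho> * x) * x + of_real (l (of_real \<rho> * x))
            * cnj x) * (of_real \<rho> * x)
     + a (of_real \<rho> * x) * x))))"
          unfolding e1 of_real_mult[of h] of_real_diff of_real_mult[of \<rho>] of_real_mult[of "4 * \<rho>\<^sup>2"]
          apply (simp add: power2_eq_square)
          using x i_squared
          apply algebra
          done
        thus "2 * Re (a (of_real \<rho> * cis t) * (\<i> * (of_real h * (\<i> * (of_real \<rho> * cis t)))) +
          (c (of_real \<rho> * cis t) * (of_real h * (\<i> * (of_real \<rho> * cis t))) +
           of_real (l (of_real \<rho> * cis t)) * cnj (of_real h * (\<i> * (of_real \<rho> * cis t)))) * (\<i> * (of_real \<rho> * cis t)))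
           = h *\<^sub>R (4 * \<rho>\<^sup>2 * l (of_real \<rho> * cis t) - \<rho> * D \<rho> t)"
          unfolding D_def x_def of_real_eq_iff real_scaleR_def .
      qed
      finally show ?thesis by (simp add: has_vector_derivative_def)
    qed
    have Dint: "D \<rho> integrable_on {0..2*pi}"
      unfolding D_def by (intro integrable_continuous_real continuous_intros ac that)
    have lint: "(\<lambda>t. 4 * \<rho>\<^sup>2 * l (of_real \<rho> * cis t)) integrable_on {0..2*pi}"
      by (intro integrable_continuous_real continuous_intros ac that)
    have "((\<lambda>t. 4 * \<rho>\<^sup>2 * l (of_real \<rho> * cis t) - \<rho> * D \<rho> t) has_integral (H (2*pi) - H 0)) {0..2*pi}"
      by (rule fundamental_theorem_of_calculus[OF _ has_vector_derivative_at_within[OF dH]]) auto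
    hence "integral {0..2*pi} (\<lambda>t. 4 * \<rho>\<^sup>2 * l (of_real \<rho> * cis t) - \<rho> * D \<rho> t) = 0"
      by (auto simp: H_def dest!: integral_unique)
    hence "\<rho> * integral {0..2*pi} (D \<rho>) = integral {0..2*pi} (\<lambda>t. 4 * \<rho>\<^sup>2 * l (of_real \<rho> * cis t))"
      using Dint lint integrable_on_cmult_left[OF Dint, of \<rho>] by (subst (asm) Henstock_Kurzweil_Integration.integral_diff) auto
    also have "\<dots> \<ge> 0" using lint by (intro integral_nonneg) (auto intro!: mult_nonneg_nonneg l in_ball that)
    finally show ?thesis using that by (simp add: zero_le_mult_iff)
  qed
  have "{0..r} \<subseteq> U" using r by (auto simp: U_def)
  have K: "K \<rho> \<ge> 0" if "\<rho> \<in> {0..r}" for \<rho>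
  proof -
    have "K 0 \<le> K \<rho>"
    proof (rule DERIV_nonneg_imp_increasing_open[where f=K])
      show "continuous_on {0..\<rho>} K"
        using that r by (intro continuous_at_imp_continuous_on ballI DERIV_isCont[OF dK]) (auto simp: U_def)
      fix x assume "0 < x" "x < \<rho>"
      thus "\<exists>y. DERIV K x :> y \<and> 0 \<le> y"
        using dK[of x] K'[of x] that r by (auto simp: U_def)
    qed (use that in auto)
    thus ?thesis by (simp add: K_def)
  qed
  have N: "N \<rho> \<ge> 0" if "\<rho> \<in> {0<..r}" for \<rho>
  proof -
    have "K \<rho> = \<rho> * N \<rho>" unfolding K_def N_def
      by (subst integral_mult_right[symmetric]) (simp add: algebra_simps)
    thus ?thesis using K[of \<rho>] that by (simp add: zero_le_mult_iff)
  qed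
  have "M 0 \<le> M r"
  proof (rule DERIV_nonneg_imp_increasing_open[where f=M])
    show "continuous_on {0..r} M"
      using r by (intro continuous_at_imp_continuous_on ballI DERIV_isCont[OF dM]) (auto simp: U_def)
    fix x assume "0 < x" "x < r"
    thus "\<exists>y. DERIV M x :> y \<and> 0 \<le> y"
      using dM[of x] N[of x] r by (auto simp: U_def)
  qed (use r in auto)
  thus ?thesis by (simp add: M_def)
qed

text \<open>This is the joint convexity of (x, \<gamma>) \<mapsto> x^2 / \<gamma> for \<gamma> > 0:
  composed with a map, its Laplacian is at least its differential applied to the Laplacians of the
  components. The discarded term is \<open>2 |\<xi> - x g / \<gamma>|^2 / \<gamma>\<close>.\<close>

lemma jet_sq_div:
  assumes x: "jet x \<xi> lx" and g: "jet \<gamma> g l\<gamma>" and pos: "\<And>z. z \<in> ball 0 1 \<Longrightarrow> \<gamma> z > 0"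
  obtains a l where "jet (\<lambda>z. (x z)\<^sup>2 / \<gamma> z) a l"
    "\<And>z. z \<in> ball 0 1 \<Longrightarrow> l z \<ge> 2 * (x z / \<gamma> z) * lx z - (x z / \<gamma> z)\<^sup>2 * l\<gamma> z"
proof -
  note J = jet_mult[OF jet_mult[OF x x] jet_inverse[OF g pos]]
  show ?thesis
  proof (rule that[OF jet_cong[OF J _ refl refl]])
    fix z :: complex assume z: "z \<in> ball 0 1"
    define s where "s = 1 / \<gamma> z"
    have "s > 0" using pos[OF z] by (simp add: s_def)
    have "0 \<le> 2 * s * ((Re (\<xi> z) - x z * Re (g z) * s)\<^sup>2 + (Im (\<xi> z) - x z * Im (g z) * s)\<^sup>2)"
      using \<open>s > 0\<close> by (intro mult_nonneg_nonneg) auto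
    also have "\<dots> = (x z * x z * (- l\<gamma> z * s ^ 2 + 2 * (cmod (g z))\<^sup>2 * s ^ 3) +
     s * (x z * lx z + x z * lx z + 2 * Re (\<xi> z * cnj (\<xi> z))) +
     2 * Re ((of_real (x z) * \<xi> z + of_real (x z) * \<xi> z) * cnj (- g z * of_real (s ^ 2)))) - (2 * (x z * s) * lx z - (x z * s)\<^sup>2 *
       l\<gamma> z)"
      unfolding cmod_power2 by (simp add: algebra_simps power2_eq_square power3_eq_cube)
    finally show "2 * (x z / \<gamma> z) * lx z - (x z / \<gamma> z)\<^sup>2 * l\<gamma> z \<le> x z * x z * (- l\<gamma> z / (\<gamma> z)\<^sup>2 + 2 * (cmod (g z))\<^sup>2 / \<gamma> z ^ 3) +
     1 / \<gamma> z * (x z * lx z + x z * lx z + 2 * Re (\<xi> z * cnj (\<xi> z))) +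
     2 * Re ((of_real (x z) * \<xi> z + of_real (x z) * \<xi> z) * cnj (- g z / of_real ((\<gamma> z)\<^sup>2)))"
      by (simp add: s_def field_simps)
  qed (auto simp: power2_eq_square)
qed

text \<open>Abstracts the Poisson extensions of an A2 weight and of its reciprocal. Inside the disc
  \<open>v\<close> is not \<open>1/w\<close>: the product lies between 1, by Cauchy-Schwarz, and the
  A2 constant \<open>Q\<close>.\<close>

locale harmonic_pair =
  fixes w v :: "complex \<Rightarrow> real" and \<omega> \<eta> :: "complex \<Rightarrow> complex" and Q :: real
  assumes jw: "jet w \<omega> (\<lambda>_. 0)" and jv: "jet v \<eta> (\<lambda>_. 0)"
    and w_pos: "\<And>z. z \<in> ball 0 1 \<Longrightarrow> w z > 0" and v_pos: "\<And>z. z \<in> ball 0 1 \<Longrightarrow> v z > 0"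
    and wv_ge: "\<And>z. z \<in> ball 0 1 \<Longrightarrow> w z * v z \<ge> 1" and wv_le: "\<And>z. z \<in> ball 0 1 \<Longrightarrow> w z * v z \<le> Q"
begin

lemma Q_ge: "Q \<ge> 1" using wv_ge[of 0] wv_le[of 0] by simp

text \<open>The factor 2 in \<open>T = 2v - 1/S\<close> keeps \<open>T\<close> between
  \<open>v\<close> and \<open>2v\<close>, because \<open>1/S \<le> 1/w \<le> v\<close>.
  Superharmonicity of \<open>S\<close> makes the Laplacian of \<open>T\<close> at most
  \<open>- d / (\<kappa> S^2)\<close>, and dividing \<open>U^2\<close> by \<open>T\<close> turns
  this into a gain. The constant 16 is the square of 2 * 2, from \<open>S \<le> 2w\<close> and
  \<open>T \<le> 2v\<close>.\<close>

lemma bellman_carleson: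
  assumes U: "jet U a (\<lambda>_. 0)" and G: "jet G g lG" and k: "\<kappa> > 0"
    and G0: "\<And>z. z \<in> ball 0 1 \<Longrightarrow> 0 \<le> G z" and Gw: "\<And>z. z \<in> ball 0 1 \<Longrightarrow> G z \<le> \<kappa> * w z"
    and d0: "\<And>z. z \<in> ball 0 1 \<Longrightarrow> 0 \<le> d z" and lG: "\<And>z. z \<in> ball 0 1 \<Longrightarrow> lG z \<le> - d z"
  obtains B b l where "jet B b l"
    "\<And>z. z \<in> ball 0 1 \<Longrightarrow> 0 \<le> B z" "\<And>z. z \<in> ball 0 1 \<Longrightarrow> B z \<le> (U z)\<^sup>2 * w z"
    "\<And>z. z \<in> ball 0 1 \<Longrightarrow> l z \<ge> (U z)\<^sup>2 * d z / (16 * Q\<^sup>2 * \<kappa>)"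
proof -
  define S where "S = (\<lambda>z. w z + (1/\<kappa>) * G z)"
  define \<sigma> where "\<sigma> = (\<lambda>z. \<omega> z + of_real (1/\<kappa>) * g z)"
  define lS where "lS = (\<lambda>z. 0 + (1/\<kappa>) * lG z)"
  have jS: "jet S \<sigma> lS"
    unfolding S_def \<sigma>_def lS_def by (rule jet_add[OF jw jet_cmult[OF G]])
  have Sw: "w z \<le> S z" "S z \<le> 2 * w z" "S z > 0" if "z \<in> ball 0 1" for z
  proof -
    have "0 \<le> (1/\<kappa>) * G z" using G0[OF that] k by simp
    moreover have "(1/\<kappa>) * G z \<le> w z" using Gw[OF that] k by (simp add: field_simps)
    ultimately show "w z \<le> S z" "S z \<le> 2 * w z" "S z > 0"
      using w_pos[OF that] unfolding S_def by linarith+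
  qed
  define T where "T = (\<lambda>z. 2 * v z - 1 / S z)"
  define lT where "lT = (\<lambda>z. 2 * 0 - (- lS z / S z ^ 2 + 2 * cmod (\<sigma> z) ^ 2 / S z ^ 3))"
  have jT: "jet T (\<lambda>z. of_real 2 * \<eta> z - (- \<sigma> z / of_real (S z ^ 2))) lT"
    unfolding T_def lT_def by (rule jet_diff[OF jet_cmult[OF jv] jet_inverse[OF jS Sw(3)]])
  have T: "v z \<le> T z" "T z \<le> 2 * v z" "T z > 0" if "z \<in> ball 0 1" for z
  proof -
    have "1 / S z \<le> 1 / w z" using Sw[OF that] w_pos[OF that] by (intro divide_left_mono) auto
    also have "\<dots> \<le> v z" using wv_ge[OF that] w_pos[OF that] by (simp add: field_simps)
    finally show "v z \<le> T z" by (simp add: T_def)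
    thus "T z > 0" using v_pos[OF that] by linarith
    show "T z \<le> 2 * v z" using Sw(3)[OF that] by (simp add: T_def)
  qed
  obtain b l where bl: "jet (\<lambda>z. (U z)\<^sup>2 / T z) b l"
    "\<And>z. z \<in> ball 0 1 \<Longrightarrow> l z \<ge> 2 * (U z / T z) * 0 - (U z / T z)\<^sup>2 * lT z"
    by (rule jet_sq_div[OF U jT T(3)]; (assumption | rule that))
  show ?thesis
  proof (rule that[OF bl(1)])
    fix z :: complex assume z: "z \<in> ball 0 1"
    note p = w_pos[OF z] v_pos[OF z] Sw[OF z] T[OF z]
    show "0 \<le> (U z)\<^sup>2 / T z" using p by auto
    have "1 / T z \<le> 1 / v z" using p by (intro divide_left_mono) auto
    also have "\<dots> \<le> w z" using wv_ge[OF z] p by (simp add: field_simps)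
    finally have "(U z)\<^sup>2 * (1 / T z) \<le> (U z)\<^sup>2 * w z" by (intro mult_left_mono) auto
    thus "(U z)\<^sup>2 / T z \<le> (U z)\<^sup>2 * w z" by simp
    \<comment> \<open>The quadratic term in \<sigma> enters \<open>lT\<close> with a negative sign
      and is dropped.\<close>
    have "lT z \<le> lS z / (S z)\<^sup>2" using p by (simp add: lT_def)
    also have "\<dots> \<le> - d z / (\<kappa> * (S z)\<^sup>2)"
      using lG[OF z] k p by (simp add: lS_def field_simps)
    finally have lT: "d z / (\<kappa> * (S z)\<^sup>2) \<le> - lT z" by simp
    have "S z * T z \<le> (2 * w z) * (2 * v z)" using p by (intro mult_mono) auto
    also have "\<dots> \<le> 4 * Q" using wv_le[OF z] by simp
    finally have ST: "(S z * T z)\<^sup>2 \<le> (4 * Q)\<^sup>2" using p by (intro power_mono) auto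
    have "(U z)\<^sup>2 * d z / (16 * Q\<^sup>2 * \<kappa>) = (U z)\<^sup>2 * d z / \<kappa> / (4 * Q)\<^sup>2" by (simp add: field_simps power2_eq_square)
    also have "\<dots> \<le> (U z)\<^sup>2 * d z / \<kappa> / (S z * T z)\<^sup>2"
      using ST p d0[OF z] k by (intro divide_left_mono mult_pos_pos) (auto simp: zero_less_power)
    also have "\<dots> = (U z / T z)\<^sup>2 * (d z / (\<kappa> * (S z)\<^sup>2))"
      by (simp add: power_divide power_mult_distrib field_simps)
    also have "\<dots> \<le> (U z / T z)\<^sup>2 * (- lT z)" by (intro mult_left_mono lT) auto
    also have "\<dots> \<le> l z" using bl(2)[OF z] by simp
    finally show "l z \<ge> (U z)\<^sup>2 * d z / (16 * Q\<^sup>2 * \<kappa>)" .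
  qed
qed

text \<open>The last conclusion says that \<open>\<partial>\<partial>\<bar>(U^2 m) \<ge> |\<partial>U|^2 w\<close> for real harmonic \<open>U\<close> with
  \<open>\<partial>U = a\<close>. In \<open>m = w + 8 Q^2 / t\<close> with \<open>t = 2v - 1/w\<close>, the second summand absorbs the mixed term
  \<open>4 U Re (\<partial>U \<partial>\<bar>w)\<close>: the map \<open>(U, t) \<mapsto> U^2 / t\<close> is convex and \<open>\<partial>\<partial>\<bar>t = - 2 |\<partial>w|^2 / w^3\<close>.\<close>

lemma littlewood_paley_weight:
  obtains m m' lm where "jet m m' lm"
    "\<And>z. z \<in> ball 0 1 \<Longrightarrow> 0 < m z" "\<And>z. z \<in> ball 0 1 \<Longrightarrow> m z \<le> (1 + 8 * Q\<^sup>2) * w z"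
    "\<And>z U a. z \<in> ball 0 1 \<Longrightarrow> (cmod a)\<^sup>2 * w z \<le> 2 * (cmod a)\<^sup>2 * m z + U\<^sup>2 * lm z + 4 * U * Re (a * cnj (m' z))"
proof -
  define t where "t = (\<lambda>z. 2 * v z - 1 / w z)"
  define \<tau> where "\<tau> = (\<lambda>z. of_real 2 * \<eta> z - (- \<omega> z / of_real (w z ^ 2)))"
  define lt where "lt = (\<lambda>z. 2 * 0 - (- 0 / w z ^ 2 + 2 * cmod (\<omega> z) ^ 2 / w z ^ 3))"
  have jt: "jet t \<tau> lt"
    unfolding t_def \<tau>_def lt_def by (rule jet_diff[OF jet_cmult[OF jv] jet_inverse[OF jw w_pos]])
  have t: "v z \<le> t z" "t z \<le> 2 * v z" "t z > 0" if "z \<in> ball 0 1" for z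
  proof -
    have "1 / w z \<le> v z" using wv_ge[OF that] w_pos[OF that] by (simp add: field_simps)
    thus "v z \<le> t z" by (simp add: t_def)
    thus "t z > 0" using v_pos[OF that] by linarith
    show "t z \<le> 2 * v z" using w_pos[OF that] by (simp add: t_def)
  qed
  define lm where "lm = (\<lambda>z. 0 + 8 * Q\<^sup>2 * (- lt z / t z ^ 2 + 2 * cmod (\<tau> z) ^ 2 / t z ^ 3))"
  define m' where "m' = (\<lambda>z. \<omega> z + of_real (8 * Q\<^sup>2) * (- \<tau> z / of_real (t z ^ 2)))"
  have jm: "jet (\<lambda>z. w z + 8 * Q\<^sup>2 * (1 / t z)) m' lm"
    unfolding lm_def m'_def by (rule jet_add[OF jw jet_cmult[OF jet_inverse[OF jt t(3)]]])
  show ?thesis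
  proof (rule that[OF jm])
    fix z :: complex assume z: "z \<in> ball 0 1"
    note p = w_pos[OF z] v_pos[OF z] t[OF z]
    show "0 < w z + 8 * Q\<^sup>2 * (1 / t z)" using p by (intro add_pos_nonneg) auto
    have "1 / t z \<le> 1 / v z" using p by (intro divide_left_mono) auto
    also have "\<dots> \<le> w z" using wv_ge[OF z] p by (simp add: field_simps)
    finally have "8 * Q\<^sup>2 * (1 / t z) \<le> 8 * Q\<^sup>2 * w z" by (intro mult_left_mono) auto
    thus "w z + 8 * Q\<^sup>2 * (1 / t z) \<le> (1 + 8 * Q\<^sup>2) * w z" by (simp add: algebra_simps)
    \<comment> \<open>\<open>U\<close> and \<open>a\<close> are free numbers, not a function and its
      gradient: the oscillation argument needs the inequality for \<psi> - c with c frozen at a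
      single point.\<close>
    fix U :: real and a :: complex
    define s where "s = 1 / t z"
    have s: "s > 0" using p by (simp add: s_def)
    have "0 \<le> 2 * s * ((Re a - U * Re (\<tau> z) * s)\<^sup>2 + (Im a - U * Im (\<tau> z) * s)\<^sup>2)"
      using s by (intro mult_nonneg_nonneg) auto
    also have "\<dots> = 2 * (cmod a)\<^sup>2 * s + U\<^sup>2 * (2 * (cmod (\<tau> z))\<^sup>2 * s ^ 3) - 4 * U * Re (a * cnj (\<tau> z)) * s ^ 2"
      unfolding cmod_power2 by (simp add: algebra_simps power2_eq_square power3_eq_cube)
    finally have 1: "- (U\<^sup>2 * lt z * s\<^sup>2) \<le> 2 * (cmod a)\<^sup>2 * s + U\<^sup>2 * (- lt z * s ^ 2 + 2 * (cmod (\<tau> z))\<^sup>2 * s ^ 3) - 4 * U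
      * Re (a * cnj (\<tau> z)) * s ^ 2"
      by (simp add: algebra_simps)
    \<comment> \<open>This calibrates the constant \<open>8 * Q^2\<close>. The gain from
      \<open>- lt\<close> is \<open>2 U^2 |\<omega>|^2 / (w^3 t^2)\<close>; since
      \<open>w t \<le> 2Q\<close>, multiplying it by \<open>8 * Q^2\<close> gives at least
      \<open>4 U^2 |\<omega>|^2 / w\<close>, exactly what completing the square in the mixed term
      costs while leaving one copy of \<open>|a|^2 w\<close>.\<close>
    have "w z * t z \<le> w z * (2 * v z)" using p by (intro mult_left_mono) auto
    also have "\<dots> \<le> 2 * Q" using wv_le[OF z] by simp
    finally have "(w z * t z)\<^sup>2 \<le> (2 * Q)\<^sup>2" using p by (intro power_mono) auto
    hence "1 \<le> 4 * Q\<^sup>2 / (w z * t z)\<^sup>2" using p by (simp add: power_mult_distrib)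
    hence "(4 * U\<^sup>2 * (cmod (\<omega> z))\<^sup>2 / w z) * 1 \<le> (4 * U\<^sup>2 * (cmod (\<omega> z))\<^sup>2 / w z) * (4 * Q\<^sup>2 / (w z * t z)\<^sup>2)"
      using p by (intro mult_left_mono) auto
    also have "\<dots> = 8 * Q\<^sup>2 * (- (U\<^sup>2 * lt z * s\<^sup>2))"
      using p by (simp add: lt_def s_def field_simps power2_eq_square power3_eq_cube)
    also have "\<dots> \<le> 8 * Q\<^sup>2 * (2 * (cmod a)\<^sup>2 * s + U\<^sup>2 * (- lt z * s ^ 2 + 2 * (cmod (\<tau> z))\<^sup>2 * s ^ 3) - 4 * U * Re (a
      * cnj (\<tau> z)) * s ^ 2)"
      by (rule mult_left_mono[OF 1]) auto
    finally have 2: "4 * U\<^sup>2 * (cmod (\<omega> z))\<^sup>2 / w z \<le> \<dots>" by simp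
    have "0 \<le> (cmod a * w z - 2 * \<bar>U\<bar> * cmod (\<omega> z))\<^sup>2 / w z" using p by auto
    also have "\<dots> = (cmod a)\<^sup>2 * w z - 4 * \<bar>U\<bar> * cmod a * cmod (\<omega> z) + 4 * U\<^sup>2 * (cmod (\<omega> z))\<^sup>2 / w z"
      using p by (simp add: power2_diff power_mult_distrib field_simps) (simp add: power2_eq_square algebra_simps)
    finally have 3: "4 * \<bar>U\<bar> * cmod a * cmod (\<omega> z) \<le> (cmod a)\<^sup>2 * w z + 4 * U\<^sup>2 * (cmod (\<omega> z))\<^sup>2 / w z" by simp
    have "\<bar>U * Re (a * cnj (\<omega> z))\<bar> \<le> \<bar>U\<bar> * (cmod a * cmod (\<omega> z))"
      unfolding abs_mult using abs_Re_le_cmod[of "a * cnj (\<omega> z)"] by (intro mult_left_mono) (auto simp: norm_mult)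
    hence 4: "- (4 * \<bar>U\<bar> * cmod a * cmod (\<omega> z)) \<le> 4 * U * Re (a * cnj (\<omega> z))" by (simp add: abs_le_iff algebra_simps)
    have "2 * (cmod a)\<^sup>2 * (w z + 8 * Q\<^sup>2 * (1 / t z)) + U\<^sup>2 * lm z + 4 * U * Re (a * cnj (m' z)) =
       2 * (cmod a)\<^sup>2 * w z + 4 * U * Re (a * cnj (\<omega> z)) +
       8 * Q\<^sup>2 * (2 * (cmod a)\<^sup>2 * s + U\<^sup>2 * (- lt z * s ^ 2 + 2 * (cmod (\<tau> z))\<^sup>2 * s ^ 3) - 4 * U * Re (a * cnj (\<tau> z)) * s ^ 2)"
    proof -
      have m'e: "m' z = \<omega> z - of_real (8 * Q\<^sup>2 * s ^ 2) * \<tau> z" unfolding m'_def s_def by (simp add: field_simps)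
      have lme: "lm z = 8 * Q\<^sup>2 * (- lt z * s ^ 2 + 2 * (cmod (\<tau> z))\<^sup>2 * s ^ 3)" unfolding lm_def s_def by (simp add: field_simps)
      have "Re (a * cnj (m' z)) = Re (a * cnj (\<omega> z)) - 8 * Q\<^sup>2 * s ^ 2 * Re (a * cnj (\<tau> z))"
        unfolding m'e by (simp add: algebra_simps)
      note R = this
      show ?thesis unfolding lme R s_def[symmetric] by (simp add: algebra_simps)
    qed
    thus "(cmod a)\<^sup>2 * w z \<le> 2 * (cmod a)\<^sup>2 * (w z + 8 * Q\<^sup>2 * (1 / t z)) + U\<^sup>2 * lm z + 4 * U * Re (a * cnj (m' z))"
      using 2 3 4 by linarith
  qed
qed

lemma bellman_littlewood_paley:
  assumes U: "jet U a (\<lambda>_. 0)"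
  obtains B b l where "jet B b l"
    "\<And>z. z \<in> ball 0 1 \<Longrightarrow> 0 \<le> B z" "\<And>z. z \<in> ball 0 1 \<Longrightarrow> B z \<le> (1 + 8 * Q\<^sup>2) * (U z)\<^sup>2 * w z"
    "\<And>z. z \<in> ball 0 1 \<Longrightarrow> l z \<ge> (cmod (a z))\<^sup>2 * w z"
proof -
  obtain m m' lm where m: "jet m m' lm"
    "\<And>z. z \<in> ball 0 1 \<Longrightarrow> 0 < m z" "\<And>z. z \<in> ball 0 1 \<Longrightarrow> m z \<le> (1 + 8 * Q\<^sup>2) * w z"
    "\<And>z U a. z \<in> ball 0 1 \<Longrightarrow> (cmod a)\<^sup>2 * w z \<le> 2 * (cmod a)\<^sup>2 * m z + U\<^sup>2 * lm z + 4 * U * Re (a * cnj (m' z))"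
    by (rule littlewood_paley_weight; rule that)
  show ?thesis
  proof (rule that[OF jet_mult[OF jet_mult[OF U U] m(1)]])
    fix z :: complex assume z: "z \<in> ball 0 1"
    show "0 \<le> U z * U z * m z" using m(2)[OF z] by auto
    have "U z * U z * m z \<le> U z * U z * ((1 + 8 * Q\<^sup>2) * w z)" by (intro mult_left_mono m(3) z) auto
    thus "U z * U z * m z \<le> (1 + 8 * Q\<^sup>2) * (U z)\<^sup>2 * w z" by (simp add: power2_eq_square algebra_simps)
    have "2 * (cmod (a z))\<^sup>2 * m z + (U z)\<^sup>2 * lm z + 4 * U z * Re (a z * cnj (m' z)) =
       U z * U z * lm z + m z * (U z * 0 + U z * 0 + 2 * Re (a z * cnj (a z))) +
         2 * Re ((complex_of_real (U z) * a z + complex_of_real (U z) * a z) * cnj (m' z))"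
      unfolding cmod_power2 by (simp add: power2_eq_square algebra_simps)
    thus "(cmod (a z))\<^sup>2 * w z \<le> U z * U z * lm z + m z * (U z * 0 + U z * 0 + 2 * Re (a z * cnj (a z))) +
         2 * Re ((complex_of_real (U z) * a z + complex_of_real (U z) * a z) * cnj (m' z))"
      using m(4)[OF z, of "a z" "U z"] by simp
  qed
qed

text \<open>The function \<open>G\<close> below is the pointwise minimum over \<open>c\<close> of the superharmonic functions
  \<open>C * P[|\<psi> - c|^2 w] - |\<psi> - c|^2 m\<close>, where \<open>X\<close> and \<open>Y\<close> stand for the Poisson extensions
  of \<open>\<psi>^2 w\<close> and \<open>\<psi> w\<close>. It plays the role of the Green potential of \<open>|\<nabla>\<psi>|^2 w\<close>.\<close>

lemma bellman_oscillation:
  assumes psi: "jet \<psi> p (\<lambda>_. 0)" and X: "jet X \<xi> (\<lambda>_. 0)" and Y: "jet Y y (\<lambda>_. 0)"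
    and CS: "\<And>z c. z \<in> ball 0 1 \<Longrightarrow> (\<psi> z - c)\<^sup>2 \<le> v z * (X z - 2 * c * Y z + c\<^sup>2 * w z)"
  obtains G g lG where "jet G g lG"
    "\<And>z. z \<in> ball 0 1 \<Longrightarrow> 0 \<le> G z"
    "\<And>z. z \<in> ball 0 1 \<Longrightarrow> G z \<le> 2 * (1 + 8 * Q\<^sup>2) * Q * (X z - 2 * \<psi> z * Y z + (\<psi> z)\<^sup>2 * w z)"
    "\<And>z. z \<in> ball 0 1 \<Longrightarrow> lG z \<le> - ((cmod (p z))\<^sup>2 * w z)"
proof -
  obtain m m' lm where m: "jet m m' lm"
    "\<And>z. z \<in> ball 0 1 \<Longrightarrow> 0 < m z" "\<And>z. z \<in> ball 0 1 \<Longrightarrow> m z \<le> (1 + 8 * Q\<^sup>2) * w z"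
    "\<And>z U a. z \<in> ball 0 1 \<Longrightarrow> (cmod a)\<^sup>2 * w z \<le> 2 * (cmod a)\<^sup>2 * m z + U\<^sup>2 * lm z + 4 * U * Re (a * cnj (m' z))"
    by (rule littlewood_paley_weight; rule that)
  \<comment> \<open>The constant has two duties: at least twice \<open>1 + 8 * Q^2\<close>, so that
    \<gamma> is positive, and at least \<open>Q\<close> times it, so that the minimum over c is
    nonnegative.\<close>
  define C where "C = 2 * (1 + 8 * Q\<^sup>2) * Q"
  define \<gamma> where "\<gamma> = (\<lambda>z. C * w z - m z)"
  define \<beta> where "\<beta> = (\<lambda>z. C * Y z - \<psi> z * m z)"
  define \<alpha> where "\<alpha> = (\<lambda>z. C * X z - \<psi> z * \<psi> z * m z)"
  note jg = jet_diff[OF jet_cmult[OF jw, of C] m(1), folded \<gamma>_def]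
  note jb = jet_diff[OF jet_cmult[OF Y, of C] jet_mult[OF psi m(1)], folded \<beta>_def]
  note ja = jet_diff[OF jet_cmult[OF X, of C] jet_mult[OF jet_mult[OF psi psi] m(1)], folded \<alpha>_def]
  have C: "(1 + 8 * Q\<^sup>2) * 2 \<le> C" "(1 + 8 * Q\<^sup>2) * Q \<le> C" "C > 0"
  proof -
    have p: "0 < 1 + 8 * Q\<^sup>2" by (simp add: add_pos_nonneg)
    show "(1 + 8 * Q\<^sup>2) * 2 \<le> C" using mult_left_mono[OF Q_ge, of "2 * (1 + 8 * Q\<^sup>2)"] p by (simp add: C_def)
    show "(1 + 8 * Q\<^sup>2) * Q \<le> C" using mult_pos_pos[OF p, of Q] Q_ge by (simp add: C_def)
    show "C > 0" using mult_pos_pos[OF p, of Q] Q_ge unfolding C_def by linarith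
  qed
  have gpos: "\<gamma> z > 0" if z: "z \<in> ball 0 1" for z
  proof -
    have "m z \<le> (1 + 8 * Q\<^sup>2) * w z" using m(3)[OF z] .
    also have "\<dots> < ((1 + 8 * Q\<^sup>2) * 2) * w z"
    proof -
      have "0 < (1 + 8 * Q\<^sup>2) * w z" by (intro mult_pos_pos add_pos_nonneg w_pos z) auto
      moreover have "((1 + 8 * Q\<^sup>2) * 2) * w z = 2 * ((1 + 8 * Q\<^sup>2) * w z)" by simp
      ultimately show ?thesis by linarith
    qed
    also have "\<dots> \<le> C * w z" using C w_pos[OF z] by (intro mult_right_mono) auto
    finally show ?thesis by (simp add: \<gamma>_def)
  qed
  obtain b l where bl: "jet (\<lambda>z. (\<beta> z)\<^sup>2 / \<gamma> z) b l"
    "\<And>z. z \<in> ball 0 1 \<Longrightarrow> l z \<ge> 2 * (\<beta> z / \<gamma> z) * (C * 0 - (\<psi> z * lm z + m z * 0 + 2 * Re (p z * cnj (m' z)))) - (\<beta> z / \<gamma> z)\<^sup>2 * (C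
      * 0 - lm z)"
    by (rule jet_sq_div[OF jb jg gpos]; (assumption | rule that))
  show ?thesis
  proof (rule that[OF jet_diff[OF ja bl(1)]], fold C_def)
    fix z :: complex assume z: "z \<in> ball 0 1"
    \<comment> \<open>The minimiser over c of \<open>\<alpha> - 2 c \<beta> + c^2 \<gamma>\<close>
      at this point; \<alpha>, \<beta> and \<gamma> are the coefficients of the family as a
      quadratic polynomial in c.\<close>
    define c where "c = \<beta> z / \<gamma> z"
    have cb: "c * \<gamma> z = \<beta> z" using gpos[OF z] by (simp add: c_def)
    have e: "\<alpha> z - (\<beta> z)\<^sup>2 / \<gamma> z = \<alpha> z - 2 * c * \<beta> z + c\<^sup>2 * \<gamma> z"
    proof -
      have "(\<beta> z)\<^sup>2 / \<gamma> z = c * \<beta> z" by (simp add: c_def power2_eq_square)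
      moreover have "c\<^sup>2 * \<gamma> z = c * \<beta> z" using cb by (simp add: power2_eq_square mult.assoc)
      ultimately show ?thesis by simp
    qed
    have e2: "\<alpha> z - 2 * k * \<beta> z + k\<^sup>2 * \<gamma> z = C * (X z - 2 * k * Y z + k\<^sup>2 * w z) - (\<psi> z - k)\<^sup>2 * m z" for k
      by (simp add: \<alpha>_def \<beta>_def \<gamma>_def algebra_simps power2_eq_square)
    define N where "N = X z - 2 * c * Y z + c\<^sup>2 * w z"
    have "0 \<le> v z * N" using CS[OF z, of c] unfolding N_def by (rule order_trans[rotated]) simp
    hence N0: "0 \<le> N" using v_pos[OF z] by (simp add: zero_le_mult_iff)
    \<comment> \<open>Nonnegativity: the hypothesis \<open>CS\<close> bounds
      \<open>(\<psi> - c)^2\<close> by \<open>v N\<close>, and \<open>m\<close> is at most a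
      multiple of \<open>w\<close>, so the A2 product \<open>w v \<le> Q\<close> appears.\<close>
    have "(\<psi> z - c)\<^sup>2 * m z \<le> (v z * N) * ((1 + 8 * Q\<^sup>2) * w z)"
      unfolding N_def by (intro mult_mono CS m(3) z) (use CS[OF z, of c] m(2)[OF z] in \<open>auto intro: order_trans[OF
        zero_le_power2]\<close>)
    also have "\<dots> = (1 + 8 * Q\<^sup>2) * (w z * v z) * N" by (simp add: algebra_simps)
    also have "\<dots> \<le> (1 + 8 * Q\<^sup>2) * Q * N" using wv_le[OF z] N0 by (intro mult_right_mono mult_left_mono) auto
    also have "\<dots> \<le> C * N" using C N0 by (intro mult_right_mono) auto
    finally show "0 \<le> \<alpha> z - (\<beta> z)\<^sup>2 / \<gamma> z" unfolding e e2 N_def by simp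
    \<comment> \<open>The minimum is compared with the choice c = \<psi> z, for which the term with
      \<open>m\<close> disappears.\<close>
    have "0 \<le> \<gamma> z * (c - \<psi> z)\<^sup>2" using gpos[OF z] by auto
    also have "\<dots> = (\<alpha> z - 2 * \<psi> z * \<beta> z + (\<psi> z)\<^sup>2 * \<gamma> z) - (\<alpha> z - 2 * c * \<beta> z + c\<^sup>2 * \<gamma> z)"
      unfolding cb[symmetric] by (simp add: algebra_simps power2_eq_square)
    finally show "\<alpha> z - (\<beta> z)\<^sup>2 / \<gamma> z \<le> C * (X z - 2 * \<psi> z * Y z + (\<psi> z)\<^sup>2 * w z)"
      unfolding e e2[of "\<psi> z"] by simp
    \<comment> \<open>By convexity of the quotient, c may be treated as a constant when the
      Laplacian is taken. What remains is the Laplacian of \<open>(\<psi> - c)^2 m\<close> with the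
      opposite sign.\<close>
    have "(C * 0 - (\<psi> z * \<psi> z * lm z + m z * (\<psi> z * 0 + \<psi> z * 0 + 2 * Re (p z * cnj (p z))) +
          2 * Re ((complex_of_real (\<psi> z) * p z + complex_of_real (\<psi> z) * p z) * cnj (m' z)))) - l z
       \<le> (C * 0 - (\<psi> z * \<psi> z * lm z + m z * (\<psi> z * 0 + \<psi> z * 0 + 2 * Re (p z * cnj (p z))) +
          2 * Re ((complex_of_real (\<psi> z) * p z + complex_of_real (\<psi> z) * p z) * cnj (m' z)))) -
         (2 * c * (C * 0 - (\<psi> z * lm z + m z * 0 + 2 * Re (p z * cnj (m' z)))) - c\<^sup>2 * (C * 0 - lm z))"
      using bl(2)[OF z, folded c_def] by simp
    also have "\<dots> = - (2 * (cmod (p z))\<^sup>2 * m z + (\<psi> z - c)\<^sup>2 * lm z + 4 * (\<psi> z - c) * Re (p z * cnj (m' z)))"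
      unfolding cmod_power2 by (simp add: algebra_simps power2_eq_square)
    also have "\<dots> \<le> - ((cmod (p z))\<^sup>2 * w z)" using m(4)[OF z, of "p z" "\<psi> z - c"] by linarith
    finally show "(C * 0 - (\<psi> z * \<psi> z * lm z + m z * (\<psi> z * 0 + \<psi> z * 0 + 2 * Re (p z * cnj (p z))) +
          2 * Re ((complex_of_real (\<psi> z) * p z + complex_of_real (\<psi> z) * p z) * cnj (m' z)))) - l z \<le> - ((cmod (p z))\<^sup>2 * w z)" .
  qed
qed

end

section \<open>Comparison of circle means and the bilinear forms inside the disc\<close>

lemma continuous_on_circle:
  assumes "continuous_on (ball 0 1) f" "0 \<le> r" "r < 1"
  shows "continuous_on T (\<lambda>t. f (complex_of_real r * cis t))"
  by (rule continuous_on_compose2[OF assms(1)]) (use assms in \<open>auto intro!: continuous_intros simp: norm_mult\<close>)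

lemma jet_mean_mono:
  assumes B: "jet B b lB" and R: "jet R a lR" and l: "\<And>z. z \<in> ball 0 1 \<Longrightarrow> lR z \<le> lB z"
    and 0: "R 0 \<le> B 0" and M: "continuous_on (ball 0 1) M" and BM: "\<And>z. z \<in> ball 0 1 \<Longrightarrow> B z \<le> M z"
    and r: "0 \<le> r" "r < 1"
  shows "integral {0..2*pi} (\<lambda>t. R (of_real r * cis t)) \<le> integral {0..2*pi} (\<lambda>t. M (of_real r * cis t))"
proof -
  note i = integrable_continuous_real[OF continuous_on_circle[OF _ r]]
  have "0 \<le> 2 * pi * (B 0 - R 0)" using 0 by simp
  also have "\<dots> \<le> integral {0..2*pi} (\<lambda>t. B (of_real r * cis t) - R (of_real r * cis t))"
    by (rule jet_mean[OF jet_diff[OF B R] _ r]) (use l in auto)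
  also have "\<dots> = integral {0..2*pi} (\<lambda>t. B (of_real r * cis t)) - integral {0..2*pi} (\<lambda>t. R (of_real r * cis t))"
    by (intro Henstock_Kurzweil_Integration.integral_diff i jet_continuous[OF B] jet_continuous[OF R])
  finally have "integral {0..2*pi} (\<lambda>t. R (of_real r * cis t)) \<le> integral {0..2*pi} (\<lambda>t. B (of_real r * cis t))" by simp
  also have "\<dots> \<le> integral {0..2*pi} (\<lambda>t. M (of_real r * cis t))"
    using r by (intro integral_le i jet_continuous[OF B] M BM) (auto simp: norm_mult)
  finally show ?thesis .
qed

text \<open>Since \<open>cnj P\<close> is antiholomorphic and \<open>F\<close> holomorphic,
  \<partial> falls on \<open>F\<close> alone and \<partial>\<bar> on \<open>cnj P\<close> alone.
  Jets are real, so the product is assembled from real and imaginary parts.\<close>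

lemma jet_Re_cnj_mult:
  assumes "P holomorphic_on ball 0 1" "F holomorphic_on ball 0 1"
  obtains a where "jet (\<lambda>z. Re (cnj (P z) * F z)) a (\<lambda>z. Re (deriv P z * cnj (deriv F z)))"
proof -
  note J = jet_add[OF jet_mult[OF jet_Re[OF assms(1)] jet_Re[OF assms(2)]] jet_mult[OF jet_Im[OF assms(1)] jet_Im[OF assms(2)]]]
  show ?thesis by (rule that[OF jet_cong[OF J _ refl]]) (auto simp: field_simps)
qed

context harmonic_pair
begin

lemma swap: "harmonic_pair v w \<eta> \<omega> Q"
  using jw jv w_pos v_pos wv_ge wv_le by unfold_locales (auto simp: mult.commute)

lemma bellman_littlewood_paley_pair:
  assumes "jet U1 a1 (\<lambda>_. 0)" "jet U2 a2 (\<lambda>_. 0)"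
  obtains B b l where "jet B b l"
    "\<And>z. z \<in> ball 0 1 \<Longrightarrow> 0 \<le> B z"
    "\<And>z. z \<in> ball 0 1 \<Longrightarrow> B z \<le> (1 + 8 * Q\<^sup>2) * (((U1 z)\<^sup>2 + (U2 z)\<^sup>2) * w z)"
    "\<And>z. z \<in> ball 0 1 \<Longrightarrow> l z \<ge> ((cmod (a1 z))\<^sup>2 + (cmod (a2 z))\<^sup>2) * w z"
proof -
  obtain B1 b1 l1 where 1: "jet B1 b1 l1"
    "\<And>z. z \<in> ball 0 1 \<Longrightarrow> 0 \<le> B1 z" "\<And>z. z \<in> ball 0 1 \<Longrightarrow> B1 z \<le> (1 + 8 * Q\<^sup>2) * (U1 z)\<^sup>2 * w z"
    "\<And>z. z \<in> ball 0 1 \<Longrightarrow> l1 z \<ge> (cmod (a1 z))\<^sup>2 * w z"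
    by (rule bellman_littlewood_paley[OF assms(1)]; (assumption | rule that))
  obtain B2 b2 l2 where 2: "jet B2 b2 l2"
    "\<And>z. z \<in> ball 0 1 \<Longrightarrow> 0 \<le> B2 z" "\<And>z. z \<in> ball 0 1 \<Longrightarrow> B2 z \<le> (1 + 8 * Q\<^sup>2) * (U2 z)\<^sup>2 * w z"
    "\<And>z. z \<in> ball 0 1 \<Longrightarrow> l2 z \<ge> (cmod (a2 z))\<^sup>2 * w z"
    by (rule bellman_littlewood_paley[OF assms(2)]; (assumption | rule that))
  show ?thesis
  proof (rule that[OF jet_add[OF 1(1) 2(1)]])
    fix z :: complex assume z: "z \<in> ball 0 1"
    show "0 \<le> B1 z + B2 z" using 1(2)[OF z] 2(2)[OF z] by simp
    show "B1 z + B2 z \<le> (1 + 8 * Q\<^sup>2) * (((U1 z)\<^sup>2 + (U2 z)\<^sup>2) * w z)"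
      using 1(3)[OF z] 2(3)[OF z] by (simp add: algebra_simps)
    show "l1 z + l2 z \<ge> ((cmod (a1 z))\<^sup>2 + (cmod (a2 z))\<^sup>2) * w z"
      using 1(4)[OF z] 2(4)[OF z] by (simp add: algebra_simps)
  qed
qed

text \<open>One function for both needs of the Hankel form: a gradient of \<open>f\<close> against
  \<open>w\<close>, from the Littlewood-Paley part, and \<open>|f|^2\<close> against the density
  \<open>d\<close>, from the Carleson part. The factor 1/2 arises because \<partial> of the real and
  of the imaginary part each equal half of f' in modulus.\<close>

lemma holomorphic_bellman:
  assumes f: "f holomorphic_on ball 0 1" and G: "jet G g lG" and k: "\<kappa> > 0"
    and G0: "\<And>z. z \<in> ball 0 1 \<Longrightarrow> 0 \<le> G z" and Gw: "\<And>z. z \<in> ball 0 1 \<Longrightarrow> G z \<le> \<kappa> * w z"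
    and d0: "\<And>z. z \<in> ball 0 1 \<Longrightarrow> 0 \<le> d z" and lG: "\<And>z. z \<in> ball 0 1 \<Longrightarrow> lG z \<le> - d z"
  obtains B b l where "jet B b l"
    "\<And>z. z \<in> ball 0 1 \<Longrightarrow> 0 \<le> B z"
    "\<And>z. z \<in> ball 0 1 \<Longrightarrow> B z \<le> (1 + 8 * Q\<^sup>2 + 16 * Q\<^sup>2 * \<kappa>) * ((cmod (f z))\<^sup>2 * w z)"
    "\<And>z. z \<in> ball 0 1 \<Longrightarrow> l z \<ge> (cmod (deriv f z))\<^sup>2 * w z / 2 + (cmod (f z))\<^sup>2 * d z"
proof -
  note J = jet_Re[OF f] jet_Im[OF f]
  obtain B1 b1 l1 where 1: "jet B1 b1 l1"
    "\<And>z. z \<in> ball 0 1 \<Longrightarrow> 0 \<le> B1 z" "\<And>z. z \<in> ball 0 1 \<Longrightarrow> B1 z \<le> (1 + 8 * Q\<^sup>2) * (((Re (f z))\<^sup>2 + (Im (f z))\<^sup>2) * w z)"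
    "\<And>z. z \<in> ball 0 1 \<Longrightarrow> l1 z \<ge> ((cmod (deriv f z / 2))\<^sup>2 + (cmod (- \<i> * deriv f z / 2))\<^sup>2) * w z"
    by (rule bellman_littlewood_paley_pair[OF J]; (assumption | rule that))
  obtain B2 b2 l2 where 2: "jet B2 b2 l2"
    "\<And>z. z \<in> ball 0 1 \<Longrightarrow> 0 \<le> B2 z" "\<And>z. z \<in> ball 0 1 \<Longrightarrow> B2 z \<le> (Re (f z))\<^sup>2 * w z"
    "\<And>z. z \<in> ball 0 1 \<Longrightarrow> l2 z \<ge> (Re (f z))\<^sup>2 * d z / (16 * Q\<^sup>2 * \<kappa>)"
    by (rule bellman_carleson[OF J(1) G k G0 Gw d0 lG]; (assumption | rule that))
  obtain B3 b3 l3 where 3: "jet B3 b3 l3"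
    "\<And>z. z \<in> ball 0 1 \<Longrightarrow> 0 \<le> B3 z" "\<And>z. z \<in> ball 0 1 \<Longrightarrow> B3 z \<le> (Im (f z))\<^sup>2 * w z"
    "\<And>z. z \<in> ball 0 1 \<Longrightarrow> l3 z \<ge> (Im (f z))\<^sup>2 * d z / (16 * Q\<^sup>2 * \<kappa>)"
    by (rule bellman_carleson[OF J(2) G k G0 Gw d0 lG]; (assumption | rule that))
  \<comment> \<open>Multiplying the Carleson functions by \<open>q\<close> clears the denominator in
    their gain; the price appears in the upper bound.\<close>
  define q where "q = 16 * Q\<^sup>2 * \<kappa>"
  have q: "q > 0" using Q_ge k by (simp add: q_def)
  show ?thesis
  proof (rule that[OF jet_add[OF 1(1) jet_cmult[OF jet_add[OF 2(1) 3(1)], of q]]], fold q_def)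
    fix z :: complex assume z: "z \<in> ball 0 1"
    show "0 \<le> B1 z + q * (B2 z + B3 z)" using 1(2)[OF z] 2(2)[OF z] 3(2)[OF z] q by simp
    have "q * (B2 z + B3 z) \<le> q * ((cmod (f z))\<^sup>2 * w z)"
      using 2(3)[OF z] 3(3)[OF z] q by (intro mult_left_mono) (auto simp: cmod_power2 algebra_simps)
    thus "B1 z + q * (B2 z + B3 z) \<le> (1 + 8 * Q\<^sup>2 + q) * ((cmod (f z))\<^sup>2 * w z)"
      using 1(3)[OF z] by (simp add: cmod_power2 algebra_simps)
    have "(Re (f z))\<^sup>2 * d z / q + (Im (f z))\<^sup>2 * d z / q \<le> l2 z + l3 z"
      using 2(4)[OF z] 3(4)[OF z] by (simp add: q_def)
    hence "(cmod (f z))\<^sup>2 * d z / q \<le> l2 z + l3 z"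
      by (simp add: cmod_power2 algebra_simps add_divide_distrib)
    hence "(cmod (f z))\<^sup>2 * d z \<le> q * (l2 z + l3 z)" using q by (simp add: field_simps)
    moreover have "((cmod (deriv f z / 2))\<^sup>2 + (cmod (- \<i> * deriv f z / 2))\<^sup>2) * w z = (cmod (deriv f z))\<^sup>2 * w z / 2"
      by (simp add: norm_divide norm_mult power_divide field_simps)
    ultimately show "(cmod (deriv f z))\<^sup>2 * w z / 2 + (cmod (f z))\<^sup>2 * d z \<le> l1 z + q * (l2 z + l3 z)"
      using 1(4)[OF z] by linarith
  qed
qed

text \<open>Completing the square pairs \<open>w\<close> with \<open>1/w\<close>, and
  \<open>1/w \<le> v\<close>. So the two harmonic extensions can stand on the two factors although
  they are not reciprocal in the disc.\<close>

lemma AM_GM_weight: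
  assumes z: "z \<in> ball 0 1" and "0 \<le> x" "0 \<le> y"
  shows "x * y \<le> x\<^sup>2 * w z / 2 + y\<^sup>2 * v z / 2"
proof -
  note p = w_pos[OF z]
  have "0 \<le> (x * w z - y)\<^sup>2 / w z" using p by auto
  also have "\<dots> = x\<^sup>2 * w z - 2 * x * y + y\<^sup>2 * (1 / w z)"
    using p by (simp add: power2_diff power_mult_distrib field_simps) (simp add: power2_eq_square algebra_simps)
  also have "\<dots> \<le> x\<^sup>2 * w z - 2 * x * y + y\<^sup>2 * v z"
    using wv_ge[OF z] p by (intro add_left_mono mult_left_mono) (auto simp: field_simps)
  finally show ?thesis by simp
qed

text \<open>Here \<open>A'\<close> and \<open>B'\<close> form a second pair of functions, not
  derivatives. Of the two parts of the form, \<open>A * A'\<close> is holomorphic, while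
  \<open>A * cnj B'\<close> has a product of two derivatives as Laplacian. After splitting by
  \<open>AM_GM_weight\<close>, each half is part of a weighted Littlewood-Paley gain for
  \<open>A + cnj B\<close> or \<open>A' + cnj B'\<close>. The start value vanishes because
  \<open>A 0 = 0\<close>.\<close>

lemma riesz_projection_disc:
  assumes hol: "A holomorphic_on ball 0 1" "B holomorphic_on ball 0 1" "A' holomorphic_on ball 0 1" "B' holomorphic_on ball 0 1"
    and 0: "A 0 = 0" and r: "0 \<le> r" "r < 1"
  shows "integral {0..2*pi} (\<lambda>t. Re (A (of_real r * cis t) * (A' (of_real r * cis t) + cnj (B' (of_real r * cis t)))))
     \<le> (1 + 8 * Q\<^sup>2) * integral {0..2*pi} (\<lambda>t. (cmod (A (of_real r * cis t) + cnj (B (of_real r * cis t))))\<^sup>2 * w (of_real r * cis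
       t) +
           (cmod (A' (of_real r * cis t) + cnj (B' (of_real r * cis t))))\<^sup>2 * v (of_real r * cis t))"
proof -
  have dd: "deriv (\<lambda>z. F z + H z) z = deriv F z + deriv H z" "deriv (\<lambda>z. F z - H z) z = deriv F z - deriv H z"
    if "F holomorphic_on ball 0 1" "H holomorphic_on ball 0 1" "z \<in> ball 0 1" for F H and z :: complex
    using that by (auto intro!: deriv_add deriv_diff holomorphic_on_imp_differentiable_at)
  interpret s: harmonic_pair v w \<eta> \<omega> Q by (rule swap)
  obtain B1 b1 l1 where 1: "jet B1 b1 l1"
    "\<And>z. z \<in> ball 0 1 \<Longrightarrow> 0 \<le> B1 z" "\<And>z. z \<in> ball 0 1 \<Longrightarrow> B1 z \<le> (1 + 8 * Q\<^sup>2) * (((Re (A z + B z))\<^sup>2 + (Im (A z - B z))\<^sup>2) * w z)"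
    "\<And>z. z \<in> ball 0 1 \<Longrightarrow> l1 z \<ge> ((cmod (deriv (\<lambda>z. A z + B z) z / 2))\<^sup>2 + (cmod (- \<i> * deriv (\<lambda>z. A z - B z) z / 2))\<^sup>2) * w z"
    by (rule bellman_littlewood_paley_pair[OF jet_Re[OF holomorphic_on_add[OF hol(1,2)]] jet_Im[OF holomorphic_on_diff[OF
      hol(1,2)]]]; (assumption | rule that))
  obtain B2 b2 l2 where 2: "jet B2 b2 l2"
    "\<And>z. z \<in> ball 0 1 \<Longrightarrow> 0 \<le> B2 z" "\<And>z. z \<in> ball 0 1 \<Longrightarrow>
      B2 z \<le> (1 + 8 * Q\<^sup>2) * (((Re (A' z + B' z))\<^sup>2 + (Im (A' z - B' z))\<^sup>2) * v z)"
    "\<And>z. z \<in> ball 0 1 \<Longrightarrow> l2 z \<ge> ((cmod (deriv (\<lambda>z. A' z + B' z) z / 2))\<^sup>2 + (cmod (- \<i> * deriv (\<lambda>z. A' z - B' z) z / 2))\<^sup>2) * v z"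
    by (rule s.bellman_littlewood_paley_pair[OF jet_Re[OF holomorphic_on_add[OF hol(3,4)]] jet_Im[OF holomorphic_on_diff[OF
      hol(3,4)]]]; (assumption | rule that))
  obtain a where a: "jet (\<lambda>z. Re (cnj (B' z) * A z)) a (\<lambda>z. Re (deriv B' z * cnj (deriv A z)))"
    by (rule jet_Re_cnj_mult[OF hol(4,1)])
  note R = jet_add[OF jet_Re[OF holomorphic_on_mult[OF hol(1,3)]] a]
  \<comment> \<open>The real part of \<open>A + cnj B\<close> is that of the holomorphic
    \<open>A + B\<close>, its imaginary part that of \<open>A - B\<close>. This brings both within
    reach of \<open>bellman_littlewood_paley_pair\<close>; \<open>e2\<close> recombines the
    derivatives by the parallelogram law.\<close>
  have e1: "(Re (x + y))\<^sup>2 + (Im (x - y))\<^sup>2 = (cmod (x + cnj y))\<^sup>2" for x y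
    by (simp add: cmod_power2)
  have e2: "(cmod ((x + y) / 2))\<^sup>2 + (cmod (- \<i> * (x - y) / 2))\<^sup>2 = (cmod x)\<^sup>2 / 2 + (cmod y)\<^sup>2 / 2" for x y
    unfolding cmod_power2 by (simp add: power2_eq_square field_simps)
  define M where "M = (\<lambda>z. (1 + 8 * Q\<^sup>2) * ((cmod (A z + cnj (B z)))\<^sup>2 * w z + (cmod (A' z + cnj (B' z)))\<^sup>2 * v z))"
  have "integral {0..2*pi} (\<lambda>t. Re (A (of_real r * cis t) * A' (of_real r * cis t)) + Re (cnj (B' (of_real r * cis t))
    * A (of_real r * cis t)))
    \<le> integral {0..2*pi} (\<lambda>t. M (of_real r * cis t))"
  proof (rule jet_mean_mono[OF jet_add[OF 1(1) 2(1)] R _ _ _ _ r])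
    fix z :: complex assume z: "z \<in> ball 0 1"
    show "B1 z + B2 z \<le> M z" using 1(3)[OF z] 2(3)[OF z] unfolding e1 M_def by (simp add: algebra_simps)
    have l1: "(cmod (deriv A z))\<^sup>2 * w z / 2 \<le> l1 z"
      using 1(4)[OF z] w_pos[OF z] unfolding dd[OF hol(1,2) z] e2
      by (rule_tac order_trans) (auto simp: algebra_simps)
    have l2: "(cmod (deriv B' z))\<^sup>2 * v z / 2 \<le> l2 z"
      using 2(4)[OF z] v_pos[OF z] unfolding dd[OF hol(3,4) z] e2
      by (rule_tac order_trans) (auto simp: algebra_simps)
    have "Re (deriv B' z * cnj (deriv A z)) \<le> cmod (deriv A z) * cmod (deriv B' z)"
      using complex_Re_le_cmod[of "deriv B' z * cnj (deriv A z)"] by (simp add: norm_mult mult.commute)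
    also have "\<dots> \<le> (cmod (deriv A z))\<^sup>2 * w z / 2 + (cmod (deriv B' z))\<^sup>2 * v z / 2"
      by (rule AM_GM_weight[OF z]) auto
    also have "\<dots> \<le> l1 z + l2 z" using l1 l2 by simp
    finally show "0 + Re (deriv B' z * cnj (deriv A z)) \<le> l1 z + l2 z" by simp
  next
    show "Re (A 0 * A' 0) + Re (cnj (B' 0) * A 0) \<le> B1 0 + B2 0"
      using 1(2)[of 0] 2(2)[of 0] by (simp add: 0)
    show "continuous_on (ball 0 1) M"
      unfolding M_def by (intro continuous_intros jet_continuous[OF jw] jet_continuous[OF jv] holomorphic_on_imp_continuous_on
        hol)
  qed
  also have "integral {0..2*pi} (\<lambda>t. M (of_real r * cis t))
    = (1 + 8 * Q\<^sup>2) * integral {0..2*pi} (\<lambda>t. (cmod (A (of_real r * cis t) + cnj (B (of_real r * cis t))))\<^sup>2 * w (of_real r * cis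
      t) +
           (cmod (A' (of_real r * cis t) + cnj (B' (of_real r * cis t))))\<^sup>2 * v (of_real r * cis t))"
    unfolding M_def by (rule integral_mult_right)
  finally show ?thesis by (simp add: algebra_simps)
qed

end

text \<open>The two weight pairs are crossed: \<open>G1\<close> is driven by
  \<open>|B'|^2 v2\<close> but dominated by \<open>w1\<close>. It is needed where the derivative
  falls on \<open>h\<close>: that factor is measured by \<open>w2\<close>, so the remaining
  \<open>f B'\<close> is measured by \<open>v2\<close>, and this must be embedded into the norm of
  \<open>f\<close> with weight \<open>w1\<close>. Exchanging \<open>f\<close> and \<open>h\<close>
  explains \<open>G2\<close>.\<close>

lemma hankel_form_disc:
  assumes 1: "harmonic_pair w1 v1 \<omega>1 \<eta>1 Q1" and 2: "harmonic_pair w2 v2 \<omega>2 \<eta>2 Q2"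
    and hol: "B holomorphic_on ball 0 1" "f holomorphic_on ball 0 1" "h holomorphic_on ball 0 1" and B0: "B 0 = 0"
    and k: "\<kappa> > 0"
    and G1: "jet G1 g1 l1" "\<And>z. z \<in> ball 0 1 \<Longrightarrow> 0 \<le> G1 z" "\<And>z. z \<in> ball 0 1 \<Longrightarrow> G1 z \<le> \<kappa> * w1 z"
       "\<And>z. z \<in> ball 0 1 \<Longrightarrow> l1 z \<le> - ((cmod (deriv B z))\<^sup>2 * v2 z / 2)"
    and G2: "jet G2 g2 l2" "\<And>z. z \<in> ball 0 1 \<Longrightarrow> 0 \<le> G2 z" "\<And>z. z \<in> ball 0 1 \<Longrightarrow> G2 z \<le> \<kappa> * w2 z"
       "\<And>z. z \<in> ball 0 1 \<Longrightarrow> l2 z \<le> - ((cmod (deriv B z))\<^sup>2 * v1 z / 2)"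
    and r: "0 \<le> r" "r < 1"
  shows "integral {0..2*pi} (\<lambda>t. Re (cnj (B (of_real r * cis t)) * (f (of_real r * cis t) * h (of_real r * cis t))))
     \<le> (1 + (8 + 16 * \<kappa>) * (Q1\<^sup>2 + Q2\<^sup>2)) * integral {0..2*pi} (\<lambda>t. (cmod (f (of_real r * cis t)))\<^sup>2 * w1 (of_real r * cis t) +
           (cmod (h (of_real r * cis t)))\<^sup>2 * w2 (of_real r * cis t))"
proof -
  interpret one: harmonic_pair w1 v1 \<omega>1 \<eta>1 Q1 by (rule 1)
  interpret two: harmonic_pair w2 v2 \<omega>2 \<eta>2 Q2 by (rule 2)
  obtain F1 f1 m1 where F1: "jet F1 f1 m1"
    "\<And>z. z \<in> ball 0 1 \<Longrightarrow> 0 \<le> F1 z"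
    "\<And>z. z \<in> ball 0 1 \<Longrightarrow> F1 z \<le> (1 + 8 * Q1\<^sup>2 + 16 * Q1\<^sup>2 * \<kappa>) * ((cmod (f z))\<^sup>2 * w1 z)"
    "\<And>z. z \<in> ball 0 1 \<Longrightarrow> m1 z \<ge> (cmod (deriv f z))\<^sup>2 * w1 z / 2 + (cmod (f z))\<^sup>2 * ((cmod (deriv B z))\<^sup>2 * v2 z / 2)"
    by (rule one.holomorphic_bellman[OF hol(2) G1(1) k G1(2,3) _ G1(4)]; (assumption | rule that | use two.v_pos in \<open>force intro!:
      mult_nonneg_nonneg\<close>))
  obtain F2 f2 m2 where F2: "jet F2 f2 m2"
    "\<And>z. z \<in> ball 0 1 \<Longrightarrow> 0 \<le> F2 z"
    "\<And>z. z \<in> ball 0 1 \<Longrightarrow> F2 z \<le> (1 + 8 * Q2\<^sup>2 + 16 * Q2\<^sup>2 * \<kappa>) * ((cmod (h z))\<^sup>2 * w2 z)"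
    "\<And>z. z \<in> ball 0 1 \<Longrightarrow> m2 z \<ge> (cmod (deriv h z))\<^sup>2 * w2 z / 2 + (cmod (h z))\<^sup>2 * ((cmod (deriv B z))\<^sup>2 * v1 z / 2)"
    by (rule two.holomorphic_bellman[OF hol(3) G2(1) k G2(2,3) _ G2(4)]; (assumption | rule that | use one.v_pos in \<open>force intro!:
      mult_nonneg_nonneg\<close>))
  obtain a where a: "jet (\<lambda>z. Re (cnj (B z) * (f z * h z))) a (\<lambda>z. Re (deriv B z * cnj (deriv (\<lambda>z. f z * h z) z)))"
    by (rule jet_Re_cnj_mult[OF hol(1) holomorphic_on_mult[OF hol(2,3)]])
  define K where "K = 1 + (8 + 16 * \<kappa>) * (Q1\<^sup>2 + Q2\<^sup>2)"
  define M where "M = (\<lambda>z. K * ((cmod (f z))\<^sup>2 * w1 z + (cmod (h z))\<^sup>2 * w2 z))"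
  have "integral {0..2*pi} (\<lambda>t. Re (cnj (B (of_real r * cis t)) * (f (of_real r * cis t) * h (of_real r * cis t))))
    \<le> integral {0..2*pi} (\<lambda>t. M (of_real r * cis t))"
  proof (rule jet_mean_mono[OF jet_add[OF F1(1) F2(1)] a _ _ _ _ r])
    fix z :: complex assume z: "z \<in> ball 0 1"
    have "F1 z \<le> (1 + 8 * Q1\<^sup>2 + 16 * Q1\<^sup>2 * \<kappa>) * ((cmod (f z))\<^sup>2 * w1 z)" by (rule F1(3)[OF z])
    also have "\<dots> \<le> K * ((cmod (f z))\<^sup>2 * w1 z)"
      using one.w_pos[OF z] k by (intro mult_right_mono) (auto simp: K_def algebra_simps)
    finally have 1: "F1 z \<le> K * ((cmod (f z))\<^sup>2 * w1 z)" .
    have "F2 z \<le> (1 + 8 * Q2\<^sup>2 + 16 * Q2\<^sup>2 * \<kappa>) * ((cmod (h z))\<^sup>2 * w2 z)" by (rule F2(3)[OF z])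
    also have "\<dots> \<le> K * ((cmod (h z))\<^sup>2 * w2 z)"
      using two.w_pos[OF z] k by (intro mult_right_mono) (auto simp: K_def algebra_simps)
    finally show "F1 z + F2 z \<le> M z" using 1 by (simp add: M_def algebra_simps)
    have d: "deriv (\<lambda>z. f z * h z) z = f z * deriv h z + deriv f z * h z"
      using holomorphic_on_imp_differentiable_at[OF hol(2) open_ball z] holomorphic_on_imp_differentiable_at[OF hol(3) open_ball
        z]
      by (rule deriv_mult)
    have "Re (deriv B z * cnj (deriv (\<lambda>z. f z * h z) z)) \<le> cmod (deriv B z) * cmod (f z * deriv h z + deriv f z * h z)"
      using complex_Re_le_cmod[of "deriv B z * cnj (deriv (\<lambda>z. f z * h z) z)"] unfolding d norm_mult complex_mod_cnj .
    also have "\<dots> \<le> cmod (deriv B z) * (cmod (f z * deriv h z) + cmod (deriv f z * h z))"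
      by (intro mult_left_mono norm_triangle_ineq) auto
    also have "\<dots> = cmod (deriv h z) * (cmod (f z) * cmod (deriv B z)) + cmod (deriv f z) * (cmod (h z) * cmod (deriv B z))"
      by (simp add: norm_mult algebra_simps)
    \<comment> \<open>Each summand uses the weight pair of the factor that was
      differentiated.\<close>
    also have "\<dots> \<le> ((cmod (deriv h z))\<^sup>2 * w2 z / 2 + (cmod (f z) * cmod (deriv B z))\<^sup>2 * v2 z / 2) +
        ((cmod (deriv f z))\<^sup>2 * w1 z / 2 + (cmod (h z) * cmod (deriv B z))\<^sup>2 * v1 z / 2)"
      by (intro add_mono one.AM_GM_weight[OF z] two.AM_GM_weight[OF z]) auto
    also have "\<dots> \<le> m1 z + m2 z" using F1(4)[OF z] F2(4)[OF z] by (simp add: power_mult_distrib algebra_simps)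
    finally show "Re (deriv B z * cnj (deriv (\<lambda>z. f z * h z) z)) \<le> m1 z + m2 z" .
  next
    show "Re (cnj (B 0) * (f 0 * h 0)) \<le> F1 0 + F2 0" using F1(2)[of 0] F2(2)[of 0] by (simp add: B0)
    show "continuous_on (ball 0 1) M"
      unfolding M_def by (intro continuous_intros jet_continuous[OF one.jw] jet_continuous[OF two.jw]
        holomorphic_on_imp_continuous_on hol)
  qed
  also have "integral {0..2*pi} (\<lambda>t. M (of_real r * cis t))
    = K * integral {0..2*pi} (\<lambda>t. (cmod (f (of_real r * cis t)))\<^sup>2 * w1 (of_real r * cis t) +
           (cmod (h (of_real r * cis t)))\<^sup>2 * w2 (of_real r * cis t))"
    unfolding M_def by (rule integral_mult_right)
  finally show ?thesis by (simp add: K_def)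
qed

section \<open>Poisson extensions\<close>

lemma cnj_measurable [measurable]: "cnj \<in> borel_measurable borel"
  by (intro borel_measurable_continuous_onI continuous_intros)

lemma Poisson_measurable [measurable]: "Poisson z \<in> borel_measurable borel"
  unfolding Poisson_def by measurable

lemma circle_denom:
  assumes "cmod \<zeta> = 1" "cmod z < 1"
  shows "1 - cmod z \<le> cmod (1 - cnj z * \<zeta>)" "1 - cnj z * \<zeta> \<noteq> 0"
proof -
  have "1 - cmod z = cmod 1 - cmod (cnj z * \<zeta>)" using assms by (simp add: norm_mult)
  also have "\<dots> \<le> cmod (1 - cnj z * \<zeta>)" by (rule norm_triangle_ineq2)
  finally show "1 - cmod z \<le> cmod (1 - cnj z * \<zeta>)" .
  thus "1 - cnj z * \<zeta> \<noteq> 0" using assms by auto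
qed

lemma Poisson_pos:
  assumes "cmod \<zeta> = 1" "cmod z < 1"
  shows "Poisson z \<zeta> > 0"
  unfolding Poisson_def using circle_denom[OF assms] assms(2) by (simp add: power_less_one_iff)

lemma Poisson_le:
  assumes "cmod \<zeta> = 1" "cmod z < 1"
  shows "Poisson z \<zeta> \<le> 1 / (1 - cmod z)\<^sup>2"
proof -
  have "Poisson z \<zeta> \<le> (1 - (cmod z)\<^sup>2) / (1 - cmod z)\<^sup>2"
    unfolding Poisson_def using circle_denom[OF assms] assms(2)
    by (intro divide_left_mono power_mono mult_pos_pos) (auto simp: power_le_one)
  also have "\<dots> \<le> 1 / (1 - cmod z)\<^sup>2" by (intro divide_right_mono) auto
  finally show ?thesis .
qed

lemma integrable_Poisson_mult:
  fixes u :: "complex \<Rightarrow> 'a::{real_normed_algebra_1,banach,second_countable_topology}"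
  assumes z: "cmod z < 1" and u: "integrable dm u"
  shows "integrable dm (\<lambda>\<zeta>. Poisson z \<zeta> *\<^sub>R u \<zeta>)"
proof -
  have "integrable dm (\<lambda>\<zeta>. of_real (Poisson z \<zeta>) * u \<zeta>)"
    by (rule integrable_dm_bounded_mult[OF _ _ u, where B="1 / (1 - cmod z)\<^sup>2"])
       (use Poisson_le[OF _ z] Poisson_pos[OF _ z] in \<open>auto simp: less_imp_le\<close>)
  thus ?thesis by (simp add: scaleR_conv_of_real)
qed

text \<open>Termwise integration: on the circle the terms are dominated by the summable
  \<open>norm (a n)\<close> times \<open>norm (u \<zeta>)\<close>. It serves both for kernels in
  powers of \<zeta> and in powers of its conjugate.\<close>

lemma sums_integral_circle:
  fixes u :: "complex \<Rightarrow> complex" and a :: "nat \<Rightarrow> complex"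
  assumes u: "integrable dm u" and a: "summable (\<lambda>n. norm (a n))"
    and e [measurable]: "\<And>n. e n \<in> borel_measurable borel" and e1: "\<And>n \<zeta>. cmod \<zeta> = 1 \<Longrightarrow> norm (e n \<zeta>) \<le> 1"
    and s: "\<And>\<zeta>. cmod \<zeta> = 1 \<Longrightarrow> (\<lambda>n. a n * e n \<zeta>) sums s \<zeta>" and [measurable]: "s \<in> borel_measurable borel"
  shows "(\<lambda>n. a n * (\<integral>\<zeta>. u \<zeta> * e n \<zeta> \<partial>dm)) sums (\<integral>\<zeta>. u \<zeta> * s \<zeta> \<partial>dm)"
proof -
  have [measurable]: "u \<in> borel_measurable borel" using u by (auto dest: borel_measurable_integrable)
  have i1: "integrable dm (\<lambda>\<zeta>. u \<zeta> * e n \<zeta>)" for n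
    using integrable_dm_bounded_mult[OF e e1 u] by (simp add: mult.commute)
  hence i: "integrable dm (\<lambda>\<zeta>. u \<zeta> * (a n * e n \<zeta>))" for n
    using integrable_mult_right[of "a n" dm "\<lambda>\<zeta>. u \<zeta> * e n \<zeta>"] by (simp add: mult_ac)
  have ss: "AE \<zeta> in dm. summable (\<lambda>n. norm (u \<zeta> * (a n * e n \<zeta>)))"
    using AE_dm_circle
  proof eventually_elim
    case (elim \<zeta>)
    show ?case
      by (rule summable_comparison_test'[OF summable_mult[OF a, of "norm (u \<zeta>)"]])
         (use e1[OF elim] in \<open>auto simp: norm_mult intro!: mult_left_mono mult_left_le\<close>)
  qed
  have "summable (\<lambda>n. \<integral>\<zeta>. norm (u \<zeta> * (a n * e n \<zeta>)) \<partial>dm)"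
  proof (rule summable_comparison_test'[OF summable_mult2[OF a, of "\<integral>\<zeta>. norm (u \<zeta>) \<partial>dm"]])
    fix n :: nat
    have "(\<integral>\<zeta>. norm (u \<zeta> * (a n * e n \<zeta>)) \<partial>dm) \<le> (\<integral>\<zeta>. norm (a n) * norm (u \<zeta>) \<partial>dm)"
    proof (rule integral_mono_AE)
      show "integrable dm (\<lambda>\<zeta>. norm (u \<zeta> * (a n * e n \<zeta>)))" by (rule integrable_norm[OF i])
      show "integrable dm (\<lambda>\<zeta>. norm (a n) * norm (u \<zeta>))" using u by simp
      show "AE \<zeta> in dm. norm (u \<zeta> * (a n * e n \<zeta>)) \<le> norm (a n) * norm (u \<zeta>)"
        using AE_dm_circle
      proof eventually_elim
        case (elim \<zeta>)
        have "norm (a n) * norm (u \<zeta>) * norm (e n \<zeta>) \<le> norm (a n) * norm (u \<zeta>)"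
          by (rule mult_left_le) (use e1[OF elim] in auto)
        thus ?case by (simp add: norm_mult mult_ac)
      qed
    qed
    thus "norm (\<integral>\<zeta>. norm (u \<zeta> * (a n * e n \<zeta>)) \<partial>dm) \<le> norm (a n) * (\<integral>\<zeta>. norm (u \<zeta>) \<partial>dm)"
      by (subst real_norm_def, subst abs_of_nonneg) auto
  qed
  from sums_integral[OF i ss this]
  have "(\<lambda>n. \<integral>\<zeta>. u \<zeta> * (a n * e n \<zeta>) \<partial>dm) sums (\<integral>\<zeta>. (\<Sum>n. u \<zeta> * (a n * e n \<zeta>)) \<partial>dm)" .
  also have "(\<integral>\<zeta>. (\<Sum>n. u \<zeta> * (a n * e n \<zeta>)) \<partial>dm) = (\<integral>\<zeta>. u \<zeta> * s \<zeta> \<partial>dm)"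
    by (intro integral_dm_cong) (auto simp: sums_unique[OF sums_mult[OF s]])
  also have "(\<lambda>n. \<integral>\<zeta>. u \<zeta> * (a n * e n \<zeta>) \<partial>dm) = (\<lambda>n. a n * (\<integral>\<zeta>. u \<zeta> * e n \<zeta> \<partial>dm))"
    by (subst integral_mult_right_zero[symmetric]) (simp add: mult_ac)
  finally show ?thesis .
qed

section \<open>Fourier coefficients and the splitting of Poisson extensions\<close>

definition fourier :: "(complex \<Rightarrow> complex) \<Rightarrow> nat \<Rightarrow> complex" where
  "fourier u n = (\<integral>\<zeta>. u \<zeta> * cnj \<zeta> ^ n \<partial>dm)"

text \<open>The kernel is the sum of the powers \<open>(cnj \<zeta> * z)^n\<close> with n \<ge> 1,
  so this is the analytic part of u without its mean. Vanishing at 0 is what the bilinear estimates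
  in the disc require.\<close>

definition riesz_plus :: "(complex \<Rightarrow> complex) \<Rightarrow> complex \<Rightarrow> complex" where
  "riesz_plus u z = (\<integral>\<zeta>. u \<zeta> * (cnj \<zeta> * z / (1 - cnj \<zeta> * z)) \<partial>dm)"

lemma fourier_bound:
  assumes "integrable dm u" shows "norm (fourier u n) \<le> (\<integral>\<zeta>. norm (u \<zeta>) \<partial>dm)"
proof -
  have "norm (fourier u n) \<le> (\<integral>\<zeta>. norm (u \<zeta> * cnj \<zeta> ^ n) \<partial>dm)"
    unfolding fourier_def by (rule integral_norm_bound)
  also have "\<dots> = (\<integral>\<zeta>. norm (u \<zeta>) \<partial>dm)"
    using borel_measurable_integrable[OF assms]
    by (intro integral_dm_cong) (auto simp: norm_mult norm_power)
  finally show ?thesis .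
qed

lemma summable_fourier:
  assumes "integrable dm u" "norm z < 1"
  shows "summable (\<lambda>n. norm (fourier u n * z ^ n))"
  by (rule summable_comparison_test'[OF summable_mult[OF summable_geometric[of "norm z"], of "\<integral>\<zeta>. norm (u \<zeta>) \<partial>dm"]])
     (use assms fourier_bound[OF assms(1)] in \<open>auto simp: norm_mult norm_power intro!: mult_right_mono\<close>)

lemma geometric_sums_Suc: "norm (x::complex) < 1 \<Longrightarrow> (\<lambda>n. x ^ Suc n) sums (x / (1 - x))"
  using sums_mult[OF geometric_sums[of x], of x] by simp

lemma riesz_plus_sums:
  assumes u: "integrable dm u" and z: "norm z < 1"
  shows "(\<lambda>n. fourier u (Suc n) * z ^ Suc n) sums riesz_plus u z"
proof -
  have "(\<lambda>n. z ^ Suc n * (\<integral>\<zeta>. u \<zeta> * cnj \<zeta> ^ Suc n \<partial>dm)) sums riesz_plus u z"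
    unfolding riesz_plus_def
  proof (rule sums_integral_circle[OF u])
    show "summable (\<lambda>n. norm (z ^ Suc n))"
      using z by (subst summable_Suc_iff[where f="\<lambda>n. norm (z ^ n)"]) (simp add: norm_power)
    fix \<zeta> :: complex assume "cmod \<zeta> = 1"
    thus "(\<lambda>n. z ^ Suc n * cnj \<zeta> ^ Suc n) sums (cnj \<zeta> * z / (1 - cnj \<zeta> * z))"
      using geometric_sums_Suc[of "cnj \<zeta> * z"] z by (simp add: norm_mult power_mult_distrib mult_ac)
  qed (auto simp: norm_mult norm_power)
  thus ?thesis by (simp add: fourier_def mult_ac)
qed

lemma riesz_plus_0 [simp]: "riesz_plus u 0 = 0"
  by (simp add: riesz_plus_def)

lemma riesz_plus_holomorphic:
  assumes u: "integrable dm u"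
  shows "riesz_plus u holomorphic_on ball 0 1"
proof (rule power_series_holomorphic)
  fix w :: complex assume "w \<in> ball 0 1"
  hence "(\<lambda>n. (if Suc n = 0 then 0 else fourier u (Suc n)) * (w - 0) ^ Suc n) sums riesz_plus u w"
    using riesz_plus_sums[OF u, of w] by simp
  thus "(\<lambda>n. (if n = 0 then 0 else fourier u n) * (w - 0) ^ n) sums riesz_plus u w"
    by (subst (asm) sums_Suc_iff) simp
qed

lemma Poisson_conv:
  assumes "cmod \<zeta> = 1" "cmod z < 1"
  defines "x \<equiv> cnj \<zeta> * z"
  shows "of_real (Poisson z \<zeta>) = 1 + x / (1 - x) + cnj (x / (1 - x))"
proof -
  have nx: "norm x < 1" "norm x = norm z" using assms by (auto simp: x_def norm_mult)
  hence "x \<noteq> 1" by auto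
  hence nz: "1 - x \<noteq> 0" "1 - cnj x \<noteq> 0" by auto
  have "cmod (1 - cnj z * \<zeta>) = cmod (cnj (1 - x))" by (simp add: x_def mult.commute)
  hence "cmod (1 - cnj z * \<zeta>) = cmod (1 - x)" by (simp only: complex_mod_cnj)
  hence "of_real (Poisson z \<zeta>) = (1 - x * cnj x) / ((1 - x) * (1 - cnj x))"
    unfolding Poisson_def nx(2)[symmetric]
    by (simp add: complex_norm_square[symmetric] flip: of_real_power) (metis complex_cnj_diff complex_cnj_one complex_norm_square
      of_real_power)
  also have "\<dots> = 1 + x / (1 - x) + cnj x / (1 - cnj x)" using nz by (simp add: field_simps)
  finally show ?thesis by simp
qed

lemma integrable_mult_riesz_plus_kernel:
  assumes u: "integrable dm u" and z: "norm z < 1"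
  shows "integrable dm (\<lambda>\<zeta>. u \<zeta> * (cnj \<zeta> * z / (1 - cnj \<zeta> * z)))"
proof -
  have "norm (cnj \<zeta> * z / (1 - cnj \<zeta> * z)) \<le> 1 / (1 - norm z)" if "norm \<zeta> = 1" for \<zeta>
  proof -
    have "1 - norm z \<le> norm (1 - cnj \<zeta> * z)" using norm_triangle_ineq2[of 1 "cnj \<zeta> * z"] that by (simp add: norm_mult)
    thus ?thesis using that z by (simp add: norm_divide norm_mult) (intro frac_le, auto)
  qed
  from integrable_dm_bounded_mult[where f="\<lambda>\<zeta>. cnj \<zeta> * z / (1 - cnj \<zeta> * z)", OF _ this u]
  show ?thesis by (simp add: mult.commute)
qed

lemma poisson_ext_complex:
  fixes u :: "complex \<Rightarrow> complex"
  assumes u: "integrable dm u" and z: "norm z < 1"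
  shows "poisson_ext u z = fourier u 0 + riesz_plus u z + cnj (riesz_plus (\<lambda>\<zeta>. cnj (u \<zeta>)) z)"
proof -
  have [measurable]: "u \<in> borel_measurable borel" using u by (auto dest: borel_measurable_integrable)
  have u': "integrable dm (\<lambda>\<zeta>. cnj (u \<zeta>))" using u by simp
  note i = integrable_mult_riesz_plus_kernel[OF u z] integrable_mult_riesz_plus_kernel[OF u' z]
  have i3: "integrable dm (\<lambda>\<zeta>. u \<zeta> * cnj (cnj \<zeta> * z / (1 - cnj \<zeta> * z)))"
    using integrable_cnj[OF i(2)] by simp
  have "poisson_ext u z = (\<integral>\<zeta>. u \<zeta> + u \<zeta> * (cnj \<zeta> * z / (1 - cnj \<zeta> * z)) + u \<zeta> * cnj (cnj \<zeta> * z / (1 - cnj \<zeta> * z)) \<partial>dm)"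
    unfolding poisson_ext_def
  proof (rule integral_dm_cong)
    fix \<zeta> :: complex assume "cmod \<zeta> = 1"
    from Poisson_conv[OF this z] show "Poisson z \<zeta> *\<^sub>R u \<zeta>
      = u \<zeta> + u \<zeta> * (cnj \<zeta> * z / (1 - cnj \<zeta> * z)) + u \<zeta> * cnj (cnj \<zeta> * z / (1 - cnj \<zeta> * z))"
      unfolding scaleR_conv_of_real by (simp only: distrib_left distrib_right mult_1_left mult.commute)
  qed measurable
  also have "\<dots> = (\<integral>\<zeta>. u \<zeta> \<partial>dm) + riesz_plus u z + (\<integral>\<zeta>. u \<zeta> * cnj (cnj \<zeta> * z / (1 - cnj \<zeta> * z)) \<partial>dm)"
    unfolding riesz_plus_def using u i i3 by (simp del: complex_cnj_divide complex_cnj_mult complex_cnj_diff)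
  also have "(\<integral>\<zeta>. u \<zeta> * cnj (cnj \<zeta> * z / (1 - cnj \<zeta> * z)) \<partial>dm) = cnj (riesz_plus (\<lambda>\<zeta>. cnj (u \<zeta>)) z)"
    unfolding riesz_plus_def by (subst Bochner_Integration.integral_cnj[symmetric]) simp
  finally show ?thesis by (simp add: fourier_def)
qed

lemma poisson_ext_of_real:
  assumes u: "integrable dm u" and z: "norm z < 1"
  shows "poisson_ext (\<lambda>\<zeta>. complex_of_real (u \<zeta>)) z = of_real (poisson_ext u z)"
  unfolding poisson_ext_def by (subst integral_complex_of_real[symmetric]) (simp add: scaleR_conv_of_real)

lemma poisson_ext_Re:
  assumes u: "integrable dm u" and z: "norm z < 1"
  shows "poisson_ext (\<lambda>\<zeta>. Re (u \<zeta>)) z = Re (poisson_ext u z)"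
  using integral_Re[OF integrable_Poisson_mult[OF z u]] by (simp add: poisson_ext_def)

lemma poisson_ext_Im:
  assumes u: "integrable dm u" and z: "norm z < 1"
  shows "poisson_ext (\<lambda>\<zeta>. Im (u \<zeta>)) z = Im (poisson_ext u z)"
  using integral_Im[OF integrable_Poisson_mult[OF z u]] by (simp add: poisson_ext_def)

lemma jet_poisson_ext:
  assumes u: "integrable dm u"
  obtains a where "jet (poisson_ext u) a (\<lambda>_. 0)"
proof -
  \<comment> \<open>For real u the analytic and the antianalytic part of the extension are
    conjugate, so the extension is the real part of this function.\<close>
  define F where "F = (\<lambda>z. fourier (\<lambda>\<zeta>. complex_of_real (u \<zeta>)) 0 + 2 * riesz_plus (\<lambda>\<zeta>. complex_of_real (u \<zeta>)) z)"
  have u': "integrable dm (\<lambda>\<zeta>. complex_of_real (u \<zeta>))" using u by simp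
  have "F holomorphic_on ball 0 1"
    unfolding F_def by (intro holomorphic_intros riesz_plus_holomorphic u')
  note J = jet_Re[OF this]
  show ?thesis
  proof (rule that[OF jet_cong[OF J _ refl refl]])
    fix z :: complex assume z: "z \<in> ball 0 1"
    have "poisson_ext u z = Re (poisson_ext (\<lambda>\<zeta>. complex_of_real (u \<zeta>)) z)"
      using poisson_ext_of_real[OF u, of z] z by simp
    also have "\<dots> = Re (F z)" using z by (subst poisson_ext_complex[OF u']) (auto simp: F_def)
    finally show "Re (F z) = poisson_ext u z" by simp
  qed
qed

text \<open>A harmonic function and its negative both satisfy the sub-mean value inequality.\<close>

lemma poisson_ext_mean:
  assumes u: "integrable dm (u :: complex \<Rightarrow> real)" and r: "0 \<le> r" "r < 1"
  shows "integral {0..2*pi} (\<lambda>t. poisson_ext u (of_real r * cis t)) = 2 * pi * (\<integral>\<zeta>. u \<zeta> \<partial>dm)"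
proof -
  obtain a where a: "jet (poisson_ext u) a (\<lambda>_. 0)" by (rule jet_poisson_ext[OF u])
  have p0: "poisson_ext u 0 = (\<integral>\<zeta>. u \<zeta> \<partial>dm)" by (simp add: poisson_ext_def Poisson_def)
  have "2 * pi * (- 1 * poisson_ext u 0) \<le> integral {0..2*pi} (\<lambda>t. - 1 * poisson_ext u (of_real r * cis t))"
    by (rule jet_mean[OF jet_cmult[OF a] _ r]) simp
  moreover have "2 * pi * poisson_ext u 0 \<le> integral {0..2*pi} (\<lambda>t. poisson_ext u (of_real r * cis t))"
    by (rule jet_mean[OF a _ r]) simp
  ultimately show ?thesis by (simp add: p0)
qed

section \<open>Monotonicity, positivity and Cauchy-Schwarz for Poisson extensions\<close>

lemma poisson_ext_mono_AE:
  fixes u u' :: "complex \<Rightarrow> real"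
  assumes "integrable dm u" "integrable dm u'" "AE \<zeta> in dm. u \<zeta> \<le> u' \<zeta>" "norm z < 1"
  shows "poisson_ext u z \<le> poisson_ext u' z"
  unfolding poisson_ext_def
proof (rule integral_mono_AE)
  show "AE \<zeta> in dm. Poisson z \<zeta> *\<^sub>R u \<zeta> \<le> Poisson z \<zeta> *\<^sub>R u' \<zeta>"
    using AE_dm_circle assms(3)
  proof eventually_elim
    case (elim \<zeta>)
    thus ?case using Poisson_pos[OF elim(1) assms(4)] by simp
  qed
qed (use assms in \<open>auto intro!: integrable_Poisson_mult simp del: real_scaleR_def\<close>)

lemma poisson_ext_pos:
  fixes u :: "complex \<Rightarrow> real"
  assumes u: "integrable dm u" and pos: "AE \<zeta> in dm. u \<zeta> > 0" and z: "norm z < 1"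
  shows "poisson_ext u z > 0"
proof -
  have [measurable]: "u \<in> borel_measurable borel" using u by (auto dest: borel_measurable_integrable)
  have P: "AE \<zeta> in dm. Poisson z \<zeta> * u \<zeta> > 0"
    using AE_dm_circle pos by eventually_elim (use Poisson_pos[OF _ z] in auto)
  have i: "integrable dm (\<lambda>\<zeta>. Poisson z \<zeta> * u \<zeta>)" using integrable_Poisson_mult[OF z u] by simp
  have "poisson_ext u z \<noteq> 0"
  proof
    assume "poisson_ext u z = 0"
    hence "AE \<zeta> in dm. Poisson z \<zeta> * u \<zeta> = 0"
      using i P by (subst (asm) poisson_ext_def, subst (asm) real_scaleR_def, subst (asm) integral_nonneg_eq_0_iff_AE) (auto elim:
        eventually_mono)
    with P have "AE \<zeta> in dm. False" by eventually_elim auto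
    thus False using emeasure_dm_UNIV by (simp add: AE_iff_measurable[OF _ refl])
  qed
  moreover have "poisson_ext u z \<ge> 0" unfolding poisson_ext_def
    using P by (intro integral_nonneg_AE) (auto elim: eventually_mono)
  ultimately show ?thesis by simp
qed

lemma poisson_ext_lincomb:
  fixes u u' :: "complex \<Rightarrow> real"
  assumes "integrable dm u" "integrable dm u'" "norm z < 1"
  shows "poisson_ext (\<lambda>\<zeta>. a * u \<zeta> + b * u' \<zeta>) z = a * poisson_ext u z + b * poisson_ext u' z"
proof -
  note i = integrable_Poisson_mult[OF assms(3) assms(1)] integrable_Poisson_mult[OF assms(3) assms(2)]
  have "poisson_ext (\<lambda>\<zeta>. a * u \<zeta> + b * u' \<zeta>) z = (\<integral>\<zeta>. a * (Poisson z \<zeta> *\<^sub>R u \<zeta>) + b * (Poisson z \<zeta> *\<^sub>R u' \<zeta>) \<partial>dm)"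
    unfolding poisson_ext_def by (simp add: algebra_simps)
  also have "\<dots> = a * poisson_ext u z + b * poisson_ext u' z"
    unfolding poisson_ext_def using i by simp
  finally show ?thesis .
qed

text \<open>Pointwise \<open>2 c u - c^2 / w \<le> u^2 w\<close> for every real c, from a square
  divided by w. Extending this linear bound to z and choosing the best c, the quotient of the
  extensions of u and 1/w, gives the claim.\<close>

lemma poisson_ext_Cauchy_Schwarz:
  assumes w: "integrable dm (inv_weight w)" "AE \<zeta> in dm. w \<zeta> > 0"
    and u: "integrable dm u" "integrable dm (\<lambda>\<zeta>. (u \<zeta>)\<^sup>2 * w \<zeta>)" and z: "norm z < 1"
  shows "(poisson_ext u z)\<^sup>2 \<le> poisson_ext (inv_weight w) z * poisson_ext (\<lambda>\<zeta>. (u \<zeta>)\<^sup>2 * w \<zeta>) z"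
proof -
  define v where "v = poisson_ext (inv_weight w) z"
  define p where "p = poisson_ext u z"
  have v: "v > 0" unfolding v_def
    by (rule poisson_ext_pos[OF w(1) _ z]) (use w(2) in \<open>auto simp: inv_weight_def elim: eventually_mono\<close>)
  define c where "c = p / v"
  have "2 * c * p + (- (c\<^sup>2)) * v = poisson_ext (\<lambda>\<zeta>. 2 * c * u \<zeta> + (- (c\<^sup>2)) * inv_weight w \<zeta>) z"
    unfolding v_def p_def by (rule poisson_ext_lincomb[symmetric, OF u(1) w(1) z])
  also have "\<dots> \<le> poisson_ext (\<lambda>\<zeta>. (u \<zeta>)\<^sup>2 * w \<zeta>) z"
  proof (rule poisson_ext_mono_AE[OF _ u(2) _ z])
    show "integrable dm (\<lambda>\<zeta>. 2 * c * u \<zeta> + (- (c\<^sup>2)) * inv_weight w \<zeta>)"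
      using u(1) w(1) by (intro Bochner_Integration.integrable_add integrable_mult_right)
    show "AE \<zeta> in dm. 2 * c * u \<zeta> + (- (c\<^sup>2)) * inv_weight w \<zeta> \<le> (u \<zeta>)\<^sup>2 * w \<zeta>"
      using w(2)
    proof eventually_elim
      case (elim \<zeta>)
      have "0 \<le> (u \<zeta> * w \<zeta> - c)\<^sup>2 / w \<zeta>" using elim by auto
      also have "\<dots> = (u \<zeta>)\<^sup>2 * w \<zeta> - 2 * c * u \<zeta> + c\<^sup>2 * inv_weight w \<zeta>"
        using elim by (simp add: power2_diff power_mult_distrib inv_weight_def field_simps) (simp add: power2_eq_square
          algebra_simps)
      finally show ?case by simp
    qed
  qed
  finally have "2 * c * p - c\<^sup>2 * v \<le> poisson_ext (\<lambda>\<zeta>. (u \<zeta>)\<^sup>2 * w \<zeta>) z" by simp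
  moreover have "2 * c * p - c\<^sup>2 * v = p\<^sup>2 / v" using v by (simp add: c_def power2_eq_square)
  ultimately have "p\<^sup>2 / v \<le> poisson_ext (\<lambda>\<zeta>. (u \<zeta>)\<^sup>2 * w \<zeta>) z" by simp
  hence "p\<^sup>2 \<le> poisson_ext (\<lambda>\<zeta>. (u \<zeta>)\<^sup>2 * w \<zeta>) z * v" using v by (simp only: pos_divide_le_eq)
  thus ?thesis by (simp add: v_def p_def mult.commute)
qed

section \<open>Orthogonality of powers; analytic functions reproduce themselves\<close>

lemma power_cnj_measurable: "(\<lambda>\<zeta>::complex. \<zeta> ^ m * cnj \<zeta> ^ n) \<in> borel_measurable borel"
  by measurable

lemma integral_dm_orthogonal:
  "(\<integral>\<zeta>. \<zeta> ^ m * cnj \<zeta> ^ n \<partial>dm) = (if m = n then 1 else 0)"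
proof -
  have c: "\<zeta> ^ m * cnj \<zeta> ^ m = 1" if "norm \<zeta> = 1" for \<zeta> m
  proof -
    have "\<zeta> * cnj \<zeta> = 1" using that complex_norm_square[of \<zeta>] by simp
    thus ?thesis by (simp flip: power_mult_distrib)
  qed
  consider "m = n" | "m > n" | "m < n" by linarith
  thus ?thesis
  proof cases
    case 1
    have "(\<integral>\<zeta>. \<zeta> ^ m * cnj \<zeta> ^ n \<partial>dm) = (\<integral>\<zeta>. 1 \<partial>dm)"
      by (rule integral_dm_cong) (use 1 c in \<open>auto intro: power_cnj_measurable\<close>)
    thus ?thesis using 1 by simp
  next
    case 2
    have "(\<integral>\<zeta>. \<zeta> ^ m * cnj \<zeta> ^ n \<partial>dm) = (\<integral>\<zeta>. \<zeta> ^ (m - n) \<partial>dm)"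
    proof (intro integral_dm_cong)
      fix \<zeta> :: complex assume "norm \<zeta> = 1"
      have "\<zeta> ^ m = \<zeta> ^ (m - n) * \<zeta> ^ n" using 2 by (simp flip: power_add)
      thus "\<zeta> ^ m * cnj \<zeta> ^ n = \<zeta> ^ (m - n)" using c[OF \<open>norm \<zeta> = 1\<close>, of n] by (simp add: mult.assoc)
    qed measurable
    thus ?thesis using 2 by (simp add: integral_dm_power)
  next
    case 3
    have "(\<integral>\<zeta>. \<zeta> ^ m * cnj \<zeta> ^ n \<partial>dm) = (\<integral>\<zeta>. cnj (\<zeta> ^ (n - m)) \<partial>dm)"
    proof (intro integral_dm_cong)
      fix \<zeta> :: complex assume "norm \<zeta> = 1"
      have "cnj \<zeta> ^ n = cnj \<zeta> ^ m * cnj \<zeta> ^ (n - m)" using 3 by (simp flip: power_add)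
      thus "\<zeta> ^ m * cnj \<zeta> ^ n = cnj (\<zeta> ^ (n - m))" using c[OF \<open>norm \<zeta> = 1\<close>, of m] by (simp flip: mult.assoc)
    qed measurable
    also have "\<dots> = cnj (\<integral>\<zeta>. \<zeta> ^ (n - m) \<partial>dm)" by (rule Bochner_Integration.integral_cnj)
    finally show ?thesis using 3 by (simp add: integral_dm_power)
  qed
qed

lemma integrable_dm_power [simp]: "integrable dm (\<lambda>\<zeta>. \<zeta> ^ m)" "integrable dm (\<lambda>\<zeta>. cnj \<zeta> ^ m)"
  by (rule integrable_dm_bounded[where B=1]; (simp add: norm_power)?; measurable)+

lemma fourier_power: "fourier (\<lambda>\<zeta>. \<zeta> ^ m) n = (if m = n then 1 else 0)"
  by (simp add: fourier_def integral_dm_orthogonal)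

lemma fourier_cnj_power: "m > 0 \<Longrightarrow> fourier (\<lambda>\<zeta>. cnj \<zeta> ^ m) n = 0"
  using integral_dm_power[of "m + n"] Bochner_Integration.integral_cnj[where M=dm and f="\<lambda>\<zeta>. \<zeta> ^ (m + n)"]
    by (simp add: fourier_def power_add)

lemma poisson_ext_power:
  assumes z: "norm z < 1"
  shows "poisson_ext (\<lambda>\<zeta>. \<zeta> ^ m) z = z ^ m"
proof (cases m)
  case 0
  have "fourier (\<lambda>\<zeta>. 1) (Suc n) = 0" for n using fourier_power[of 0 "Suc n"] by simp
  hence "riesz_plus (\<lambda>\<zeta>. 1) z = 0" using riesz_plus_sums[of "\<lambda>_. 1" z] z by (simp add: sums_iff)
  thus ?thesis using 0 fourier_power[of 0 0] z by (subst poisson_ext_complex) auto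
next
  case (Suc k)
  have "(\<lambda>n. fourier (\<lambda>\<zeta>. \<zeta> ^ m) (Suc n) * z ^ Suc n) sums riesz_plus (\<lambda>\<zeta>. \<zeta> ^ m) z" by (rule riesz_plus_sums[OF _ z]) simp
  also have "(\<lambda>n. fourier (\<lambda>\<zeta>. \<zeta> ^ m) (Suc n) * z ^ Suc n) = (\<lambda>n. if n = k then z ^ Suc n else 0)"
    unfolding Suc by (auto simp: fourier_power simp del: power_Suc)
  finally have "(\<lambda>n. if n = k then z ^ Suc n else 0) sums riesz_plus (\<lambda>\<zeta>. \<zeta> ^ m) z" .
  moreover have "(\<lambda>n. if n = k then z ^ Suc n else 0) sums z ^ Suc k" by (rule sums_single)
  ultimately have 1: "riesz_plus (\<lambda>\<zeta>. \<zeta> ^ m) z = z ^ m" using Suc sums_unique2 by blast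
  have "(\<lambda>n. fourier (\<lambda>\<zeta>. cnj \<zeta> ^ m) (Suc n) * z ^ Suc n) sums riesz_plus (\<lambda>\<zeta>. cnj \<zeta> ^ m) z"
    by (rule riesz_plus_sums[OF _ z]) simp
  moreover have "fourier (\<lambda>\<zeta>. cnj \<zeta> ^ m) (Suc n) = 0" for n
    by (rule fourier_cnj_power) (simp add: Suc)
  ultimately have 2: "riesz_plus (\<lambda>\<zeta>. cnj \<zeta> ^ m) z = 0" by (simp add: sums_iff)
  have "fourier (\<lambda>\<zeta>. \<zeta> ^ m) 0 = 0" using fourier_power[of m 0] Suc by simp
  thus ?thesis using poisson_ext_complex[OF integrable_dm_power(1) z, of m] 1 2 by simp
qed

lemma poisson_ext_power_series:
  fixes f :: "complex \<Rightarrow> complex"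
  assumes a: "summable (\<lambda>n. norm (a n))" and f: "\<And>\<zeta>. norm \<zeta> \<le> 1 \<Longrightarrow> (\<lambda>n. a n * \<zeta> ^ n) sums f \<zeta>"
    and [measurable]: "f \<in> borel_measurable borel" and z: "norm z < 1"
  shows "poisson_ext f z = f z"
proof -
  have "(\<lambda>n. a n * (\<integral>\<zeta>. of_real (Poisson z \<zeta>) * \<zeta> ^ n \<partial>dm)) sums (\<integral>\<zeta>. of_real (Poisson z \<zeta>) * f \<zeta> \<partial>dm)"
  proof (rule sums_integral_circle[OF _ a])
    show "integrable dm (\<lambda>\<zeta>. complex_of_real (Poisson z \<zeta>))"
      using integrable_Poisson_mult[OF z, of "\<lambda>_. 1::real"] by simp
  qed (use f in \<open>auto simp: norm_power\<close>)
  hence "(\<lambda>n. a n * z ^ n) sums poisson_ext f z"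
    using poisson_ext_power[OF z] by (simp add: poisson_ext_def scaleR_conv_of_real)
  thus ?thesis using f[of z] z sums_unique2 by auto
qed

section \<open>From arcs to the Poisson form of the Muckenhoupt condition\<close>

text \<open>The conformally invariant form of the Muckenhoupt condition, Poisson averages in place
  of arc averages, restricted to weights that are positive almost everywhere.\<close>

definition poisson_A2 :: "(complex \<Rightarrow> real) \<Rightarrow> real \<Rightarrow> bool" where
  "poisson_A2 w Q \<longleftrightarrow> w \<in> borel_measurable borel \<and> (AE \<zeta> in dm. 0 < w \<zeta>) \<and>
     integrable dm w \<and> integrable dm (inv_weight w) \<and>
     (\<forall>z\<in>ball 0 1. poisson_ext w z * poisson_ext (inv_weight w) z \<le> Q)"

lemma inv_weight_inv_weight [simp]: "inv_weight (inv_weight w) = w"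
  by (simp add: inv_weight_def)

lemma inv_weight_measurable [measurable]: "w \<in> borel_measurable M \<Longrightarrow> inv_weight w \<in> borel_measurable M"
  unfolding inv_weight_def by measurable

text \<open>Rotates the window of angles that parametrises the circle, so that an arc can be placed
  in the middle of its window instead of across the cut.\<close>

lemma emeasure_dm_shift:
  assumes [measurable]: "A \<in> sets borel" and c: "0 \<le> c" "c \<le> 2 * pi"
  shows "emeasure dm A = emeasure lborel {t\<in>{c<..c + 2 * pi}. cis t \<in> A} / ennreal (2 * pi)"
proof -
  have [measurable]: "{t\<in>T. cis t \<in> A} \<in> sets lborel" if "T \<in> sets lborel" for T
    using that by measurable
  have "emeasure dm A = (\<integral>\<^sup>+\<zeta>. indicator A \<zeta> \<partial>dm)" by simp
  also have "\<dots> = (\<integral>\<^sup>+t\<in>{0..2*pi}. indicator A (cis t) \<partial>lborel) / ennreal (2*pi)"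
    by (rule nn_integral_dm) measurable
  also have "(\<integral>\<^sup>+t\<in>{0..2*pi}. indicator A (cis t) \<partial>lborel) = (\<integral>\<^sup>+t. indicator {t\<in>{0..2*pi}. cis t \<in> A} t \<partial>lborel)"
    by (intro nn_integral_cong) (auto simp: indicator_def)
  also have "\<dots> = emeasure lborel {t\<in>{0..2*pi}. cis t \<in> A}" by simp
  also have "\<dots> = emeasure lborel {t\<in>{0<..2*pi}. cis t \<in> A}"
  proof (rule emeasure_eq_AE)
    have "AE t in lborel. t \<noteq> (0::real)" by (rule AE_lborel_singleton)
    thus "AE t in lborel. t \<in> {t\<in>{0..2*pi}. cis t \<in> A} \<longleftrightarrow> t \<in> {t\<in>{0<..2*pi}. cis t \<in> A}"
      by eventually_elim auto
  qed auto
  also have "\<dots> = emeasure lborel ({t\<in>{0<..c}. cis t \<in> A} \<union> {t\<in>{c<..2*pi}. cis t \<in> A})"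
    using c by (intro arg_cong[where f="emeasure lborel"]) auto
  also have "\<dots> = emeasure lborel {t\<in>{0<..c}. cis t \<in> A} + emeasure lborel {t\<in>{c<..2*pi}. cis t \<in> A}"
    by (intro plus_emeasure[symmetric]) auto
  also have "emeasure lborel {t\<in>{0<..c}. cis t \<in> A} = emeasure (distr lborel borel ((+) (-2*pi))) {t\<in>{0<..c}. cis t \<in> A}"
    by (simp add: lborel_distr_plus)
  also have "\<dots> = emeasure lborel ((+) (-2*pi) -` {t\<in>{0<..c}. cis t \<in> A})"
    by (subst emeasure_distr) auto
  also have "(+) (-2*pi) -` {t\<in>{0<..c}. cis t \<in> A} = {t\<in>{2*pi<..c + 2*pi}. cis t \<in> A}"
  proof -
    have "cis (-2*pi + t) = cis t" for t by (simp add: cis.ctr complex_eq_iff cos_diff sin_diff)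
    thus ?thesis by auto
  qed
  also have "emeasure lborel {t\<in>{2*pi<..c + 2*pi}. cis t \<in> A} + emeasure lborel {t\<in>{c<..2*pi}. cis t \<in> A} =
     emeasure lborel ({t\<in>{2*pi<..c + 2*pi}. cis t \<in> A} \<union> {t\<in>{c<..2*pi}. cis t \<in> A})"
    by (intro plus_emeasure) auto
  also have "{t\<in>{2*pi<..c + 2*pi}. cis t \<in> A} \<union> {t\<in>{c<..2*pi}. cis t \<in> A} = {t\<in>{c<..c + 2 * pi}. cis t \<in> A}"
    using c by auto
  finally show ?thesis .
qed

lemma arc_borel [measurable]: "cis ` {a..b} \<in> sets borel"
  by (intro borel_compact compact_continuous_image continuous_intros) auto

lemma measure_dm_arc:
  assumes \<theta>: "pi \<le> \<theta>" "\<theta> \<le> 3 * pi" and a: "0 < a" "a \<le> pi"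
  shows "emeasure dm (cis ` {\<theta> - a..\<theta> + a}) = ennreal (a / pi)"
proof -
  have "emeasure dm (cis ` {\<theta> - a..\<theta> + a}) =
      emeasure lborel {t\<in>{\<theta> - pi<..\<theta> - pi + 2 * pi}. cis t \<in> cis ` {\<theta> - a..\<theta> + a}} / ennreal (2 * pi)"
    using \<theta> by (intro emeasure_dm_shift) auto
  also have "{t\<in>{\<theta> - pi<..\<theta> - pi + 2 * pi}. cis t \<in> cis ` {\<theta> - a..\<theta> + a}} = {\<theta> - a..\<theta> + a} \<inter> {\<theta> - pi<..}"
  proof (intro set_eqI iffI)
    fix t assume "t \<in> {t\<in>{\<theta> - pi<..\<theta> - pi + 2 * pi}. cis t \<in> cis ` {\<theta> - a..\<theta> + a}}"
    then obtain s where t: "\<theta> - pi < t" "t \<le> \<theta> + pi" and s: "\<theta> - a \<le> s" "s \<le> \<theta> + a" and e: "cis t = cis s" by auto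
    from e have "sin t = sin s \<and> cos t = cos s" by (simp add: complex_eq_iff)
    then obtain n :: int where n: "t = s + 2 * pi * n" unfolding sin_cos_eq_iff by blast
    \<comment> \<open>The half-open window excludes every winding number but 0, except that n = 1
      occurs when a = pi and t is the right end of the window. The left end lost by the half-open
      window is a null set.\<close>
    have "n \<ge> 2 \<or> n = 1 \<or> n = 0 \<or> n \<le> -1" by arith
    thus "t \<in> {\<theta> - a..\<theta> + a} \<inter> {\<theta> - pi<..}"
    proof (elim disjE)
      assume "n \<ge> 2"
      hence "2 * pi * n \<ge> 2 * pi * 2" by (intro mult_left_mono) auto
      thus ?thesis using n t s a pi_gt_zero by linarith
    next
      assume "n \<le> -1"
      hence "2 * pi * n \<le> 2 * pi * (-1)" by (intro mult_left_mono) auto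
      thus ?thesis using n t s a by auto
    next
      assume "n = 1"
      hence "t = s + 2 * pi" using n by simp
      thus ?thesis using t s a by auto
    qed (use n t s in auto)
  qed (use a in auto)
  also have "emeasure lborel \<dots> = emeasure lborel {\<theta> - a..\<theta> + a}"
  proof (rule emeasure_eq_AE)
    have "AE t in lborel. t \<noteq> \<theta> - pi" by (rule AE_lborel_singleton)
    thus "AE t in lborel. t \<in> {\<theta> - a..\<theta> + a} \<inter> {\<theta> - pi<..} \<longleftrightarrow> t \<in> {\<theta> - a..\<theta> + a}"
      by eventually_elim (use a in auto)
  qed auto
  also have "\<dots> / ennreal (2 * pi) = ennreal (2 * a / (2 * pi))"
    using a by (simp add: divide_ennreal)
  finally show ?thesis by simp
qed

lemma sin_ge_half:
  assumes "0 \<le> x" "x \<le> pi / 2"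
  shows "x / 2 \<le> sin x"
proof -
  define y where "y = x / 2"
  have y: "0 \<le> y" "y \<le> pi / 4" using assms by (auto simp: y_def)
  have "sin 0 - 0 * cos 0 \<le> sin y - y * cos y"
  proof (rule DERIV_nonneg_imp_nondecreasing[OF y(1), where f="\<lambda>y. sin y - y * cos y"])
    fix t assume t: "0 \<le> t" "t \<le> y"
    have "((\<lambda>y. sin y - y * cos y) has_real_derivative t * sin t) (at t)"
      by (auto intro!: derivative_eq_intros)
    moreover have "t * sin t \<ge> 0" using t y pi_gt_zero by (intro mult_nonneg_nonneg sin_ge_zero) auto
    ultimately show "\<exists>d. ((\<lambda>y. sin y - y * cos y) has_real_derivative d) (at t) \<and> 0 \<le> d" by blast
  qed
  hence s: "y * cos y \<le> sin y" by simp
  have c: "cos y \<ge> sqrt 2 / 2"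
    using cos_monotone_0_pi_le[of y "pi/4"] y pi_gt_zero by (simp add: cos_45)
  have "1 / 2 \<le> cos y * cos y"
    using mult_mono[OF c c] c by (simp add: field_simps)
  hence "2 * y * (1 / 2) \<le> 2 * y * (cos y * cos y)" using y by (intro mult_left_mono) auto
  hence "y \<le> 2 * (y * cos y) * cos y" by simp
  also have "\<dots> \<le> 2 * sin y * cos y" using s order_trans[OF _ c, of 0] by (intro mult_right_mono) auto
  also have "\<dots> = sin x" using sin_double[of y] by (simp add: y_def)
  finally show ?thesis by (simp add: y_def)
qed

text \<open>At angular distance about 2^-K from \<theta>, with \<open>1 - \<rho>\<close> about 2^-n,
  the kernel is of size 2^-n 4^K. The innermost arc of the list that contains \<zeta> thus accounts
  for the whole bound, and the other summands are nonnegative.\<close>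

lemma Poisson_dyadic_bound:
  assumes \<rho>: "0 \<le> \<rho>" "\<rho> < 1" and n: "1 - \<rho> \<le> (1/2) ^ n" "(1/2) ^ Suc n < 1 - \<rho>" and \<zeta>: "norm \<zeta> = 1"
  shows "Poisson (of_real \<rho> * cis \<theta>) \<zeta> \<le> 8 * (1/2) ^ n * (\<Sum>k\<le>n. 4 ^ k * indicator (cis ` {\<theta> - pi * (1/2) ^ k..\<theta> + pi
    * (1/2) ^ k}) \<zeta>)"
proof -
  define s where "s = Arg (\<zeta> * cis (- \<theta>))"
  have "norm (\<zeta> * cis (- \<theta>)) = 1" using \<zeta> by (simp add: norm_mult)
  hence "cis s = \<zeta> * cis (- \<theta>)" unfolding s_def by (subst cis_Arg) (auto simp: sgn_eq)
  hence "cis s * cis \<theta> = \<zeta>" by (simp add: mult.assoc cis_mult)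
  hence zs: "\<zeta> = cis (\<theta> + s)" by (simp add: cis_mult add.commute)
  have s: "\<bar>s\<bar> \<le> pi" using Arg_bounded[of "\<zeta> * cis (- \<theta>)"] by (auto simp: s_def)
  define I where "I = (\<lambda>k. cis ` {\<theta> - pi * (1/2) ^ k..\<theta> + pi * (1/2) ^ k})"
  have inI: "\<zeta> \<in> I k" if "\<bar>s\<bar> \<le> pi * (1/2) ^ k" for k
    unfolding I_def zs using that by (intro imageI) auto
  have cz: "cnj (of_real \<rho> * cis \<theta>) * \<zeta> = of_real \<rho> * cis s"
    unfolding zs by (simp add: cis_cnj mult.assoc cis_mult)
  have den: "(cmod (1 - cnj (of_real \<rho> * cis \<theta>) * \<zeta>))\<^sup>2 = (1 - \<rho>)\<^sup>2 + 4 * \<rho> * (sin (s / 2))\<^sup>2"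
  proof -
    have "(cmod (1 - of_real \<rho> * cis s))\<^sup>2 = (1 - \<rho> * cos s)\<^sup>2 + (\<rho> * sin s)\<^sup>2"
      unfolding cmod_power2 by simp
    also have "\<dots> = 1 - 2 * \<rho> * cos s + \<rho>\<^sup>2 * ((cos s)\<^sup>2 + (sin s)\<^sup>2)" by algebra
    also have "\<dots> = 1 - 2 * \<rho> * cos s + \<rho>\<^sup>2" by simp
    also have "cos s = 1 - 2 * (sin (s / 2))\<^sup>2" using cos_double_sin[of "s / 2"] by simp
    finally show ?thesis unfolding cz by (simp add: power2_eq_square algebra_simps)
  qed
  have P: "Poisson (of_real \<rho> * cis \<theta>) \<zeta> = (1 - \<rho>\<^sup>2) / ((1 - \<rho>)\<^sup>2 + 4 * \<rho> * (sin (s / 2))\<^sup>2)"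
    unfolding Poisson_def den using \<rho> by (simp add: norm_mult)
  \<comment> \<open>The index of the innermost arc containing \<zeta>, capped at n; beyond n the
    term \<open>(1 - \<rho>)^2\<close> of the denominator takes over.\<close>
  define K where "K = Max {k. k \<le> n \<and> \<bar>s\<bar> \<le> pi * (1/2) ^ k}"
  have fin: "finite {k. k \<le> n \<and> \<bar>s\<bar> \<le> pi * (1/2) ^ k}" by (rule finite_subset[of _ "{..n}"]) auto
  have "0 \<in> {k. k \<le> n \<and> \<bar>s\<bar> \<le> pi * (1/2) ^ k}" using s by simp
  hence "K \<in> {k. k \<le> n \<and> \<bar>s\<bar> \<le> pi * (1/2) ^ k}" unfolding K_def by (intro Max_in fin) blast
  hence K: "K \<le> n" "\<bar>s\<bar> \<le> pi * (1/2) ^ K" by auto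
  have Kmax: "\<not> \<bar>s\<bar> \<le> pi * (1/2) ^ Suc K" if "K < n"
    using Max_ge[OF fin, of "Suc K"] that unfolding K_def[symmetric] by auto
  have num: "1 - \<rho>\<^sup>2 \<le> 2 * (1 - \<rho>)"
  proof -
    have "(1 - \<rho>) * (1 + \<rho>) \<le> (1 - \<rho>) * 2" using \<rho> by (intro mult_left_mono) auto
    thus ?thesis by (simp add: power2_eq_square algebra_simps)
  qed
  have num0: "0 \<le> 1 - \<rho>\<^sup>2" using \<rho> by (simp add: power_le_one)
  have main: "Poisson (of_real \<rho> * cis \<theta>) \<zeta> \<le> 8 * (1/2) ^ n * 4 ^ K"
  proof (cases "K = n")
    case True
    have "Poisson (of_real \<rho> * cis \<theta>) \<zeta> \<le> (1 - \<rho>\<^sup>2) / (1 - \<rho>)\<^sup>2"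
      unfolding P using \<rho> num0 by (intro divide_left_mono mult_pos_pos) (auto intro: add_pos_nonneg)
    also have "\<dots> \<le> 2 * (1 - \<rho>) / (1 - \<rho>)\<^sup>2" by (intro divide_right_mono num) auto
    also have "\<dots> = 2 / (1 - \<rho>)" using \<rho> by (simp only: power2_eq_square) (intro nonzero_mult_divide_mult_cancel_right, simp)
    also have "\<dots> \<le> 2 / (1/2) ^ Suc n" using n \<rho> by (intro divide_left_mono) auto
    also have "\<dots> = 4 * 2 ^ n" by (simp add: power_one_over)
    also have "\<dots> \<le> 8 * ((1/2) ^ n * 4 ^ n)" by (simp flip: power_mult_distrib)
    finally show ?thesis using True by simp
  next
    case False
    with K have Kn: "K < n" by simp
    have "(1/2::real) ^ n \<le> (1/2) ^ 1" using Kn by (intro power_decreasing) auto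
    hence r2: "\<rho> \<ge> 1/2" using n by simp
    have "\<bar>s\<bar> / 4 \<le> sin (\<bar>s\<bar> / 2)" using sin_ge_half[of "\<bar>s\<bar> / 2"] s by simp
    hence "(\<bar>s\<bar> / 4)\<^sup>2 \<le> (sin (\<bar>s\<bar> / 2))\<^sup>2" by (intro power_mono) auto
    also have "(sin (\<bar>s\<bar> / 2))\<^sup>2 = (sin (s / 2))\<^sup>2" by (cases "s \<ge> 0") auto
    finally have 1: "(\<bar>s\<bar> / 4)\<^sup>2 \<le> (sin (s / 2))\<^sup>2" .
    \<comment> \<open>The constants just suffice: with \<open>pi > 3\<close> and
      \<open>\<rho> \<ge> 1/2\<close>, four \<rho> times 9/16 is at least 9/8, so the denominator is
      at least \<open>(1/4) ^ Suc K\<close>.\<close>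
    have "3 * (1/2) ^ Suc K \<le> pi * (1/2) ^ Suc K" using pi_gt3 by (intro mult_right_mono) auto
    hence "3 * (1/2) ^ Suc K / 4 \<le> \<bar>s\<bar> / 4" using Kmax[OF Kn] by linarith
    hence "(3 * (1/2) ^ Suc K / 4)\<^sup>2 \<le> (\<bar>s\<bar> / 4)\<^sup>2" by (intro power_mono) auto
    hence 2: "9 / 16 * (1/4) ^ Suc K \<le> (sin (s / 2))\<^sup>2"
      using 1 by (simp add: power_mult_distrib power_divide power_mult[symmetric] mult.commute power2_eq_square flip:
        power_mult_distrib)
    have "(1/4) ^ Suc K \<le> 2 * (9 / 16 * (1/4) ^ Suc K :: real)" by simp
    also have "\<dots> \<le> 2 * (sin (s / 2))\<^sup>2" using 2 by simp
    also have "\<dots> \<le> 4 * \<rho> * (sin (s / 2))\<^sup>2" using r2 by (intro mult_right_mono) auto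
    also have "\<dots> \<le> (1 - \<rho>)\<^sup>2 + 4 * \<rho> * (sin (s / 2))\<^sup>2" by simp
    finally have 3: "(1/4) ^ Suc K \<le> (1 - \<rho>)\<^sup>2 + 4 * \<rho> * (sin (s / 2))\<^sup>2" .
    have "Poisson (of_real \<rho> * cis \<theta>) \<zeta> \<le> (1 - \<rho>\<^sup>2) / (1/4) ^ Suc K"
      unfolding P using num0 by (intro divide_left_mono 3 mult_pos_pos less_le_trans[OF _ 3]) auto
    also have "\<dots> \<le> 2 * (1 - \<rho>) / (1/4) ^ Suc K" by (intro divide_right_mono num) auto
    also have "\<dots> \<le> 2 * (1/2) ^ n / (1/4) ^ Suc K" using n by (intro divide_right_mono) auto
    also have "\<dots> = 8 * (1/2) ^ n * 4 ^ K" by (simp add: power_one_over)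
    finally show ?thesis .
  qed
  also have "8 * (1/2) ^ n * 4 ^ K = 8 * (1/2) ^ n * (4 ^ K * indicator (I K) \<zeta> :: real)" using inI[OF K(2)] by simp
  also have "\<dots> \<le> 8 * (1/2) ^ n * (\<Sum>k\<le>n. 4 ^ k * indicator (I k) \<zeta>)"
    using K(1) by (intro mult_left_mono member_le_sum) auto
  finally show ?thesis unfolding I_def .
qed

lemma set_Cauchy_Schwarz:
  assumes w: "integrable dm w" "integrable dm (inv_weight w)" "AE \<zeta> in dm. 0 < w \<zeta>" and E: "E \<in> sets borel"
  shows "(measure dm E)\<^sup>2 \<le> (\<integral>\<zeta>. indicator E \<zeta> * w \<zeta> \<partial>dm) * (\<integral>\<zeta>. indicator E \<zeta> * inv_weight w \<zeta> \<partial>dm)"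
proof -
  define W V m where "W = (\<integral>\<zeta>. indicator E \<zeta> * w \<zeta> \<partial>dm)" and "V = (\<integral>\<zeta>. indicator E \<zeta> * inv_weight w \<zeta> \<partial>dm)" and "m = measure dm E"
  have i: "integrable dm (\<lambda>\<zeta>. indicator E \<zeta> * w \<zeta>)" "integrable dm (\<lambda>\<zeta>. indicator E \<zeta> * inv_weight w \<zeta>)"
    "integrable dm (\<lambda>\<zeta>. indicator E \<zeta> :: real)"
    using integrable_real_mult_indicator[OF _ w(1), of E] integrable_real_mult_indicator[OF _ w(2), of E] E
    by (auto simp: mult.commute intro: integrable_dm_bounded[where B=1])
  have q: "0 \<le> c\<^sup>2 * W - 2 * c * m + V" for c
  proof -
    have "0 \<le> (\<integral>\<zeta>. c\<^sup>2 * (indicator E \<zeta> * w \<zeta>) - 2 * c * indicator E \<zeta> + indicator E \<zeta> * inv_weight w \<zeta> \<partial>dm)"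
    proof (rule integral_nonneg_AE)
      show "AE \<zeta> in dm. 0 \<le> c\<^sup>2 * (indicator E \<zeta> * w \<zeta>) - 2 * c * indicator E \<zeta> + indicator E \<zeta> * inv_weight w \<zeta>"
        using w(3)
      proof eventually_elim
        case (elim \<zeta>)
        have "0 \<le> (c * w \<zeta> - 1)\<^sup>2 / w \<zeta>" using elim by simp
        also have "\<dots> = c\<^sup>2 * w \<zeta> - 2 * c + inv_weight w \<zeta>"
          using elim by (simp add: power2_diff power_mult_distrib inv_weight_def field_simps) (simp add: power2_eq_square
            algebra_simps)
        finally show ?case by (cases "\<zeta> \<in> E") auto
      qed
    qed
    also have "\<dots> = c\<^sup>2 * W - 2 * c * m + V" using i E by (simp add: W_def V_def m_def)
    finally show ?thesis .
  qed
  have "m\<^sup>2 \<le> W * V"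
  proof (cases "W = 0")
    case True
    have "m = 0"
    proof (rule ccontr)
      assume "m \<noteq> 0"
      \<comment> \<open>For W = 0 the quadratic is linear in c, and this c gives it the value
        -1.\<close>
      thus False using q[of "(V + 1) / (2 * m)"] True by simp
    qed
    thus ?thesis using True by simp
  next
    case False
    have "W \<ge> 0" unfolding W_def using w(3) by (intro integral_nonneg_AE) (auto elim!: eventually_mono simp: indicator_def)
    thus ?thesis using q[of "m / W"] False by (simp add: field_simps power2_eq_square)
  qed
  thus ?thesis by (simp add: W_def V_def m_def)
qed

text \<open>Think of \<open>W k\<close>, \<open>V k\<close> as the masses of a weight and its
  reciprocal on nested arcs of measure 2^-k. The A2 bound gives
  \<open>4^k W k \<le> A / V k\<close>, which by itself does not sum to a bound free of n.
  Cauchy-Schwarz on the ring between consecutive arcs shows that the ring carries a fixed fraction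
  \<open>1 / (4A)\<close> of \<open>V k\<close>; so \<open>V\<close> decays geometrically, the last
  term dominates, and the series contributes \<open>1 / (1 - \<tau>) = 4A\<close>.\<close>

lemma dyadic_decay_sum:
  fixes W V :: "nat \<Rightarrow> real"
  assumes A: "A \<ge> 1" and pos: "\<And>k. W k > 0" "\<And>k. V k > 0"
    and WV: "\<And>k. W k * V k \<le> A * (1/4) ^ k"
    and CS: "\<And>k. ((1/2) ^ Suc k)\<^sup>2 \<le> (W k - W (Suc k)) * (V k - V (Suc k))"
    and mono: "\<And>k. W (Suc k) \<le> W k" "\<And>k. V (Suc k) \<le> V k"
  shows "(\<Sum>k\<le>n. 4 ^ k * W k) \<le> 4 * A\<^sup>2 / V n"
proof -
  define \<tau> where "\<tau> = 1 - 1 / (4 * A)"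
  have \<tau>: "0 < \<tau>" "\<tau> < 1" using A by (auto simp: \<tau>_def field_simps)
  have step: "V (Suc k) \<le> \<tau> * V k" for k
  proof -
    have "(1/4) ^ Suc k \<le> (W k - W (Suc k)) * (V k - V (Suc k))"
      using CS[of k] by (simp add: power_mult[symmetric] power2_eq_square flip: power_mult_distrib)
    also have "\<dots> \<le> W k * (V k - V (Suc k))" using pos[of "Suc k"] mono[of k] by (intro mult_right_mono) auto
    finally have "(1/4) ^ Suc k * V k \<le> (W k * (V k - V (Suc k))) * V k" using pos(2)[of k] by (intro mult_right_mono) auto
    also have "\<dots> = (W k * V k) * (V k - V (Suc k))" by simp
    also have "\<dots> \<le> A * (1/4) ^ k * (V k - V (Suc k))" using WV[of k] mono[of k] by (intro mult_right_mono) auto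
    finally have "(1/4) ^ k * (V k / 4) \<le> (1/4) ^ k * (A * (V k - V (Suc k)))" by simp
    hence "V k / 4 \<le> A * (V k - V (Suc k))" by (subst (asm) mult_le_cancel_left_pos) auto
    thus ?thesis using A by (simp add: \<tau>_def field_simps)
  qed
  have dec: "V (k + j) \<le> \<tau> ^ j * V k" for k j
  proof (induction j)
    case (Suc j)
    have "V (k + Suc j) \<le> \<tau> * V (k + j)" using step[of "k + j"] by simp
    also have "\<dots> \<le> \<tau> * (\<tau> ^ j * V k)" using Suc \<tau> by (intro mult_left_mono) auto
    finally show ?case by simp
  qed simp
  have "4 ^ k * W k \<le> A / V n * \<tau> ^ (n - k)" if "k \<le> n" for k
  proof -
    have "W k * V n \<le> W k * (\<tau> ^ (n - k) * V k)" using dec[of k "n - k"] that pos(1)[of k] by (intro mult_left_mono) auto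
    also have "\<dots> = (W k * V k) * \<tau> ^ (n - k)" by simp
    also have "\<dots> \<le> A * (1/4) ^ k * \<tau> ^ (n - k)" using WV[of k] \<tau> by (intro mult_right_mono) auto
    finally have "4 ^ k * (W k * V n) \<le> 4 ^ k * (A * (1/4) ^ k * \<tau> ^ (n - k))" by (intro mult_left_mono) auto
    also have "\<dots> = A * \<tau> ^ (n - k)" by (simp add: power_one_over)
    finally show ?thesis using pos(2)[of n] by (simp add: field_simps)
  qed
  hence "(\<Sum>k\<le>n. 4 ^ k * W k) \<le> (\<Sum>k\<le>n. A / V n * \<tau> ^ (n - k))" by (intro sum_mono) auto
  also have "\<dots> = A / V n * (\<Sum>k\<le>n. \<tau> ^ (n - k))" by (simp add: sum_distrib_left)
  also have "(\<Sum>k\<le>n. \<tau> ^ (n - k)) = (\<Sum>k\<le>n. \<tau> ^ k)"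
    by (rule sum.nat_diff_reindex[of "\<lambda>k. \<tau> ^ k" "Suc n", simplified lessThan_Suc_atMost, symmetric, THEN sym, THEN
      trans[rotated]])
       (rule sum.cong, auto)
  also have "A / V n * (\<Sum>k\<le>n. \<tau> ^ k) \<le> A / V n * (1 / (1 - \<tau>))"
  proof (rule mult_left_mono)
    have "(\<Sum>k<Suc n. \<tau> ^ k) \<le> (\<Sum>k. \<tau> ^ k)" using \<tau> by (intro sum_le_suminf) (auto intro: summable_geometric)
    thus "(\<Sum>k\<le>n. \<tau> ^ k) \<le> 1 / (1 - \<tau>)" using \<tau> by (simp add: suminf_geometric lessThan_Suc_atMost)
    show "0 \<le> A / V n" using A pos(2)[of n] by simp
  qed
  also have "1 / (1 - \<tau>) = 4 * A" using A by (simp add: \<tau>_def)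
  finally show ?thesis by (simp add: power2_eq_square mult_ac)
qed

text \<open>Since \<open>0 * \<infinity> = 0\<close> in the extended reals, weights that vanish almost everywhere satisfy \<open>A2\<close>.\<close>

lemma A2_dichotomy:
  assumes "A2 w"
  shows "(AE \<zeta> in dm. w \<zeta> = 0) \<or> (\<exists>Q. poisson_A2 w Q)"
proof (cases "AE \<zeta> in dm. w \<zeta> = 0")
  case False
  from assms have [measurable]: "w \<in> borel_measurable borel" and w0: "\<And>\<zeta>. norm \<zeta> = 1 \<Longrightarrow> 0 \<le> w \<zeta>"
    by (auto simp: A2_def)
  from assms obtain C where C: "\<And>I. I \<in> arcs \<Longrightarrow> (\<integral>\<^sup>+\<zeta>\<in>I. ennreal (w \<zeta>) \<partial>dm) * (\<integral>\<^sup>+\<zeta>\<in>I. inverse (ennreal (w \<zeta>)) \<partial>dm)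
          \<le> ennreal C * (emeasure dm I)\<^sup>2" by (auto simp: A2_def)
  define A where "A = max C 1"
  have A: "A \<ge> 1" "C \<le> A" by (auto simp: A_def)
  \<comment> \<open>The whole circle is itself an admissible arc, since arcs may have angular length
    exactly 2 pi. Testing on it gives integrability of the weight and its reciprocal.\<close>
  have full: "indicator (cis ` {2 * pi - pi..2 * pi + pi}) \<zeta> = (1::ennreal)" if "norm \<zeta> = 1" for \<zeta>
  proof -
    have "cis (2 * pi + Arg \<zeta>) = cis (Arg \<zeta>)" by (simp add: complex_eq_iff cos_add sin_add)
    also have "\<dots> = \<zeta>" using that by (subst cis_Arg) (auto simp: sgn_eq)
    finally have "\<zeta> = cis (2 * pi + Arg \<zeta>)" by simp
    thus ?thesis using Arg_bounded[of \<zeta>] by (auto simp: indicator_def)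
  qed
  have S: "(\<integral>\<^sup>+\<zeta>\<in>cis ` {2 * pi - pi..2 * pi + pi}. f \<zeta> \<partial>dm) = (\<integral>\<^sup>+\<zeta>. f \<zeta> \<partial>dm)" for f
    by (rule nn_integral_cong_AE) (use AE_dm_circle full in \<open>auto elim: eventually_mono\<close>)
  have "cis ` {2 * pi - pi..2 * pi + pi} \<in> arcs" unfolding arcs_def using pi_gt_zero by force
  from C[OF this] have "(\<integral>\<^sup>+\<zeta>. ennreal (w \<zeta>) \<partial>dm) * (\<integral>\<^sup>+\<zeta>. inverse (ennreal (w \<zeta>)) \<partial>dm)
    \<le> ennreal C * (emeasure dm (cis ` {2 * pi - pi..2 * pi + pi}))\<^sup>2"
    unfolding S .
  also have "\<dots> < \<infinity>" using dm.emeasure_finite by (auto simp: ennreal_mult_eq_top_iff power2_eq_square less_top[symmetric])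
  finally have fin: "(\<integral>\<^sup>+\<zeta>. ennreal (w \<zeta>) \<partial>dm) * (\<integral>\<^sup>+\<zeta>. inverse (ennreal (w \<zeta>)) \<partial>dm) < \<infinity>" .
  have nz1: "(\<integral>\<^sup>+\<zeta>. ennreal (w \<zeta>) \<partial>dm) \<noteq> 0"
  proof
    assume "(\<integral>\<^sup>+\<zeta>. ennreal (w \<zeta>) \<partial>dm) = 0"
    hence "AE \<zeta> in dm. ennreal (w \<zeta>) = 0" by (subst (asm) nn_integral_0_iff_AE) auto
    hence "AE \<zeta> in dm. w \<zeta> = 0" using AE_dm_circle
      by eventually_elim (use w0 in \<open>fastforce simp: ennreal_eq_0_iff\<close>)
    with False show False by contradiction
  qed
  have nz2: "(\<integral>\<^sup>+\<zeta>. inverse (ennreal (w \<zeta>)) \<partial>dm) \<noteq> 0"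
  proof
    assume "(\<integral>\<^sup>+\<zeta>. inverse (ennreal (w \<zeta>)) \<partial>dm) = 0"
    hence "AE \<zeta> in dm. inverse (ennreal (w \<zeta>)) = 0" by (subst (asm) nn_integral_0_iff_AE) auto
    hence "AE \<zeta> in dm. False" by (auto elim: eventually_mono)
    thus False using emeasure_dm_UNIV by (simp add: AE_iff_measurable[OF _ refl])
  qed
  \<comment> \<open>A finite product bounds both factors only when both are nonzero; this is the
    point at which the zero weight had to be set aside.\<close>
  have fin1: "(\<integral>\<^sup>+\<zeta>. ennreal (w \<zeta>) \<partial>dm) < \<infinity>" and fin2: "(\<integral>\<^sup>+\<zeta>. inverse (ennreal (w \<zeta>)) \<partial>dm) < \<infinity>"
    using fin nz1 nz2 by (auto simp: ennreal_mult_less_top)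
  have "AE \<zeta> in dm. inverse (ennreal (w \<zeta>)) \<noteq> \<infinity>"
    using fin2 by (intro nn_integral_PInf_AE) auto
  hence pos: "AE \<zeta> in dm. 0 < w \<zeta>"
    using AE_dm_circle by eventually_elim (use w0 in \<open>force simp: less_le ennreal_inverse_eq_top_iff\<close>)
  have inv: "AE \<zeta> in dm. inverse (ennreal (w \<zeta>)) = ennreal (inv_weight w \<zeta>)"
    using pos by eventually_elim (auto simp: inv_weight_def inverse_ennreal)
  have int_w: "integrable dm w"
    using fin1 pos by (intro integrableI_nonneg) (auto elim: eventually_mono)
  have int_v: "integrable dm (inv_weight w)"
  proof (intro integrableI_nonneg)
    show "AE \<zeta> in dm. 0 \<le> inv_weight w \<zeta>" using pos by eventually_elim (simp add: inv_weight_def)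
    have "(\<integral>\<^sup>+\<zeta>. ennreal (inv_weight w \<zeta>) \<partial>dm) = (\<integral>\<^sup>+\<zeta>. inverse (ennreal (w \<zeta>)) \<partial>dm)"
      using inv by (intro nn_integral_cong_AE) (auto elim: eventually_mono)
    thus "(\<integral>\<^sup>+\<zeta>. ennreal (inv_weight w \<zeta>) \<partial>dm) < \<infinity>" using fin2 by simp
  qed measurable
  define M where "M = (\<lambda>f E. \<integral>\<zeta>. indicator E \<zeta> * f \<zeta> \<partial>dm :: real)"
  have iM: "integrable dm (\<lambda>\<zeta>. indicator E \<zeta> * f \<zeta>)" if "integrable dm f" "E \<in> sets borel" for f :: "complex \<Rightarrow> real" and E
    using that by (auto intro!: integrable_real_mult_indicator simp: mult.commute)
  have nnM: "(\<integral>\<^sup>+\<zeta>\<in>E. ennreal (f \<zeta>) \<partial>dm) = ennreal (M f E)" if "integrable dm f" "E \<in> sets borel" "AE \<zeta> in dm. 0 < f \<zeta>" for f E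
  proof -
    have "(\<integral>\<^sup>+\<zeta>\<in>E. ennreal (f \<zeta>) \<partial>dm) = (\<integral>\<^sup>+\<zeta>. ennreal (indicator E \<zeta> * f \<zeta>) \<partial>dm)"
      by (intro nn_integral_cong) (auto simp: indicator_def)
    also have "\<dots> = ennreal (M f E)" unfolding M_def
      using that by (intro nn_integral_eq_integral iM) (auto elim!: eventually_mono simp: indicator_def)
    finally show ?thesis .
  qed
  have posv: "AE \<zeta> in dm. 0 < inv_weight w \<zeta>" using pos by eventually_elim (simp add: inv_weight_def)
  have M0: "0 \<le> M f E" if "AE \<zeta> in dm. 0 < f \<zeta>" for f E
    unfolding M_def using that by (intro integral_nonneg_AE) (auto elim!: eventually_mono simp: indicator_def)
  define v where "v = inv_weight w"
  have arcWV: "M w (cis ` {\<theta> - a..\<theta> + a}) * M v (cis ` {\<theta> - a..\<theta> + a}) \<le> A * (a / pi)\<^sup>2"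
    if "pi \<le> \<theta>" "\<theta> \<le> 3 * pi" "0 < a" "a \<le> pi" for \<theta> a
  proof -
    let ?I = "cis ` {\<theta> - a..\<theta> + a}"
    have "?I \<in> arcs" unfolding arcs_def using that by force
    note C[OF this]
    also have "(\<integral>\<^sup>+\<zeta>\<in>?I. inverse (ennreal (w \<zeta>)) \<partial>dm) = (\<integral>\<^sup>+\<zeta>\<in>?I. ennreal (v \<zeta>) \<partial>dm)"
      using inv by (intro nn_integral_cong_AE) (auto elim: eventually_mono simp: v_def)
    also have "\<dots> = ennreal (M v ?I)" unfolding v_def by (rule nnM[OF int_v arc_borel posv])
    also have "(\<integral>\<^sup>+\<zeta>\<in>?I. ennreal (w \<zeta>) \<partial>dm) = ennreal (M w ?I)" by (rule nnM[OF int_w arc_borel pos])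
    also have "emeasure dm ?I = ennreal (a / pi)" by (rule measure_dm_arc[OF that])
    also have "ennreal C * (ennreal (a / pi))\<^sup>2 \<le> ennreal A * (ennreal (a / pi))\<^sup>2"
      using A by (intro mult_right_mono ennreal_leI) auto
    also have "\<dots> = ennreal (A * (a / pi)\<^sup>2)" using that A by (simp add: ennreal_mult ennreal_power)
    also have "ennreal (M w ?I) * ennreal (M v ?I) = ennreal (M w ?I * M v ?I)"
      by (rule ennreal_mult[symmetric]) (auto intro: M0 pos posv simp: v_def)
    finally show ?thesis using A by (subst (asm) ennreal_le_iff) auto
  qed
  have bound: "poisson_ext w z * poisson_ext v z \<le> (32 * A\<^sup>2)\<^sup>2" if z: "z \<in> ball 0 1" for z
  proof -
    \<comment> \<open>The argument is moved into [pi, 3 pi], as \<open>measure_dm_arc\<close>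
      requires.\<close>
    define \<rho> \<theta> where "\<rho> = norm z" and "\<theta> = Arg z + 2 * pi"
    have \<rho>: "0 \<le> \<rho>" "\<rho> < 1" using z by (auto simp: \<rho>_def)
    have \<theta>: "pi \<le> \<theta>" "\<theta> \<le> 3 * pi" using Arg_bounded[of z] by (auto simp: \<theta>_def)
    have "cis \<theta> = cis (Arg z)" by (simp add: \<theta>_def complex_eq_iff cos_add sin_add)
    hence zz: "z = of_real \<rho> * cis \<theta>"
      using rcis_cmod_Arg[of z] by (simp add: rcis_def \<rho>_def)
    have "\<exists>n. (1/2) ^ Suc n < 1 - \<rho>"
    proof -
      obtain n where "(1/2::real) ^ n < 1 - \<rho>" using real_arch_pow_inv[of "1 - \<rho>" "1/2"] \<rho> by auto
      hence "(1/2) ^ Suc n < 1 - \<rho>" by (rule le_less_trans[rotated]) simp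
      thus ?thesis by blast
    qed
    \<comment> \<open>The dyadic scale of z, characterised by
      \<open>(1/2)^(n+1) < 1 - \<rho> \<le> (1/2)^n\<close>.\<close>
    define n where "n = (LEAST n. (1/2) ^ Suc n < 1 - \<rho>)"
    have n2: "(1/2) ^ Suc n < 1 - \<rho>" unfolding n_def by (rule LeastI_ex) fact
    have n1: "1 - \<rho> \<le> (1/2) ^ n"
    proof (cases n)
      case 0 thus ?thesis using \<rho> by simp
    next
      case (Suc k)
      hence "\<not> (1/2) ^ Suc k < 1 - \<rho>" unfolding n_def by (intro not_less_Least) simp
      thus ?thesis using Suc by simp
    qed
    define I where "I = (\<lambda>k. cis ` {\<theta> - pi * (1/2) ^ k..\<theta> + pi * (1/2) ^ k})"
    have I_borel [measurable]: "I k \<in> sets borel" for k unfolding I_def by (rule arc_borel)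
    have ak: "0 < pi * (1/2) ^ k" "pi * (1/2) ^ k \<le> pi" for k
      using power_le_one[of "1/2::real" k] by (auto simp: mult_left_le)
    have mI: "measure dm (I k) = (1/2) ^ k" for k
      using measure_dm_arc[OF \<theta> ak[of k]] by (simp add: measure_def I_def)
    have sub: "I (Suc k) \<subseteq> I k" for k
      unfolding I_def by (intro image_mono) (auto simp: field_simps)
    have Mdiff: "M f (I k - I (Suc k)) = M f (I k) - M f (I (Suc k))" if "integrable dm f" for f k
    proof -
      have "M f (I k) - M f (I (Suc k)) = (\<integral>\<zeta>. indicator (I k) \<zeta> * f \<zeta> - indicator (I (Suc k)) \<zeta> * f \<zeta> \<partial>dm)"
        unfolding M_def by (rule Bochner_Integration.integral_diff[symmetric]) (intro iM that I_borel)+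
      also have "\<dots> = M f (I k - I (Suc k))"
        unfolding M_def using sub[of k] by (intro Bochner_Integration.integral_cong) (auto simp: indicator_def)
      finally show ?thesis by simp
    qed
    have CS: "((1/2) ^ Suc k)\<^sup>2 \<le> (M w (I k) - M w (I (Suc k))) * (M v (I k) - M v (I (Suc k)))" for k
    proof -
      have "measure dm (I k - I (Suc k)) = measure dm (I k) - measure dm (I (Suc k))"
        using sub by (intro dm.finite_measure_Diff) auto
      also have "\<dots> = (1/2) ^ Suc k" by (simp add: mI)
      finally have e: "measure dm (I k - I (Suc k)) = (1/2) ^ Suc k" .
      have "((1/2) ^ Suc k)\<^sup>2 \<le> M w (I k - I (Suc k)) * M v (I k - I (Suc k))"
        using set_Cauchy_Schwarz[OF int_w int_v pos, of "I k - I (Suc k)", unfolded e] I_borel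
          by (simp only: M_def v_def sets.Diff)
      thus ?thesis using int_w int_v by (simp add: Mdiff v_def)
    qed
    have CS1: "((1/2) ^ k)\<^sup>2 \<le> M w (I k) * M v (I k)" for k
      using set_Cauchy_Schwarz[OF int_w int_v pos I_borel[of k]] by (simp add: M_def v_def mI)
    have Mw0: "0 \<le> M w E" "0 \<le> M v E" for E using M0 pos posv by (auto simp: v_def)
    have Mpos: "0 < M w (I k)" "0 < M v (I k)" for k
    proof -
      have "0 < M w (I k) * M v (I k)" by (rule less_le_trans[OF _ CS1]) simp
      thus "0 < M w (I k)" "0 < M v (I k)" using Mw0[of "I k"] by (auto simp: zero_less_mult_iff)
    qed
    have mono: "M w (I (Suc k)) \<le> M w (I k)" "M v (I (Suc k)) \<le> M v (I k)" for k
      using Mdiff[of w k] Mdiff[of v k] Mw0[of "I k - I (Suc k)"] int_w int_v by (auto simp: v_def)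
    have WV: "M w (I k) * M v (I k) \<le> A * (1/4) ^ k" for k
      using arcWV[OF \<theta> ak[of k]] by (simp add: I_def power_mult[symmetric] power_mult_distrib mult.commute power2_eq_square flip:
        power_mult_distrib)
    have P: "poisson_ext f z \<le> 8 * (1/2) ^ n * (\<Sum>k\<le>n. 4 ^ k * M f (I k))" if f: "integrable dm f" "AE \<zeta> in dm. 0 < f \<zeta>" for f
    proof -
      have "poisson_ext f z \<le> (\<integral>\<zeta>. 8 * (1/2) ^ n * (\<Sum>k\<le>n. 4 ^ k * (indicator (I k) \<zeta> * f \<zeta>)) \<partial>dm)"
        unfolding poisson_ext_def
      proof (rule integral_mono_AE)
        show "integrable dm (\<lambda>\<zeta>. Poisson z \<zeta> *\<^sub>R f \<zeta>)" using z by (intro integrable_Poisson_mult f) auto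
        show "integrable dm (\<lambda>\<zeta>. 8 * (1/2) ^ n * (\<Sum>k\<le>n. 4 ^ k * (indicator (I k) \<zeta> * f \<zeta>)))"
          by (intro integrable_mult_right Bochner_Integration.integrable_sum iM f I_borel)
        show "AE \<zeta> in dm. Poisson z \<zeta> *\<^sub>R f \<zeta> \<le> 8 * (1/2) ^ n * (\<Sum>k\<le>n. 4 ^ k * (indicator (I k) \<zeta> * f \<zeta>))"
          using AE_dm_circle f(2)
        proof eventually_elim
          case (elim \<zeta>)
          have "Poisson z \<zeta> * f \<zeta> \<le> (8 * (1/2) ^ n * (\<Sum>k\<le>n. 4 ^ k * indicator (I k) \<zeta>)) * f \<zeta>"
            unfolding zz I_def by (intro mult_right_mono Poisson_dyadic_bound \<rho> n1 n2 elim(1)) (use elim in auto)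
          also have "\<dots> = 8 * (1/2) ^ n * (\<Sum>k\<le>n. 4 ^ k * (indicator (I k) \<zeta> * f \<zeta>))"
            by (simp only: sum_distrib_right mult.assoc)
          finally show ?case by simp
        qed
      qed
      also have "\<dots> = 8 * (1/2) ^ n * (\<Sum>k\<le>n. 4 ^ k * M f (I k))"
        unfolding M_def using iM[OF f(1) I_borel] by (simp add: Bochner_Integration.integral_sum)
      finally show ?thesis .
    qed
    have "(\<Sum>k\<le>n. 4 ^ k * M w (I k)) \<le> 4 * A\<^sup>2 / M v (I n)"
      by (rule dyadic_decay_sum[where W="\<lambda>k. M w (I k)" and V="\<lambda>k. M v (I k)", OF A(1) Mpos WV CS mono])
    hence "8 * (1/2) ^ n * (\<Sum>k\<le>n. 4 ^ k * M w (I k)) \<le> 8 * (1/2) ^ n * (4 * A\<^sup>2 / M v (I n))"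
      by (intro mult_left_mono) auto
    with P[OF int_w pos] have 1: "poisson_ext w z \<le> 32 * A\<^sup>2 * (1/2) ^ n / M v (I n)" by (simp add: mult_ac)
    have "(\<Sum>k\<le>n. 4 ^ k * M v (I k)) \<le> 4 * A\<^sup>2 / M w (I n)"
      by (rule dyadic_decay_sum[where W="\<lambda>k. M v (I k)"
        and V="\<lambda>k. M w (I k)", OF A(1) Mpos(2,1) _ _ mono(2,1)]) (use WV CS in \<open>simp_all add: mult.commute\<close>)
    hence "8 * (1/2) ^ n * (\<Sum>k\<le>n. 4 ^ k * M v (I k)) \<le> 8 * (1/2) ^ n * (4 * A\<^sup>2 / M w (I n))"
      by (intro mult_left_mono) auto
    with P[OF int_v posv] have 2: "poisson_ext v z \<le> 32 * A\<^sup>2 * (1/2) ^ n / M w (I n)" by (simp add: v_def mult_ac)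
    have nn: "0 \<le> poisson_ext v z" using poisson_ext_pos[OF int_v posv, of z] z by (simp add: v_def)
    \<comment> \<open>The extension of each weight was bounded by the reciprocal mass of the other
      on the smallest arc. In the product these masses are cancelled by Cauchy-Schwarz on that arc,
      so n disappears.\<close>
    have "poisson_ext w z * poisson_ext v z \<le> (32 * A\<^sup>2 * (1/2) ^ n / M v (I n)) * (32 * A\<^sup>2 * (1/2) ^ n / M w (I n))"
      using Mpos[of n] A by (intro mult_mono 1 2 nn) auto
    also have "\<dots> = (32 * A\<^sup>2)\<^sup>2 * (((1/2) ^ n)\<^sup>2 / (M w (I n) * M v (I n)))"
      by (simp add: power2_eq_square field_simps)
    also have "\<dots> \<le> (32 * A\<^sup>2)\<^sup>2 * 1"
      using CS1[of n] Mpos[of n] by (intro mult_left_mono) (auto simp: divide_le_eq_1)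
    finally show ?thesis by simp
  qed
  have "poisson_A2 w ((32 * A\<^sup>2)\<^sup>2)"
    unfolding poisson_A2_def using pos int_w int_v bound by (auto simp: v_def)
  thus ?thesis by blast
qed simp

lemma poisson_A2_inv:
  assumes "poisson_A2 w Q" shows "poisson_A2 (inv_weight w) Q"
proof -
  have "AE \<zeta> in dm. 0 < inv_weight w \<zeta>"
    using assms unfolding poisson_A2_def by (auto simp: inv_weight_def elim: eventually_mono)
  thus ?thesis using assms unfolding poisson_A2_def by (auto simp: mult.commute)
qed

text \<open>The lower bound 1 for the product of the extensions is Cauchy-Schwarz applied to the
  constant function 1.\<close>

lemma poisson_A2_harmonic_pair:
  assumes "poisson_A2 w Q"
  obtains \<omega> \<eta> where "harmonic_pair (poisson_ext w) (poisson_ext (inv_weight w)) \<omega> \<eta> Q"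
proof -
  have w: "AE \<zeta> in dm. 0 < w \<zeta>" "integrable dm w" "integrable dm (inv_weight w)"
    "\<And>z. z \<in> ball 0 1 \<Longrightarrow> poisson_ext w z * poisson_ext (inv_weight w) z \<le> Q"
    using assms by (auto simp: poisson_A2_def)
  have v: "AE \<zeta> in dm. 0 < inv_weight w \<zeta>" using w(1) by eventually_elim (simp add: inv_weight_def)
  obtain \<omega> where \<omega>: "jet (poisson_ext w) \<omega> (\<lambda>_. 0)" by (rule jet_poisson_ext[OF w(2)])
  obtain \<eta> where \<eta>: "jet (poisson_ext (inv_weight w)) \<eta> (\<lambda>_. 0)" by (rule jet_poisson_ext[OF w(3)])
  show ?thesis
  proof (rule that[of \<omega> \<eta>], unfold_locales)
    fix z :: complex assume z: "z \<in> ball 0 1"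
    show "0 < poisson_ext w z" "0 < poisson_ext (inv_weight w) z"
      using poisson_ext_pos[OF w(2,1)] poisson_ext_pos[OF w(3) v] z by auto
    have sq: "AE \<zeta> in dm. 1\<^sup>2 * w \<zeta> = w \<zeta>" by simp
    have p1: "poisson_ext (\<lambda>_. 1 :: real) z = 1"
    proof -
      have "poisson_ext (\<lambda>_. 1 :: complex) z = 1" using poisson_ext_power[of z 0] z by simp
      thus ?thesis using poisson_ext_of_real[of "\<lambda>_. 1" z] z by simp
    qed
    show "1 \<le> poisson_ext w z * poisson_ext (inv_weight w) z"
      using poisson_ext_Cauchy_Schwarz[OF w(3,1), of "\<lambda>_. 1" z] w(2) z p1 by (simp add: mult.commute)
  qed (use \<omega> \<eta> w in auto)
qed

section \<open>Weighted bounds for the Riesz projection and for Hankel forms\<close>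

lemma riesz_plus_measurable [measurable]:
  assumes [measurable]: "u \<in> borel_measurable borel"
  shows "riesz_plus u \<in> borel_measurable borel"
  unfolding riesz_plus_def by measurable

lemma poisson_ext_measurable [measurable]:
  fixes u :: "complex \<Rightarrow> 'a::{banach,second_countable_topology}"
  assumes [measurable]: "u \<in> borel_measurable borel"
  shows "poisson_ext u \<in> borel_measurable borel"
  unfolding poisson_ext_def Poisson_def by measurable

lemma continuous_on_poisson_ext:
  fixes u :: "complex \<Rightarrow> complex"
  assumes u: "integrable dm u"
  shows "continuous_on (ball 0 1) (poisson_ext u)"
proof -
  have u': "integrable dm (\<lambda>\<zeta>. cnj (u \<zeta>))" using u by simp
  have "continuous_on (ball 0 1) (\<lambda>z. fourier u 0 + riesz_plus u z + cnj (riesz_plus (\<lambda>\<zeta>. cnj (u \<zeta>)) z))"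
    by (intro continuous_intros holomorphic_on_imp_continuous_on riesz_plus_holomorphic u u')
  thus ?thesis by (rule continuous_on_eq) (simp add: poisson_ext_complex[OF u])
qed

lemma circle_mean_integral:
  fixes F :: "complex \<Rightarrow> 'a::euclidean_space"
  assumes [measurable]: "F \<in> borel_measurable borel" and c: "continuous_on (ball 0 1) F" and r: "0 \<le> r" "r < 1"
  shows "integral {0..2*pi} (\<lambda>t. F (of_real r * cis t)) = (2 * pi) *\<^sub>R (\<integral>\<zeta>. F (of_real r * \<zeta>) \<partial>dm)"
proof -
  have "continuous_on (sphere 0 1) (\<lambda>\<zeta>. F (of_real r * \<zeta>))"
    by (rule continuous_on_compose2[OF c]) (use r in \<open>auto intro!: continuous_intros simp: norm_mult\<close>)
  from integral_dm_cont[OF _ this] show ?thesis by simp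
qed

lemma circle_bounded:
  fixes F :: "complex \<Rightarrow> 'a::real_normed_vector"
  assumes c: "continuous_on (ball 0 1) F" and r: "0 \<le> r" "r < 1"
  obtains M where "\<And>\<zeta>. norm \<zeta> = 1 \<Longrightarrow> norm (F (of_real r * \<zeta>)) \<le> M"
proof -
  have "continuous_on (sphere 0 1) (\<lambda>\<zeta>. F (of_real r * \<zeta>))"
    by (rule continuous_on_compose2[OF c]) (use r in \<open>auto intro!: continuous_intros simp: norm_mult\<close>)
  hence "bounded ((\<lambda>\<zeta>. F (of_real r * \<zeta>)) ` sphere 0 1)"
    by (intro compact_imp_bounded compact_continuous_image) auto
  then obtain M where "\<forall>x\<in>sphere 0 1. norm (F (of_real r * x)) \<le> M" unfolding bounded_iff by auto
  thus ?thesis by (intro that[of M]) auto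
qed

section \<open>Symmetry and weighted bounds of the Poisson operator\<close>

lemma Poisson_symmetric:
  assumes "norm \<zeta> = 1" "norm \<xi> = 1"
  shows "Poisson (of_real r * \<zeta>) \<xi> = Poisson (of_real r * \<xi>) \<zeta>"
proof -
  have "cmod (1 - cnj (of_real r * \<zeta>) * \<xi>) = cmod (cnj (1 - cnj (of_real r * \<xi>) * \<zeta>))"
    by (simp add: mult_ac)
  hence "cmod (1 - cnj (of_real r * \<zeta>) * \<xi>) = cmod (1 - cnj (of_real r * \<xi>) * \<zeta>)"
    unfolding complex_mod_cnj .
  thus ?thesis using assms by (simp add: Poisson_def norm_mult)
qed

text \<open>The kernel is symmetric in the two boundary variables, and for fixed r < 1 it is
  bounded, so Fubini applies although \<open>l\<close> is merely integrable.\<close>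

lemma poisson_ext_self_adjoint:
  fixes F l :: "complex \<Rightarrow> complex"
  assumes [measurable]: "F \<in> borel_measurable borel" and F: "\<And>\<zeta>. norm \<zeta> = 1 \<Longrightarrow> norm (F \<zeta>) \<le> M"
    and l: "integrable dm l" and r: "0 \<le> r" "r < 1"
  shows "(\<integral>\<zeta>. F \<zeta> * poisson_ext l (of_real r * \<zeta>) \<partial>dm) = (\<integral>\<xi>. poisson_ext F (of_real r * \<xi>) * l \<xi> \<partial>dm)"
proof -
  have [measurable]: "l \<in> borel_measurable borel" using l by (auto dest: borel_measurable_integrable)
  interpret pair_sigma_finite dm dm by unfold_locales
  define f where "f = (\<lambda>\<zeta> \<xi>. of_real (Poisson (of_real r * \<zeta>) \<xi>) * (F \<zeta> * l \<xi>))"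
  have M0: "0 \<le> M" by (rule order_trans[OF norm_ge_zero F[of 1]]) simp
  have fm [measurable]: "case_prod f \<in> borel_measurable (dm \<Otimes>\<^sub>M dm)"
    unfolding f_def Poisson_def by measurable
  define B where "B = M / (1 - r)\<^sup>2"
  have fb: "norm (f \<zeta> \<xi>) \<le> B * norm (l \<xi>)" if "norm \<zeta> = 1" "norm \<xi> = 1" for \<zeta> \<xi>
  proof -
    have n: "norm (of_real r * \<zeta>) = r" using that r by (simp add: norm_mult)
    have "norm (f \<zeta> \<xi>) = Poisson (of_real r * \<zeta>) \<xi> * (norm (F \<zeta>) * norm (l \<xi>))"
      using Poisson_pos[OF that(2), of "of_real r * \<zeta>"] unfolding n using r by (simp add: f_def norm_mult)
    also have "\<dots> \<le> 1 / (1 - r)\<^sup>2 * (M * norm (l \<xi>))"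
      using Poisson_le[OF that(2), of "of_real r * \<zeta>"] unfolding n using r F[OF that(1)] by (intro mult_mono mult_right_mono) auto
    finally show ?thesis by (simp add: B_def)
  qed
  have i2: "integrable dm (\<lambda>\<xi>. f \<zeta> \<xi>)" if "norm \<zeta> = 1" for \<zeta>
  proof (rule Bochner_Integration.integrable_bound)
    show "integrable dm (\<lambda>\<xi>. B * norm (l \<xi>))" using l by simp
    show "(\<lambda>\<xi>. f \<zeta> \<xi>) \<in> borel_measurable dm" unfolding f_def Poisson_def by measurable
    show "AE \<xi> in dm. norm (f \<zeta> \<xi>) \<le> norm (B * norm (l \<xi>))"
      using AE_dm_circle by eventually_elim (use fb[OF that] in \<open>force intro: order_trans\<close>)
  qed
  have "integrable (dm \<Otimes>\<^sub>M dm) (case_prod f)"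
  proof (rule Fubini_integrable[OF fm])
    show "integrable dm (\<lambda>\<zeta>. \<integral>\<xi>. norm (case_prod f (\<zeta>, \<xi>)) \<partial>dm)"
    proof (rule integrable_dm_bounded[where B="B * (\<integral>\<xi>. norm (l \<xi>) \<partial>dm)"])
      show "(\<lambda>\<zeta>. \<integral>\<xi>. norm (case_prod f (\<zeta>, \<xi>)) \<partial>dm) \<in> borel_measurable borel"
        unfolding f_def Poisson_def by measurable
      fix \<zeta> :: complex assume z: "norm \<zeta> = 1"
      have "(\<integral>\<xi>. norm (f \<zeta> \<xi>) \<partial>dm) \<le> (\<integral>\<xi>. B * norm (l \<xi>) \<partial>dm)"
        using i2[OF z] l AE_dm_circle by (intro integral_mono_AE) (auto elim!: eventually_mono intro: fb[OF z])
      thus "norm (\<integral>\<xi>. norm (case_prod f (\<zeta>, \<xi>)) \<partial>dm) \<le> B * (\<integral>\<xi>. norm (l \<xi>) \<partial>dm)" by simp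
    qed
    show "AE \<zeta> in dm. integrable dm (\<lambda>\<xi>. case_prod f (\<zeta>, \<xi>))"
      using AE_dm_circle by eventually_elim (simp add: i2)
  qed
  note Fub = Fubini_integral[OF this]
  have "(\<integral>\<zeta>. F \<zeta> * poisson_ext l (of_real r * \<zeta>) \<partial>dm) = (\<integral>\<zeta>. \<integral>\<xi>. f \<zeta> \<xi> \<partial>dm \<partial>dm)"
    unfolding poisson_ext_def f_def
    by (intro Bochner_Integration.integral_cong refl, subst integral_mult_right_zero[symmetric])
       (simp add: scaleR_conv_of_real mult_ac)
  also have "\<dots> = (\<integral>\<xi>. \<integral>\<zeta>. f \<zeta> \<xi> \<partial>dm \<partial>dm)" by (rule Fub[symmetric])
  also have "\<dots> = (\<integral>\<xi>. poisson_ext F (of_real r * \<xi>) * l \<xi> \<partial>dm)"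
  proof (rule integral_dm_cong)
    show "(\<lambda>\<xi>. \<integral>\<zeta>. f \<zeta> \<xi> \<partial>dm) \<in> borel_measurable borel" unfolding f_def Poisson_def by measurable
    show "(\<lambda>\<xi>. poisson_ext F (of_real r * \<xi>) * l \<xi>) \<in> borel_measurable borel" by measurable
    fix \<xi> :: complex assume x: "norm \<xi> = 1"
    have "poisson_ext F (of_real r * \<xi>) * l \<xi> = (\<integral>\<zeta>. (Poisson (of_real r * \<xi>) \<zeta> *\<^sub>R F \<zeta>) * l \<xi> \<partial>dm)"
      unfolding poisson_ext_def by (rule integral_mult_left_zero[symmetric])
    also have "\<dots> = (\<integral>\<zeta>. f \<zeta> \<xi> \<partial>dm)"
    proof (rule integral_dm_cong)
      show "(\<lambda>\<zeta>. (Poisson (of_real r * \<xi>) \<zeta> *\<^sub>R F \<zeta>) * l \<xi>) \<in> borel_measurable borel" by measurable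
      show "(\<lambda>\<zeta>. f \<zeta> \<xi>) \<in> borel_measurable borel" unfolding f_def Poisson_def by measurable
      fix \<zeta> :: complex assume "norm \<zeta> = 1"
      from Poisson_symmetric[OF this x, of r]
      show "(Poisson (of_real r * \<xi>) \<zeta> *\<^sub>R F \<zeta>) * l \<xi> = f \<zeta> \<xi>" by (simp add: f_def scaleR_conv_of_real)
    qed
    finally show "(\<integral>\<zeta>. f \<zeta> \<xi> \<partial>dm) = poisson_ext F (of_real r * \<xi>) * l \<xi>" by simp
  qed
  finally show ?thesis .
qed

text \<open>By the square of \<open>2 |u| w - 1\<close>, divided by 4w, the modulus of u is at most
  \<open>|u|^2 w\<close> plus a quarter of \<open>1/w\<close>.\<close>

lemma weighted_integrable:
  fixes u :: "complex \<Rightarrow> complex"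
  assumes [measurable]: "u \<in> borel_measurable borel" and w: "AE \<zeta> in dm. 0 < w \<zeta>" "integrable dm (inv_weight w)"
    and u: "integrable dm (\<lambda>\<zeta>. (norm (u \<zeta>))\<^sup>2 * w \<zeta>)"
  shows "integrable dm u"
proof (rule Bochner_Integration.integrable_bound)
  show "integrable dm (\<lambda>\<zeta>. (norm (u \<zeta>))\<^sup>2 * w \<zeta> + inv_weight w \<zeta>)" using w u by simp
  show "AE \<zeta> in dm. norm (u \<zeta>) \<le> norm ((norm (u \<zeta>))\<^sup>2 * w \<zeta> + inv_weight w \<zeta>)"
    using w(1)
  proof eventually_elim
    case (elim \<zeta>)
    have "0 \<le> (2 * norm (u \<zeta>) * w \<zeta> - 1)\<^sup>2 / (4 * w \<zeta>)" using elim by auto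
    also have "\<dots> = (norm (u \<zeta>))\<^sup>2 * w \<zeta> - norm (u \<zeta>) + inv_weight w \<zeta> / 4"
      using elim by (simp add: power2_diff power_mult_distrib inv_weight_def field_simps) (simp add: power2_eq_square
        algebra_simps)
    finally have 1: "norm (u \<zeta>) \<le> (norm (u \<zeta>))\<^sup>2 * w \<zeta> + inv_weight w \<zeta> / 4" by simp
    have "0 < inv_weight w \<zeta>" using elim by (simp add: inv_weight_def)
    hence "norm (u \<zeta>) \<le> (norm (u \<zeta>))\<^sup>2 * w \<zeta> + inv_weight w \<zeta>" using 1 by simp
    thus ?case by (simp add: abs_le_iff)
  qed
qed measurable

text \<open>Cauchy-Schwarz bounds \<open>|u(z)|^2\<close> by the extension of \<open>1/w\<close>
  times that of \<open>|u|^2 w\<close>; multiplication by \<open>w(z)\<close> produces the A2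
  product. It carries disc estimates with extended weights over to boundary norms, uniformly in the
  radius.\<close>

lemma poisson_ext_weighted_bound:
  fixes u :: "complex \<Rightarrow> complex"
  assumes A: "poisson_A2 w Q" and [measurable]: "u \<in> borel_measurable borel"
    and u: "integrable dm (\<lambda>\<zeta>. (norm (u \<zeta>))\<^sup>2 * w \<zeta>)" and z: "norm z < 1"
  shows "(norm (poisson_ext u z))\<^sup>2 * poisson_ext w z \<le> Q * poisson_ext (\<lambda>\<zeta>. (norm (u \<zeta>))\<^sup>2 * w \<zeta>) z"
proof -
  have w: "AE \<zeta> in dm. 0 < w \<zeta>" "integrable dm w" "integrable dm (inv_weight w)" and [measurable]: "w \<in> borel_measurable borel"
    and Q: "poisson_ext w z * poisson_ext (inv_weight w) z \<le> Q"
    using A z by (auto simp: poisson_A2_def)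
  have iu: "integrable dm u" by (rule weighted_integrable[OF _ w(1,3) u]) measurable
  have dom: "integrable dm (\<lambda>\<zeta>. (g \<zeta>)\<^sup>2 * w \<zeta>)" if [measurable]: "g \<in> borel_measurable borel" and "\<And>\<zeta>. \<bar>g \<zeta>\<bar> \<le> norm (u \<zeta>)" for g
  proof (rule Bochner_Integration.integrable_bound[OF u])
    show "AE \<zeta> in dm. norm ((g \<zeta>)\<^sup>2 * w \<zeta>) \<le> norm ((norm (u \<zeta>))\<^sup>2 * w \<zeta>)"
      using w(1) by eventually_elim (use that(2) in \<open>auto simp: abs_mult power2_le_iff_abs_le intro!: mult_right_mono\<close>)
  qed measurable
  have i1: "integrable dm (\<lambda>\<zeta>. (Re (u \<zeta>))\<^sup>2 * w \<zeta>)" and i2: "integrable dm (\<lambda>\<zeta>. (Im (u \<zeta>))\<^sup>2 * w \<zeta>)"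
    by (rule dom; simp add: abs_Re_le_cmod abs_Im_le_cmod)+
  have "(norm (poisson_ext u z))\<^sup>2 = (poisson_ext (\<lambda>\<zeta>. Re (u \<zeta>)) z)\<^sup>2 + (poisson_ext (\<lambda>\<zeta>. Im (u \<zeta>)) z)\<^sup>2"
    using iu z by (simp add: poisson_ext_Re poisson_ext_Im cmod_power2)
  also have "\<dots> \<le> poisson_ext (inv_weight w) z * poisson_ext (\<lambda>\<zeta>. (Re (u \<zeta>))\<^sup>2 * w \<zeta>) z +
       poisson_ext (inv_weight w) z * poisson_ext (\<lambda>\<zeta>. (Im (u \<zeta>))\<^sup>2 * w \<zeta>) z"
    using iu w i1 i2 z by (intro add_mono poisson_ext_Cauchy_Schwarz) auto
  also have "\<dots> = poisson_ext (inv_weight w) z * poisson_ext (\<lambda>\<zeta>. 1 * ((Re (u \<zeta>))\<^sup>2 * w \<zeta>) + 1 * ((Im (u \<zeta>))\<^sup>2 * w \<zeta>)) z"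
    by (subst poisson_ext_lincomb[OF i1 i2 z]) (simp add: algebra_simps)
  also have "(\<lambda>\<zeta>. 1 * ((Re (u \<zeta>))\<^sup>2 * w \<zeta>) + 1 * ((Im (u \<zeta>))\<^sup>2 * w \<zeta>)) = (\<lambda>\<zeta>. (norm (u \<zeta>))\<^sup>2 * w \<zeta>)"
    by (simp add: cmod_power2 algebra_simps)
  finally have 1: "(norm (poisson_ext u z))\<^sup>2 \<le> poisson_ext (inv_weight w) z * poisson_ext (\<lambda>\<zeta>. (norm (u \<zeta>))\<^sup>2 * w \<zeta>) z" .
  have nn: "0 \<le> poisson_ext (\<lambda>\<zeta>. (norm (u \<zeta>))\<^sup>2 * w \<zeta>) z"
  proof -
    have "AE \<zeta> in dm. 0 \<le> (norm (u \<zeta>))\<^sup>2 * w \<zeta>" using w(1) by eventually_elim simp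
    hence "poisson_ext (\<lambda>_. 0 :: real) z \<le> poisson_ext (\<lambda>\<zeta>. (norm (u \<zeta>))\<^sup>2 * w \<zeta>) z"
      using u z by (intro poisson_ext_mono_AE) auto
    thus ?thesis by (simp add: poisson_ext_def)
  qed
  have "(norm (poisson_ext u z))\<^sup>2 * poisson_ext w z
    \<le> (poisson_ext (inv_weight w) z * poisson_ext (\<lambda>\<zeta>. (norm (u \<zeta>))\<^sup>2 * w \<zeta>) z) * poisson_ext w z"
    using poisson_ext_pos[OF w(2,1) z] by (intro mult_right_mono 1) auto
  also have "\<dots> = (poisson_ext w z * poisson_ext (inv_weight w) z) * poisson_ext (\<lambda>\<zeta>. (norm (u \<zeta>))\<^sup>2 * w \<zeta>) z" by simp
  also have "\<dots> \<le> Q * poisson_ext (\<lambda>\<zeta>. (norm (u \<zeta>))\<^sup>2 * w \<zeta>) z" by (intro mult_right_mono Q nn)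
  finally show ?thesis .
qed

lemma mean_weighted_bound:
  fixes u :: "complex \<Rightarrow> complex"
  assumes A: "poisson_A2 w Q" and [measurable]: "u \<in> borel_measurable borel"
    and u: "integrable dm (\<lambda>\<zeta>. (norm (u \<zeta>))\<^sup>2 * w \<zeta>)" and r: "0 \<le> r" "r < 1"
  shows "integral {0..2*pi} (\<lambda>t. (norm (poisson_ext u (of_real r * cis t)))\<^sup>2 * poisson_ext w (of_real r * cis t))
     \<le> 2 * pi * Q * (\<integral>\<zeta>. (norm (u \<zeta>))\<^sup>2 * w \<zeta> \<partial>dm)"
    and "(\<lambda>t. (norm (poisson_ext u (of_real r * cis t)))\<^sup>2 * poisson_ext w (of_real r * cis t)) integrable_on {0..2*pi}"
proof -
  have w: "AE \<zeta> in dm. 0 < w \<zeta>" "integrable dm w" "integrable dm (inv_weight w)"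
    using A by (auto simp: poisson_A2_def)
  have iu: "integrable dm u" by (rule weighted_integrable[OF _ w(1,3) u]) measurable
  obtain a b where a: "jet (poisson_ext w) a (\<lambda>_. 0)" and b: "jet (poisson_ext (\<lambda>\<zeta>. (norm (u \<zeta>))\<^sup>2 * w \<zeta>)) b (\<lambda>_. 0)"
    using jet_poisson_ext[OF w(2)] jet_poisson_ext[OF u] by metis
  have "continuous_on (ball 0 1) (\<lambda>z. (norm (poisson_ext u z))\<^sup>2 * poisson_ext w z)"
    by (intro continuous_intros continuous_on_poisson_ext iu jet_continuous[OF a])
  from integrable_continuous_real[OF continuous_on_circle[OF this r]]
  show i: "(\<lambda>t. (norm (poisson_ext u (of_real r * cis t)))\<^sup>2 * poisson_ext w (of_real r * cis t)) integrable_on {0..2*pi}" .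
  have c: "continuous_on (ball 0 1) (\<lambda>z. Q * poisson_ext (\<lambda>\<zeta>. (norm (u \<zeta>))\<^sup>2 * w \<zeta>) z)"
    by (intro continuous_intros jet_continuous[OF b])
  have "integral {0..2*pi} (\<lambda>t. (norm (poisson_ext u (of_real r * cis t)))\<^sup>2 * poisson_ext w (of_real r * cis t))
     \<le> integral {0..2*pi} (\<lambda>t. Q * poisson_ext (\<lambda>\<zeta>. (norm (u \<zeta>))\<^sup>2 * w \<zeta>) (of_real r * cis t))"
    using r by (intro integral_le i integrable_continuous_real continuous_on_circle[OF c r] poisson_ext_weighted_bound[OF A _ u])
      (auto simp: norm_mult)
  also have "\<dots> = Q * (2 * pi * (\<integral>\<zeta>. (norm (u \<zeta>))\<^sup>2 * w \<zeta> \<partial>dm))"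
    by (subst integral_mult_right, subst poisson_ext_mean[OF u r]) simp
  finally show "integral {0..2*pi} (\<lambda>t. (norm (poisson_ext u (of_real r * cis t)))\<^sup>2 * poisson_ext w (of_real r * cis t))
     \<le> 2 * pi * Q * (\<integral>\<zeta>. (norm (u \<zeta>))\<^sup>2 * w \<zeta> \<partial>dm)" by (simp add: mult_ac)
qed

lemma riesz_plus_dilation:
  assumes k: "integrable dm k" and r: "0 \<le> r" "r < 1" and z: "norm z < 1"
  shows "poisson_ext (\<lambda>\<zeta>. riesz_plus k (of_real r * \<zeta>)) z = riesz_plus k (of_real r * z)"
proof -
  have [measurable]: "k \<in> borel_measurable borel" using k by (auto dest: borel_measurable_integrable)
  define a where "a = (\<lambda>n. if n = 0 then 0 else fourier k n * of_real r ^ n)"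
  have "summable (\<lambda>n. norm (fourier k n * of_real r ^ n))" using r by (intro summable_fourier k) auto
  hence "summable (\<lambda>n. norm (a n))" by (rule summable_comparison_test'[where N=0]) (auto simp: a_def)
  moreover have "(\<lambda>n. a n * \<zeta> ^ n) sums riesz_plus k (of_real r * \<zeta>)" if "norm \<zeta> \<le> 1" for \<zeta>
  proof -
    have "norm (of_real r * \<zeta>) < 1" using that r by (simp add: norm_mult mult_le_one order.strict_trans1[OF mult_left_le])
    from riesz_plus_sums[OF k this] have "(\<lambda>n. a (Suc n) * \<zeta> ^ Suc n) sums riesz_plus k (of_real r * \<zeta>)"
      by (simp add: a_def power_mult_distrib mult_ac)
    thus ?thesis by (subst (asm) sums_Suc_iff) (simp add: a_def)
  qed
  ultimately show ?thesis by (rule poisson_ext_power_series[OF _ _ _ z]) measurable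
qed

text \<open>The additive disc estimate becomes a norm bound by testing against \<open>l\<close>,
  built from the projection itself: the pairing is \<epsilon> N and the squared dual norm of
  \<open>l\<close> is \<epsilon>^2 N. Since N is finite for \<rho> < 1, its multiple on the right
  can be absorbed.\<close>

theorem riesz_projection_weighted:
  assumes A: "poisson_A2 w Q" and [measurable]: "k \<in> borel_measurable borel"
    and k: "integrable dm (\<lambda>\<zeta>. (norm (k \<zeta>))\<^sup>2 * w \<zeta>)" and \<rho>: "0 \<le> \<rho>" "\<rho> < 1"
  shows "(\<integral>\<zeta>. (norm (riesz_plus k (of_real \<rho> * \<zeta>)))\<^sup>2 * w \<zeta> \<partial>dm) \<le> (2 * ((1 + 8 * Q\<^sup>2) * Q))\<^sup>2 * (\<integral>\<zeta>. (norm (k \<zeta>))\<^sup>2 * w \<zeta> \<partial>dm)"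
proof -
  have w: "AE \<zeta> in dm. 0 < w \<zeta>" "integrable dm w" "integrable dm (inv_weight w)" and [measurable]: "w \<in> borel_measurable borel"
    using A by (auto simp: poisson_A2_def)
  have ik: "integrable dm k" by (rule weighted_integrable[OF _ w(1,3) k]) measurable
  obtain \<omega> \<eta> where hp: "harmonic_pair (poisson_ext w) (poisson_ext (inv_weight w)) \<omega> \<eta> Q"
    by (rule poisson_A2_harmonic_pair[OF A])
  interpret harmonic_pair "poisson_ext w" "poisson_ext (inv_weight w)" \<omega> \<eta> Q by (rule hp)
  define K where "K = (1 + 8 * Q\<^sup>2) * Q"
  have K: "K > 0" using Q_ge unfolding K_def by (intro mult_pos_pos add_pos_nonneg) auto
  \<comment> \<open>The dilation is shared: one factor r puts the analytic part inside the disc, the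
    other belongs to the Poisson extension of \<open>l\<close> and is moved back by
    symmetry.\<close>
  define r where "r = sqrt \<rho>"
  have r: "0 \<le> r" "r < 1" "r * r = \<rho>" using \<rho> by (auto simp: r_def)
  define N where "N = (\<integral>\<zeta>. (norm (riesz_plus k (of_real \<rho> * \<zeta>)))\<^sup>2 * w \<zeta> \<partial>dm)"
  have contF: "continuous_on (ball 0 1) (riesz_plus k)"
    by (rule holomorphic_on_imp_continuous_on[OF riesz_plus_holomorphic[OF ik]])
  obtain M1 where M1: "\<And>\<zeta>. norm \<zeta> = 1 \<Longrightarrow> norm (riesz_plus k (of_real \<rho> * \<zeta>)) \<le> M1"
    by (rule circle_bounded[OF contF \<rho>]; rule that)
  obtain M2 where M2: "\<And>\<zeta>. norm \<zeta> = 1 \<Longrightarrow> norm (riesz_plus k (of_real r * \<zeta>)) \<le> M2"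
    by (rule circle_bounded[OF contF r(1,2)]; rule that)
  have iN: "integrable dm (\<lambda>\<zeta>. (norm (riesz_plus k (of_real \<rho> * \<zeta>)))\<^sup>2 * w \<zeta>)"
  proof (rule integrable_dm_bounded_mult[OF _ _ w(2)])
    show "(\<lambda>\<zeta>. (norm (riesz_plus k (of_real \<rho> * \<zeta>)))\<^sup>2) \<in> borel_measurable borel" by measurable
    show "norm ((norm (riesz_plus k (of_real \<rho> * \<zeta>)))\<^sup>2) \<le> M1\<^sup>2" if "norm \<zeta> = 1" for \<zeta> :: complex
      using M1[OF that] by (simp add: power_mono)
  qed
  \<comment> \<open>The maximiser of \<open>\<epsilon> - K \<epsilon>^2\<close>, leaving
    \<open>N / (4K)\<close> on the left.\<close>
  define \<epsilon> where "\<epsilon> = 1 / (2 * K)"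
  define l where "l = (\<lambda>\<zeta>. of_real \<epsilon> * (cnj (riesz_plus k (of_real \<rho> * \<zeta>)) * of_real (w \<zeta>)))"
  have l2: "(norm (l \<zeta>))\<^sup>2 * inv_weight w \<zeta> = \<epsilon>\<^sup>2 * ((norm (riesz_plus k (of_real \<rho> * \<zeta>)))\<^sup>2 * w \<zeta>)" for \<zeta>
    unfolding l_def inv_weight_def by (cases "w \<zeta> = 0") (auto simp: norm_mult power_mult_distrib field_simps power2_eq_square)
  have [measurable]: "l \<in> borel_measurable borel" unfolding l_def by measurable
  have il2: "integrable dm (\<lambda>\<zeta>. (norm (l \<zeta>))\<^sup>2 * inv_weight w \<zeta>)" unfolding l2 using iN by simp
  have A': "poisson_A2 (inv_weight w) Q" by (rule poisson_A2_inv[OF A])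
  have il: "integrable dm l"
    by (rule weighted_integrable[OF _ _ _ il2]) (use A' in \<open>auto simp: poisson_A2_def\<close>)
  have icnj: "integrable dm (\<lambda>\<zeta>. cnj (k \<zeta>))" "integrable dm (\<lambda>\<zeta>. cnj (l \<zeta>))" using ik il by auto
  have pk: "poisson_ext k (of_real r * cis t)
    = riesz_plus k (of_real r * cis t) + cnj (cnj (fourier k 0) + riesz_plus (\<lambda>\<zeta>. cnj (k \<zeta>)) (of_real r * cis t))" for t
    using r by (subst poisson_ext_complex[OF ik]) (auto simp: norm_mult)
  have pl: "poisson_ext l (of_real r * cis t)
    = (fourier l 0 + riesz_plus l (of_real r * cis t)) + cnj (riesz_plus (\<lambda>\<zeta>. cnj (l \<zeta>)) (of_real r * cis t))" for t
    using r by (subst poisson_ext_complex[OF il]) (auto simp: norm_mult)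
  have "integral {0..2*pi} (\<lambda>t. Re (riesz_plus k (of_real r * cis t) * poisson_ext l (of_real r * cis t)))
     \<le> (1 + 8 * Q\<^sup>2) * integral {0..2*pi} (\<lambda>t. (norm (poisson_ext k (of_real r * cis t)))\<^sup>2 * poisson_ext w (of_real r * cis t) +
           (norm (poisson_ext l (of_real r * cis t)))\<^sup>2 * poisson_ext (inv_weight w) (of_real r * cis t))"
    unfolding pk pl
    by (rule riesz_projection_disc[where B="\<lambda>z. cnj (fourier k 0) + riesz_plus (\<lambda>\<zeta>. cnj (k \<zeta>)) z"
      and A'="\<lambda>z. fourier l 0 + riesz_plus l z"])
       (use r ik il icnj in \<open>auto intro!: holomorphic_intros riesz_plus_holomorphic\<close>)
  also have "\<dots> \<le> (1 + 8 * Q\<^sup>2) * (2 * pi * Q * (\<integral>\<zeta>. (norm (k \<zeta>))\<^sup>2 * w \<zeta> \<partial>dm) + 2 * pi * Q * (\<integral>\<zeta>. (norm (l \<zeta>))\<^sup>2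
    * inv_weight w \<zeta> \<partial>dm))"
    using mean_weighted_bound[OF A _ k r(1,2)] mean_weighted_bound[OF A' _ il2 r(1,2)]
    by (intro mult_left_mono) (auto simp: Henstock_Kurzweil_Integration.integral_add)
  also have "(\<integral>\<zeta>. (norm (l \<zeta>))\<^sup>2 * inv_weight w \<zeta> \<partial>dm) = \<epsilon>\<^sup>2 * N" unfolding l2 N_def by simp
  also have "integral {0..2*pi} (\<lambda>t. Re (riesz_plus k (of_real r * cis t) * poisson_ext l (of_real r * cis t)))
    = 2 * pi * (\<epsilon> * N)"
  proof -
    have c: "continuous_on (ball 0 1) (\<lambda>z. riesz_plus k z * poisson_ext l z)"
      by (intro continuous_intros continuous_on_poisson_ext il holomorphic_on_imp_continuous_on riesz_plus_holomorphic ik)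
    have "integral {0..2*pi} (\<lambda>t. Re (riesz_plus k (of_real r * cis t) * poisson_ext l (of_real r * cis t))) =
       2 * pi * (\<integral>\<zeta>. Re (riesz_plus k (of_real r * \<zeta>) * poisson_ext l (of_real r * \<zeta>)) \<partial>dm)"
    proof -
      have m: "(\<lambda>z. Re (riesz_plus k z * poisson_ext l z)) \<in> borel_measurable borel" by measurable
      show ?thesis using circle_mean_integral[OF m continuous_on_Re[OF c] r(1,2)] by (simp only: real_scaleR_def)
    qed
    also have "(\<integral>\<zeta>. Re (riesz_plus k (of_real r * \<zeta>) * poisson_ext l (of_real r * \<zeta>)) \<partial>dm)
      = Re (\<integral>\<zeta>. riesz_plus k (of_real r * \<zeta>) * poisson_ext l (of_real r * \<zeta>) \<partial>dm)"
    proof (rule integral_Re)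
      obtain B where "\<And>\<zeta>. norm \<zeta> = 1 \<Longrightarrow> norm (riesz_plus k (of_real r * \<zeta>) * poisson_ext l (of_real r * \<zeta>)) \<le> B"
        by (rule circle_bounded[OF c r(1,2)]; rule that)
      thus "integrable dm (\<lambda>\<zeta>. riesz_plus k (of_real r * \<zeta>) * poisson_ext l (of_real r * \<zeta>))"
        by (intro integrable_dm_bounded) auto
    qed
    also have "(\<integral>\<zeta>. riesz_plus k (of_real r * \<zeta>) * poisson_ext l (of_real r * \<zeta>) \<partial>dm)
      = (\<integral>\<xi>. poisson_ext (\<lambda>\<zeta>. riesz_plus k (of_real r * \<zeta>)) (of_real r * \<xi>) * l \<xi> \<partial>dm)"
      by (rule poisson_ext_self_adjoint[OF _ M2 il r(1,2)]) measurable
    also have "\<dots> = (\<integral>\<xi>. of_real (\<epsilon> * ((norm (riesz_plus k (of_real \<rho> * \<xi>)))\<^sup>2 * w \<xi>)) \<partial>dm)"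
    proof (rule integral_dm_cong)
      fix \<xi> :: complex assume "norm \<xi> = 1"
      hence "poisson_ext (\<lambda>\<zeta>. riesz_plus k (of_real r * \<zeta>)) (of_real r * \<xi>) = riesz_plus k (of_real \<rho> * \<xi>)"
        using r by (subst riesz_plus_dilation[OF ik]) (auto simp: norm_mult mult.assoc[symmetric] simp flip: of_real_mult)
      thus "poisson_ext (\<lambda>\<zeta>. riesz_plus k (of_real r * \<zeta>)) (of_real r * \<xi>) * l \<xi>
        = of_real (\<epsilon> * ((norm (riesz_plus k (of_real \<rho> * \<xi>)))\<^sup>2 * w \<xi>))"
        by (simp add: l_def complex_norm_square mult_ac del: of_real_power flip: of_real_power)
    qed measurable
    also have "\<dots> = of_real (\<integral>\<xi>. \<epsilon> * ((norm (riesz_plus k (of_real \<rho> * \<xi>)))\<^sup>2 * w \<xi>) \<partial>dm)"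
      by (rule integral_complex_of_real)
    also have "\<dots> = of_real (\<epsilon> * N)" unfolding N_def by (subst integral_mult_right_zero) simp
    finally show ?thesis by simp
  qed
  finally have "2 * pi * (\<epsilon> * N) \<le> 2 * pi * (K * (\<integral>\<zeta>. (norm (k \<zeta>))\<^sup>2 * w \<zeta> \<partial>dm) + K * \<epsilon>\<^sup>2 * N)"
    by (simp add: K_def algebra_simps)
  hence "\<epsilon> * N \<le> K * (\<integral>\<zeta>. (norm (k \<zeta>))\<^sup>2 * w \<zeta> \<partial>dm) + K * \<epsilon>\<^sup>2 * N" by simp
  moreover have "\<epsilon> * N - K * \<epsilon>\<^sup>2 * N = N / (4 * K)" using K by (simp add: \<epsilon>_def field_simps power2_eq_square)
  ultimately have "N / (4 * K) \<le> K * (\<integral>\<zeta>. (norm (k \<zeta>))\<^sup>2 * w \<zeta> \<partial>dm)" by linarith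
  hence "N \<le> (2 * K)\<^sup>2 * (\<integral>\<zeta>. (norm (k \<zeta>))\<^sup>2 * w \<zeta> \<partial>dm)" using K by (simp add: field_simps power2_eq_square)
  thus ?thesis by (simp add: N_def K_def)
qed

text \<open>The quadratic polynomial in c required by \<open>bellman_oscillation\<close> is the
  Poisson extension of \<open>(\<psi> - c)^2 w\<close>. Its hypothesis is therefore Cauchy-Schwarz
  for \<psi> - c, and its upper bound is the oscillation about \<psi>(z).\<close>

lemma oscillation_potential_real:
  fixes \<psi> :: "complex \<Rightarrow> real"
  assumes A: "poisson_A2 w Q" and [measurable]: "\<psi> \<in> borel_measurable borel" and i1: "integrable dm \<psi>"
    and i2: "integrable dm (\<lambda>\<zeta>. (\<psi> \<zeta>)\<^sup>2 * w \<zeta>)" and j: "jet (poisson_ext \<psi>) p (\<lambda>_. 0)"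
  obtains G g lG where "jet G g lG"
    "\<And>z. z \<in> ball 0 1 \<Longrightarrow> 0 \<le> G z"
    "\<And>z. z \<in> ball 0 1 \<Longrightarrow> G z \<le> 2 * (1 + 8 * Q\<^sup>2) * Q * poisson_ext (\<lambda>\<zeta>. (\<psi> \<zeta> - poisson_ext \<psi> z)\<^sup>2 * w \<zeta>) z"
    "\<And>z. z \<in> ball 0 1 \<Longrightarrow> lG z \<le> - ((cmod (p z))\<^sup>2 * poisson_ext w z)"
proof -
  have w: "AE \<zeta> in dm. 0 < w \<zeta>" "integrable dm w" "integrable dm (inv_weight w)" and [measurable]: "w \<in> borel_measurable borel"
    using A by (auto simp: poisson_A2_def)
  obtain \<omega> \<eta> where hp: "harmonic_pair (poisson_ext w) (poisson_ext (inv_weight w)) \<omega> \<eta> Q"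
    by (rule poisson_A2_harmonic_pair[OF A])
  interpret harmonic_pair "poisson_ext w" "poisson_ext (inv_weight w)" \<omega> \<eta> Q by (rule hp)
  have i3: "integrable dm (\<lambda>\<zeta>. \<psi> \<zeta> * w \<zeta>)"
  proof (rule Bochner_Integration.integrable_bound)
    show "integrable dm (\<lambda>\<zeta>. (\<psi> \<zeta>)\<^sup>2 * w \<zeta> + w \<zeta>)" using i2 w by simp
    show "AE \<zeta> in dm. norm (\<psi> \<zeta> * w \<zeta>) \<le> norm ((\<psi> \<zeta>)\<^sup>2 * w \<zeta> + w \<zeta>)"
      using w(1)
    proof eventually_elim
      case (elim \<zeta>)
      have "0 \<le> (2 * \<bar>\<psi> \<zeta>\<bar> - 1)\<^sup>2" by simp
      hence "\<bar>\<psi> \<zeta>\<bar> \<le> (\<psi> \<zeta>)\<^sup>2 + 1" by (simp add: power2_diff power_mult_distrib)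
      hence "\<bar>\<psi> \<zeta>\<bar> * w \<zeta> \<le> ((\<psi> \<zeta>)\<^sup>2 + 1) * w \<zeta>" using elim by (intro mult_right_mono) auto
      thus ?case using elim by (simp add: abs_mult algebra_simps)
    qed
  qed measurable
  obtain \<xi> where X: "jet (poisson_ext (\<lambda>\<zeta>. (\<psi> \<zeta>)\<^sup>2 * w \<zeta>)) \<xi> (\<lambda>_. 0)" by (rule jet_poisson_ext[OF i2])
  obtain y where Y: "jet (poisson_ext (\<lambda>\<zeta>. \<psi> \<zeta> * w \<zeta>)) y (\<lambda>_. 0)" by (rule jet_poisson_ext[OF i3])
  have expand: "poisson_ext (\<lambda>\<zeta>. (\<psi> \<zeta> - c)\<^sup>2 * w \<zeta>) z
    = poisson_ext (\<lambda>\<zeta>. (\<psi> \<zeta>)\<^sup>2 * w \<zeta>) z - 2 * c * poisson_ext (\<lambda>\<zeta>. \<psi> \<zeta> * w \<zeta>) z + c\<^sup>2 * poisson_ext w z"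
    and int: "integrable dm (\<lambda>\<zeta>. (\<psi> \<zeta> - c)\<^sup>2 * w \<zeta>)" if z: "norm z < 1" for z c
  proof -
    have i4: "integrable dm (\<lambda>\<zeta>. 1 * ((\<psi> \<zeta>)\<^sup>2 * w \<zeta>) + (- (2 * c)) * (\<psi> \<zeta> * w \<zeta>))" using i2 i3 by simp
    have e: "(\<lambda>\<zeta>. (\<psi> \<zeta> - c)\<^sup>2 * w \<zeta>) = (\<lambda>\<zeta>. 1 * (1 * ((\<psi> \<zeta>)\<^sup>2 * w \<zeta>) + (- (2 * c)) * (\<psi> \<zeta> * w \<zeta>)) + c\<^sup>2 * w \<zeta>)"
      by (auto simp: power2_eq_square algebra_simps)
    show "integrable dm (\<lambda>\<zeta>. (\<psi> \<zeta> - c)\<^sup>2 * w \<zeta>)" unfolding e using i2 i3 w(2)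
      by (intro Bochner_Integration.integrable_add integrable_mult_right)
    show "poisson_ext (\<lambda>\<zeta>. (\<psi> \<zeta> - c)\<^sup>2 * w \<zeta>) z = poisson_ext (\<lambda>\<zeta>. (\<psi> \<zeta>)\<^sup>2 * w \<zeta>) z - 2 * c * poisson_ext (\<lambda>\<zeta>. \<psi> \<zeta> * w \<zeta>) z + c\<^sup>2
      * poisson_ext w z"
      unfolding e by (subst poisson_ext_lincomb[OF i4 w(2) z], subst poisson_ext_lincomb[OF i2 i3 z]) simp
  qed
  have CS: "(poisson_ext \<psi> z - c)\<^sup>2 \<le> poisson_ext (inv_weight w) z *
     (poisson_ext (\<lambda>\<zeta>. (\<psi> \<zeta>)\<^sup>2 * w \<zeta>) z - 2 * c * poisson_ext (\<lambda>\<zeta>. \<psi> \<zeta> * w \<zeta>) z + c\<^sup>2 * poisson_ext w z)"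
    if "z \<in> ball 0 1" for z c
  proof -
    have z: "norm z < 1" using that by simp
    have one: "poisson_ext (\<lambda>_. 1 :: real) z = 1"
    proof -
      have "poisson_ext (\<lambda>_. 1 :: complex) z = 1" using poisson_ext_power[of z 0] z by simp
      thus ?thesis using poisson_ext_of_real[of "\<lambda>_. 1" z] z by simp
    qed
    have "poisson_ext (\<lambda>\<zeta>. \<psi> \<zeta> - c) z = poisson_ext \<psi> z - c"
      using poisson_ext_lincomb[OF i1 _ z, of "\<lambda>_. 1" 1 "- c"] one by simp
    thus ?thesis
      using poisson_ext_Cauchy_Schwarz[OF w(3,1) _ int[OF z, of c] z] i1 expand[OF z, of c] by simp
  qed
  obtain G g lG where G: "jet G g lG"
    "\<And>z. z \<in> ball 0 1 \<Longrightarrow> 0 \<le> G z"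
    "\<And>z. z \<in> ball 0 1 \<Longrightarrow> G z \<le> 2 * (1 + 8 * Q\<^sup>2) * Q * (poisson_ext (\<lambda>\<zeta>. (\<psi> \<zeta>)\<^sup>2 * w \<zeta>) z - 2 * poisson_ext \<psi> z
      * poisson_ext (\<lambda>\<zeta>. \<psi> \<zeta> * w \<zeta>) z + (poisson_ext \<psi> z)\<^sup>2 * poisson_ext w z)"
    "\<And>z. z \<in> ball 0 1 \<Longrightarrow> lG z \<le> - ((cmod (p z))\<^sup>2 * poisson_ext w z)"
    by (rule bellman_oscillation[OF j X Y CS]; (assumption | rule that))
  show ?thesis
    by (rule that[OF G(1,2) _ G(4)]) (use G(3) expand in auto)
qed

text \<open>The oscillations of real and imaginary part add up to that of \<phi>. Each part
  contributes a quarter of \<open>|B'|^2\<close> to the Laplacian, hence the total factor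
  1/2.\<close>

lemma oscillation_potential:
  fixes \<phi> :: "complex \<Rightarrow> complex"
  assumes A: "poisson_A2 w Q" and [measurable]: "\<phi> \<in> borel_measurable borel"
    and i2: "integrable dm (\<lambda>\<zeta>. (norm (\<phi> \<zeta>))\<^sup>2 * w \<zeta>)"
    and B: "B holomorphic_on ball 0 1" "\<And>z. norm z < 1 \<Longrightarrow> poisson_ext \<phi> z = cnj (B z)"
    and osc: "\<And>z. z \<in> ball 0 1 \<Longrightarrow> poisson_ext (\<lambda>\<zeta>. (norm (\<phi> \<zeta> - poisson_ext \<phi> z))\<^sup>2 * w \<zeta>) z \<le> \<kappa> * m z"
  obtains G g lG where "jet G g lG"
    "\<And>z. z \<in> ball 0 1 \<Longrightarrow> 0 \<le> G z"
    "\<And>z. z \<in> ball 0 1 \<Longrightarrow> G z \<le> 2 * (1 + 8 * Q\<^sup>2) * Q * (\<kappa> * m z)"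
    "\<And>z. z \<in> ball 0 1 \<Longrightarrow> lG z \<le> - ((cmod (deriv B z))\<^sup>2 * poisson_ext w z / 2)"
proof -
  have w: "AE \<zeta> in dm. 0 < w \<zeta>" "integrable dm w" "integrable dm (inv_weight w)" and [measurable]: "w \<in> borel_measurable borel"
    using A by (auto simp: poisson_A2_def)
  have Q: "Q > 0"
  proof -
    obtain \<omega> \<eta> where hp: "harmonic_pair (poisson_ext w) (poisson_ext (inv_weight w)) \<omega> \<eta> Q"
      by (rule poisson_A2_harmonic_pair[OF A])
    then show ?thesis using harmonic_pair.Q_ge by fastforce
  qed
  have i1: "integrable dm \<phi>" by (rule weighted_integrable[OF _ w(1,3) i2]) measurable
  have dom: "integrable dm (\<lambda>\<zeta>. (g \<zeta>)\<^sup>2 * w \<zeta>)" if [measurable]: "g \<in> borel_measurable borel" and "\<And>\<zeta>. \<bar>g \<zeta>\<bar> \<le> norm (\<phi> \<zeta>)" for g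
  proof (rule Bochner_Integration.integrable_bound[OF i2])
    show "AE \<zeta> in dm. norm ((g \<zeta>)\<^sup>2 * w \<zeta>) \<le> norm ((norm (\<phi> \<zeta>))\<^sup>2 * w \<zeta>)"
      using w(1) by eventually_elim (use that(2) in \<open>auto simp: abs_mult power2_le_iff_abs_le intro!: mult_right_mono\<close>)
  qed measurable
  have iR: "integrable dm (\<lambda>\<zeta>. (Re (\<phi> \<zeta>))\<^sup>2 * w \<zeta>)" and iI: "integrable dm (\<lambda>\<zeta>. (Im (\<phi> \<zeta>))\<^sup>2 * w \<zeta>)"
    by (rule dom; simp add: abs_Re_le_cmod abs_Im_le_cmod)+
  have j1: "jet (poisson_ext (\<lambda>\<zeta>. Re (\<phi> \<zeta>))) (\<lambda>z. deriv B z / 2) (\<lambda>_. 0)"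
    by (rule jet_cong[OF jet_Re[OF B(1)]]) (use i1 B(2) in \<open>auto simp: poisson_ext_Re\<close>)
  \<comment> \<open>\<phi> extends to the conjugate of \<open>B\<close>, so the imaginary part
    changes sign.\<close>
  have j2: "jet (poisson_ext (\<lambda>\<zeta>. Im (\<phi> \<zeta>))) (\<lambda>z. of_real (-1) * (- \<i> * deriv B z / 2)) (\<lambda>_. 0)"
    by (rule jet_cong[OF jet_cmult[OF jet_Im[OF B(1)], of "-1"]]) (use i1 B(2) in \<open>auto simp: poisson_ext_Im\<close>)
  obtain G1 g1 l1 where 1: "jet G1 g1 l1"
    "\<And>z. z \<in> ball 0 1 \<Longrightarrow> 0 \<le> G1 z"
    "\<And>z. z \<in> ball 0 1 \<Longrightarrow> G1 z \<le> 2 * (1 + 8 * Q\<^sup>2) * Q * poisson_ext (\<lambda>\<zeta>. (Re (\<phi> \<zeta>) - poisson_ext (\<lambda>\<zeta>. Re (\<phi> \<zeta>)) z)\<^sup>2 * w \<zeta>) z"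
    "\<And>z. z \<in> ball 0 1 \<Longrightarrow> l1 z \<le> - ((cmod (deriv B z / 2))\<^sup>2 * poisson_ext w z)"
    by (rule oscillation_potential_real[OF A _ integrable_Re[OF i1] iR j1]; (assumption | rule that | measurable))
  obtain G2 g2 l2 where 2: "jet G2 g2 l2"
    "\<And>z. z \<in> ball 0 1 \<Longrightarrow> 0 \<le> G2 z"
    "\<And>z. z \<in> ball 0 1 \<Longrightarrow> G2 z \<le> 2 * (1 + 8 * Q\<^sup>2) * Q * poisson_ext (\<lambda>\<zeta>. (Im (\<phi> \<zeta>) - poisson_ext (\<lambda>\<zeta>. Im (\<phi> \<zeta>)) z)\<^sup>2 * w \<zeta>) z"
    "\<And>z. z \<in> ball 0 1 \<Longrightarrow> l2 z \<le> - ((cmod (of_real (-1) * (- \<i> * deriv B z / 2)))\<^sup>2 * poisson_ext w z)"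
    by (rule oscillation_potential_real[OF A _ integrable_Im[OF i1] iI j2]; (assumption | rule that | measurable))
  have intc: "integrable dm (\<lambda>\<zeta>. (Re (\<phi> \<zeta>) - c)\<^sup>2 * w \<zeta>)" "integrable dm (\<lambda>\<zeta>. (Im (\<phi> \<zeta>) - c)\<^sup>2 * w \<zeta>)" for c
  proof -
    have bnd: "integrable dm (\<lambda>\<zeta>. (g \<zeta> - c)\<^sup>2 * w \<zeta>)" if "integrable dm (\<lambda>\<zeta>. (g \<zeta>)\<^sup>2 * w \<zeta>)"
      and [measurable]: "g \<in> borel_measurable borel" for g
    proof (rule Bochner_Integration.integrable_bound)
      show "integrable dm (\<lambda>\<zeta>. 2 * ((g \<zeta>)\<^sup>2 * w \<zeta>) + 2 * c\<^sup>2 * w \<zeta>)" using that w(2) by simp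
      show "AE \<zeta> in dm. norm ((g \<zeta> - c)\<^sup>2 * w \<zeta>) \<le> norm (2 * ((g \<zeta>)\<^sup>2 * w \<zeta>) + 2 * c\<^sup>2 * w \<zeta>)"
        using w(1)
      proof eventually_elim
        case (elim \<zeta>)
        have "0 \<le> (g \<zeta> + c)\<^sup>2" by simp
        hence "(g \<zeta> - c)\<^sup>2 \<le> 2 * (g \<zeta>)\<^sup>2 + 2 * c\<^sup>2" by (simp add: power2_eq_square algebra_simps)
        hence "(g \<zeta> - c)\<^sup>2 * w \<zeta> \<le> (2 * (g \<zeta>)\<^sup>2 + 2 * c\<^sup>2) * w \<zeta>" using elim by (intro mult_right_mono) auto
        thus ?case using elim by (simp add: algebra_simps)
      qed
    qed measurable
    show "integrable dm (\<lambda>\<zeta>. (Re (\<phi> \<zeta>) - c)\<^sup>2 * w \<zeta>)" by (rule bnd[OF iR]) measurable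
    show "integrable dm (\<lambda>\<zeta>. (Im (\<phi> \<zeta>) - c)\<^sup>2 * w \<zeta>)" by (rule bnd[OF iI]) measurable
  qed
  show ?thesis
  proof (rule that[OF jet_add[OF 1(1) 2(1)]])
    fix z :: complex assume z: "z \<in> ball 0 1"
    hence nz: "norm z < 1" by simp
    show "0 \<le> G1 z + G2 z" using 1(2)[OF z] 2(2)[OF z] by simp
    define C where "C = 2 * (1 + 8 * Q\<^sup>2) * Q"
    have "C > 0" unfolding C_def using Q by (intro mult_pos_pos add_pos_nonneg) auto
    have "poisson_ext (\<lambda>\<zeta>. (norm (\<phi> \<zeta> - poisson_ext \<phi> z))\<^sup>2 * w \<zeta>) z =
      poisson_ext (\<lambda>\<zeta>. 1 * ((Re (\<phi> \<zeta>) - Re (poisson_ext \<phi> z))\<^sup>2 * w \<zeta>) + 1 * ((Im (\<phi> \<zeta>) - Im (poisson_ext \<phi> z))\<^sup>2 * w \<zeta>)) z"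
      unfolding cmod_power2 by (simp add: algebra_simps)
    also have "\<dots> = poisson_ext (\<lambda>\<zeta>. (Re (\<phi> \<zeta>) - Re (poisson_ext \<phi> z))\<^sup>2 * w \<zeta>) z + poisson_ext (\<lambda>\<zeta>. (Im (\<phi> \<zeta>)
      - Im (poisson_ext \<phi> z))\<^sup>2 * w \<zeta>) z"
      by (subst poisson_ext_lincomb[OF intc(1) intc(2) nz]) simp
    finally have "G1 z + G2 z \<le> C * poisson_ext (\<lambda>\<zeta>. (norm (\<phi> \<zeta> - poisson_ext \<phi> z))\<^sup>2 * w \<zeta>) z"
      using 1(3)[OF z] 2(3)[OF z] poisson_ext_Re[OF i1 nz] poisson_ext_Im[OF i1 nz] by (simp add: C_def algebra_simps)
    also have "\<dots> \<le> C * (\<kappa> * m z)" using \<open>C > 0\<close> by (intro mult_left_mono osc z) auto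
    finally show "G1 z + G2 z \<le> 2 * (1 + 8 * Q\<^sup>2) * Q * (\<kappa> * m z)" by (simp add: C_def)
    have "(cmod (deriv B z / 2))\<^sup>2 = (cmod (deriv B z))\<^sup>2 / 4" "(cmod (of_real (-1) * (- \<i> * deriv B z / 2)))\<^sup>2
      = (cmod (deriv B z))\<^sup>2 / 4"
      by (simp_all add: norm_divide norm_mult power_divide)
    note e = this
    show "l1 z + l2 z \<le> - ((cmod (deriv B z))\<^sup>2 * poisson_ext w z / 2)"
      using 1(4)[OF z] 2(4)[OF z] unfolding e by simp
  qed
qed

text \<open>In \<open>hankel_form_disc\<close> the first pair is mu with its reciprocal and the
  second is 1/lam with lam. Condition \<open>o1\<close> supplies a potential of
  \<open>|B'|^2 lam\<close> below mu, condition \<open>o2\<close> one of \<open>|B'|^2 / mu\<close>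
  below 1/lam; these are precisely the two crossed embeddings.\<close>

theorem hankel_form_bounded:
  fixes \<phi> :: "complex \<Rightarrow> complex"
  assumes A1: "poisson_A2 mu Q1" and A2: "poisson_A2 lam Q2" and [measurable]: "\<phi> \<in> borel_measurable borel"
    and il: "integrable dm (\<lambda>\<zeta>. (norm (\<phi> \<zeta>))\<^sup>2 * lam \<zeta>)"
    and im: "integrable dm (\<lambda>\<zeta>. (norm (\<phi> \<zeta>))\<^sup>2 * inv_weight mu \<zeta>)"
    and B: "B holomorphic_on ball 0 1" "B 0 = 0" "\<And>z. norm z < 1 \<Longrightarrow> poisson_ext \<phi> z = cnj (B z)"
    and k: "\<kappa> > 0"
    and o1: "\<And>z. z \<in> ball 0 1 \<Longrightarrow> poisson_ext (\<lambda>\<zeta>. (norm (\<phi> \<zeta> - poisson_ext \<phi> z))\<^sup>2 * lam \<zeta>) z \<le> \<kappa> * poisson_ext mu z"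
    and o2: "\<And>z. z \<in> ball 0 1 \<Longrightarrow> poisson_ext (\<lambda>\<zeta>. (norm (\<phi> \<zeta> - poisson_ext \<phi> z))\<^sup>2 * inv_weight mu \<zeta>) z
      \<le> \<kappa> * poisson_ext (inv_weight lam) z"
  obtains C where "C > 0"
    "\<And>f h r. f holomorphic_on ball 0 1 \<Longrightarrow> h holomorphic_on ball 0 1 \<Longrightarrow> f \<in> borel_measurable borel \<Longrightarrow> h \<in> borel_measurable borel \<Longrightarrow>
       integrable dm (\<lambda>\<zeta>. (norm (f \<zeta>))\<^sup>2 * mu \<zeta>) \<Longrightarrow> integrable dm (\<lambda>\<zeta>. (norm (h \<zeta>))\<^sup>2 * inv_weight lam \<zeta>) \<Longrightarrow>
       (\<And>z. norm z < 1 \<Longrightarrow> poisson_ext f z = f z) \<Longrightarrow> (\<And>z. norm z < 1 \<Longrightarrow> poisson_ext h z = h z) \<Longrightarrow> 0 \<le> r \<Longrightarrow> r < 1 \<Longrightarrow>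
       Re (\<integral>\<zeta>. poisson_ext \<phi> (of_real r * \<zeta>) * (f (of_real r * \<zeta>) * h (of_real r * \<zeta>)) \<partial>dm)
         \<le> C * ((\<integral>\<zeta>. (norm (f \<zeta>))\<^sup>2 * mu \<zeta> \<partial>dm) + (\<integral>\<zeta>. (norm (h \<zeta>))\<^sup>2 * inv_weight lam \<zeta> \<partial>dm))"
proof -
  note A1' = poisson_A2_inv[OF A1] and A2' = poisson_A2_inv[OF A2]
  obtain \<omega>1 \<eta>1 where hp1: "harmonic_pair (poisson_ext mu) (poisson_ext (inv_weight mu)) \<omega>1 \<eta>1 Q1"
    by (rule poisson_A2_harmonic_pair[OF A1])
  obtain \<omega>2 \<eta>2 where hp2: "harmonic_pair (poisson_ext (inv_weight lam)) (poisson_ext lam) \<omega>2 \<eta>2 Q2"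
    by (rule poisson_A2_harmonic_pair[OF A2', unfolded inv_weight_inv_weight])
  interpret one: harmonic_pair "poisson_ext mu" "poisson_ext (inv_weight mu)" \<omega>1 \<eta>1 Q1 by (rule hp1)
  interpret two: harmonic_pair "poisson_ext (inv_weight lam)" "poisson_ext lam" \<omega>2 \<eta>2 Q2 by (rule hp2)
  obtain G1 g1 l1 where G1: "jet G1 g1 l1"
    "\<And>z. z \<in> ball 0 1 \<Longrightarrow> 0 \<le> G1 z"
    "\<And>z. z \<in> ball 0 1 \<Longrightarrow> G1 z \<le> 2 * (1 + 8 * Q2\<^sup>2) * Q2 * (\<kappa> * poisson_ext mu z)"
    "\<And>z. z \<in> ball 0 1 \<Longrightarrow> l1 z \<le> - ((cmod (deriv B z))\<^sup>2 * poisson_ext lam z / 2)"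
    by (rule oscillation_potential[OF A2 _ il B(1,3) o1]; (assumption | rule that | measurable))
  obtain G2 g2 l2 where G2: "jet G2 g2 l2"
    "\<And>z. z \<in> ball 0 1 \<Longrightarrow> 0 \<le> G2 z"
    "\<And>z. z \<in> ball 0 1 \<Longrightarrow> G2 z \<le> 2 * (1 + 8 * Q1\<^sup>2) * Q1 * (\<kappa> * poisson_ext (inv_weight lam) z)"
    "\<And>z. z \<in> ball 0 1 \<Longrightarrow> l2 z \<le> - ((cmod (deriv B z))\<^sup>2 * poisson_ext (inv_weight mu) z / 2)"
    by (rule oscillation_potential[OF A1' _ im B(1,3) o2]; (assumption | rule that | measurable))
  \<comment> \<open>The sum of the two domination constants, so that one number serves both
    potentials.\<close>
  define \<kappa>' where "\<kappa>' = 2 * (1 + 8 * Q1\<^sup>2) * Q1 * \<kappa> + 2 * (1 + 8 * Q2\<^sup>2) * Q2 * \<kappa>"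
  have p: "2 * (1 + 8 * Q1\<^sup>2) * Q1 * \<kappa> > 0" "2 * (1 + 8 * Q2\<^sup>2) * Q2 * \<kappa> > 0"
    using one.Q_ge two.Q_ge k by (intro mult_pos_pos add_pos_nonneg; simp)+
  hence k': "\<kappa>' > 0" unfolding \<kappa>'_def by simp
  have G1b: "G1 z \<le> \<kappa>' * poisson_ext mu z" if "z \<in> ball 0 1" for z
  proof -
    have "G1 z \<le> (2 * (1 + 8 * Q2\<^sup>2) * Q2 * \<kappa>) * poisson_ext mu z" using G1(3)[OF that] by (simp add: mult.assoc)
    also have "\<dots> \<le> \<kappa>' * poisson_ext mu z" using p one.w_pos[OF that] by (intro mult_right_mono) (auto simp: \<kappa>'_def)
    finally show ?thesis .
  qed
  have G2b: "G2 z \<le> \<kappa>' * poisson_ext (inv_weight lam) z" if "z \<in> ball 0 1" for z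
  proof -
    have "G2 z \<le> (2 * (1 + 8 * Q1\<^sup>2) * Q1 * \<kappa>) * poisson_ext (inv_weight lam) z" using G2(3)[OF that] by (simp add: mult.assoc)
    also have "\<dots> \<le> \<kappa>' * poisson_ext (inv_weight lam) z" using p two.w_pos[OF that] by (intro mult_right_mono) (auto simp: \<kappa>'_def)
    finally show ?thesis .
  qed
  define K where "K = 1 + (8 + 16 * \<kappa>') * (Q1\<^sup>2 + Q2\<^sup>2)"
  have K: "K > 0" using k' unfolding K_def by (intro add_pos_nonneg mult_nonneg_nonneg) auto
  have wl: "AE \<zeta> in dm. 0 < lam \<zeta>" "integrable dm (inv_weight lam)" using A2 by (auto simp: poisson_A2_def)
  have iphi: "integrable dm \<phi>" by (rule weighted_integrable[OF _ wl il]) measurable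
  show ?thesis
  proof (rule that[of "K * (Q1 + Q2)"])
    show "K * (Q1 + Q2) > 0" using K one.Q_ge two.Q_ge by simp
    fix f h r
    assume hol: "f holomorphic_on ball 0 1" "h holomorphic_on ball 0 1"
      and [measurable]: "f \<in> borel_measurable borel" "h \<in> borel_measurable borel"
      and i: "integrable dm (\<lambda>\<zeta>. (norm (f \<zeta>))\<^sup>2 * mu \<zeta>)" "integrable dm (\<lambda>\<zeta>. (norm (h \<zeta>))\<^sup>2 * inv_weight lam \<zeta>)"
      and P: "\<And>z. norm z < 1 \<Longrightarrow> poisson_ext f z = f z" "\<And>z. norm z < 1 \<Longrightarrow> poisson_ext h z = h z"
      and r: "0 \<le> r" "r < (1::real)"
    have nr: "norm (of_real r * cis t) < 1" for t using r by (simp add: norm_mult)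
    have c: "continuous_on (ball 0 1) (\<lambda>z. poisson_ext \<phi> z * (f z * h z))"
      by (intro continuous_intros continuous_on_poisson_ext iphi holomorphic_on_imp_continuous_on hol)
    have m: "(\<lambda>z. Re (poisson_ext \<phi> z * (f z * h z))) \<in> borel_measurable borel" by measurable
    have "Re (\<integral>\<zeta>. poisson_ext \<phi> (of_real r * \<zeta>) * (f (of_real r * \<zeta>) * h (of_real r * \<zeta>)) \<partial>dm) =
       (\<integral>\<zeta>. Re (poisson_ext \<phi> (of_real r * \<zeta>) * (f (of_real r * \<zeta>) * h (of_real r * \<zeta>))) \<partial>dm)"
    proof (rule integral_Re[symmetric])
      obtain M where "\<And>\<zeta>. norm \<zeta> = 1 \<Longrightarrow> norm (poisson_ext \<phi> (of_real r * \<zeta>) * (f (of_real r * \<zeta>) * h (of_real r * \<zeta>))) \<le> M"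
        by (rule circle_bounded[OF c r]; rule that)
      thus "integrable dm (\<lambda>\<zeta>. poisson_ext \<phi> (of_real r * \<zeta>) * (f (of_real r * \<zeta>) * h (of_real r * \<zeta>)))"
        by (intro integrable_dm_bounded) auto
    qed
    hence "2 * pi * Re (\<integral>\<zeta>. poisson_ext \<phi> (of_real r * \<zeta>) * (f (of_real r * \<zeta>) * h (of_real r * \<zeta>)) \<partial>dm) =
       integral {0..2*pi} (\<lambda>t. Re (poisson_ext \<phi> (of_real r * cis t) * (f (of_real r * cis t) * h (of_real r * cis t))))"
      using circle_mean_integral[OF m continuous_on_Re[OF c] r] by (simp only: real_scaleR_def)
    also have "\<dots> = integral {0..2*pi} (\<lambda>t. Re (cnj (B (of_real r * cis t)) * (f (of_real r * cis t) * h (of_real r * cis t))))"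
      using B(3)[OF nr] by simp
    also have "\<dots> \<le> K * integral {0..2*pi} (\<lambda>t. (cmod (f (of_real r * cis t)))\<^sup>2 * poisson_ext mu (of_real r * cis t) +
           (cmod (h (of_real r * cis t)))\<^sup>2 * poisson_ext (inv_weight lam) (of_real r * cis t))"
      unfolding K_def by (rule hankel_form_disc[OF hp1 hp2 B(1) hol B(2) k' G1(1,2) G1b G1(4) G2(1,2) G2b G2(4) r])
    also have "\<dots> = K * integral {0..2*pi} (\<lambda>t. (norm (poisson_ext f (of_real r * cis t)))\<^sup>2 * poisson_ext mu (of_real r * cis t) +
           (norm (poisson_ext h (of_real r * cis t)))\<^sup>2 * poisson_ext (inv_weight lam) (of_real r * cis t))"
      unfolding P(1)[OF nr] P(2)[OF nr] ..
    also have "\<dots> \<le> K * (2 * pi * Q1 * (\<integral>\<zeta>. (norm (f \<zeta>))\<^sup>2 * mu \<zeta> \<partial>dm) + 2 * pi * Q2 * (\<integral>\<zeta>. (norm (h \<zeta>))\<^sup>2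
      * inv_weight lam \<zeta> \<partial>dm))"
      using mean_weighted_bound[OF A1 _ i(1) r] mean_weighted_bound[OF A2' _ i(2) r] K
      by (intro mult_left_mono) (auto simp: Henstock_Kurzweil_Integration.integral_add)
    finally have "2 * pi * Re (\<integral>\<zeta>. poisson_ext \<phi> (of_real r * \<zeta>) * (f (of_real r * \<zeta>) * h (of_real r * \<zeta>)) \<partial>dm)
       \<le> 2 * pi * (K * (Q1 * (\<integral>\<zeta>. (norm (f \<zeta>))\<^sup>2 * mu \<zeta> \<partial>dm) + Q2 * (\<integral>\<zeta>. (norm (h \<zeta>))\<^sup>2 * inv_weight lam \<zeta> \<partial>dm)))"
      by (simp only: algebra_simps)
    hence 1: "Re (\<integral>\<zeta>. poisson_ext \<phi> (of_real r * \<zeta>) * (f (of_real r * \<zeta>) * h (of_real r * \<zeta>)) \<partial>dm)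
       \<le> K * (Q1 * (\<integral>\<zeta>. (norm (f \<zeta>))\<^sup>2 * mu \<zeta> \<partial>dm) + Q2 * (\<integral>\<zeta>. (norm (h \<zeta>))\<^sup>2 * inv_weight lam \<zeta> \<partial>dm))"
      by (subst (asm) mult_le_cancel_left_pos) auto
    have n1: "0 \<le> (\<integral>\<zeta>. (norm (f \<zeta>))\<^sup>2 * mu \<zeta> \<partial>dm)"
      using A1 by (intro integral_nonneg_AE) (auto simp: poisson_A2_def elim!: eventually_mono)
    have n2: "0 \<le> (\<integral>\<zeta>. (norm (h \<zeta>))\<^sup>2 * inv_weight lam \<zeta> \<partial>dm)"
      using A2' by (intro integral_nonneg_AE) (auto simp: poisson_A2_def elim!: eventually_mono)
    have "Q1 * (\<integral>\<zeta>. (norm (f \<zeta>))\<^sup>2 * mu \<zeta> \<partial>dm) + Q2 * (\<integral>\<zeta>. (norm (h \<zeta>))\<^sup>2 * inv_weight lam \<zeta> \<partial>dm)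
        \<le> (Q1 + Q2) * (\<integral>\<zeta>. (norm (f \<zeta>))\<^sup>2 * mu \<zeta> \<partial>dm) + (Q1 + Q2) * (\<integral>\<zeta>. (norm (h \<zeta>))\<^sup>2 * inv_weight lam \<zeta> \<partial>dm)"
      using n1 n2 one.Q_ge two.Q_ge by (intro add_mono mult_right_mono) auto
    hence "K * (Q1 * (\<integral>\<zeta>. (norm (f \<zeta>))\<^sup>2 * mu \<zeta> \<partial>dm) + Q2 * (\<integral>\<zeta>. (norm (h \<zeta>))\<^sup>2 * inv_weight lam \<zeta> \<partial>dm))
        \<le> K * ((Q1 + Q2) * ((\<integral>\<zeta>. (norm (f \<zeta>))\<^sup>2 * mu \<zeta> \<partial>dm) + (\<integral>\<zeta>. (norm (h \<zeta>))\<^sup>2 * inv_weight lam \<zeta> \<partial>dm)))"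
      using K by (intro mult_left_mono) (auto simp: algebra_simps)
    with 1 show "Re (\<integral>\<zeta>. poisson_ext \<phi> (of_real r * \<zeta>) * (f (of_real r * \<zeta>) * h (of_real r * \<zeta>)) \<partial>dm)
         \<le> K * (Q1 + Q2) * ((\<integral>\<zeta>. (norm (f \<zeta>))\<^sup>2 * mu \<zeta> \<partial>dm) + (\<integral>\<zeta>. (norm (h \<zeta>))\<^sup>2 * inv_weight lam \<zeta> \<partial>dm))"
      by (simp add: mult.assoc)
  qed
qed

section \<open>Weighted norms and the orthogonal projection\<close>

lemma sqnormL2_eq_integral:
  assumes [measurable]: "f \<in> borel_measurable borel" "w \<in> borel_measurable borel" and w: "AE \<zeta> in dm. 0 \<le> w \<zeta>"
    and i: "integrable dm (\<lambda>\<zeta>. (norm (f \<zeta>))\<^sup>2 * w \<zeta>)"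
  shows "sqnormL2 w f = ennreal (\<integral>\<zeta>. (norm (f \<zeta>))\<^sup>2 * w \<zeta> \<partial>dm)"
  unfolding sqnormL2_def by (rule nn_integral_eq_integral[OF i]) (use w in \<open>auto elim: eventually_mono\<close>)

lemma sqnormL2_finite_iff:
  assumes [measurable]: "f \<in> borel_measurable borel" "w \<in> borel_measurable borel" and w: "AE \<zeta> in dm. 0 \<le> w \<zeta>"
  shows "sqnormL2 w f < \<infinity> \<longleftrightarrow> integrable dm (\<lambda>\<zeta>. (norm (f \<zeta>))\<^sup>2 * w \<zeta>)"
proof
  assume "sqnormL2 w f < \<infinity>"
  thus "integrable dm (\<lambda>\<zeta>. (norm (f \<zeta>))\<^sup>2 * w \<zeta>)"
    unfolding sqnormL2_def using w by (intro integrableI_nonneg) (auto elim: eventually_mono)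
qed (simp add: sqnormL2_eq_integral[OF assms])

lemma sqnormL2_cong_AE:
  assumes "AE \<zeta> in dm. f \<zeta> = g \<zeta>" shows "sqnormL2 w f = sqnormL2 w g"
  unfolding sqnormL2_def by (rule nn_integral_cong_AE) (use assms in \<open>auto elim: eventually_mono\<close>)

lemma sqnormL2_add_le:
  assumes [measurable]: "f \<in> borel_measurable borel" "g \<in> borel_measurable borel" "w \<in> borel_measurable borel"
    and w: "AE \<zeta> in dm. 0 \<le> w \<zeta>"
  shows "sqnormL2 w (\<lambda>\<zeta>. f \<zeta> + g \<zeta>) \<le> 2 * sqnormL2 w f + 2 * sqnormL2 w g"
proof -
  have "sqnormL2 w (\<lambda>\<zeta>. f \<zeta> + g \<zeta>) \<le> (\<integral>\<^sup>+\<zeta>. 2 * ennreal ((norm (f \<zeta>))\<^sup>2 * w \<zeta>) + 2 * ennreal ((norm (g \<zeta>))\<^sup>2 * w \<zeta>) \<partial>dm)"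
    unfolding sqnormL2_def
  proof (rule nn_integral_mono_AE)
    show "AE \<zeta> in dm. ennreal ((cmod (f \<zeta> + g \<zeta>))\<^sup>2 * w \<zeta>)
      \<le> 2 * ennreal ((norm (f \<zeta>))\<^sup>2 * w \<zeta>) + 2 * ennreal ((norm (g \<zeta>))\<^sup>2 * w \<zeta>)"
      using w
    proof eventually_elim
      case (elim \<zeta>)
      have "(norm (f \<zeta> + g \<zeta>))\<^sup>2 \<le> (norm (f \<zeta>) + norm (g \<zeta>))\<^sup>2" by (intro power_mono norm_triangle_ineq) auto
      also have "\<dots> \<le> 2 * (norm (f \<zeta>))\<^sup>2 + 2 * (norm (g \<zeta>))\<^sup>2" using sum_squares_bound[of "norm (f \<zeta>)" "norm (g \<zeta>)"]
        by (simp add: power2_sum)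
      finally have "(norm (f \<zeta> + g \<zeta>))\<^sup>2 * w \<zeta> \<le> (2 * (norm (f \<zeta>))\<^sup>2 + 2 * (norm (g \<zeta>))\<^sup>2) * w \<zeta>"
        using elim by (intro mult_right_mono) auto
      hence "ennreal ((norm (f \<zeta> + g \<zeta>))\<^sup>2 * w \<zeta>) \<le> ennreal (2 * ((norm (f \<zeta>))\<^sup>2 * w \<zeta>) + 2 * ((norm (g \<zeta>))\<^sup>2 * w \<zeta>))"
        by (intro ennreal_leI) (simp add: algebra_simps)
      also have "\<dots> = 2 * ennreal ((norm (f \<zeta>))\<^sup>2 * w \<zeta>) + 2 * ennreal ((norm (g \<zeta>))\<^sup>2 * w \<zeta>)"
        using elim by (simp add: ennreal_plus ennreal_mult' del: ennreal_plus[symmetric])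
      finally show ?case .
    qed
  qed
  also have "\<dots> = 2 * sqnormL2 w f + 2 * sqnormL2 w g"
    unfolding sqnormL2_def by (subst nn_integral_add) (auto simp: nn_integral_cmult)
  finally show ?thesis .
qed

lemma sqnormL2_cmult:
  assumes [measurable]: "f \<in> borel_measurable borel" "w \<in> borel_measurable borel"
  shows "sqnormL2 w (\<lambda>\<zeta>. a * f \<zeta>) = ennreal ((norm a)\<^sup>2) * sqnormL2 w f"
  unfolding sqnormL2_def
  by (subst nn_integral_cmult[symmetric]) (auto simp: norm_mult power_mult_distrib mult.assoc ennreal_mult')

lemma sqnormL2_lincomb_le:
  assumes [measurable]: "f \<in> borel_measurable borel" "g \<in> borel_measurable borel" "w \<in> borel_measurable borel"
    and w: "AE \<zeta> in dm. 0 \<le> w \<zeta>"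
  shows "sqnormL2 w (\<lambda>\<zeta>. a * f \<zeta> + b * g \<zeta>) \<le> ennreal (2 * (norm a)\<^sup>2) * sqnormL2 w f + ennreal (2 * (norm b)\<^sup>2) * sqnormL2 w g"
  using sqnormL2_add_le[of "\<lambda>\<zeta>. a * f \<zeta>" "\<lambda>\<zeta>. b * g \<zeta>" w] w
  by (simp add: sqnormL2_cmult ennreal_mult mult.assoc)

text \<open>The summand 1 in the denominator covers the case that both coefficients vanish.\<close>

lemma ennreal_small_lincomb:
  assumes "0 < \<epsilon>" "0 \<le> A" "0 \<le> B" and x: "x < ennreal (\<epsilon> / (A + B + 1))" and y: "y < ennreal (\<epsilon> / (A + B + 1))"
  shows "ennreal A * x + ennreal B * y < ennreal \<epsilon>"
proof -
  define d where "d = \<epsilon> / (A + B + 1)"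
  have d: "d > 0" using assms by (simp add: d_def add_nonneg_pos)
  have "ennreal A * x + ennreal B * y \<le> ennreal A * ennreal d + ennreal B * ennreal d"
    using x y by (intro add_mono mult_left_mono) (auto simp: d_def)
  also have "\<dots> = ennreal ((A + B) * d)" using assms d
    by (simp add: ennreal_mult[symmetric] ennreal_plus[symmetric] algebra_simps del: ennreal_plus)
  also have "\<dots> < ennreal \<epsilon>"
  proof (rule ennreal_lessI[OF assms(1)])
    have "(A + B) * d < (A + B + 1) * d" using d by (intro mult_strict_right_mono) auto
    also have "\<dots> = \<epsilon>" using assms by (simp add: d_def add_nonneg_pos)
    finally show "(A + B) * d < \<epsilon>" .
  qed
  finally show ?thesis .
qed

lemma closL2_lincomb:
  assumes S: "\<And>p. p \<in> S \<Longrightarrow> p \<in> borel_measurable borel" "\<And>p q a b. p \<in> S \<Longrightarrow> q \<in> S \<Longrightarrow> (\<lambda>x. a * p x + b * q x) \<in> S"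
    and [measurable]: "w \<in> borel_measurable borel" and w: "AE \<zeta> in dm. 0 \<le> w \<zeta>"
    and f: "f \<in> closL2 w S" and g: "g \<in> closL2 w S"
  shows "(\<lambda>x. a * f x + b * g x) \<in> closL2 w S"
proof -
  have [measurable]: "f \<in> borel_measurable borel" "g \<in> borel_measurable borel" and fin: "sqnormL2 w f < \<infinity>" "sqnormL2 w g < \<infinity>"
    using f g by (auto simp: closL2_def L2w_def measurable_cong_sets[OF sets_dm refl])
  note [measurable_dest] = S(1)
  have "sqnormL2 w (\<lambda>x. a * f x + b * g x) \<le> ennreal (2 * (norm a)\<^sup>2) * sqnormL2 w f + ennreal (2 * (norm b)\<^sup>2) * sqnormL2 w g"
    by (rule sqnormL2_lincomb_le) (use w in auto)
  also have "\<dots> < \<infinity>" using fin by (auto simp: ennreal_mult_less_top)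
  finally have 1: "(\<lambda>x. a * f x + b * g x) \<in> L2w w" by (auto simp: L2w_def measurable_cong_sets[OF sets_dm refl])
  have "\<exists>h\<in>S. sqnormL2 w (\<lambda>\<zeta>. a * f \<zeta> + b * g \<zeta> - h \<zeta>) < ennreal \<epsilon>" if e: "\<epsilon> > 0" for \<epsilon>
  proof -
    define d where "d = \<epsilon> / (2 * (norm a)\<^sup>2 + 2 * (norm b)\<^sup>2 + 1)"
    have d: "d > 0" using e by (simp add: d_def add_nonneg_pos)
    from f d obtain p where p: "p \<in> S" "sqnormL2 w (\<lambda>\<zeta>. f \<zeta> - p \<zeta>) < ennreal d" by (auto simp: closL2_def)
    from g d obtain q where q: "q \<in> S" "sqnormL2 w (\<lambda>\<zeta>. g \<zeta> - q \<zeta>) < ennreal d" by (auto simp: closL2_def)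
    have [measurable]: "p \<in> borel_measurable borel" "q \<in> borel_measurable borel" using S(1) p q by auto
    have "sqnormL2 w (\<lambda>\<zeta>. a * f \<zeta> + b * g \<zeta> - (a * p \<zeta> + b * q \<zeta>)) = sqnormL2 w (\<lambda>\<zeta>. a * (f \<zeta> - p \<zeta>) + b * (g \<zeta> - q \<zeta>))"
      by (simp add: algebra_simps)
    also have "\<dots> \<le> ennreal (2 * (norm a)\<^sup>2) * sqnormL2 w (\<lambda>\<zeta>. f \<zeta> - p \<zeta>) + ennreal (2 * (norm b)\<^sup>2) * sqnormL2 w (\<lambda>\<zeta>. g \<zeta> - q \<zeta>)"
      by (rule sqnormL2_lincomb_le) (use w in auto)
    also have "\<dots> < ennreal \<epsilon>"
      using p(2) q(2) e by (intro ennreal_small_lincomb) (auto simp: d_def)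
    finally have L: "sqnormL2 w (\<lambda>\<zeta>. a * f \<zeta> + b * g \<zeta> - (a * p \<zeta> + b * q \<zeta>)) < ennreal \<epsilon>" .
    show ?thesis by (rule bexI[where x="\<lambda>x. a * p x + b * q x"], rule L, rule S(2)[OF p(1) q(1)])
  qed
  with 1 show ?thesis by (auto simp: closL2_def)
qed

section \<open>Polynomials, \<open>H2minus\<close> and the orthogonal projection\<close>

lemma borel_dm: "borel_measurable dm = borel_measurable borel"
  by (rule measurable_cong_sets) auto

lemma antianalytic_polys_measurable: "p \<in> antianalytic_polys \<Longrightarrow> p \<in> borel_measurable borel"
  unfolding antianalytic_polys_def by (auto intro!: borel_measurable_sum)

lemma analytic_polys_measurable: "p \<in> analytic_polys \<Longrightarrow> p \<in> borel_measurable borel"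
  unfolding analytic_polys_def by (auto intro!: borel_measurable_sum)

lemma sum_pad: "(n::nat) \<le> N \<Longrightarrow> (\<Sum>k<n. c k * (e k :: complex)) = (\<Sum>k<N. (if k < n then c k else 0) * e k)"
  by (rule sum.mono_neutral_cong_left) auto

lemma span_lincomb:
  fixes e :: "nat \<Rightarrow> complex \<Rightarrow> complex"
  assumes "p \<in> {(\<lambda>\<zeta>. \<Sum>k<n. c k * e k \<zeta>) | c n. True}" "q \<in> {(\<lambda>\<zeta>. \<Sum>k<n. c k * e k \<zeta>) | c n. True}"
  shows "(\<lambda>x. a * p x + b * q x) \<in> {(\<lambda>\<zeta>. \<Sum>k<n. c k * e k \<zeta>) | c n. True}"
proof -
  from assms obtain c n d m where p: "p = (\<lambda>\<zeta>. \<Sum>k<n. c k * e k \<zeta>)" and q: "q = (\<lambda>\<zeta>. \<Sum>k<m. d k * e k \<zeta>)" by blast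
  define N where "N = max n m"
  have "(\<lambda>x. a * p x + b * q x) = (\<lambda>x. \<Sum>k<N. (a * (if k < n then c k else 0) + b * (if k < m then d k else 0)) * e k x)"
  proof
    fix x
    show "a * p x + b * q x = (\<Sum>k<N. (a * (if k < n then c k else 0) + b * (if k < m then d k else 0)) * e k x)"
      unfolding p q by (subst sum_pad[of n N], simp add: N_def, subst sum_pad[of m N], simp add: N_def)
         (simp only: sum_distrib_left sum.distrib[symmetric] distrib_right mult.assoc)
  qed
  thus ?thesis by (intro CollectI exI[of _ "\<lambda>k. a * (if k < n then c k else 0) + b * (if k
    < m then d k else 0)"] exI[of _ N] conjI TrueI)
qed

lemma antianalytic_polys_lincomb:
  "p \<in> antianalytic_polys \<Longrightarrow> q \<in> antianalytic_polys \<Longrightarrow> (\<lambda>x. a * p x + b * q x) \<in> antianalytic_polys"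
  unfolding antianalytic_polys_def by (rule span_lincomb[where e="\<lambda>k \<zeta>. inverse \<zeta> ^ Suc k"])

lemma analytic_polys_lincomb:
  "p \<in> analytic_polys \<Longrightarrow> q \<in> analytic_polys \<Longrightarrow> (\<lambda>x. a * p x + b * q x) \<in> analytic_polys"
  unfolding analytic_polys_def by (rule span_lincomb[where e="\<lambda>k \<zeta>. \<zeta> ^ k"])

lemma H2minus_lincomb:
  "f \<in> H2minus \<Longrightarrow> g \<in> H2minus \<Longrightarrow> (\<lambda>x. a * f x + b * g x) \<in> H2minus"
  unfolding H2minus_def
  by (rule closL2_lincomb) (auto intro: antianalytic_polys_measurable antianalytic_polys_lincomb)

lemma H2minusD:
  assumes "f \<in> H2minus"
  shows "f \<in> borel_measurable borel" "integrable dm (\<lambda>\<zeta>. (norm (f \<zeta>))\<^sup>2)" "integrable dm f"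
proof -
  show 1: "f \<in> borel_measurable borel" using assms by (auto simp: H2minus_def closL2_def L2w_def borel_dm)
  show 2: "integrable dm (\<lambda>\<zeta>. (norm (f \<zeta>))\<^sup>2)"
    using assms sqnormL2_finite_iff[of f "\<lambda>_. 1"] 1 by (auto simp: H2minus_def closL2_def L2w_def)
  show "integrable dm f"
    by (rule weighted_integrable[where w="\<lambda>_. 1"]) (use 1 2 in \<open>auto simp: inv_weight_def\<close>)
qed

lemma H2minus_approx:
  assumes f: "f \<in> H2minus" and e: "\<epsilon> > 0"
  obtains p where "p \<in> antianalytic_polys" "integrable dm (\<lambda>\<zeta>. (norm (f \<zeta> - p \<zeta>))\<^sup>2)" "(\<integral>\<zeta>. (norm (f \<zeta> - p \<zeta>))\<^sup>2 \<partial>dm) < \<epsilon>"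
proof -
  from f e obtain p where p: "p \<in> antianalytic_polys" "sqnormL2 (\<lambda>_. 1) (\<lambda>\<zeta>. f \<zeta> - p \<zeta>) < ennreal \<epsilon>"
    by (auto simp: H2minus_def closL2_def)
  have [measurable]: "f \<in> borel_measurable borel" "p \<in> borel_measurable borel"
    using H2minusD(1)[OF f] antianalytic_polys_measurable[OF p(1)] by auto
  have "sqnormL2 (\<lambda>_. 1) (\<lambda>\<zeta>. f \<zeta> - p \<zeta>) < \<infinity>" using p(2) by (auto intro: less_trans)
  hence i: "integrable dm (\<lambda>\<zeta>. (norm (f \<zeta> - p \<zeta>))\<^sup>2)" by (subst (asm) sqnormL2_finite_iff) auto
  have "ennreal (\<integral>\<zeta>. (norm (f \<zeta> - p \<zeta>))\<^sup>2 \<partial>dm) < ennreal \<epsilon>"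
    using p(2) i by (subst (asm) sqnormL2_eq_integral) auto
  hence "(\<integral>\<zeta>. (norm (f \<zeta> - p \<zeta>))\<^sup>2 \<partial>dm) < \<epsilon>" using e by (simp add: ennreal_less_iff)
  thus ?thesis using that p(1) i by blast
qed

lemma L1_le_L2:
  fixes u :: "complex \<Rightarrow> complex"
  assumes [measurable]: "u \<in> borel_measurable borel" and i: "integrable dm (\<lambda>\<zeta>. (norm (u \<zeta>))\<^sup>2)"
  shows "integrable dm u" "(\<integral>\<zeta>. norm (u \<zeta>) \<partial>dm)\<^sup>2 \<le> (\<integral>\<zeta>. (norm (u \<zeta>))\<^sup>2 \<partial>dm)"
proof -
  show iu: "integrable dm u"
    by (rule weighted_integrable[where w="\<lambda>_. 1"]) (use i in \<open>auto simp: inv_weight_def\<close>)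
  have "(poisson_ext (\<lambda>\<zeta>. norm (u \<zeta>)) 0)\<^sup>2 \<le> poisson_ext (inv_weight (\<lambda>_. 1)) 0 * poisson_ext (\<lambda>\<zeta>. (norm (u \<zeta>))\<^sup>2 * 1) 0"
    by (rule poisson_ext_Cauchy_Schwarz) (use iu i in \<open>auto simp: inv_weight_def\<close>)
  thus "(\<integral>\<zeta>. norm (u \<zeta>) \<partial>dm)\<^sup>2 \<le> (\<integral>\<zeta>. (norm (u \<zeta>))\<^sup>2 \<partial>dm)"
    by (simp add: poisson_ext_def Poisson_def inv_weight_def)
qed

lemma inverse_circle: "norm \<zeta> = 1 \<Longrightarrow> inverse \<zeta> = cnj (\<zeta>::complex)"
  by (rule inverse_unique) (simp add: complex_norm_square[symmetric])

text \<open>Cauchy-Schwarz with a free scale t in place of square roots; it follows from the square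
  of \<open>t |u| - |v|\<close>.\<close>

lemma integrable_L2_mult:
  fixes u v :: "complex \<Rightarrow> complex"
  assumes [measurable]: "u \<in> borel_measurable borel" "v \<in> borel_measurable borel"
    and i: "integrable dm (\<lambda>\<zeta>. (norm (u \<zeta>))\<^sup>2)" "integrable dm (\<lambda>\<zeta>. (norm (v \<zeta>))\<^sup>2)" and t: "t > 0"
  shows "integrable dm (\<lambda>\<zeta>. u \<zeta> * v \<zeta>)"
    "norm (\<integral>\<zeta>. u \<zeta> * v \<zeta> \<partial>dm) \<le> t * (\<integral>\<zeta>. (norm (u \<zeta>))\<^sup>2 \<partial>dm) + (\<integral>\<zeta>. (norm (v \<zeta>))\<^sup>2 \<partial>dm) / t"
proof -
  have b: "norm (u \<zeta> * v \<zeta>) \<le> t * (norm (u \<zeta>))\<^sup>2 + (norm (v \<zeta>))\<^sup>2 / t" for \<zeta>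
  proof -
    have "0 \<le> (t * norm (u \<zeta>) - norm (v \<zeta>))\<^sup>2 / t" using t by simp
    also have "\<dots> = t * (norm (u \<zeta>))\<^sup>2 - 2 * norm (u \<zeta>) * norm (v \<zeta>) + (norm (v \<zeta>))\<^sup>2 / t"
      using t by (simp add: power2_eq_square field_simps)
    finally have "2 * (norm (u \<zeta>) * norm (v \<zeta>)) \<le> t * (norm (u \<zeta>))\<^sup>2 + (norm (v \<zeta>))\<^sup>2 / t" by simp
    moreover have "0 \<le> norm (u \<zeta>) * norm (v \<zeta>)" by simp
    ultimately show ?thesis unfolding norm_mult by linarith
  qed
  have ib: "integrable dm (\<lambda>\<zeta>. t * (norm (u \<zeta>))\<^sup>2 + (norm (v \<zeta>))\<^sup>2 / t)" using i by simp
  show iuv: "integrable dm (\<lambda>\<zeta>. u \<zeta> * v \<zeta>)"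
  proof (rule Bochner_Integration.integrable_bound[OF ib])
    show "AE \<zeta> in dm. norm (u \<zeta> * v \<zeta>) \<le> norm (t * (norm (u \<zeta>))\<^sup>2 + (norm (v \<zeta>))\<^sup>2 / t)"
      by (intro AE_I2 order_trans[OF b]) simp
  qed measurable
  have "norm (\<integral>\<zeta>. u \<zeta> * v \<zeta> \<partial>dm) \<le> (\<integral>\<zeta>. norm (u \<zeta> * v \<zeta>) \<partial>dm)" by (rule integral_norm_bound)
  also have "\<dots> \<le> (\<integral>\<zeta>. t * (norm (u \<zeta>))\<^sup>2 + (norm (v \<zeta>))\<^sup>2 / t \<partial>dm)"
    by (rule integral_mono[OF integrable_norm[OF iuv] ib b])
  also have "\<dots> = t * (\<integral>\<zeta>. (norm (u \<zeta>))\<^sup>2 \<partial>dm) + (\<integral>\<zeta>. (norm (v \<zeta>))\<^sup>2 \<partial>dm) / t" using i by simp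
  finally show "norm (\<integral>\<zeta>. u \<zeta> * v \<zeta> \<partial>dm) \<le> t * (\<integral>\<zeta>. (norm (u \<zeta>))\<^sup>2 \<partial>dm) + (\<integral>\<zeta>. (norm (v \<zeta>))\<^sup>2 \<partial>dm) / t" .
qed

lemma integrable_L2_add:
  fixes u v :: "complex \<Rightarrow> complex"
  assumes [measurable]: "u \<in> borel_measurable borel" "v \<in> borel_measurable borel"
    and "integrable dm (\<lambda>\<zeta>. (norm (u \<zeta>))\<^sup>2)" "integrable dm (\<lambda>\<zeta>. (norm (v \<zeta>))\<^sup>2)"
  shows "integrable dm (\<lambda>\<zeta>. (norm (a * u \<zeta> + b * v \<zeta>))\<^sup>2)"
proof -
  have fin: "sqnormL2 (\<lambda>_. 1) u < \<infinity>" "sqnormL2 (\<lambda>_. 1) v < \<infinity>"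
    by (subst sqnormL2_finite_iff; use assms in simp)+
  have "sqnormL2 (\<lambda>_. 1) (\<lambda>\<zeta>. a * u \<zeta> + b * v \<zeta>)
    \<le> ennreal (2 * (norm a)\<^sup>2) * sqnormL2 (\<lambda>_. 1) u + ennreal (2 * (norm b)\<^sup>2) * sqnormL2 (\<lambda>_. 1) v"
    by (rule sqnormL2_lincomb_le) auto
  also have "\<dots> < \<infinity>" using fin by (auto simp: ennreal_mult_less_top)
  finally show ?thesis by (subst (asm) sqnormL2_finite_iff) auto
qed

text \<open>The choice in \<open>Pminus\<close> is determined only up to null sets, and once a
  candidate g is exhibited. Orthogonality need be checked only against the conjugates of the
  antianalytic monomials, that is, against positive powers of \<zeta>, and then passes to the
  closure.\<close>

lemma Pminus_AE:
  assumes [measurable]: "h \<in> borel_measurable borel" and h: "integrable dm (\<lambda>\<zeta>. (norm (h \<zeta>))\<^sup>2)" and g: "g \<in> H2minus"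
    and orth: "\<And>n. (\<integral>\<zeta>. (h \<zeta> - g \<zeta>) * \<zeta> ^ Suc n \<partial>dm) = 0"
  shows "Pminus h \<in> H2minus" "AE \<zeta> in dm. Pminus h \<zeta> = g \<zeta>"
proof -
  note gD = H2minusD[OF g]
  have [measurable]: "g \<in> borel_measurable borel" by (rule gD)
  have hg: "integrable dm (\<lambda>\<zeta>. (norm (h \<zeta> - g \<zeta>))\<^sup>2)"
    using integrable_L2_add[OF _ gD(1) h gD(2), of 1 "-1"] by simp
  have ihg: "integrable dm (\<lambda>\<zeta>. h \<zeta> - g \<zeta>)" by (rule L1_le_L2(1)[OF _ hg]) measurable
  have orth_p: "(\<integral>\<zeta>. (h \<zeta> - g \<zeta>) * cnj (p \<zeta>) \<partial>dm) = 0" if "p \<in> antianalytic_polys" for p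
  proof -
    from that obtain c n where p: "p = (\<lambda>\<zeta>. \<Sum>k<n. c k * inverse \<zeta> ^ Suc k)" by (auto simp: antianalytic_polys_def)
    have [measurable]: "p \<in> borel_measurable borel" by (rule antianalytic_polys_measurable[OF that])
    have "(\<integral>\<zeta>. (h \<zeta> - g \<zeta>) * cnj (p \<zeta>) \<partial>dm) = (\<integral>\<zeta>. (\<Sum>k<n. cnj (c k) * ((h \<zeta> - g \<zeta>) * \<zeta> ^ Suc k)) \<partial>dm)"
    proof (rule integral_dm_cong)
      fix \<zeta> :: complex assume z: "norm \<zeta> = 1"
      have "cnj (p \<zeta>) = (\<Sum>k<n. cnj (c k) * \<zeta> ^ Suc k)" unfolding p inverse_circle[OF z] by (simp del: power_Suc)
      thus "(h \<zeta> - g \<zeta>) * cnj (p \<zeta>) = (\<Sum>k<n. cnj (c k) * ((h \<zeta> - g \<zeta>) * \<zeta> ^ Suc k))"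
        by (simp add: sum_distrib_left mult_ac del: power_Suc)
    qed measurable
    also have "\<dots> = (\<Sum>k<n. (\<integral>\<zeta>. cnj (c k) * ((h \<zeta> - g \<zeta>) * \<zeta> ^ Suc k) \<partial>dm))"
    proof (rule Bochner_Integration.integral_sum)
      fix k
      have "integrable dm (\<lambda>\<zeta>. \<zeta> ^ Suc k * (h \<zeta> - g \<zeta>))"
        by (rule integrable_dm_bounded_mult[where B=1, OF _ _ ihg]) (measurable, simp add: norm_power norm_mult)
      thus "integrable dm (\<lambda>\<zeta>. cnj (c k) * ((h \<zeta> - g \<zeta>) * \<zeta> ^ Suc k))" by (simp only: mult.commute integrable_mult_right)
    qed
    also have "\<dots> = 0" by (simp only: integral_mult_right_zero orth mult_zero_right sum.neutral_const)
    finally show ?thesis .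
  qed
  have orth_u: "(\<integral>\<zeta>. (h \<zeta> - g \<zeta>) * cnj (u \<zeta>) \<partial>dm) = 0" if u: "u \<in> H2minus" for u
  proof -
    define D where "D = (\<integral>\<zeta>. (norm (h \<zeta> - g \<zeta>))\<^sup>2 \<partial>dm)"
    have D: "D \<ge> 0" unfolding D_def by simp
    have [measurable]: "u \<in> borel_measurable borel" using H2minusD(1)[OF u] .
    have "norm (\<integral>\<zeta>. (h \<zeta> - g \<zeta>) * cnj (u \<zeta>) \<partial>dm) \<le> 0 + e" if e: "e > 0" for e
    proof -
      \<comment> \<open>Approximating u to within t^2 in squared norm turns the scaled
        Cauchy-Schwarz bound into \<open>t D + t\<close>, which is e.\<close>
      define t where "t = e / (D + 1)"
      have t: "t > 0" using e D by (simp add: t_def add_nonneg_pos)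
      obtain p where p: "p \<in> antianalytic_polys" "integrable dm (\<lambda>\<zeta>. (norm (u \<zeta> - p \<zeta>))\<^sup>2)" "(\<integral>\<zeta>. (norm (u \<zeta> - p \<zeta>))\<^sup>2 \<partial>dm)
        < t * t"
        by (rule H2minus_approx[OF u mult_pos_pos[OF t t]]; rule that)
      have [measurable]: "p \<in> borel_measurable borel" by (rule antianalytic_polys_measurable[OF p(1)])
      have i1: "integrable dm (\<lambda>\<zeta>. (h \<zeta> - g \<zeta>) * cnj (u \<zeta> - p \<zeta>))"
        and b1: "norm (\<integral>\<zeta>. (h \<zeta> - g \<zeta>) * cnj (u \<zeta> - p \<zeta>) \<partial>dm) \<le> t * D + (\<integral>\<zeta>. (norm (cnj (u \<zeta> - p \<zeta>)))\<^sup>2 \<partial>dm) / t"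
        unfolding D_def using p(2) integrable_L2_mult(2)[where v="\<lambda>\<zeta>. cnj (u \<zeta> - p \<zeta>)", OF _ _ hg _ t]
        by (auto intro!: integrable_L2_mult(1)[OF _ _ hg _ t] simp del: complex_cnj_diff)
      have i2: "integrable dm (\<lambda>\<zeta>. (h \<zeta> - g \<zeta>) * cnj (u \<zeta>))"
        by (rule integrable_L2_mult(1)[OF _ _ hg _ t]) (use H2minusD(2)[OF u] in simp_all)
      have "(\<integral>\<zeta>. (h \<zeta> - g \<zeta>) * cnj (u \<zeta>) \<partial>dm) - (\<integral>\<zeta>. (h \<zeta> - g \<zeta>) * cnj (u \<zeta> - p \<zeta>) \<partial>dm) = (\<integral>\<zeta>. (h \<zeta> - g \<zeta>) * cnj (p \<zeta>) \<partial>dm)"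
        by (subst Bochner_Integration.integral_diff[OF i2 i1, symmetric]) (simp add: algebra_simps)
      hence "norm (\<integral>\<zeta>. (h \<zeta> - g \<zeta>) * cnj (u \<zeta>) \<partial>dm) \<le> t * D + (\<integral>\<zeta>. (norm (cnj (u \<zeta> - p \<zeta>)))\<^sup>2 \<partial>dm) / t"
        using b1 orth_p[OF p(1)] by simp
      also have "\<dots> \<le> t * D + (t * t) / t" using p(3) t unfolding complex_mod_cnj by (intro add_left_mono divide_right_mono) auto
      also have "\<dots> = t * (D + 1)" using t by (simp add: algebra_simps)
      also have "\<dots> = e" using D by (simp add: t_def add_nonneg_pos)
      finally show ?thesis by simp
    qed
    hence "norm (\<integral>\<zeta>. (h \<zeta> - g \<zeta>) * cnj (u \<zeta>) \<partial>dm) \<le> 0" by (rule field_le_epsilon)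
    thus ?thesis by simp
  qed
  have P: "Pminus h \<in> H2minus \<and> (\<forall>u\<in>H2minus. (\<integral>\<zeta>. (h \<zeta> - Pminus h \<zeta>) * cnj (u \<zeta>) \<partial>dm) = 0)"
    unfolding Pminus_def by (rule someI[of _ g]) (use g orth_u in auto)
  thus P1: "Pminus h \<in> H2minus" by simp
  define g' where "g' = Pminus h"
  note PD = H2minusD[OF P1, folded g'_def]
  have [measurable]: "g' \<in> borel_measurable borel" by (rule PD)
  \<comment> \<open>The difference of two candidates lies in the subspace and is orthogonal to
    itself.\<close>
  define u where "u = (\<lambda>x. 1 * g' x + (-1) * g x)"
  have u: "u \<in> H2minus" unfolding u_def using P1 g by (intro H2minus_lincomb) (auto simp: g'_def)
  note uD = H2minusD[OF u]
  have [measurable]: "u \<in> borel_measurable borel" by (rule uD)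
  have hg': "integrable dm (\<lambda>\<zeta>. (norm (h \<zeta> - g' \<zeta>))\<^sup>2)"
    using integrable_L2_add[OF _ PD(1) h PD(2), of 1 "-1"] by simp
  have i1: "integrable dm (\<lambda>\<zeta>. (h \<zeta> - g \<zeta>) * cnj (u \<zeta>))"
    by (rule integrable_L2_mult(1)[OF _ _ hg _ zero_less_one]) (use uD(2) in simp_all)
  have i2: "integrable dm (\<lambda>\<zeta>. (h \<zeta> - g' \<zeta>) * cnj (u \<zeta>))"
    by (rule integrable_L2_mult(1)[OF _ _ hg' _ zero_less_one]) (use uD(2) in simp_all)
  have "(\<integral>\<zeta>. (h \<zeta> - g \<zeta>) * cnj (u \<zeta>) \<partial>dm) - (\<integral>\<zeta>. (h \<zeta> - g' \<zeta>) * cnj (u \<zeta>) \<partial>dm) = (\<integral>\<zeta>. of_real ((norm (u \<zeta>))\<^sup>2) \<partial>dm)"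
    by (subst Bochner_Integration.integral_diff[OF i1 i2, symmetric])
       (simp add: u_def complex_norm_square algebra_simps del: of_real_power flip: of_real_power)
  moreover have "(\<integral>\<zeta>. (h \<zeta> - g' \<zeta>) * cnj (u \<zeta>) \<partial>dm) = 0" using P u by (simp add: g'_def)
  ultimately have "complex_of_real (\<integral>\<zeta>. (norm (u \<zeta>))\<^sup>2 \<partial>dm) = 0" using orth_u[OF u] by (simp only: integral_complex_of_real) simp
  hence "(\<integral>\<zeta>. (norm (u \<zeta>))\<^sup>2 \<partial>dm) = 0" by (simp only: of_real_eq_0_iff)
  hence "AE \<zeta> in dm. (norm (u \<zeta>))\<^sup>2 = 0" using uD(2) by (subst (asm) integral_nonneg_eq_0_iff_AE) auto
  thus "AE \<zeta> in dm. Pminus h \<zeta> = g \<zeta>" by eventually_elim (simp add: u_def g'_def)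
qed

section \<open>Hankel operators on polynomials and on kernels\<close>

text \<open>The Fourier coefficient at frequency -j; the index 0 is kept so that power series in
  \<open>cnj z\<close> start at 0.\<close>

definition neg_coef :: "(complex \<Rightarrow> complex) \<Rightarrow> nat \<Rightarrow> complex" where
  "neg_coef u j = (\<integral>\<zeta>. u \<zeta> * \<zeta> ^ j \<partial>dm)"

lemma integrable_mult_power:
  assumes "integrable dm (u :: complex \<Rightarrow> complex)"
  shows "integrable dm (\<lambda>\<zeta>. u \<zeta> * \<zeta> ^ j)" "integrable dm (\<lambda>\<zeta>. u \<zeta> * cnj \<zeta> ^ j)"
proof -
  have "integrable dm (\<lambda>\<zeta>. \<zeta> ^ j * u \<zeta>)"
    by (rule integrable_dm_bounded_mult[where B=1, OF _ _ assms]) (auto simp: norm_power)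
  moreover have "integrable dm (\<lambda>\<zeta>. cnj \<zeta> ^ j * u \<zeta>)"
    by (rule integrable_dm_bounded_mult[where B=1, OF _ _ assms]) (auto simp: norm_power)
  ultimately show "integrable dm (\<lambda>\<zeta>. u \<zeta> * \<zeta> ^ j)" "integrable dm (\<lambda>\<zeta>. u \<zeta> * cnj \<zeta> ^ j)" by (simp_all add: mult.commute)
qed

lemma neg_coef_eq_fourier: "neg_coef u j = cnj (fourier (\<lambda>\<zeta>. cnj (u \<zeta>)) j)"
  unfolding neg_coef_def fourier_def by (subst Bochner_Integration.integral_cnj[symmetric]) simp

lemma neg_coef_bound: "integrable dm u \<Longrightarrow> norm (neg_coef u j) \<le> (\<integral>\<zeta>. norm (u \<zeta>) \<partial>dm)"
  using fourier_bound[of "\<lambda>\<zeta>. cnj (u \<zeta>)" j] by (simp add: neg_coef_eq_fourier)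

lemma circle_power_cnj: "norm \<zeta> = 1 \<Longrightarrow> \<zeta> ^ m * cnj \<zeta> ^ m = (1::complex)"
  by (simp add: power_mult_distrib[symmetric] complex_norm_square[symmetric])

lemma antianalytic_polysI: "(\<lambda>\<zeta>. \<Sum>k<n. c k * inverse \<zeta> ^ Suc k) \<in> antianalytic_polys"
  unfolding antianalytic_polys_def by (rule CollectI, rule exI[of _ c], rule exI[of _ n]) simp

lemma integral_lincomb:
  assumes "\<And>k. k \<in> A \<Longrightarrow> integrable dm (e k)"
  shows "(\<integral>\<zeta>. (\<Sum>k\<in>A. c k * e k \<zeta>) \<partial>dm) = (\<Sum>k\<in>A. c k * (\<integral>\<zeta>. e k \<zeta> \<partial>dm :: complex))"
  using assms by (subst Bochner_Integration.integral_sum) auto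

lemma fourier_antianalytic_poly:
  assumes "p \<in> antianalytic_polys" shows "fourier p n = 0"
proof -
  from assms obtain c N where p: "p = (\<lambda>\<zeta>. \<Sum>k<N. c k * inverse \<zeta> ^ Suc k)" by (auto simp: antianalytic_polys_def)
  have [measurable]: "p \<in> borel_measurable borel" by (rule antianalytic_polys_measurable[OF assms])
  have "fourier p n = (\<integral>\<zeta>. (\<Sum>k<N. c k * (cnj \<zeta> ^ Suc k * cnj \<zeta> ^ n)) \<partial>dm)"
    unfolding fourier_def
  proof (rule integral_dm_cong)
    fix \<zeta> :: complex assume z: "norm \<zeta> = 1"
    show "p \<zeta> * cnj \<zeta> ^ n = (\<Sum>k<N. c k * (cnj \<zeta> ^ Suc k * cnj \<zeta> ^ n))"
      unfolding p inverse_circle[OF z] by (simp only: sum_distrib_right mult.assoc)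
  qed measurable
  also have "\<dots> = (\<Sum>k<N. c k * fourier (\<lambda>\<zeta>. cnj \<zeta> ^ Suc k) n)"
    unfolding fourier_def by (intro integral_lincomb integrable_mult_power integrable_dm_power)
  also have "\<dots> = 0" by (simp add: fourier_cnj_power del: power_Suc)
  finally show ?thesis .
qed

lemma fourier_H2minus:
  assumes f: "f \<in> H2minus" shows "fourier f n = 0"
proof -
  note D = H2minusD[OF f]
  have [measurable]: "f \<in> borel_measurable borel" by (rule D)
  have "norm (fourier f n) \<le> 0 + e" if e: "e > 0" for e
  proof -
    obtain p where p: "p \<in> antianalytic_polys" "integrable dm (\<lambda>\<zeta>. (norm (f \<zeta> - p \<zeta>))\<^sup>2)" "(\<integral>\<zeta>. (norm (f \<zeta> - p \<zeta>))\<^sup>2 \<partial>dm) < e * e"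
      by (rule H2minus_approx[OF f mult_pos_pos[OF e e]]; rule that)
    have [measurable]: "p \<in> borel_measurable borel" by (rule antianalytic_polys_measurable[OF p(1)])
    have i: "integrable dm (\<lambda>\<zeta>. f \<zeta> - p \<zeta>)" and b: "(\<integral>\<zeta>. norm (f \<zeta> - p \<zeta>) \<partial>dm)\<^sup>2 \<le> (\<integral>\<zeta>. (norm (f \<zeta> - p \<zeta>))\<^sup>2 \<partial>dm)"
      by (rule L1_le_L2[OF _ p(2)], measurable)+
    have ip: "integrable dm p" using Bochner_Integration.integrable_diff[OF D(3) i] by simp
    have "fourier f n = fourier (\<lambda>\<zeta>. f \<zeta> - p \<zeta>) n + fourier p n"
      unfolding fourier_def
      by (subst Bochner_Integration.integral_add[OF integrable_mult_power(2)[OF i] integrable_mult_power(2)[OF ip], symmetric])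
        (simp add: algebra_simps)
    hence "norm (fourier f n) \<le> (\<integral>\<zeta>. norm (f \<zeta> - p \<zeta>) \<partial>dm)"
      using fourier_bound[OF i, of n] fourier_antianalytic_poly[OF p(1)] by simp
    also have "\<dots> \<le> e"
      by (rule power2_le_imp_le) (use b p(3) e in \<open>auto simp: power2_eq_square\<close>)
    finally show ?thesis by simp
  qed
  hence "norm (fourier f n) \<le> 0" by (rule field_le_epsilon)
  thus ?thesis by simp
qed

lemma neg_coef_0_H2minus: "f \<in> H2minus \<Longrightarrow> neg_coef f 0 = 0"
  using fourier_H2minus[of f 0] by (simp add: neg_coef_def fourier_def)

lemma poisson_H2minus:
  assumes f: "f \<in> H2minus" and z: "norm z < 1"
  shows "poisson_ext f z = cnj (riesz_plus (\<lambda>\<zeta>. cnj (f \<zeta>)) z)" "(\<lambda>j. neg_coef f j * cnj z ^ j) sums poisson_ext f z"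
proof -
  note D = H2minusD[OF f]
  have D': "integrable dm (\<lambda>\<zeta>. cnj (f \<zeta>))" using D(3) by simp
  have "riesz_plus f z = 0" using riesz_plus_sums[OF D(3) z] by (simp add: fourier_H2minus[OF f] sums_iff)
  thus 1: "poisson_ext f z = cnj (riesz_plus (\<lambda>\<zeta>. cnj (f \<zeta>)) z)"
    using poisson_ext_complex[OF D(3) z] by (simp add: fourier_H2minus[OF f])
  have "(\<lambda>n. cnj (fourier (\<lambda>\<zeta>. cnj (f \<zeta>)) (Suc n) * z ^ Suc n)) sums cnj (riesz_plus (\<lambda>\<zeta>. cnj (f \<zeta>)) z)"
    unfolding sums_cnj by (rule riesz_plus_sums[OF D' z])
  hence "(\<lambda>n. neg_coef f (Suc n) * cnj z ^ Suc n) sums poisson_ext f z"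
    unfolding 1 by (simp add: neg_coef_eq_fourier)
  thus "(\<lambda>j. neg_coef f j * cnj z ^ j) sums poisson_ext f z"
    by (subst (asm) sums_Suc_iff) (simp add: neg_coef_0_H2minus[OF f])
qed

text \<open>Think of \<open>F\<close> and \<open>q\<close> as the images of \<open>f\<close> and
  \<open>p\<close> under one linear operation bounded in L2 that maps antianalytic polynomials to
  antianalytic polynomials; such an operation preserves the closure.\<close>

lemma H2minus_operator:
  assumes f: "f \<in> H2minus" and [measurable]: "F \<in> borel_measurable borel" and C: "C \<ge> 0"
    and app: "\<And>p. p \<in> antianalytic_polys \<Longrightarrow> integrable dm (\<lambda>\<zeta>. (norm (f \<zeta> - p \<zeta>))\<^sup>2) \<Longrightarrow>
       \<exists>q\<in>antianalytic_polys. integrable dm (\<lambda>\<zeta>. (norm (F \<zeta> - q \<zeta>))\<^sup>2) \<and> (\<integral>\<zeta>. (norm (F \<zeta> - q \<zeta>))\<^sup>2 \<partial>dm) \<le> C * (\<integral>\<zeta>. (norm (f \<zeta> - p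
         \<zeta>))\<^sup>2 \<partial>dm)"
    and F2: "integrable dm (\<lambda>\<zeta>. (norm (F \<zeta>))\<^sup>2)"
  shows "F \<in> H2minus"
  unfolding H2minus_def closL2_def
proof (intro CollectI conjI allI impI)
  show "F \<in> L2w (\<lambda>_. 1)" unfolding L2w_def
    by (simp add: borel_dm) (subst sqnormL2_finite_iff[unfolded infinity_ennreal_def], use F2 in auto)
  fix \<epsilon> :: real assume e: "\<epsilon> > 0"
  have "\<epsilon> / (C + 1) > 0" using e C by (simp add: add_nonneg_pos)
  note e1 = this
  obtain p where p: "p \<in> antianalytic_polys" "integrable dm (\<lambda>\<zeta>. (norm (f \<zeta> - p \<zeta>))\<^sup>2)" "(\<integral>\<zeta>. (norm (f \<zeta> - p \<zeta>))\<^sup>2 \<partial>dm)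
    < \<epsilon> / (C + 1)"
    by (rule H2minus_approx[OF f e1]; rule that)
  from app[OF p(1,2)] obtain q where q: "q \<in> antianalytic_polys" "integrable dm (\<lambda>\<zeta>. (norm (F \<zeta> - q \<zeta>))\<^sup>2)"
    "(\<integral>\<zeta>. (norm (F \<zeta> - q \<zeta>))\<^sup>2 \<partial>dm) \<le> C * (\<integral>\<zeta>. (norm (f \<zeta> - p \<zeta>))\<^sup>2 \<partial>dm)" by blast
  have [measurable]: "q \<in> borel_measurable borel" by (rule antianalytic_polys_measurable[OF q(1)])
  note q(3)
  also have "C * (\<integral>\<zeta>. (norm (f \<zeta> - p \<zeta>))\<^sup>2 \<partial>dm) \<le> C * (\<epsilon> / (C + 1))"
    using p(3) C by (intro mult_left_mono) auto
  also have "\<dots> < \<epsilon>" using e C by (simp add: field_simps)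
  finally have "ennreal (\<integral>\<zeta>. (norm (F \<zeta> - q \<zeta>))\<^sup>2 \<partial>dm) < ennreal \<epsilon>" using e by (intro ennreal_lessI)
  hence "sqnormL2 (\<lambda>_. 1) (\<lambda>\<zeta>. F \<zeta> - q \<zeta>) < ennreal \<epsilon>" using q(2) by (subst sqnormL2_eq_integral) auto
  thus "\<exists>g\<in>antianalytic_polys. sqnormL2 (\<lambda>_. 1) (\<lambda>\<zeta>. F \<zeta> - g \<zeta>) < ennreal \<epsilon>" using q(1) by blast
qed

text \<open>The operations used below are multiplication by a bounded function plus a correction
  controlled by the L1 norm, which is at most the L2 norm as the total mass is 1. Squaring the
  two-term sum gives 2 + 2 = 4.\<close>

lemma operator_bound_L2:
  assumes [measurable]: "u \<in> borel_measurable borel" "a \<in> borel_measurable borel" "d \<in> borel_measurable borel"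
    and u: "integrable dm (\<lambda>\<zeta>. (norm (u \<zeta> :: complex))\<^sup>2)" and M: "M \<ge> 0"
    and a: "\<And>\<zeta>. norm \<zeta> = 1 \<Longrightarrow> norm (a \<zeta> :: complex) \<le> M"
    and d: "\<And>\<zeta>. norm \<zeta> = 1 \<Longrightarrow> norm (d \<zeta> :: complex) \<le> M * (\<integral>\<zeta>. norm (u \<zeta>) \<partial>dm)"
    and F: "\<And>\<zeta>. norm \<zeta> = 1 \<Longrightarrow> F \<zeta> = a \<zeta> * u \<zeta> + d \<zeta>" and [measurable]: "F \<in> borel_measurable borel"
  shows "integrable dm (\<lambda>\<zeta>. (norm (F \<zeta>))\<^sup>2)" "(\<integral>\<zeta>. (norm (F \<zeta>))\<^sup>2 \<partial>dm) \<le> 4 * M\<^sup>2 * (\<integral>\<zeta>. (norm (u \<zeta>))\<^sup>2 \<partial>dm)"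
proof -
  define I where "I = (\<integral>\<zeta>. (norm (u \<zeta>))\<^sup>2 \<partial>dm)"
  have L: "(\<integral>\<zeta>. norm (u \<zeta>) \<partial>dm)\<^sup>2 \<le> I" unfolding I_def by (rule L1_le_L2[OF _ u]) measurable
  have b: "(norm (F \<zeta>))\<^sup>2 \<le> 2 * M\<^sup>2 * (norm (u \<zeta>))\<^sup>2 + 2 * M\<^sup>2 * I" if z: "norm \<zeta> = 1" for \<zeta>
  proof -
    have "norm (F \<zeta>) \<le> norm (a \<zeta> * u \<zeta>) + norm (d \<zeta>)" unfolding F[OF z] by (rule norm_triangle_ineq)
    also have "\<dots> \<le> M * norm (u \<zeta>) + M * (\<integral>\<zeta>. norm (u \<zeta>) \<partial>dm)"
      unfolding norm_mult using a[OF z] d[OF z] by (intro add_mono mult_right_mono) auto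
    finally have "(norm (F \<zeta>))\<^sup>2 \<le> (M * norm (u \<zeta>) + M * (\<integral>\<zeta>. norm (u \<zeta>) \<partial>dm))\<^sup>2" by (intro power_mono) auto
    also have "\<dots> \<le> 2 * (M * norm (u \<zeta>))\<^sup>2 + 2 * (M * (\<integral>\<zeta>. norm (u \<zeta>) \<partial>dm))\<^sup>2"
      using sum_squares_bound[of "M * norm (u \<zeta>)" "M * (\<integral>\<zeta>. norm (u \<zeta>) \<partial>dm)"] by (simp add: power2_sum)
    also have "\<dots> = 2 * M\<^sup>2 * (norm (u \<zeta>))\<^sup>2 + 2 * M\<^sup>2 * (\<integral>\<zeta>. norm (u \<zeta>) \<partial>dm)\<^sup>2" by (simp add: power_mult_distrib)
    also have "\<dots> \<le> 2 * M\<^sup>2 * (norm (u \<zeta>))\<^sup>2 + 2 * M\<^sup>2 * I" using L by (intro add_left_mono mult_left_mono) auto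
    finally show ?thesis .
  qed
  have ib: "integrable dm (\<lambda>\<zeta>. 2 * M\<^sup>2 * (norm (u \<zeta>))\<^sup>2 + 2 * M\<^sup>2 * I)" using u by simp
  show iF: "integrable dm (\<lambda>\<zeta>. (norm (F \<zeta>))\<^sup>2)"
  proof (rule Bochner_Integration.integrable_bound[OF ib])
    show "AE \<zeta> in dm. norm ((norm (F \<zeta>))\<^sup>2) \<le> norm (2 * M\<^sup>2 * (norm (u \<zeta>))\<^sup>2 + 2 * M\<^sup>2 * I)"
      using AE_dm_circle by eventually_elim (use b in \<open>force intro: order_trans\<close>)
  qed measurable
  have "(\<integral>\<zeta>. (norm (F \<zeta>))\<^sup>2 \<partial>dm) \<le> (\<integral>\<zeta>. 2 * M\<^sup>2 * (norm (u \<zeta>))\<^sup>2 + 2 * M\<^sup>2 * I \<partial>dm)"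
    by (rule integral_mono_AE[OF iF ib]) (use AE_dm_circle b in \<open>auto elim: eventually_mono\<close>)
  also have "\<dots> = 4 * M\<^sup>2 * I" using u by (simp add: I_def)
  finally show "(\<integral>\<zeta>. (norm (F \<zeta>))\<^sup>2 \<partial>dm) \<le> 4 * M\<^sup>2 * (\<integral>\<zeta>. (norm (u \<zeta>))\<^sup>2 \<partial>dm)" by (simp add: I_def)
qed

lemma neg_coef_antianalytic_poly:
  "neg_coef (\<lambda>\<zeta>. \<Sum>k<N. c k * inverse \<zeta> ^ Suc k) (Suc 0) = (if 0 < N then c 0 else 0)"
proof -
  have "neg_coef (\<lambda>\<zeta>. \<Sum>k<N. c k * inverse \<zeta> ^ Suc k) (Suc 0) = (\<integral>\<zeta>. (\<Sum>k<N. c k * (\<zeta> ^ 1 * cnj \<zeta> ^ Suc k)) \<partial>dm)"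
    unfolding neg_coef_def
  proof (rule integral_dm_cong)
    fix \<zeta> :: complex assume z: "norm \<zeta> = 1"
    show "(\<Sum>k<N. c k * inverse \<zeta> ^ Suc k) * \<zeta> ^ Suc 0 = (\<Sum>k<N. c k * (\<zeta> ^ 1 * cnj \<zeta> ^ Suc k))"
      unfolding inverse_circle[OF z] sum_distrib_right by (intro sum.cong refl) (simp add: mult_ac)
  qed measurable
  also have "\<dots> = (\<Sum>k<N. c k * (\<integral>\<zeta>. \<zeta> ^ 1 * cnj \<zeta> ^ Suc k \<partial>dm))"
    by (intro integral_lincomb integrable_mult_power integrable_dm_power)
  also have "\<dots> = (\<Sum>k<N. if k = 0 then c k else 0)"
    unfolding integral_dm_orthogonal by (intro sum.cong) auto
  also have "\<dots> = (if 0 < N then c 0 else 0)" by (auto simp: sum.delta)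
  finally show ?thesis .
qed

text \<open>Multiplication by \<zeta> moves frequency -1 to 0 and keeps the lower ones negative, so
  removing that one coefficient returns to the subspace.\<close>

lemma H2minus_shift:
  assumes f: "f \<in> H2minus"
  shows "(\<lambda>\<zeta>. \<zeta> * f \<zeta> - neg_coef f 1) \<in> H2minus"
proof -
  note D = H2minusD[OF f]
  have [measurable]: "f \<in> borel_measurable borel" by (rule D)
  have d1: "norm (- neg_coef u 1) \<le> 1 * (\<integral>\<zeta>. norm (u \<zeta>) \<partial>dm)" if "integrable dm u" for u
    using neg_coef_bound[OF that] by simp
  show ?thesis
  proof (rule H2minus_operator[OF f, where C="4 * 1\<^sup>2"])
    show "integrable dm (\<lambda>\<zeta>. (norm (\<zeta> * f \<zeta> - neg_coef f 1))\<^sup>2)"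
      by (rule operator_bound_L2(1)[where u=f and a="\<lambda>\<zeta>. \<zeta>" and M=1 and d="\<lambda>_. - neg_coef f 1"]) (use D d1[OF D(3)] in auto)
    fix p assume p: "p \<in> antianalytic_polys" and i: "integrable dm (\<lambda>\<zeta>. (norm (f \<zeta> - p \<zeta>))\<^sup>2)"
    have [measurable]: "p \<in> borel_measurable borel" by (rule antianalytic_polys_measurable[OF p])
    from p obtain c N where pe: "p = (\<lambda>\<zeta>. \<Sum>k<N. c k * inverse \<zeta> ^ Suc k)" by (auto simp: antianalytic_polys_def)
    \<comment> \<open>Coefficient k of \<open>p\<close> sits at frequency -(k+1). The shift loses k
      = 0, hence the index \<open>Suc k\<close> and the length \<open>N-1\<close>.\<close>
    define q where "q = (\<lambda>\<zeta>::complex. \<Sum>k<N-1. c (Suc k) * inverse \<zeta> ^ Suc k)"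
    have q: "q \<in> antianalytic_polys" unfolding q_def by (rule antianalytic_polysI)
    have [measurable]: "q \<in> borel_measurable borel" by (rule antianalytic_polys_measurable[OF q])
    have qe: "q \<zeta> = \<zeta> * p \<zeta> - neg_coef p 1" if z: "norm \<zeta> = 1" for \<zeta>
    proof -
      have "\<zeta> \<noteq> 0" using z by auto
      have "neg_coef p 1 = (if 0 < N then c 0 else 0)" using neg_coef_antianalytic_poly[of c N] unfolding pe by simp
      moreover have "\<zeta> * p \<zeta> = (\<Sum>k<N. c k * inverse \<zeta> ^ k)"
        unfolding pe sum_distrib_left using \<open>\<zeta> \<noteq> 0\<close> by (intro sum.cong) (auto simp: field_simps)
      moreover have "(\<Sum>k<N. c k * inverse \<zeta> ^ k) = (if 0 < N then c 0 else 0) + q \<zeta>"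
        unfolding q_def by (cases N) (auto simp: sum.lessThan_Suc_shift simp del: power_Suc sum.lessThan_Suc)
      ultimately show ?thesis by simp
    qed
    have ifp: "integrable dm (\<lambda>\<zeta>. f \<zeta> - p \<zeta>)" by (rule L1_le_L2(1)[OF _ i]) measurable
    have ip: "integrable dm p" using Bochner_Integration.integrable_diff[OF D(3) ifp] by simp
    have cd: "neg_coef (\<lambda>\<zeta>. f \<zeta> - p \<zeta>) 1 = neg_coef f 1 - neg_coef p 1"
      unfolding neg_coef_def
      by (subst Bochner_Integration.integral_diff[OF integrable_mult_power(1)[OF D(3)] integrable_mult_power(1)[OF ip],
        symmetric]) (simp add: algebra_simps)
    have Fe: "\<zeta> * f \<zeta> - neg_coef f 1 - q \<zeta> = \<zeta> * (f \<zeta> - p \<zeta>) + - neg_coef (\<lambda>\<zeta>. f \<zeta> - p \<zeta>) 1" if "norm \<zeta> = 1" for \<zeta>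
      unfolding cd qe[OF that] by (simp add: algebra_simps)
    note O = operator_bound_L2[where u="\<lambda>\<zeta>. f \<zeta> - p \<zeta>" and a="\<lambda>\<zeta>. \<zeta>" and M=1 and d="\<lambda>_. - neg_coef (\<lambda>\<zeta>. f \<zeta> - p \<zeta>) 1"
          and F="\<lambda>\<zeta>. \<zeta> * f \<zeta> - neg_coef f 1 - q \<zeta>", OF _ _ _ i _ _ d1[OF ifp] Fe]
    have "integrable dm (\<lambda>\<zeta>. (norm (\<zeta> * f \<zeta> - neg_coef f 1 - q \<zeta>))\<^sup>2) \<and> (\<integral>\<zeta>. (norm (\<zeta> * f \<zeta> - neg_coef f 1 - q \<zeta>))\<^sup>2 \<partial>dm)
      \<le> 4 * 1\<^sup>2 * (\<integral>\<zeta>. (norm (f \<zeta> - p \<zeta>))\<^sup>2 \<partial>dm)"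
      by (rule conjI; rule O; (assumption | measurable | simp))
    thus "\<exists>q\<in>antianalytic_polys. integrable dm (\<lambda>\<zeta>. (norm (\<zeta> * f \<zeta> - neg_coef f 1 - q \<zeta>))\<^sup>2) \<and> (\<integral>\<zeta>. (norm (\<zeta> * f \<zeta> - neg_coef f 1
      - q \<zeta>))\<^sup>2 \<partial>dm) \<le> 4 * 1\<^sup>2 * (\<integral>\<zeta>. (norm (f \<zeta> - p \<zeta>))\<^sup>2 \<partial>dm)"
      using q by blast
  qed auto
qed

text \<open>For u in \<open>H2minus\<close> this is the projection of \<zeta>^k u: the subtracted
  sum collects the frequencies from -k to 0 of u, which the factor \<zeta>^k has made
  nonnegative.\<close>

definition hankel_power :: "(complex \<Rightarrow> complex) \<Rightarrow> nat \<Rightarrow> complex \<Rightarrow> complex" where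
  "hankel_power u k \<zeta> = \<zeta> ^ k * u \<zeta> - (\<Sum>j\<le>k. neg_coef u j * \<zeta> ^ (k - j))"

lemma hankel_power_measurable [measurable]:
  "u \<in> borel_measurable borel \<Longrightarrow> hankel_power u k \<in> borel_measurable borel"
  unfolding hankel_power_def
  by (intro borel_measurable_diff borel_measurable_times borel_measurable_power borel_measurable_sum borel_measurable_const
    measurable_ident_sets refl)

lemma hankel_power_Suc: "hankel_power u (Suc k) \<zeta> = \<zeta> * hankel_power u k \<zeta> - neg_coef u (Suc k)"
proof -
  have "(\<Sum>j\<le>Suc k. neg_coef u j * \<zeta> ^ (Suc k - j)) = (\<Sum>j\<le>k. neg_coef u j * \<zeta> ^ (Suc k - j)) + neg_coef u (Suc k)" by simp
  also have "(\<Sum>j\<le>k. neg_coef u j * \<zeta> ^ (Suc k - j)) = \<zeta> * (\<Sum>j\<le>k. neg_coef u j * \<zeta> ^ (k - j))"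
    unfolding sum_distrib_left by (intro sum.cong) (auto simp: Suc_diff_le)
  finally show ?thesis by (simp add: hankel_power_def algebra_simps)
qed

text \<open>After one more factor \<zeta> all previously subtracted terms have positive frequency
  and zero mean. The recursion for \<open>hankel_power\<close> is therefore an instance of
  \<open>H2minus_shift\<close>.\<close>

lemma neg_coef_hankel_power:
  assumes u: "integrable dm u"
  shows "neg_coef (hankel_power u k) (Suc 0) = neg_coef u (Suc k)"
proof -
  have "neg_coef (hankel_power u k) (Suc 0) = (\<integral>\<zeta>. u \<zeta> * \<zeta> ^ Suc k - (\<Sum>j\<le>k. neg_coef u j * \<zeta> ^ Suc (k - j)) \<partial>dm)"
    unfolding neg_coef_def hankel_power_def
    by (intro Bochner_Integration.integral_cong refl) (simp add: algebra_simps sum_distrib_left sum_distrib_right)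
  also have "\<dots> = neg_coef u (Suc k) - (\<Sum>j\<le>k. neg_coef u j * (\<integral>\<zeta>. \<zeta> ^ Suc (k - j) \<partial>dm))"
    unfolding neg_coef_def
    by (subst Bochner_Integration.integral_diff)
       (auto intro!: integrable_mult_power u integrable_mult_right Bochner_Integration.integrable_sum simp:
         Bochner_Integration.integral_sum simp del: power_Suc)
  also have "\<dots> = neg_coef u (Suc k)" by (simp add: integral_dm_power del: power_Suc)
  finally show ?thesis .
qed

lemma hankel_power_H2minus:
  assumes f: "f \<in> H2minus" shows "hankel_power f k \<in> H2minus"
proof (induction k)
  case 0
  have "hankel_power f 0 = f" by (auto simp: hankel_power_def neg_coef_0_H2minus[OF f])
  thus ?case using f by simp
next
  case (Suc k)
  have "hankel_power f (Suc k) = (\<lambda>\<zeta>. \<zeta> * hankel_power f k \<zeta> - neg_coef (hankel_power f k) 1)"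
    using neg_coef_hankel_power[OF H2minusD(3)[OF f]] by (auto simp: hankel_power_Suc)
  thus ?case using H2minus_shift[OF Suc] by simp
qed

lemma H2minus_0: "(\<lambda>_. 0) \<in> H2minus"
proof -
  have "(\<lambda>\<zeta>. \<Sum>k<(0::nat). 0 * inverse \<zeta> ^ Suc k) \<in> antianalytic_polys" by (rule antianalytic_polysI)
  hence "(\<lambda>_. 0) \<in> antianalytic_polys" by simp
  thus ?thesis unfolding H2minus_def closL2_def L2w_def
    by (auto simp: sqnormL2_def intro!: bexI[of _ "\<lambda>_. 0"])
qed

lemma H2minus_sum:
  assumes "\<And>k. k < n \<Longrightarrow> f k \<in> H2minus"
  shows "(\<lambda>\<zeta>. \<Sum>k<(n::nat). c k * f k \<zeta>) \<in> H2minus"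
  using assms
proof (induction n)
  case 0 thus ?case by (simp add: H2minus_0)
next
  case (Suc n)
  have "(\<lambda>\<zeta>. 1 * (\<Sum>k<n. c k * f k \<zeta>) + c n * f n \<zeta>) \<in> H2minus"
    by (rule H2minus_lincomb) (use Suc in auto)
  thus ?case by simp
qed

lemma analytic_poly_bounded:
  "\<exists>M\<ge>0. \<forall>\<zeta>. norm \<zeta> = 1 \<longrightarrow> norm (\<Sum>k<n. c k * (\<zeta>::complex) ^ k) \<le> M"
proof (intro exI[of _ "\<Sum>k<n. norm (c k)"] conjI allI impI)
  fix \<zeta> :: complex assume "norm \<zeta> = 1"
  thus "norm (\<Sum>k<n. c k * \<zeta> ^ k) \<le> (\<Sum>k<n. norm (c k))"
    by (intro sum_norm_le) (simp add: norm_mult norm_power)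
qed (auto intro: sum_nonneg)

lemma integrable_bounded_L2:
  assumes [measurable]: "u \<in> borel_measurable borel" "a \<in> borel_measurable borel"
    and u: "integrable dm (\<lambda>\<zeta>. (norm (u \<zeta> :: complex))\<^sup>2)"
    and a: "\<And>\<zeta>. norm \<zeta> = 1 \<Longrightarrow> norm (a \<zeta> :: complex) \<le> M"
  shows "integrable dm (\<lambda>\<zeta>. (norm (u \<zeta> * a \<zeta>))\<^sup>2)"
proof -
  have "integrable dm (\<lambda>\<zeta>. (norm (a \<zeta>))\<^sup>2 * (norm (u \<zeta>))\<^sup>2)"
    by (rule integrable_dm_bounded_mult[where B="M\<^sup>2", OF _ _ u]) (use a in \<open>auto intro!: power_mono\<close>)
  thus ?thesis by (simp add: norm_mult power_mult_distrib mult.commute)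
qed

text \<open>What is removed from \<open>f p\<close> is an analytic polynomial, and its product with
  a positive power of \<zeta> has mean zero; so the candidate satisfies the orthogonality test of
  \<open>Pminus_AE\<close>.\<close>

theorem Hankel_poly:
  assumes f: "f \<in> H2minus"
  shows "AE \<zeta> in dm. Hankel f (\<lambda>\<zeta>. \<Sum>k<n. c k * \<zeta> ^ k) \<zeta> = (\<Sum>k<n. c k * hankel_power f k \<zeta>)"
    and "Hankel f (\<lambda>\<zeta>. \<Sum>k<n. c k * \<zeta> ^ k) \<in> H2minus"
proof -
  note D = H2minusD[OF f]
  have [measurable]: "f \<in> borel_measurable borel" by (rule D)
  obtain M where M: "\<And>\<zeta>. norm \<zeta> = 1 \<Longrightarrow> norm (\<Sum>k<n. c k * \<zeta> ^ k) \<le> M" using analytic_poly_bounded[of c n] by blast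
  have g: "(\<lambda>\<zeta>. \<Sum>k<n. c k * hankel_power f k \<zeta>) \<in> H2minus"
    by (intro H2minus_sum hankel_power_H2minus f)
  have orth: "(\<integral>\<zeta>. (f \<zeta> * (\<Sum>k<n. c k * \<zeta> ^ k) - (\<Sum>k<n. c k * hankel_power f k \<zeta>)) * \<zeta> ^ Suc m \<partial>dm) = 0" for m
  proof -
    have e: "(f \<zeta> * (\<Sum>k<n. c k * \<zeta> ^ k) - (\<Sum>k<n. c k * hankel_power f k \<zeta>)) * \<zeta> ^ Suc m
      = (\<Sum>k<n. \<Sum>j\<le>k. c k * (neg_coef f j * (\<zeta> ^ (k - j) * \<zeta> ^ Suc m)))" for \<zeta>
    proof -
      have "f \<zeta> * (\<Sum>k<n. c k * \<zeta> ^ k) - (\<Sum>k<n. c k * hankel_power f k \<zeta>) = (\<Sum>k<n. c k * (\<Sum>j\<le>k. neg_coef f j * \<zeta> ^ (k - j)))"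
        unfolding hankel_power_def sum_distrib_left[of "f \<zeta>"] sum_subtractf[symmetric]
          by (intro sum.cong) (auto simp: algebra_simps)
      thus ?thesis by (simp only: sum_distrib_left sum_distrib_right mult.assoc)
    qed
    have z: "(\<integral>\<zeta>. \<zeta> ^ (k - j) * \<zeta> ^ Suc m \<partial>dm) = 0" for k j
      using integral_dm_power[of "k - j + Suc m"] by (simp only: power_add)
    have i: "integrable dm (\<lambda>\<zeta>. \<zeta> ^ (k - j) * \<zeta> ^ Suc m)" for k j
      by (intro integrable_mult_power integrable_dm_power)
    have "(\<integral>\<zeta>. (\<Sum>k<n. c k * (\<Sum>j\<le>k. neg_coef f j * (\<zeta> ^ (k - j) * \<zeta> ^ Suc m))) \<partial>dm) =
       (\<Sum>k<n. c k * (\<integral>\<zeta>. (\<Sum>j\<le>k. neg_coef f j * (\<zeta> ^ (k - j) * \<zeta> ^ Suc m)) \<partial>dm))"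
      by (intro integral_lincomb Bochner_Integration.integrable_sum integrable_mult_right i)
    also have "\<dots> = 0" by (subst integral_lincomb[OF i]) (simp only: z mult_zero_right sum.neutral_const)
    finally show ?thesis unfolding e by (simp only: sum_distrib_left)
  qed
  have "integrable dm (\<lambda>\<zeta>. (norm (f \<zeta> * (\<Sum>k<n. c k * \<zeta> ^ k)))\<^sup>2)"
    by (rule integrable_bounded_L2[OF _ _ D(2) M]) measurable
  from Pminus_AE[OF _ this g orth]
  show "AE \<zeta> in dm. Hankel f (\<lambda>\<zeta>. \<Sum>k<n. c k * \<zeta> ^ k) \<zeta> = (\<Sum>k<n. c k * hankel_power f k \<zeta>)"
    "Hankel f (\<lambda>\<zeta>. \<Sum>k<n. c k * \<zeta> ^ k) \<in> H2minus" unfolding Hankel_def by auto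
qed

section \<open>Action on the kernels \<open>Kz\<close>\<close>

lemma Kz_measurable [measurable]: "Kz z \<in> borel_measurable borel"
  unfolding Kz_def by measurable

lemma Kz_bound:
  assumes "norm z < 1" "norm \<zeta> = 1" shows "norm (Kz z \<zeta>) \<le> 1 / (1 - norm z)"
  unfolding Kz_def using circle_denom[OF assms(2,1)] assms(1) by (simp add: norm_divide frac_le)

lemma antianalytic_polys_sum:
  assumes "\<And>k. k < n \<Longrightarrow> f k \<in> antianalytic_polys"
  shows "(\<lambda>\<zeta>. \<Sum>k<(n::nat). c k * f k \<zeta>) \<in> antianalytic_polys"
  using assms
proof (induction n)
  case 0
  have "(\<lambda>\<zeta>. \<Sum>k<(0::nat). 0 * inverse \<zeta> ^ Suc k) \<in> antianalytic_polys" by (rule antianalytic_polysI)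
  thus ?case by simp
next
  case (Suc n)
  have "(\<lambda>\<zeta>. 1 * (\<Sum>k<n. c k * f k \<zeta>) + c n * f n \<zeta>) \<in> antianalytic_polys"
    by (rule antianalytic_polys_lincomb) (use Suc in auto)
  thus ?case by simp
qed

lemma poisson_ext_cnj_power: "norm z < 1 \<Longrightarrow> poisson_ext (\<lambda>\<zeta>. cnj \<zeta> ^ m) z = cnj z ^ m"
proof -
  assume z: "norm z < 1"
  have "poisson_ext (\<lambda>\<zeta>. cnj \<zeta> ^ m) z = cnj (poisson_ext (\<lambda>\<zeta>. \<zeta> ^ m) z)"
    unfolding poisson_ext_def by (subst Bochner_Integration.integral_cnj[symmetric]) simp
  thus ?thesis using poisson_ext_power[OF z] by simp
qed

lemma poisson_ext_norm_bound:
  fixes u :: "complex \<Rightarrow> complex"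
  assumes u: "integrable dm u" and z: "norm z < 1"
  shows "norm (poisson_ext u z) \<le> 1 / (1 - norm z)\<^sup>2 * (\<integral>\<zeta>. norm (u \<zeta>) \<partial>dm)"
proof -
  have "norm (poisson_ext u z) \<le> (\<integral>\<zeta>. norm (Poisson z \<zeta> *\<^sub>R u \<zeta>) \<partial>dm)" unfolding poisson_ext_def by (rule integral_norm_bound)
  also have "\<dots> \<le> (\<integral>\<zeta>. 1 / (1 - norm z)\<^sup>2 * norm (u \<zeta>) \<partial>dm)"
  proof (rule integral_mono_AE)
    show "AE \<zeta> in dm. norm (Poisson z \<zeta> *\<^sub>R u \<zeta>) \<le> 1 / (1 - norm z)\<^sup>2 * norm (u \<zeta>)"
      using AE_dm_circle
    proof eventually_elim
      case (elim \<zeta>)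
      show ?case unfolding norm_scaleR using Poisson_le[OF elim z] Poisson_pos[OF elim z] by (intro mult_right_mono) auto
    qed
  qed (use u integrable_norm[OF integrable_Poisson_mult[OF z u]] in auto)
  also have "\<dots> = 1 / (1 - norm z)\<^sup>2 * (\<integral>\<zeta>. norm (u \<zeta>) \<partial>dm)" by (rule integral_mult_right_zero)
  finally show ?thesis .
qed

text \<open>For f = \<zeta>^-(k+1) the numerator is a difference of powers of 1/\<zeta> and
  \<open>cnj z\<close>; its factor \<open>1/\<zeta> - cnj z\<close> equals
  \<open>(1 - cnj z * \<zeta>) / \<zeta>\<close> and cancels the denominator of the kernel, leaving
  an antianalytic polynomial. The general case follows by approximation.\<close>

lemma Hankel_Kz_H2minus:
  assumes f: "f \<in> H2minus" and z: "norm z < 1"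
  shows "(\<lambda>\<zeta>. (f \<zeta> - poisson_ext f z) * Kz z \<zeta>) \<in> H2minus"
proof -
  note D = H2minusD[OF f]
  have [measurable]: "f \<in> borel_measurable borel" by (rule D)
  \<comment> \<open>The bound for the kernel times the bound for Poisson evaluation at z, as needed
    for the correction; the second factor is at least 1, so \<open>M\<close> bounds the kernel alone
    too.\<close>
  define M where "M = 1 / (1 - norm z) * (1 / (1 - norm z)\<^sup>2)"
  have Mle: "1 / (1 - norm z) \<le> M"
    unfolding M_def using z mult_left_mono[of 1 "1 / (1 - norm z)\<^sup>2" "1 / (1 - norm z)"] by (simp add: power_le_one)
  have M0: "M \<ge> 0" unfolding M_def using z by simp
  have Kb: "norm (Kz z \<zeta>) \<le> M" if "norm \<zeta> = 1" for \<zeta> using Kz_bound[OF z that] Mle by simp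
  have db: "norm (- poisson_ext u z * Kz z \<zeta>) \<le> M * (\<integral>\<zeta>. norm (u \<zeta>) \<partial>dm)" if "integrable dm u" "norm \<zeta> = 1" for u \<zeta>
  proof -
    have "norm (- poisson_ext u z * Kz z \<zeta>) = norm (poisson_ext u z) * norm (Kz z \<zeta>)" by (simp add: norm_mult)
    also have "\<dots> \<le> (1 / (1 - norm z)\<^sup>2 * (\<integral>\<zeta>. norm (u \<zeta>) \<partial>dm)) * (1 / (1 - norm z))"
      using z by (intro mult_mono poisson_ext_norm_bound[OF that(1) z] Kz_bound[OF z that(2)]) auto
    finally show ?thesis by (simp add: M_def mult_ac)
  qed
  show ?thesis
  proof (rule H2minus_operator[OF f, where C="4 * M\<^sup>2"])
    show "integrable dm (\<lambda>\<zeta>. (norm ((f \<zeta> - poisson_ext f z) * Kz z \<zeta>))\<^sup>2)"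
      by (rule operator_bound_L2(1)[where u=f and a="Kz z" and M=M and d="\<lambda>\<zeta>. - poisson_ext f z * Kz z \<zeta>"])
         (use D(2) db[OF D(3)] Kb M0 in \<open>simp_all add: left_diff_distrib right_diff_distrib mult.commute\<close>)
    fix p assume p: "p \<in> antianalytic_polys" and i: "integrable dm (\<lambda>\<zeta>. (norm (f \<zeta> - p \<zeta>))\<^sup>2)"
    have [measurable]: "p \<in> borel_measurable borel" by (rule antianalytic_polys_measurable[OF p])
    from p obtain c N where pe: "p = (\<lambda>\<zeta>. \<Sum>k<N. c k * inverse \<zeta> ^ Suc k)" by (auto simp: antianalytic_polys_def)
    define q where "q = (\<lambda>\<zeta>::complex. \<Sum>k<N. c k * (\<Sum>l<Suc k. cnj z ^ (k - l) * inverse \<zeta> ^ Suc l))"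
    have q: "q \<in> antianalytic_polys" unfolding q_def
      by (rule antianalytic_polys_sum) (rule antianalytic_polysI)
    have [measurable]: "q \<in> borel_measurable borel" by (rule antianalytic_polys_measurable[OF q])
    have pz: "poisson_ext p z = (\<Sum>k<N. c k * cnj z ^ Suc k)"
    proof -
      have "poisson_ext p z = (\<integral>\<zeta>. (\<Sum>k<N. c k * (Poisson z \<zeta> *\<^sub>R cnj \<zeta> ^ Suc k)) \<partial>dm)"
        unfolding poisson_ext_def
      proof (rule integral_dm_cong)
        fix \<zeta> :: complex assume n: "norm \<zeta> = 1"
        show "Poisson z \<zeta> *\<^sub>R p \<zeta> = (\<Sum>k<N. c k * (Poisson z \<zeta> *\<^sub>R cnj \<zeta> ^ Suc k))"
          unfolding pe inverse_circle[OF n] by (simp add: scaleR_sum_right del: power_Suc)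
      qed measurable
      also have "\<dots> = (\<Sum>k<N. c k * poisson_ext (\<lambda>\<zeta>. cnj \<zeta> ^ Suc k) z)"
        unfolding poisson_ext_def by (intro integral_lincomb integrable_Poisson_mult z integrable_dm_power)
      finally show ?thesis using z by (simp add: poisson_ext_cnj_power del: power_Suc)
    qed
    have qe: "q \<zeta> = (p \<zeta> - poisson_ext p z) * Kz z \<zeta>" if n: "norm \<zeta> = 1" for \<zeta>
    proof -
      have nz: "1 - cnj z * \<zeta> \<noteq> 0" by (rule circle_denom(2)[OF n z])
      have "\<zeta> \<noteq> 0" using n by auto
      have k: "(\<Sum>l<Suc k. cnj z ^ (k - l) * inverse \<zeta> ^ Suc l) = (inverse \<zeta> ^ Suc k - cnj z ^ Suc k) * Kz z \<zeta>" for k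
      proof -
        have "(inverse \<zeta> ^ Suc k - cnj z ^ Suc k) = (inverse \<zeta> - cnj z) * (\<Sum>l<Suc k. inverse \<zeta> ^ l * cnj z ^ (k - l))"
          by (rule diff_power_eq_sum)
        also have "inverse \<zeta> - cnj z = inverse \<zeta> * (1 - cnj z * \<zeta>)" using \<open>\<zeta> \<noteq> 0\<close> by (simp add: field_simps)
        finally have "(inverse \<zeta> ^ Suc k - cnj z ^ Suc k) * Kz z \<zeta> = inverse \<zeta> * (\<Sum>l<Suc k. inverse \<zeta> ^ l * cnj z ^ (k - l))"
          using nz by (simp add: Kz_def del: power_Suc sum.lessThan_Suc)
        also have "\<dots> = (\<Sum>l<Suc k. cnj z ^ (k - l) * inverse \<zeta> ^ Suc l)"
          unfolding sum_distrib_left by (intro sum.cong) (auto simp: mult_ac)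
        finally show ?thesis by simp
      qed
      show ?thesis unfolding q_def k pz unfolding pe
        by (simp only: sum_distrib_right sum_subtractf[symmetric] left_diff_distrib right_diff_distrib mult.assoc)
    qed
    have ifp: "integrable dm (\<lambda>\<zeta>. f \<zeta> - p \<zeta>)" by (rule L1_le_L2(1)[OF _ i]) measurable
    have ip: "integrable dm p" using Bochner_Integration.integrable_diff[OF D(3) ifp] by simp
    have cd: "poisson_ext (\<lambda>\<zeta>. f \<zeta> - p \<zeta>) z = poisson_ext f z - poisson_ext p z"
      unfolding poisson_ext_def by (subst Bochner_Integration.integral_diff[symmetric]) (auto intro!: integrable_Poisson_mult z
        D(3) ip simp: algebra_simps)
    have Fe: "(f \<zeta> - poisson_ext f z) * Kz z \<zeta> - q \<zeta> = Kz z \<zeta> * (f \<zeta> - p \<zeta>) + - poisson_ext (\<lambda>\<zeta>. f \<zeta> - p \<zeta>) z * Kz z \<zeta>"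
      if "norm \<zeta> = 1" for \<zeta>
      unfolding cd qe[OF that] by (simp add: algebra_simps)
    note O = operator_bound_L2[where u="\<lambda>\<zeta>. f \<zeta> - p \<zeta>" and a="Kz z" and M=M and d="\<lambda>\<zeta>. - poisson_ext (\<lambda>\<zeta>. f \<zeta> - p \<zeta>) z * Kz z \<zeta>"
          and F="\<lambda>\<zeta>. (f \<zeta> - poisson_ext f z) * Kz z \<zeta> - q \<zeta>", OF _ _ _ i M0 Kb db[OF ifp] Fe]
    have "integrable dm (\<lambda>\<zeta>. (norm ((f \<zeta> - poisson_ext f z) * Kz z \<zeta> - q \<zeta>))\<^sup>2) \<and> (\<integral>\<zeta>. (norm ((f \<zeta> - poisson_ext f z) * Kz z \<zeta>
      - q \<zeta>))\<^sup>2 \<partial>dm) \<le> 4 * M\<^sup>2 * (\<integral>\<zeta>. (norm (f \<zeta> - p \<zeta>))\<^sup>2 \<partial>dm)"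
      by (rule conjI; rule O; (assumption | measurable | simp))
    thus "\<exists>q\<in>antianalytic_polys. integrable dm (\<lambda>\<zeta>. (norm ((f \<zeta> - poisson_ext f z) * Kz z \<zeta> - q \<zeta>))\<^sup>2) \<and> (\<integral>\<zeta>. (norm ((f \<zeta>
      - poisson_ext f z) * Kz z \<zeta> - q \<zeta>))\<^sup>2 \<partial>dm) \<le> 4 * M\<^sup>2 * (\<integral>\<zeta>. (norm (f \<zeta> - p \<zeta>))\<^sup>2 \<partial>dm)"
      using q by blast
  qed auto
qed

text \<open>The part removed from \<open>f Kz\<close> is the constant f(z) times the analytic
  function \<open>Kz z\<close>.\<close>

theorem Hankel_Kz:
  assumes f: "f \<in> H2minus" and z: "norm z < 1"
  shows "AE \<zeta> in dm. Hankel f (Kz z) \<zeta> = (f \<zeta> - poisson_ext f z) * Kz z \<zeta>"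
proof -
  note D = H2minusD[OF f]
  have [measurable]: "f \<in> borel_measurable borel" by (rule D)
  have orth: "(\<integral>\<zeta>. (f \<zeta> * Kz z \<zeta> - (f \<zeta> - poisson_ext f z) * Kz z \<zeta>) * \<zeta> ^ Suc m \<partial>dm) = 0" for m
  proof -
    have "(\<lambda>n. cnj z ^ n * (\<integral>\<zeta>. \<zeta> ^ Suc m * \<zeta> ^ n \<partial>dm)) sums (\<integral>\<zeta>. \<zeta> ^ Suc m * Kz z \<zeta> \<partial>dm)"
    proof (rule sums_integral_circle)
      show "integrable dm (\<lambda>\<zeta>. \<zeta> ^ Suc m)" by (rule integrable_dm_power)
      show "summable (\<lambda>n. norm (cnj z ^ n))" using z by (simp add: norm_power)
      fix \<zeta> :: complex assume "norm \<zeta> = 1"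
      thus "(\<lambda>n. cnj z ^ n * \<zeta> ^ n) sums Kz z \<zeta>"
        using geometric_sums[of "cnj z * \<zeta>"] z by (simp add: Kz_def norm_mult power_mult_distrib)
    qed (auto simp: norm_power)
    moreover have "(\<integral>\<zeta>. \<zeta> ^ Suc m * \<zeta> ^ n \<partial>dm) = 0" for n
      using integral_dm_power[of "Suc m + n"] by (simp only: power_add)
    ultimately have "(\<integral>\<zeta>. \<zeta> ^ Suc m * Kz z \<zeta> \<partial>dm) = 0" by (simp add: sums_iff del: power_Suc)
    moreover have "(\<lambda>\<zeta>. (f \<zeta> * Kz z \<zeta> - (f \<zeta> - poisson_ext f z) * Kz z \<zeta>) * \<zeta> ^ Suc m)
      = (\<lambda>\<zeta>. poisson_ext f z * (\<zeta> ^ Suc m * Kz z \<zeta>))"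
      by (intro ext) (simp add: algebra_simps)
    ultimately show ?thesis by (simp only: integral_mult_right_zero mult_zero_right)
  qed
  have "integrable dm (\<lambda>\<zeta>. (norm (f \<zeta> * Kz z \<zeta>))\<^sup>2)"
    by (rule integrable_bounded_L2[OF _ _ D(2) Kz_bound[OF z]]) measurable
  from Pminus_AE(2)[OF _ this Hankel_Kz_H2minus[OF f z] orth] show ?thesis unfolding Hankel_def by auto
qed

section \<open>Dilation to the closed disc\<close>

definition dilate :: "real \<Rightarrow> (complex \<Rightarrow> complex) \<Rightarrow> complex \<Rightarrow> complex" where
  "dilate s u \<xi> = poisson_ext u (of_real s * \<xi>)"

lemma norm_of_real_mult_less:
  "norm z \<le> 1 \<Longrightarrow> 0 \<le> r \<Longrightarrow> r < 1 \<Longrightarrow> norm (complex_of_real r * z) < 1"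
  using mult_left_le[of "norm z" r] by (simp add: norm_mult)

lemma dilate_measurable [measurable]:
  assumes "u \<in> borel_measurable borel"
  shows "dilate s u \<in> borel_measurable borel"
proof -
  have "(\<lambda>\<xi>. complex_of_real s * \<xi>) \<in> borel_measurable borel"
    by (intro borel_measurable_times borel_measurable_const measurable_ident_sets refl)
  from measurable_compose[OF this poisson_ext_measurable[OF assms]] show ?thesis
    unfolding dilate_def[abs_def] .
qed

lemma dilate_bounded:
  assumes "integrable dm u" "0 \<le> s" "s < 1"
  obtains M where "\<And>\<zeta>. norm \<zeta> = 1 \<Longrightarrow> norm (dilate s u \<zeta>) \<le> M"
proof (rule circle_bounded[OF continuous_on_poisson_ext[OF assms(1)] assms(2,3)])
  fix M assume "\<And>\<zeta>. norm \<zeta> = 1 \<Longrightarrow> norm (poisson_ext u (complex_of_real s * \<zeta>)) \<le> M"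
  thus thesis by (intro that[of M]) (simp add: dilate_def)
qed

lemma integrable_dilate:
  assumes u: "integrable dm u" and s: "0 \<le> s" "s < 1"
  shows "integrable dm (dilate s u)"
proof -
  have [measurable]: "u \<in> borel_measurable borel" using u by (auto dest: borel_measurable_integrable)
  obtain M where "\<And>\<zeta>. norm \<zeta> = 1 \<Longrightarrow> norm (dilate s u \<zeta>) \<le> M" by (rule dilate_bounded[OF u s]; rule that)
  thus ?thesis by (intro integrable_dm_bounded) measurable
qed

text \<open>Symmetry of the Poisson operator moves the dilation onto the power of \<zeta>, where it
  acts as a scalar.\<close>

lemma neg_coef_dilate:
  assumes u: "integrable dm u" and s: "0 \<le> s" "s < 1"
  shows "neg_coef (dilate s u) j = of_real s ^ j * neg_coef u j"
proof -
  have [measurable]: "u \<in> borel_measurable borel" using u by (auto dest: borel_measurable_integrable)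
  have "neg_coef (dilate s u) j = (\<integral>\<zeta>. \<zeta> ^ j * poisson_ext u (of_real s * \<zeta>) \<partial>dm)"
    unfolding neg_coef_def dilate_def by (simp add: mult.commute)
  also have "\<dots> = (\<integral>\<xi>. poisson_ext (\<lambda>\<zeta>. \<zeta> ^ j) (of_real s * \<xi>) * u \<xi> \<partial>dm)"
    by (rule poisson_ext_self_adjoint[where M=1, OF _ _ u s]) (auto simp: norm_power)
  also have "\<dots> = (\<integral>\<xi>. of_real s ^ j * (u \<xi> * \<xi> ^ j) \<partial>dm)"
  proof (rule integral_dm_cong)
    fix \<xi> :: complex assume "norm \<xi> = 1"
    thus "poisson_ext (\<lambda>\<zeta>. \<zeta> ^ j) (of_real s * \<xi>) * u \<xi> = of_real s ^ j * (u \<xi> * \<xi> ^ j)"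
      using s by (subst poisson_ext_power) (auto simp: norm_mult power_mult_distrib)
  qed measurable
  also have "\<dots> = of_real s ^ j * neg_coef u j" unfolding neg_coef_def by (rule integral_mult_right_zero)
  finally show ?thesis .
qed

text \<open>On the dilated circle the antianalytic series converges pointwise, so the projection
  amounts to deleting its first k+1 terms.\<close>

lemma hankel_power_dilate_sums:
  assumes f: "f \<in> H2minus" and s: "0 \<le> s" "s < 1" and x: "norm \<xi> = 1"
  shows "(\<lambda>m. (neg_coef f (Suc m + k) * of_real s ^ (Suc m + k)) * cnj \<xi> ^ Suc m) sums hankel_power (dilate s f) k \<xi>"
proof -
  have "norm (of_real s * \<xi>) < 1" using s x by (simp add: norm_mult)
  from sums_mult[OF poisson_H2minus(2)[OF f this], of "\<xi> ^ k"]
  have "(\<lambda>j. \<xi> ^ k * (neg_coef f j * cnj (of_real s * \<xi>) ^ j)) sums (\<xi> ^ k * dilate s f \<xi>)" by (simp add: dilate_def)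
  from sums_split_initial_segment[OF this, of "Suc k"]
  have "(\<lambda>i. \<xi> ^ k * (neg_coef f (i + Suc k) * cnj (of_real s * \<xi>) ^ (i + Suc k))) sums
    (\<xi> ^ k * dilate s f \<xi> - (\<Sum>j<Suc k. \<xi> ^ k * (neg_coef f j * cnj (of_real s * \<xi>) ^ j)))" .
  moreover have "\<xi> ^ k * (neg_coef f (i + Suc k) * cnj (of_real s * \<xi>) ^ (i + Suc k))
    = (neg_coef f (Suc i + k) * of_real s ^ (Suc i + k)) * cnj \<xi> ^ Suc i" for i
  proof -
    have e: "i + Suc k = Suc i + k" by simp
    have "\<xi> ^ k * (neg_coef f (i + Suc k) * cnj (of_real s * \<xi>) ^ (i + Suc k)) =
      (neg_coef f (Suc i + k) * of_real s ^ (Suc i + k)) * cnj \<xi> ^ Suc i * (\<xi> ^ k * cnj \<xi> ^ k)"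
      unfolding e by (simp add: power_mult_distrib power_add mult_ac)
    thus ?thesis by (simp only: circle_power_cnj[OF x] mult_1_right)
  qed
  moreover have "(\<Sum>j<Suc k. \<xi> ^ k * (neg_coef f j * cnj (of_real s * \<xi>) ^ j)) = (\<Sum>j\<le>k. neg_coef (dilate s f) j * \<xi> ^ (k - j))"
    unfolding lessThan_Suc_atMost
  proof (rule sum.cong[OF refl])
    fix j assume "j \<in> {..k}"
    hence "\<xi> ^ k = \<xi> ^ (k - j) * \<xi> ^ j" by (simp flip: power_add)
    hence "\<xi> ^ k * (neg_coef f j * cnj (of_real s * \<xi>) ^ j) = (of_real s ^ j * neg_coef f j * \<xi> ^ (k - j)) * (\<xi> ^ j * cnj \<xi> ^ j)"
      by (simp add: power_mult_distrib mult_ac)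
    thus "\<xi> ^ k * (neg_coef f j * cnj (of_real s * \<xi>) ^ j) = neg_coef (dilate s f) j * \<xi> ^ (k - j)"
      by (simp only: circle_power_cnj[OF x] mult_1_right neg_coef_dilate[OF H2minusD(3)[OF f] s])
  qed
  ultimately show ?thesis unfolding hankel_power_def by (simp only:)
qed

text \<open>Compare the coefficients of \<open>fourier k (m+1)\<close>. On the left the powers of r
  have exponents i, i+m+1 and 2(m+1); on the right -i and 3(m+1+i). Both total 2i + 3(m+1).\<close>

lemma dilated_pairing_power:
  assumes f: "f \<in> H2minus" and r: "0 < r" "r < 1" and k: "integrable dm k"
  shows "(\<integral>\<zeta>. poisson_ext f (of_real r * \<zeta>) * ((of_real r * \<zeta>) ^ i * riesz_plus k (of_real r * (of_real r * \<zeta>))) \<partial>dm)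
    = inverse (of_real r) ^ i * (\<integral>\<zeta>. hankel_power (dilate (r ^ 3) f) i \<zeta> * k \<zeta> \<partial>dm)"
proof -
  note D = H2minusD[OF f]
  have [measurable]: "f \<in> borel_measurable borel" "k \<in> borel_measurable borel" using D k
    by (auto dest: borel_measurable_integrable)
  have r3: "0 \<le> r ^ 3" "r ^ 3 < 1" using r by (auto simp: power_less_one_iff)
  define u where "u = (\<lambda>\<zeta>. dilate r f \<zeta> * (of_real r * \<zeta>) ^ i)"
  have [measurable]: "u \<in> borel_measurable borel" unfolding u_def by measurable
  have iu: "integrable dm u"
    using integrable_mult_right[OF integrable_mult_power(1)[OF integrable_dilate[OF D(3), of r]], of "of_real r ^ i" i] r
    by (simp add: u_def power_mult_distrib mult_ac)
  have "(\<lambda>m. (fourier k (Suc m) * (of_real r * of_real r) ^ Suc m) * (\<integral>\<zeta>. u \<zeta> * \<zeta> ^ Suc m \<partial>dm)) sums (\<integral>\<zeta>. u \<zeta>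
    * riesz_plus k (of_real r * (of_real r * \<zeta>)) \<partial>dm)"
  proof (rule sums_integral_circle[OF iu])
    have "summable (\<lambda>n. norm (fourier k n * (of_real r * of_real r) ^ n))"
      using norm_of_real_mult_less[of "of_real r" r] r by (intro summable_fourier k) auto
    thus "summable (\<lambda>m. norm (fourier k (Suc m) * (of_real r * of_real r) ^ Suc m))"
      by (subst summable_Suc_iff[where f="\<lambda>n. norm (fourier k n * (of_real r * of_real r) ^ n)"])
    fix \<zeta> :: complex assume z: "norm \<zeta> = 1"
    have "norm (of_real r * (of_real r * \<zeta>)) < 1"
      using r z norm_of_real_mult_less[of \<zeta> r] by (intro norm_of_real_mult_less) auto
    from riesz_plus_sums[OF k this]
    show "(\<lambda>m. (fourier k (Suc m) * (of_real r * of_real r) ^ Suc m) * \<zeta> ^ Suc m) sums riesz_plus k (of_real r * (of_real r * \<zeta>))"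
      by (simp add: power_mult_distrib mult_ac)
  qed (auto simp: norm_mult norm_power)
  moreover have "(\<integral>\<zeta>. u \<zeta> * \<zeta> ^ Suc m \<partial>dm) = of_real r ^ i * (of_real r ^ (i + Suc m) * neg_coef f (i + Suc m))" for m
  proof -
    have "(\<integral>\<zeta>. u \<zeta> * \<zeta> ^ Suc m \<partial>dm) = (\<integral>\<zeta>. of_real r ^ i * (dilate r f \<zeta> * \<zeta> ^ (i + Suc m)) \<partial>dm)"
      unfolding u_def by (intro Bochner_Integration.integral_cong refl) (simp add: power_mult_distrib power_add mult_ac)
    also have "\<dots> = of_real r ^ i * neg_coef (dilate r f) (i + Suc m)" unfolding neg_coef_def by (rule integral_mult_right_zero)
    finally show ?thesis using r by (simp add: neg_coef_dilate[OF D(3)])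
  qed
  ultimately have L: "(\<lambda>m. (fourier k (Suc m) * (of_real r * of_real r) ^ Suc m) * (of_real r ^ i * (of_real r ^ (i + Suc m)
    * neg_coef f (i + Suc m)))) sums
     (\<integral>\<zeta>. u \<zeta> * riesz_plus k (of_real r * (of_real r * \<zeta>)) \<partial>dm)" by (simp only:)
  have "(\<lambda>m. (neg_coef f (Suc m + i) * of_real (r ^ 3) ^ (Suc m + i)) * (\<integral>\<zeta>. k \<zeta> * cnj \<zeta> ^ Suc m \<partial>dm)) sums (\<integral>\<zeta>. k \<zeta>
    * hankel_power (dilate (r ^ 3) f) i \<zeta> \<partial>dm)"
  proof (rule sums_integral_circle[OF k])
    have c: "summable (\<lambda>n. norm (fourier (\<lambda>\<zeta>. cnj (f \<zeta>)) n * of_real (r ^ 3) ^ n))"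
      using r3 D(3) by (intro summable_fourier) (auto simp: norm_power)
    have "norm (fourier (\<lambda>\<zeta>. cnj (f \<zeta>)) n * of_real (r ^ 3) ^ n) = norm (neg_coef f n * of_real (r ^ 3) ^ n)" for n
      by (simp add: neg_coef_eq_fourier norm_mult)
    hence "summable (\<lambda>n. norm (neg_coef f n * of_real (r ^ 3) ^ n))" using c by (simp only:)
    hence "summable (\<lambda>m. norm (neg_coef f (m + Suc i) * of_real (r ^ 3) ^ (m + Suc i)))"
      by (subst summable_iff_shift[where f="\<lambda>n. norm (neg_coef f n * of_real (r ^ 3) ^ n)"])
    thus "summable (\<lambda>m. norm (neg_coef f (Suc m + i) * of_real (r ^ 3) ^ (Suc m + i)))" by simp
  qed (use hankel_power_dilate_sums[OF f r3] in \<open>auto simp: norm_mult norm_power simp del: power_Suc of_real_power add_Suc\<close>)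
  from sums_mult[OF this, of "inverse (of_real r) ^ i"]
  have R: "(\<lambda>m. inverse (of_real r) ^ i * ((neg_coef f (Suc m + i) * of_real (r ^ 3) ^ (Suc m + i)) * fourier k (Suc m))) sums
     (inverse (of_real r) ^ i * (\<integral>\<zeta>. k \<zeta> * hankel_power (dilate (r ^ 3) f) i \<zeta> \<partial>dm))"
    unfolding fourier_def .
  have "inverse (of_real r) ^ i * ((neg_coef f (Suc m + i) * of_real (r ^ 3) ^ (Suc m + i)) * fourier k (Suc m)) =
     (fourier k (Suc m) * (of_real r * of_real r) ^ Suc m) * (of_real r ^ i * (of_real r ^ (i + Suc m) * neg_coef f (i + Suc
       m)))" for m
  proof -
    define R where "R = complex_of_real r"
    have "R \<noteq> 0" using r by (simp add: R_def)
    have "(R ^ 3) ^ (Suc m + i) = R ^ (3 * (Suc m + i))" by (simp only: power_mult)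
    also have "3 * (Suc m + i) = i + (Suc m + Suc m + i + (i + Suc m))" by simp
    also have "R ^ \<dots> = R ^ i * ((R * R) ^ Suc m * R ^ i * R ^ (i + Suc m))"
      by (simp only: power_add power_mult_distrib)
    finally have "inverse R ^ i * (R ^ 3) ^ (Suc m + i) = (inverse R ^ i * R ^ i) * ((R * R) ^ Suc m * R ^ i * R ^ (i + Suc m))"
      by (simp only: mult.assoc)
    also have "inverse R ^ i * R ^ i = 1" using \<open>R \<noteq> 0\<close> by (simp add: power_mult_distrib[symmetric])
    finally have "inverse R ^ i * (R ^ 3) ^ (Suc m + i) = (R * R) ^ Suc m * R ^ i * R ^ (i + Suc m)" by simp
    moreover have "inverse R ^ i * ((neg_coef f (Suc m + i) * (R ^ 3) ^ (Suc m + i)) * fourier k (Suc m)) =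
       (inverse R ^ i * (R ^ 3) ^ (Suc m + i)) * (neg_coef f (Suc m + i) * fourier k (Suc m))" by (simp only: mult_ac)
    ultimately show ?thesis unfolding R_def[symmetric] of_real_power by (simp only: mult_ac add.commute)
  qed
  with L R have "(\<integral>\<zeta>. u \<zeta> * riesz_plus k (of_real r * (of_real r * \<zeta>)) \<partial>dm)
    = inverse (of_real r) ^ i * (\<integral>\<zeta>. k \<zeta> * hankel_power (dilate (r ^ 3) f) i \<zeta> \<partial>dm)"
    by (simp only: sums_unique2)
  thus ?thesis by (simp add: u_def dilate_def mult_ac)
qed

text \<open>Pairing \<open>f(r \<zeta>) (r \<zeta>)^i\<close> with \<open>h(r^2 \<zeta>)\<close>, where \<open>h\<close> is analytic, multiplies the coefficient
  of \<open>f\<close> at \<open>-j\<close> by \<open>r^(3j - i)\<close>; hence the dilation by \<open>r^3\<close> and the factors \<open>r^(-i)\<close>.\<close>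

definition dilated_hankel :: "real \<Rightarrow> (complex \<Rightarrow> complex) \<Rightarrow> (nat \<Rightarrow> complex) \<Rightarrow> nat \<Rightarrow> complex \<Rightarrow> complex" where
  "dilated_hankel r f c n \<zeta> = (\<Sum>i<n. c i * (inverse (of_real r) ^ i * hankel_power (dilate (r ^ 3) f) i \<zeta>))"

lemma dilated_hankel_measurable [measurable]:
  assumes [measurable]: "f \<in> borel_measurable borel" shows "dilated_hankel r f c n \<in> borel_measurable borel"
  unfolding dilated_hankel_def by measurable

lemma dilated_hankel_bounded:
  assumes f: "f \<in> H2minus" and r: "0 < r" "r < 1"
  obtains M where "\<And>\<zeta>. norm \<zeta> = 1 \<Longrightarrow> norm (dilated_hankel r f c n \<zeta>) \<le> M"
proof -
  note D = H2minusD[OF f]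
  have r3: "0 \<le> r ^ 3" "r ^ 3 < 1" using r by (auto simp: power_less_one_iff)
  obtain M where M: "\<And>\<zeta>. norm \<zeta> = 1 \<Longrightarrow> norm (dilate (r ^ 3) f \<zeta>) \<le> M" by (rule dilate_bounded[OF D(3) r3]; rule that)
  define B where "B = (\<lambda>i. M + (\<Sum>j\<le>i. norm (neg_coef (dilate (r ^ 3) f) j)))"
  have B: "norm (hankel_power (dilate (r ^ 3) f) i \<zeta>) \<le> B i" if z: "norm \<zeta> = 1" for i \<zeta>
  proof -
    have "norm (hankel_power (dilate (r ^ 3) f) i \<zeta>)
      \<le> norm (\<zeta> ^ i * dilate (r ^ 3) f \<zeta>) + norm (\<Sum>j\<le>i. neg_coef (dilate (r ^ 3) f) j * \<zeta> ^ (i - j))"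
      unfolding hankel_power_def by (rule norm_triangle_ineq4)
    also have "\<dots> \<le> B i" unfolding B_def
      using M[OF z] z by (intro add_mono sum_norm_le) (auto simp: norm_mult norm_power)
    finally show ?thesis .
  qed
  show ?thesis
  proof (rule that[of "\<Sum>i<n. norm (c i) * (norm (inverse (complex_of_real r)) ^ i * B i)"])
    fix \<zeta> :: complex assume z: "norm \<zeta> = 1"
    show "norm (dilated_hankel r f c n \<zeta>) \<le> (\<Sum>i<n. norm (c i) * (norm (inverse (complex_of_real r)) ^ i * B i))"
      unfolding dilated_hankel_def
      by (rule sum_norm_le) (auto simp only: norm_mult norm_power intro!: mult_left_mono B z mult_nonneg_nonneg zero_le_power
        norm_ge_zero)
  qed
qed

lemma dilated_pairing:
  assumes f: "f \<in> H2minus" and r: "0 < r" "r < 1" and k: "integrable dm k"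
  shows "(\<integral>\<zeta>. poisson_ext f (of_real r * \<zeta>) * ((\<Sum>i<n. c i * (of_real r * \<zeta>) ^ i) * riesz_plus k (of_real r * (of_real r
    * \<zeta>))) \<partial>dm)
    = (\<integral>\<zeta>. dilated_hankel r f c n \<zeta> * k \<zeta> \<partial>dm)"
proof -
  note D = H2minusD[OF f]
  have [measurable]: "f \<in> borel_measurable borel" "k \<in> borel_measurable borel" using D k
    by (auto dest: borel_measurable_integrable)
  have i1: "integrable dm (\<lambda>\<zeta>. poisson_ext f (of_real r * \<zeta>) * ((of_real r * \<zeta>) ^ i * riesz_plus k (of_real r * (of_real r
    * \<zeta>))))" for i
  proof -
    have c: "continuous_on (ball 0 1) (\<lambda>z. riesz_plus k (of_real r * z))"
      by (rule continuous_on_compose2[OF holomorphic_on_imp_continuous_on[OF riesz_plus_holomorphic[OF k]]])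
         (use r in \<open>auto intro!: continuous_intros norm_of_real_mult_less\<close>)
    have "continuous_on (ball 0 1) (\<lambda>z. poisson_ext f z * (z ^ i * riesz_plus k (of_real r * z)))"
      by (intro continuous_intros continuous_on_poisson_ext D(3) c)
    then obtain M where "\<And>\<zeta>. norm \<zeta> = 1 \<Longrightarrow>
      norm (poisson_ext f (of_real r * \<zeta>) * ((of_real r * \<zeta>) ^ i * riesz_plus k (of_real r * (of_real r * \<zeta>)))) \<le> M"
      using circle_bounded[of "\<lambda>z. poisson_ext f z * (z ^ i * riesz_plus k (of_real r * z))" r] r by (metis less_imp_le)
    thus ?thesis by (intro integrable_dm_bounded) measurable
  qed
  have i2: "integrable dm (\<lambda>\<zeta>. inverse (of_real r) ^ i * hankel_power (dilate (r ^ 3) f) i \<zeta> * k \<zeta>)" for i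
  proof -
    \<comment> \<open>A single summand is bounded by viewing it as a \<open>dilated_hankel\<close>
      with one nonzero coefficient.\<close>
    obtain M where "\<And>\<zeta>. norm \<zeta> = 1 \<Longrightarrow> norm (dilated_hankel r f (\<lambda>j. if j = i then 1 else 0) (Suc i) \<zeta>) \<le> M"
      by (rule dilated_hankel_bounded[OF f r]; rule that)
    hence "integrable dm (\<lambda>\<zeta>. dilated_hankel r f (\<lambda>j. if j = i then 1 else 0) (Suc i) \<zeta> * k \<zeta>)"
      by (intro integrable_dm_bounded_mult[OF _ _ k]) measurable
    moreover have "dilated_hankel r f (\<lambda>j. if j = i then 1 else 0) (Suc i) \<zeta>
      = inverse (of_real r) ^ i * hankel_power (dilate (r ^ 3) f) i \<zeta>" for \<zeta>
      unfolding dilated_hankel_def by (simp only: if_distrib[where f="\<lambda>x. x * _"] mult_1_left mult_zero_left sum.delta'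
        finite_lessThan lessThan_iff lessI if_True sum.lessThan_Suc) simp
    ultimately show ?thesis by simp
  qed
  have "(\<integral>\<zeta>. poisson_ext f (of_real r * \<zeta>) * ((\<Sum>i<n. c i * (of_real r * \<zeta>) ^ i) * riesz_plus k (of_real r * (of_real r
    * \<zeta>))) \<partial>dm) =
     (\<integral>\<zeta>. (\<Sum>i<n. c i * (poisson_ext f (of_real r * \<zeta>) * ((of_real r * \<zeta>) ^ i * riesz_plus k (of_real r * (of_real r * \<zeta>))))) \<partial>dm)"
    by (intro Bochner_Integration.integral_cong refl) (simp only: sum_distrib_left sum_distrib_right mult_ac)
  also have "\<dots> = (\<Sum>i<n. c i * (\<integral>\<zeta>. inverse (of_real r) ^ i * hankel_power (dilate (r ^ 3) f) i \<zeta> * k \<zeta> \<partial>dm))"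
    unfolding integral_lincomb[OF i1] dilated_pairing_power[OF f r k] by (simp only: mult.assoc integral_mult_right_zero)
  also have "\<dots> = (\<integral>\<zeta>. (\<Sum>i<n. c i * (inverse (of_real r) ^ i * hankel_power (dilate (r ^ 3) f) i \<zeta> * k \<zeta>)) \<partial>dm)"
    by (rule integral_lincomb[OF i2, symmetric])
  also have "\<dots> = (\<integral>\<zeta>. dilated_hankel r f c n \<zeta> * k \<zeta> \<partial>dm)"
    unfolding dilated_hankel_def by (simp only: sum_distrib_right mult.assoc)
  finally show ?thesis .
qed

lemma poisson_ext_finite_poly:
  assumes z: "norm z < 1"
  shows "poisson_ext (\<lambda>\<zeta>. \<Sum>i<n. c i * \<zeta> ^ i) z = (\<Sum>i<n. c i * z ^ i)"
proof -
  have "poisson_ext (\<lambda>\<zeta>. \<Sum>i<n. c i * \<zeta> ^ i) z = (\<integral>\<zeta>. (\<Sum>i<n. c i * (Poisson z \<zeta> *\<^sub>R \<zeta> ^ i)) \<partial>dm)"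
    unfolding poisson_ext_def by (intro Bochner_Integration.integral_cong refl) (simp add: scaleR_sum_right)
  also have "\<dots> = (\<Sum>i<n. c i * poisson_ext (\<lambda>\<zeta>. \<zeta> ^ i) z)"
    unfolding poisson_ext_def by (intro integral_lincomb integrable_Poisson_mult z integrable_dm_power)
  finally show ?thesis by (simp add: poisson_ext_power[OF z])
qed

text \<open>Duality with a self-chosen test function: pairing \<open>g\<close> with \<open>k\<close>
  gives \<epsilon> N, while \<open>k\<close> has squared norm \<epsilon>^2 N in L2(1/lam). As
  \<open>g\<close> has negative frequencies only, \<open>k\<close> may be replaced by its analytic
  part, to which the form bound applies and whose norm the Riesz projection controls by
  \<open>C'\<close>. Boundedness of \<open>g\<close> for r < 1 makes N finite.\<close>

theorem dilated_hankel_bound: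
  assumes A1: "poisson_A2 mu Q1" and A2: "poisson_A2 lam Q2" and f: "f \<in> H2minus"
    and il: "integrable dm (\<lambda>\<zeta>. (norm (f \<zeta>))\<^sup>2 * lam \<zeta>)"
    and im: "integrable dm (\<lambda>\<zeta>. (norm (f \<zeta>))\<^sup>2 * inv_weight mu \<zeta>)"
    and k: "\<kappa> > 0"
    and o1: "\<And>z. z \<in> ball 0 1 \<Longrightarrow> poisson_ext (\<lambda>\<zeta>. (norm (f \<zeta> - poisson_ext f z))\<^sup>2 * lam \<zeta>) z \<le> \<kappa> * poisson_ext mu z"
    and o2: "\<And>z. z \<in> ball 0 1 \<Longrightarrow> poisson_ext (\<lambda>\<zeta>. (norm (f \<zeta> - poisson_ext f z))\<^sup>2 * inv_weight mu \<zeta>) z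
      \<le> \<kappa> * poisson_ext (inv_weight lam) z"
  obtains K where "K > 0"
    "\<And>c n r. 0 < r \<Longrightarrow> r < 1 \<Longrightarrow> integrable dm (\<lambda>\<zeta>. (norm (dilated_hankel r f c n \<zeta>))\<^sup>2 * lam \<zeta>) \<and>
      (\<integral>\<zeta>. (norm (dilated_hankel r f c n \<zeta>))\<^sup>2 * lam \<zeta> \<partial>dm) \<le> K * (\<integral>\<zeta>. (norm (\<Sum>i<n. c i * \<zeta> ^ i))\<^sup>2 * mu \<zeta> \<partial>dm)"
proof -
  note D = H2minusD[OF f]
  have [measurable]: "f \<in> borel_measurable borel" by (rule D)
  have D': "integrable dm (\<lambda>\<zeta>. cnj (f \<zeta>))" using D(3) by simp
  note A2' = poisson_A2_inv[OF A2]
  have mu: "integrable dm mu" and lam: "integrable dm lam" "AE \<zeta> in dm. 0 < lam \<zeta>"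
    and [measurable]: "lam \<in> borel_measurable borel" "mu \<in> borel_measurable borel"
    using A1 A2 by (auto simp: poisson_A2_def)
  show ?thesis
  proof (rule hankel_form_bounded[OF A1 A2 D(1) il im riesz_plus_holomorphic[OF D'] riesz_plus_0 poisson_H2minus(1)[OF f] k o1
    o2])
  fix C :: real assume C: "C > 0" "(\<And>g h r. g holomorphic_on ball 0 1 \<Longrightarrow> h holomorphic_on ball 0 1 \<Longrightarrow> g \<in> borel_measurable borel \<Longrightarrow>
    h \<in> borel_measurable borel \<Longrightarrow>
       integrable dm (\<lambda>\<zeta>. (norm (g \<zeta>))\<^sup>2 * mu \<zeta>) \<Longrightarrow> integrable dm (\<lambda>\<zeta>. (norm (h \<zeta>))\<^sup>2 * inv_weight lam \<zeta>) \<Longrightarrow>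
       (\<And>z. norm z < 1 \<Longrightarrow> poisson_ext g z = g z) \<Longrightarrow> (\<And>z. norm z < 1 \<Longrightarrow> poisson_ext h z = h z) \<Longrightarrow> 0 \<le> r \<Longrightarrow> r < 1 \<Longrightarrow>
       Re (\<integral>\<zeta>. poisson_ext f (of_real r * \<zeta>) * (g (of_real r * \<zeta>) * h (of_real r * \<zeta>)) \<partial>dm)
         \<le> C * ((\<integral>\<zeta>. (norm (g \<zeta>))\<^sup>2 * mu \<zeta> \<partial>dm) + (\<integral>\<zeta>. (norm (h \<zeta>))\<^sup>2 * inv_weight lam \<zeta> \<partial>dm)))"
  define C' where "C' = (2 * ((1 + 8 * Q2\<^sup>2) * Q2))\<^sup>2"
  have C': "C' > 0"
  proof -
    obtain \<omega> \<eta> where hp: "harmonic_pair (poisson_ext lam) (poisson_ext (inv_weight lam)) \<omega> \<eta> Q2"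
      by (rule poisson_A2_harmonic_pair[OF A2])
    have "Q2 \<ge> 1" using harmonic_pair.Q_ge[OF hp] .
    thus ?thesis unfolding C'_def by (intro zero_less_power mult_pos_pos add_pos_nonneg) auto
  qed
  show thesis
  proof (rule that[of "4 * C\<^sup>2 * C'"])
    show "4 * C\<^sup>2 * C' > 0" using C C' by simp
    fix c :: "nat \<Rightarrow> complex" and n and r :: real assume r: "0 < r" "r < 1"
    define g where "g = dilated_hankel r f c n"
    define p where "p = (\<lambda>\<zeta>::complex. \<Sum>i<n. c i * \<zeta> ^ i)"
    have [measurable]: "g \<in> borel_measurable borel" "p \<in> borel_measurable borel" unfolding g_def p_def by measurable
    obtain M where "\<And>\<zeta>. norm \<zeta> = 1 \<Longrightarrow> norm (dilated_hankel r f c n \<zeta>) \<le> M"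
      by (rule dilated_hankel_bounded[OF f r]; rule that)
    note M = this[folded g_def]
    have ig: "integrable dm (\<lambda>\<zeta>. (norm (g \<zeta>))\<^sup>2 * lam \<zeta>)"
      by (rule integrable_dm_bounded_mult[where B="M\<^sup>2", OF _ _ lam(1)]) (use M in \<open>auto intro!: power_mono\<close>)
    obtain M' where M': "\<And>\<zeta>. norm \<zeta> = 1 \<Longrightarrow> norm (p \<zeta>) \<le> M'" unfolding p_def using analytic_poly_bounded[of c n] by blast
    have ip: "integrable dm (\<lambda>\<zeta>. (norm (p \<zeta>))\<^sup>2 * mu \<zeta>)"
      by (rule integrable_dm_bounded_mult[where B="M'\<^sup>2", OF _ _ mu]) (use M' in \<open>auto intro!: power_mono\<close>)
    define N where "N = (\<integral>\<zeta>. (norm (g \<zeta>))\<^sup>2 * lam \<zeta> \<partial>dm)"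
    \<comment> \<open>The right side then returns \<open>C C' \<epsilon>^2 N\<close>, half of the
      \<epsilon> N on the left.\<close>
    define \<epsilon> where "\<epsilon> = 1 / (2 * C * C')"
    define k where "k = (\<lambda>\<zeta>. of_real \<epsilon> * (cnj (g \<zeta>) * of_real (lam \<zeta>)))"
    have [measurable]: "k \<in> borel_measurable borel" unfolding k_def by measurable
    have k2: "(norm (k \<zeta>))\<^sup>2 * inv_weight lam \<zeta> = \<epsilon>\<^sup>2 * ((norm (g \<zeta>))\<^sup>2 * lam \<zeta>)" for \<zeta>
      unfolding k_def inv_weight_def by (cases "lam \<zeta> = 0") (auto simp: norm_mult power_mult_distrib field_simps power2_eq_square)
    have ik2: "integrable dm (\<lambda>\<zeta>. (norm (k \<zeta>))\<^sup>2 * inv_weight lam \<zeta>)" unfolding k2 using ig by simp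
    have ik: "integrable dm k"
      by (rule weighted_integrable[OF _ _ _ ik2]) (use A2' in \<open>auto simp: poisson_A2_def\<close>)
    \<comment> \<open>The extra dilation makes \<open>h\<close> bounded on the circle and equal to
      its own Poisson extension.\<close>
    define h where "h = (\<lambda>z. riesz_plus k (of_real r * z))"
    have [measurable]: "h \<in> borel_measurable borel" unfolding h_def by measurable
    have hh: "h holomorphic_on ball 0 1"
    proof -
      have "of_real r * z \<in> ball 0 1" if "z \<in> ball 0 1" for z :: complex
        using that r norm_of_real_mult_less[of z r] by simp
      thus ?thesis unfolding h_def
        by (intro holomorphic_on_compose_gen[OF _ riesz_plus_holomorphic[OF ik], unfolded o_def]) (auto intro!:
          holomorphic_intros)
    qed
    have Ph: "poisson_ext h z = h z" if "norm z < 1" for z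
      unfolding h_def using r by (intro riesz_plus_dilation ik that) auto
    have hb: "(\<integral>\<zeta>. (norm (h \<zeta>))\<^sup>2 * inv_weight lam \<zeta> \<partial>dm) \<le> C' * (\<epsilon>\<^sup>2 * N)"
      using riesz_projection_weighted[OF A2' _ ik2, of r] r unfolding k2 by (simp add: h_def C'_def N_def)
    have ih: "integrable dm (\<lambda>\<zeta>. (norm (h \<zeta>))\<^sup>2 * inv_weight lam \<zeta>)"
    proof -
      obtain B where B: "\<And>\<zeta>. norm \<zeta> = 1 \<Longrightarrow> norm (riesz_plus k (of_real r * \<zeta>)) \<le> B"
        by (rule circle_bounded[OF holomorphic_on_imp_continuous_on[OF riesz_plus_holomorphic[OF ik]] less_imp_le[OF r(1)] r(2)];
          rule that)
      have "integrable dm (inv_weight lam)" using A2 by (simp add: poisson_A2_def)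
      thus ?thesis unfolding h_def
        by (intro integrable_dm_bounded_mult[where B="B\<^sup>2"]) (use B in \<open>auto intro!: power_mono\<close>)
    qed
    have "\<epsilon> * N = Re (\<integral>\<zeta>. g \<zeta> * k \<zeta> \<partial>dm)"
    proof -
      have "(\<lambda>\<zeta>. g \<zeta> * k \<zeta>) = (\<lambda>\<zeta>. of_real (\<epsilon> * ((norm (g \<zeta>))\<^sup>2 * lam \<zeta>)))"
        by (intro ext) (simp add: k_def complex_norm_square mult_ac del: of_real_power flip: of_real_power)
      hence "(\<integral>\<zeta>. g \<zeta> * k \<zeta> \<partial>dm) = of_real (\<integral>\<zeta>. \<epsilon> * ((norm (g \<zeta>))\<^sup>2 * lam \<zeta>) \<partial>dm)"
        by (simp only: integral_complex_of_real)
      thus ?thesis unfolding N_def by (subst (asm) integral_mult_right_zero) simp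
    qed
    also have "\<dots> = Re (\<integral>\<zeta>. poisson_ext f (of_real r * \<zeta>) * (p (of_real r * \<zeta>) * h (of_real r * \<zeta>)) \<partial>dm)"
      unfolding g_def p_def h_def by (simp only: dilated_pairing[OF f r ik])
    also have "\<dots> \<le> C * ((\<integral>\<zeta>. (norm (p \<zeta>))\<^sup>2 * mu \<zeta> \<partial>dm) + (\<integral>\<zeta>. (norm (h \<zeta>))\<^sup>2 * inv_weight lam \<zeta> \<partial>dm))"
    proof (rule C(2)[OF _ hh _ _ ip ih _ Ph])
      show "p holomorphic_on ball 0 1" unfolding p_def by (intro holomorphic_intros)
      show "poisson_ext p z = p z" if "norm z < 1" for z unfolding p_def by (rule poisson_ext_finite_poly[OF that])
    qed (use r in auto)
    also have "\<dots> \<le> C * ((\<integral>\<zeta>. (norm (p \<zeta>))\<^sup>2 * mu \<zeta> \<partial>dm) + C' * (\<epsilon>\<^sup>2 * N))"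
      using hb C(1) by (intro mult_left_mono add_left_mono) auto
    also have "\<dots> = C * (\<integral>\<zeta>. (norm (p \<zeta>))\<^sup>2 * mu \<zeta> \<partial>dm) + N / (4 * C * C')"
      using C C' by (simp add: \<epsilon>_def field_simps power2_eq_square)
    finally have "\<epsilon> * N \<le> C * (\<integral>\<zeta>. (norm (p \<zeta>))\<^sup>2 * mu \<zeta> \<partial>dm) + N / (4 * C * C')" .
    moreover have "\<epsilon> * N = 2 * (N / (4 * C * C'))" by (simp add: \<epsilon>_def)
    ultimately have "N / (4 * C * C') \<le> C * (\<integral>\<zeta>. (norm (p \<zeta>))\<^sup>2 * mu \<zeta> \<partial>dm)" by linarith
    hence "N \<le> (C * (\<integral>\<zeta>. (norm (p \<zeta>))\<^sup>2 * mu \<zeta> \<partial>dm)) * (4 * C * C')"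
      using C(1) C' by (subst (asm) pos_divide_le_eq) auto
    hence "N \<le> 4 * C\<^sup>2 * C' * (\<integral>\<zeta>. (norm (p \<zeta>))\<^sup>2 * mu \<zeta> \<partial>dm)" by (simp add: power2_eq_square mult_ac)
    thus "integrable dm (\<lambda>\<zeta>. (norm (dilated_hankel r f c n \<zeta>))\<^sup>2 * lam \<zeta>) \<and>
      (\<integral>\<zeta>. (norm (dilated_hankel r f c n \<zeta>))\<^sup>2 * lam \<zeta> \<partial>dm) \<le> 4 * C\<^sup>2 * C' * (\<integral>\<zeta>. (norm (\<Sum>i<n. c i * \<zeta> ^ i))\<^sup>2 * mu \<zeta> \<partial>dm)"
      using ig by (simp add: N_def g_def p_def)
  qed
  qed (assumption | simp)+
qed

section \<open>Passage to the boundary\<close>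

lemma poisson_ext_one: "norm z < 1 \<Longrightarrow> poisson_ext (\<lambda>_. 1 :: complex) z = 1"
  using poisson_ext_power[of z 0] by simp

text \<open>The modulus of an extension is at most the extension of the modulus, and averaging over
  the circle returns the L1 norm because the symmetric kernel has mean 1 in either variable.\<close>

lemma dilate_L1_contraction:
  fixes u :: "complex \<Rightarrow> complex"
  assumes u: "integrable dm u" and s: "0 \<le> s" "s < 1"
  shows "(\<integral>\<zeta>. norm (dilate s u \<zeta>) \<partial>dm) \<le> (\<integral>\<zeta>. norm (u \<zeta>) \<partial>dm)"
proof -
  have [measurable]: "u \<in> borel_measurable borel" using u by (auto dest: borel_measurable_integrable)
  have iu: "integrable dm (\<lambda>\<zeta>. complex_of_real (norm (u \<zeta>)))" using u by simp
  have pe: "poisson_ext (\<lambda>\<zeta>. complex_of_real (norm (u \<zeta>))) (of_real s * \<zeta>)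
    = of_real (poisson_ext (\<lambda>\<zeta>. norm (u \<zeta>)) (of_real s * \<zeta>))"
    if "norm \<zeta> = 1" for \<zeta> using u s that by (intro poisson_ext_of_real norm_of_real_mult_less) auto
  have "complex_of_real (\<integral>\<zeta>. poisson_ext (\<lambda>\<zeta>. norm (u \<zeta>)) (of_real s * \<zeta>) \<partial>dm)
    = (\<integral>\<zeta>. 1 * poisson_ext (\<lambda>\<zeta>. complex_of_real (norm (u \<zeta>))) (of_real s * \<zeta>) \<partial>dm)"
    unfolding integral_complex_of_real[symmetric] by (intro integral_dm_cong) (auto simp: pe)
  also have "\<dots> = (\<integral>\<xi>. poisson_ext (\<lambda>_. 1) (of_real s * \<xi>) * complex_of_real (norm (u \<xi>)) \<partial>dm)"
    by (rule poisson_ext_self_adjoint[where M=1, OF _ _ iu s]) auto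
  also have "\<dots> = (\<integral>\<xi>. complex_of_real (norm (u \<xi>)) \<partial>dm)"
    using s by (intro integral_dm_cong) (auto simp: poisson_ext_one norm_of_real_mult_less)
  also have "\<dots> = complex_of_real (\<integral>\<xi>. norm (u \<xi>) \<partial>dm)" by (rule integral_complex_of_real)
  finally have e: "(\<integral>\<zeta>. poisson_ext (\<lambda>\<zeta>. norm (u \<zeta>)) (of_real s * \<zeta>) \<partial>dm) = (\<integral>\<xi>. norm (u \<xi>) \<partial>dm)" by (simp only: of_real_eq_iff)
  have le: "norm (dilate s u \<zeta>) \<le> poisson_ext (\<lambda>\<zeta>. norm (u \<zeta>)) (of_real s * \<zeta>)" if z: "norm \<zeta> = 1" for \<zeta>
  proof -
    have "norm (dilate s u \<zeta>) \<le> (\<integral>\<xi>. norm (Poisson (of_real s * \<zeta>) \<xi> *\<^sub>R u \<xi>) \<partial>dm)"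
      unfolding dilate_def poisson_ext_def by (rule integral_norm_bound)
    also have "\<dots> = poisson_ext (\<lambda>\<zeta>. norm (u \<zeta>)) (of_real s * \<zeta>)"
      unfolding poisson_ext_def
    proof (rule integral_dm_cong)
      fix \<xi> :: complex assume "norm \<xi> = 1"
      from Poisson_pos[OF this norm_of_real_mult_less[of \<zeta> s]] z s
      show "norm (Poisson (of_real s * \<zeta>) \<xi> *\<^sub>R u \<xi>) = Poisson (of_real s * \<zeta>) \<xi> *\<^sub>R norm (u \<xi>)" by simp
    qed measurable
    finally show ?thesis .
  qed
  have ip: "integrable dm (\<lambda>\<zeta>. poisson_ext (\<lambda>\<zeta>. norm (u \<zeta>)) (of_real s * \<zeta>))"
  proof (rule integrable_dm_bounded[where B="1 / (1 - s)\<^sup>2 * (\<integral>\<zeta>. norm (u \<zeta>) \<partial>dm)"])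
    fix \<zeta> :: complex assume z: "norm \<zeta> = 1"
    have "norm (poisson_ext (\<lambda>\<zeta>. complex_of_real (norm (u \<zeta>))) (of_real s * \<zeta>))
      \<le> 1 / (1 - norm (of_real s * \<zeta>))\<^sup>2 * (\<integral>\<zeta>. norm (complex_of_real (norm (u \<zeta>))) \<partial>dm)"
      using z s by (intro poisson_ext_norm_bound iu norm_of_real_mult_less) auto
    thus "norm (poisson_ext (\<lambda>\<zeta>. norm (u \<zeta>)) (of_real s * \<zeta>)) \<le> 1 / (1 - s)\<^sup>2 * (\<integral>\<zeta>. norm (u \<zeta>) \<partial>dm)"
      unfolding pe[OF z] using z s by (simp add: norm_mult)
  qed measurable
  have "(\<integral>\<zeta>. norm (dilate s u \<zeta>) \<partial>dm) \<le> (\<integral>\<zeta>. poisson_ext (\<lambda>\<zeta>. norm (u \<zeta>)) (of_real s * \<zeta>) \<partial>dm)"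
    by (rule integral_mono_AE[OF integrable_norm[OF integrable_dilate[OF u s]] ip]) (use AE_dm_circle le in \<open>auto elim:
      eventually_mono\<close>)
  thus ?thesis using e by simp
qed

lemma dilate_antianalytic_poly:
  assumes "0 \<le> s" "s < 1" "norm \<zeta> = 1"
  shows "dilate s (\<lambda>\<zeta>. \<Sum>k<N. c k * inverse \<zeta> ^ Suc k) \<zeta> = (\<Sum>k<N. c k * (of_real s ^ Suc k * cnj \<zeta> ^ Suc k))"
proof -
  define z where "z = complex_of_real s * \<zeta>"
  have z: "norm z < 1" unfolding z_def using assms by (intro norm_of_real_mult_less) auto
  have "poisson_ext (\<lambda>\<zeta>. \<Sum>k<N. c k * inverse \<zeta> ^ Suc k) z = (\<integral>\<zeta>. (\<Sum>k<N. c k * (Poisson z \<zeta> *\<^sub>R cnj \<zeta> ^ Suc k)) \<partial>dm)"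
    unfolding poisson_ext_def
  proof (rule integral_dm_cong)
    fix \<zeta> :: complex assume n: "norm \<zeta> = 1"
    show "Poisson z \<zeta> *\<^sub>R (\<Sum>k<N. c k * inverse \<zeta> ^ Suc k) = (\<Sum>k<N. c k * (Poisson z \<zeta> *\<^sub>R cnj \<zeta> ^ Suc k))"
      unfolding inverse_circle[OF n] by (simp add: scaleR_sum_right del: power_Suc)
  qed measurable
  also have "\<dots> = (\<Sum>k<N. c k * poisson_ext (\<lambda>\<zeta>. cnj \<zeta> ^ Suc k) z)"
    unfolding poisson_ext_def by (intro integral_lincomb integrable_Poisson_mult z integrable_dm_power)
  finally show ?thesis using z unfolding dilate_def z_def[symmetric]
    by (simp only: poisson_ext_cnj_power) (simp add: z_def power_mult_distrib del: power_Suc)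
qed

text \<open>Antianalytic polynomials converge uniformly under dilation, and the contraction property
  transfers this by density. Convergence in L1 suffices, as it serves to extract an almost
  everywhere convergent subsequence.\<close>

lemma dilate_L1_convergence:
  assumes f: "f \<in> H2minus" and s: "\<And>n::nat. 0 \<le> s n" "\<And>n. s n < 1" "s \<longlonglongrightarrow> 1"
  shows "(\<lambda>n. \<integral>\<zeta>. norm (dilate (s n) f \<zeta> - f \<zeta>) \<partial>dm) \<longlonglongrightarrow> 0"
proof (rule LIMSEQ_I)
  fix e :: real assume e: "e > 0"
  note D = H2minusD[OF f]
  have [measurable]: "f \<in> borel_measurable borel" by (rule D)
  have e3: "0 < (e/3) * (e/3)" using e by simp
  obtain p where p: "p \<in> antianalytic_polys" "integrable dm (\<lambda>\<zeta>. (norm (f \<zeta> - p \<zeta>))\<^sup>2)" "(\<integral>\<zeta>. (norm (f \<zeta> - p \<zeta>))\<^sup>2 \<partial>dm)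
    < (e/3) * (e/3)"
    by (rule H2minus_approx[OF f e3]; rule that)
  have [measurable]: "p \<in> borel_measurable borel" by (rule antianalytic_polys_measurable[OF p(1)])
  have i: "integrable dm (\<lambda>\<zeta>. f \<zeta> - p \<zeta>)" and b: "(\<integral>\<zeta>. norm (f \<zeta> - p \<zeta>) \<partial>dm)\<^sup>2 \<le> (\<integral>\<zeta>. (norm (f \<zeta> - p \<zeta>))\<^sup>2 \<partial>dm)"
    by (rule L1_le_L2[OF _ p(2)], measurable)+
  have b1: "(\<integral>\<zeta>. norm (f \<zeta> - p \<zeta>) \<partial>dm) < e / 3"
    by (rule power2_less_imp_less) (use b p(3) e in \<open>auto simp: power2_eq_square\<close>)
  have ip: "integrable dm p" using Bochner_Integration.integrable_diff[OF D(3) i] by simp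
  from p obtain c N where pe: "p = (\<lambda>\<zeta>. \<Sum>k<N. c k * inverse \<zeta> ^ Suc k)" by (auto simp: antianalytic_polys_def)
  have "(\<lambda>n. \<Sum>k<N. norm (c k) * (1 - s n ^ Suc k)) \<longlonglongrightarrow> (\<Sum>k<N. norm (c k) * (1 - 1 ^ Suc k))"
    by (intro tendsto_intros s)
  hence "(\<lambda>n. \<Sum>k<N. norm (c k) * (1 - s n ^ Suc k)) \<longlonglongrightarrow> 0" by simp
  from LIMSEQ_D[OF this, of "e/3"] e obtain n0 where n0: "\<And>n. n \<ge> n0 \<Longrightarrow> norm (\<Sum>k<N. norm (c k) * (1 - s n ^ Suc k)) < e / 3"
    by auto
  show "\<exists>no. \<forall>n\<ge>no. norm ((\<integral>\<zeta>. norm (dilate (s n) f \<zeta> - f \<zeta>) \<partial>dm) - 0) < e"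
  proof (intro exI[of _ n0] allI impI)
    fix n assume n: "n \<ge> n0"
    have dd: "dilate (s n) f \<zeta> = dilate (s n) (\<lambda>\<zeta>. f \<zeta> - p \<zeta>) \<zeta> + dilate (s n) p \<zeta>" if "norm \<zeta> = 1" for \<zeta>
    proof -
      have z: "norm (of_real (s n) * \<zeta>) < 1" using s that by (intro norm_of_real_mult_less) auto
      show ?thesis unfolding dilate_def poisson_ext_def
        by (subst Bochner_Integration.integral_add[OF integrable_Poisson_mult[OF z i] integrable_Poisson_mult[OF z ip],
          symmetric]) (simp add: algebra_simps)
    qed
    have pb: "norm (dilate (s n) p \<zeta> - p \<zeta>) \<le> (\<Sum>k<N. norm (c k) * (1 - s n ^ Suc k))" if z: "norm \<zeta> = 1" for \<zeta>
    proof -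
      have "dilate (s n) p \<zeta> - p \<zeta> = (\<Sum>k<N. c k * (of_real (s n ^ Suc k - 1) * cnj \<zeta> ^ Suc k))"
        unfolding pe dilate_antianalytic_poly[OF s(1,2) z] inverse_circle[OF z]
        by (simp add: sum_subtractf[symmetric] algebra_simps del: power_Suc)
      also have "norm \<dots> \<le> (\<Sum>k<N. norm (c k) * (1 - s n ^ Suc k))"
      proof (rule sum_norm_le)
        fix k
        have "s n ^ Suc k \<le> 1" using s(1)[of n] s(2)[of n] by (intro power_le_one) auto
        thus "norm (c k * (of_real (s n ^ Suc k - 1) * cnj \<zeta> ^ Suc k)) \<le> norm (c k) * (1 - s n ^ Suc k)"
          using z by (simp add: norm_mult norm_power del: power_Suc of_real_diff)
      qed
      finally show ?thesis .
    qed
    note id = integrable_dilate[OF i s(1,2)] integrable_dilate[OF D(3) s(1,2)]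
    have "(\<integral>\<zeta>. norm (dilate (s n) f \<zeta> - f \<zeta>) \<partial>dm)
      \<le> (\<integral>\<zeta>. norm (dilate (s n) (\<lambda>\<zeta>. f \<zeta> - p \<zeta>) \<zeta>) + (\<Sum>k<N. norm (c k) * (1 - s n ^ Suc k)) + norm (f \<zeta> - p \<zeta>) \<partial>dm)"
    proof (rule integral_mono_AE)
      show "AE \<zeta> in dm. norm (dilate (s n) f \<zeta> - f \<zeta>)
        \<le> norm (dilate (s n) (\<lambda>\<zeta>. f \<zeta> - p \<zeta>) \<zeta>) + (\<Sum>k<N. norm (c k) * (1 - s n ^ Suc k)) + norm (f \<zeta> - p \<zeta>)"
        using AE_dm_circle
      proof eventually_elim
        case (elim \<zeta>)
        have "dilate (s n) f \<zeta> - f \<zeta> = dilate (s n) (\<lambda>\<zeta>. f \<zeta> - p \<zeta>) \<zeta> + (dilate (s n) p \<zeta> - p \<zeta>) - (f \<zeta> - p \<zeta>)"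
          unfolding dd[OF elim] by simp
        also have "norm \<dots> \<le> norm (dilate (s n) (\<lambda>\<zeta>. f \<zeta> - p \<zeta>) \<zeta>) + norm (dilate (s n) p \<zeta> - p \<zeta>) + norm (f \<zeta> - p \<zeta>)"
          by (rule order_trans[OF norm_triangle_ineq4]) (simp add: norm_triangle_ineq)
        finally show ?case using pb[OF elim] by linarith
      qed
      show "integrable dm (\<lambda>\<zeta>. norm (dilate (s n) f \<zeta> - f \<zeta>))" using id D(3) by simp
    qed (use id i in simp)
    also have "\<dots> = (\<integral>\<zeta>. norm (dilate (s n) (\<lambda>\<zeta>. f \<zeta> - p \<zeta>) \<zeta>) \<partial>dm) + (\<Sum>k<N. norm (c k) * (1 - s n ^ Suc k)) + (\<integral>\<zeta>. norm (f \<zeta>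
      - p \<zeta>) \<partial>dm)"
      using id i by simp
    also have "\<dots> < e / 3 + e / 3 + e / 3"
      using dilate_L1_contraction[OF i s(1,2), of n] b1 n0[OF n] by (intro add_strict_mono) auto
    finally show "norm ((\<integral>\<zeta>. norm (dilate (s n) f \<zeta> - f \<zeta>) \<partial>dm) - 0) < e" by simp
  qed
qed

text \<open>The bounds for \<open>dilated_hankel\<close> do not depend on r, and its pointwise limit
  as r tends to 1 is the Hankel image; Fatou's lemma keeps the constant.\<close>

theorem Hankel_poly_bound:
  assumes A1: "poisson_A2 mu Q1" and A2: "poisson_A2 lam Q2" and f: "f \<in> H2minus"
    and il: "integrable dm (\<lambda>\<zeta>. (norm (f \<zeta>))\<^sup>2 * lam \<zeta>)"
    and im: "integrable dm (\<lambda>\<zeta>. (norm (f \<zeta>))\<^sup>2 * inv_weight mu \<zeta>)"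
    and k: "\<kappa> > 0"
    and o1: "\<And>z. z \<in> ball 0 1 \<Longrightarrow> poisson_ext (\<lambda>\<zeta>. (norm (f \<zeta> - poisson_ext f z))\<^sup>2 * lam \<zeta>) z \<le> \<kappa> * poisson_ext mu z"
    and o2: "\<And>z. z \<in> ball 0 1 \<Longrightarrow> poisson_ext (\<lambda>\<zeta>. (norm (f \<zeta> - poisson_ext f z))\<^sup>2 * inv_weight mu \<zeta>) z
      \<le> \<kappa> * poisson_ext (inv_weight lam) z"
  shows "\<exists>K\<ge>0. \<forall>p\<in>analytic_polys. sqnormL2 lam (Hankel f p) \<le> ennreal K * sqnormL2 mu p"
proof (rule dilated_hankel_bound[OF A1 A2 f il im k o1 o2])
  fix K :: real assume K0: "K > 0" and K: "(\<And>c n r. 0 < r \<Longrightarrow> r < 1 \<Longrightarrow>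
    integrable dm (\<lambda>\<zeta>. (norm (dilated_hankel r f c n \<zeta>))\<^sup>2 * lam \<zeta>) \<and>
      (\<integral>\<zeta>. (norm (dilated_hankel r f c n \<zeta>))\<^sup>2 * lam \<zeta> \<partial>dm) \<le> K * (\<integral>\<zeta>. (norm (\<Sum>i<n. c i * \<zeta> ^ i))\<^sup>2 * mu \<zeta> \<partial>dm))"
  note D = H2minusD[OF f]
  have [measurable]: "f \<in> borel_measurable borel" by (rule D)
  have mu: "integrable dm mu" "AE \<zeta> in dm. 0 \<le> mu \<zeta>" and lam: "AE \<zeta> in dm. 0 \<le> lam \<zeta>"
    and [measurable]: "lam \<in> borel_measurable borel" "mu \<in> borel_measurable borel"
    using A1 A2 by (auto simp: poisson_A2_def elim: eventually_mono)
  \<comment> \<open>The shift by 2 keeps all radii strictly between 0 and 1; positivity matters for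
    the inverse powers of r.\<close>
  define \<rho> where "\<rho> = (\<lambda>n::nat. 1 - inverse (real (n + 2)))"
  have \<rho>: "0 < \<rho> n" "\<rho> n < 1" for n unfolding \<rho>_def by (auto simp: field_simps)
  have \<rho>1: "\<rho> \<longlonglongrightarrow> 1 - 0" unfolding \<rho>_def
    by (intro tendsto_diff tendsto_const LIMSEQ_ignore_initial_segment[OF lim_inverse_n])
  have s: "0 \<le> \<rho> n ^ 3" "\<rho> n ^ 3 < 1" for n using \<rho>[of n] by (auto simp: power_less_one_iff)
  have s1: "(\<lambda>n. \<rho> n ^ 3) \<longlonglongrightarrow> 1" using tendsto_power[OF \<rho>1, of 3] by simp
  \<comment> \<open>The subsequence depends on \<open>f\<close> alone, so it serves all polynomials
    at once.\<close>
  have "\<exists>q::nat\<Rightarrow>nat. strict_mono q \<and> (AE x in dm. (\<lambda>n. dilate (\<rho> (q n) ^ 3) f x - f x) \<longlonglongrightarrow> 0)"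
    by (rule tendsto_L1_AE_subseq[OF _ dilate_L1_convergence[OF f s s1]]) (use integrable_dilate[OF D(3) s] D(3) in simp)
  then obtain q where q: "strict_mono q" and ae: "AE x in dm. (\<lambda>n. dilate (\<rho> (q n) ^ 3) f x - f x) \<longlonglongrightarrow> 0" by blast
  have qlim: "(\<lambda>n. \<rho> (q n)) \<longlonglongrightarrow> 1" using LIMSEQ_subseq_LIMSEQ[OF \<rho>1 q] by (simp add: o_def)
  have "sqnormL2 lam (Hankel f p) \<le> ennreal K * sqnormL2 mu p" if "p \<in> analytic_polys" for p
  proof -
    from that obtain c n where p: "p = (\<lambda>\<zeta>. \<Sum>i<n. c i * \<zeta> ^ i)" by (auto simp: analytic_polys_def)
    have [measurable]: "p \<in> borel_measurable borel" by (rule analytic_polys_measurable[OF that])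
    have conv: "AE \<zeta> in dm. (\<lambda>m. dilated_hankel (\<rho> (q m)) f c n \<zeta>) \<longlonglongrightarrow> (\<Sum>i<n. c i * hankel_power f i \<zeta>)"
      using ae
    proof eventually_elim
      case (elim \<zeta>)
      have l1: "(\<lambda>m. dilate (\<rho> (q m) ^ 3) f \<zeta>) \<longlonglongrightarrow> f \<zeta>" using elim by (rule LIM_zero_cancel)
      have l2: "(\<lambda>m. neg_coef (dilate (\<rho> (q m) ^ 3) f) j) \<longlonglongrightarrow> neg_coef f j" for j
      proof -
        have "(\<lambda>m. of_real (\<rho> (q m) ^ 3) ^ j * neg_coef f j) \<longlonglongrightarrow> of_real (1 ^ 3) ^ j * neg_coef f j" by (intro tendsto_intros qlim)
        thus ?thesis by (simp only: neg_coef_dilate[OF D(3) s]) simp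
      qed
      have l3: "(\<lambda>m. hankel_power (dilate (\<rho> (q m) ^ 3) f) i \<zeta>) \<longlonglongrightarrow> hankel_power f i \<zeta>" for i
        unfolding hankel_power_def by (intro tendsto_intros l1 l2)
      have l4: "(\<lambda>m. inverse (complex_of_real (\<rho> (q m)))) \<longlonglongrightarrow> inverse (of_real 1)" by (intro tendsto_intros qlim) auto
      have "(\<lambda>m. dilated_hankel (\<rho> (q m)) f c n \<zeta>) \<longlonglongrightarrow> (\<Sum>i<n. c i * (inverse (of_real 1) ^ i * hankel_power f i \<zeta>))"
        unfolding dilated_hankel_def by (intro tendsto_intros l3 l4)
      thus ?case by simp
    qed
    obtain M' where M': "\<And>\<zeta>. norm \<zeta> = 1 \<Longrightarrow> norm (p \<zeta>) \<le> M'" unfolding p using analytic_poly_bounded[of c n] by blast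
    have ip: "integrable dm (\<lambda>\<zeta>. (norm (p \<zeta>))\<^sup>2 * mu \<zeta>)"
      by (rule integrable_dm_bounded_mult[where B="M'\<^sup>2", OF _ _ mu(1)]) (use M' in \<open>auto intro!: power_mono\<close>)
    have "sqnormL2 lam (Hankel f p) = sqnormL2 lam (\<lambda>\<zeta>. \<Sum>i<n. c i * hankel_power f i \<zeta>)"
      unfolding p by (rule sqnormL2_cong_AE[OF Hankel_poly(1)[OF f]])
    also have "\<dots> = (\<integral>\<^sup>+\<zeta>. liminf (\<lambda>m. ennreal ((norm (dilated_hankel (\<rho> (q m)) f c n \<zeta>))\<^sup>2 * lam \<zeta>)) \<partial>dm)"
      unfolding sqnormL2_def
    proof (rule nn_integral_cong_AE)
      show "AE \<zeta> in dm. ennreal ((norm (\<Sum>i<n. c i * hankel_power f i \<zeta>))\<^sup>2 * lam \<zeta>)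
        = liminf (\<lambda>m. ennreal ((norm (dilated_hankel (\<rho> (q m)) f c n \<zeta>))\<^sup>2 * lam \<zeta>))"
        using conv
      proof eventually_elim
        case (elim \<zeta>)
        have "(\<lambda>m. ennreal ((norm (dilated_hankel (\<rho> (q m)) f c n \<zeta>))\<^sup>2 * lam \<zeta>)) \<longlonglongrightarrow> ennreal ((norm (\<Sum>i<n. c i
          * hankel_power f i \<zeta>))\<^sup>2 * lam \<zeta>)"
          by (intro tendsto_ennrealI tendsto_intros elim)
        thus ?case by (intro lim_imp_Liminf[symmetric]) auto
      qed
    qed
    also have "\<dots> \<le> liminf (\<lambda>m. \<integral>\<^sup>+\<zeta>. ennreal ((norm (dilated_hankel (\<rho> (q m)) f c n \<zeta>))\<^sup>2 * lam \<zeta>) \<partial>dm)"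
      by (rule nn_integral_liminf) measurable
    also have "\<dots> \<le> ennreal K * sqnormL2 mu p"
    proof (rule Liminf_le)
      have "(\<integral>\<^sup>+\<zeta>. ennreal ((norm (dilated_hankel (\<rho> (q m)) f c n \<zeta>))\<^sup>2 * lam \<zeta>) \<partial>dm) \<le> ennreal K * sqnormL2 mu p" for m
      proof -
        note KK = K[where r="\<rho> (q m)" and c=c and n=n, OF \<rho>]
        have "(\<integral>\<^sup>+\<zeta>. ennreal ((norm (dilated_hankel (\<rho> (q m)) f c n \<zeta>))\<^sup>2 * lam \<zeta>) \<partial>dm)
          = ennreal (\<integral>\<zeta>. (norm (dilated_hankel (\<rho> (q m)) f c n \<zeta>))\<^sup>2 * lam \<zeta> \<partial>dm)"
          using sqnormL2_eq_integral[OF _ _ lam, of "dilated_hankel (\<rho> (q m)) f c n"] KK by (simp add: sqnormL2_def)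
        also have "\<dots> \<le> ennreal (K * (\<integral>\<zeta>. (norm (p \<zeta>))\<^sup>2 * mu \<zeta> \<partial>dm))" using KK by (intro ennreal_leI) (simp add: p)
        also have "\<dots> = ennreal K * sqnormL2 mu p"
          using K0 by (subst sqnormL2_eq_integral[OF _ _ mu(2) ip]) (auto simp: ennreal_mult')
        finally show ?thesis .
      qed
      thus "eventually (\<lambda>m. (\<integral>\<^sup>+\<zeta>. ennreal ((norm (dilated_hankel (\<rho> (q m)) f c n \<zeta>))\<^sup>2 * lam \<zeta>) \<partial>dm)
        \<le> ennreal K * sqnormL2 mu p) sequentially" by simp
    qed simp
    finally show ?thesis .
  qed
  thus ?thesis using K0 by (intro exI[of _ K]) auto
qed (assumption | simp)+

text \<open>Square root and square are adjoint on the extended nonnegative reals. This is why the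
  root commutes with arbitrary suprema.\<close>

lemma ennsqrt_le_iff: "ennsqrt x \<le> y \<longleftrightarrow> x \<le> y * y"
proof (cases x)
  case (real a)
  show ?thesis
  proof (cases y)
    case (real b)
    have "sqrt a \<le> b \<longleftrightarrow> a \<le> b * b"
      using \<open>0 \<le> a\<close> \<open>0 \<le> b\<close> by (simp add: real_sqrt_le_iff' power2_eq_square)
    thus ?thesis using \<open>x = ennreal a\<close> \<open>0 \<le> a\<close> real by (simp add: ennsqrt_def ennreal_mult[symmetric])
  qed (simp add: ennreal_mult_top)
qed (auto simp: ennsqrt_def top_unique ennreal_mult_eq_top_iff)

lemma le_ennsqrt_mult: "x \<le> ennsqrt x * ennsqrt x"
  using ennsqrt_le_iff[of x "ennsqrt x"] by simp

lemma ennsqrt_SUP: "ennsqrt (SUP z\<in>A. F z) = (SUP z\<in>A. ennsqrt (F z))"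
proof (rule antisym)
  show "ennsqrt (SUP z\<in>A. F z) \<le> (SUP z\<in>A. ennsqrt (F z))"
    unfolding ennsqrt_le_iff
  proof (rule SUP_least)
    fix z assume "z \<in> A"
    hence "ennsqrt (F z) \<le> (SUP z\<in>A. ennsqrt (F z))" by (rule SUP_upper)
    thus "F z \<le> (SUP z\<in>A. ennsqrt (F z)) * (SUP z\<in>A. ennsqrt (F z))" unfolding ennsqrt_le_iff .
  qed
  show "(SUP z\<in>A. ennsqrt (F z)) \<le> ennsqrt (SUP z\<in>A. F z)"
  proof (rule SUP_least)
    fix z assume "z \<in> A"
    hence "F z \<le> (SUP z\<in>A. F z)" by (rule SUP_upper)
    also have "\<dots> \<le> ennsqrt (SUP z\<in>A. F z) * ennsqrt (SUP z\<in>A. F z)" by (rule le_ennsqrt_mult)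
    finally show "ennsqrt (F z) \<le> ennsqrt (SUP z\<in>A. F z)" unfolding ennsqrt_le_iff .
  qed
qed

lemma ennsqrt_finite_iff: "ennsqrt x < \<infinity> \<longleftrightarrow> x < \<infinity>"
  by (cases x) (auto simp: ennsqrt_def)

lemma ennsqrt_0 [simp]: "ennsqrt 0 = 0"
  by (simp add: ennsqrt_def)

text \<open>A zero denominator is allowed: the quotient is then 0 or infinite according to x, and
  the root preserves both values. This keeps the norm identities valid for a vanishing
  weight.\<close>

lemma ennsqrt_divide:
  assumes m: "0 \<le> m"
  shows "ennsqrt x / ennsqrt (ennreal m) = ennsqrt (x / ennreal m)"
proof (cases "m = 0")
  case True
  show ?thesis
  proof (cases "x = 0")
    case False
    have "ennsqrt x \<noteq> 0" using False le_ennsqrt_mult[of x] by auto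
    thus ?thesis using True False by (simp add: ennreal_divide_zero ennsqrt_def)
  qed (use True in simp)
next
  case False
  with m have m: "m > 0" by simp
  show ?thesis
  proof (cases x)
    case (real a)
    thus ?thesis using m by (simp add: ennsqrt_def divide_ennreal real_sqrt_divide)
  next
    case top
    thus ?thesis using m by (simp add: ennsqrt_def ennreal_top_divide)
  qed
qed

lemma ennreal_cancel_factor:
  assumes "d > 0" "m \<ge> 0"
  shows "(ennreal d * N) / ennreal (d * m) = N / ennreal m"
proof (cases "m = 0")
  case True
  show ?thesis using True assms by (cases "N = 0") (auto simp: ennreal_divide_zero)
next
  case False
  with assms have m: "m > 0" by simp
  show ?thesis
  proof (cases N)
    case (real a)
    thus ?thesis using m assms by (simp add: divide_ennreal ennreal_mult[symmetric])
  next
    case top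
    thus ?thesis using m assms by (simp add: ennreal_top_divide ennreal_mult_top)
  qed
qed

lemma Kz_norm_sq:
  assumes "norm z < 1"
  shows "(norm (Kz z \<zeta>))\<^sup>2 = 1 / (1 - (norm z)\<^sup>2) * Poisson z \<zeta>"
proof -
  have "(norm z)\<^sup>2 < 1" using assms by (simp add: power_less_one_iff)
  thus ?thesis by (simp add: Kz_def Poisson_def norm_divide power_divide)
qed

lemma Kz_ratio:
  assumes f: "f \<in> H2minus" and z: "norm z < 1"
    and [measurable]: "w \<in> borel_measurable borel" "v \<in> borel_measurable borel"
    and w: "AE \<zeta> in dm. 0 \<le> w \<zeta>" and v: "AE \<zeta> in dm. 0 \<le> v \<zeta>" "integrable dm v"
  shows "normL2 w (Hankel f (Kz z)) / normL2 v (Kz z)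
    = ennsqrt ((\<integral>\<^sup>+\<zeta>. ennreal ((norm (f \<zeta> - poisson_ext f z))\<^sup>2 * Poisson z \<zeta> * w \<zeta>) \<partial>dm) / ennreal (poisson_ext v z))"
proof -
  define d where "d = 1 / (1 - (norm z)\<^sup>2)"
  have d: "d > 0" using z by (simp add: d_def power_less_one_iff)
  have [measurable]: "f \<in> borel_measurable borel" by (rule H2minusD[OF f])
  have "sqnormL2 w (Hankel f (Kz z)) = (\<integral>\<^sup>+\<zeta>. ennreal d * ennreal ((norm (f \<zeta> - poisson_ext f z))\<^sup>2 * Poisson z \<zeta> * w \<zeta>) \<partial>dm)"
    unfolding sqnormL2_cong_AE[OF Hankel_Kz[OF f z]] unfolding sqnormL2_def
    using d by (intro nn_integral_cong) (simp add: norm_mult power_mult_distrib Kz_norm_sq[OF z] d_def[symmetric]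
      ennreal_mult'[symmetric] mult_ac)
  also have "\<dots> = ennreal d * (\<integral>\<^sup>+\<zeta>. ennreal ((norm (f \<zeta> - poisson_ext f z))\<^sup>2 * Poisson z \<zeta> * w \<zeta>) \<partial>dm)"
    by (rule nn_integral_cmult) measurable
  finally have 1: "sqnormL2 w (Hankel f (Kz z)) = \<dots>" .
  have i: "integrable dm (\<lambda>\<zeta>. Poisson z \<zeta> * v \<zeta>)" using integrable_Poisson_mult[OF z v(2)] by simp
  have pv: "0 \<le> poisson_ext v z"
    using poisson_ext_mono_AE[of "\<lambda>_. 0" v z] v z by (simp add: poisson_ext_def)
  have e: "(norm (Kz z \<zeta>))\<^sup>2 * v \<zeta> = d * (Poisson z \<zeta> * v \<zeta>)" for \<zeta> by (simp add: Kz_norm_sq[OF z] d_def)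
  have "sqnormL2 v (Kz z) = ennreal (\<integral>\<zeta>. (norm (Kz z \<zeta>))\<^sup>2 * v \<zeta> \<partial>dm)"
    by (rule sqnormL2_eq_integral[OF _ _ v(1)]) (measurable, unfold e, rule integrable_mult_right[OF i])
  also have "\<dots> = ennreal (d * poisson_ext v z)"
    unfolding e poisson_ext_def real_scaleR_def by (subst integral_mult_right_zero) simp
  finally have 2: "sqnormL2 v (Kz z) = ennreal (d * poisson_ext v z)" .
  show ?thesis unfolding normL2_def 1 2 using d pv by (subst ennsqrt_divide) (auto simp: ennreal_cancel_factor)
qed

theorem Kz_SUP_eq_Gnorm:
  assumes "f \<in> H2minus" "w \<in> borel_measurable borel" "v \<in> borel_measurable borel"
    "AE \<zeta> in dm. 0 \<le> w \<zeta>" "AE \<zeta> in dm. 0 \<le> v \<zeta>" "integrable dm v"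
  shows "(SUP z\<in>ball 0 1. normL2 w (Hankel f (Kz z)) / normL2 v (Kz z)) = Gnorm f w v"
  unfolding Gnorm_def ennsqrt_SUP by (rule SUP_cong) (use assms in \<open>auto intro!: Kz_ratio\<close>)

section \<open>The reproducing kernel test\<close>

lemma analytic_poly_power: "(\<lambda>\<zeta>. \<Sum>k<n. c k * \<zeta> ^ k) \<in> analytic_polys"
  unfolding analytic_polys_def by (rule CollectI, rule exI[of _ c], rule exI[of _ n]) simp

lemma analytic_poly_sqnorm_finite:
  assumes p: "p \<in> analytic_polys" and [measurable]: "w \<in> borel_measurable borel" and w: "AE \<zeta> in dm. 0 \<le> w \<zeta>" "integrable dm w"
  shows "sqnormL2 w p < \<infinity>"
proof -
  have [measurable]: "p \<in> borel_measurable borel" by (rule analytic_polys_measurable[OF p])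
  from p obtain c n where pe: "p = (\<lambda>\<zeta>. \<Sum>i<n. c i * \<zeta> ^ i)" by (auto simp: analytic_polys_def)
  obtain M' where M': "\<And>\<zeta>. norm \<zeta> = 1 \<Longrightarrow> norm (p \<zeta>) \<le> M'" unfolding pe using analytic_poly_bounded[of c n] by blast
  have "integrable dm (\<lambda>\<zeta>. (norm (p \<zeta>))\<^sup>2 * w \<zeta>)"
    by (rule integrable_dm_bounded_mult[where B="M'\<^sup>2", OF _ _ w(2)]) (use M' in \<open>auto intro!: power_mono\<close>)
  thus ?thesis using w by (subst sqnormL2_finite_iff) auto
qed

lemma analytic_poly_H2w:
  assumes p: "p \<in> analytic_polys" and [measurable]: "w \<in> borel_measurable borel" and w: "AE \<zeta> in dm. 0 \<le> w \<zeta>" "integrable dm w"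
  shows "p \<in> H2w w"
proof -
  have "sqnormL2 w (\<lambda>\<zeta>. p \<zeta> - p \<zeta>) = 0" by (simp add: sqnormL2_def)
  thus ?thesis unfolding H2w_def closL2_def L2w_def
    using p analytic_polys_measurable[OF p] analytic_poly_sqnorm_finite[OF assms] by (auto simp: borel_dm intro!: bexI[of _ p])
qed

text \<open>Cauchy product of the series of f(z) in powers of \<open>cnj z\<close> with the
  geometric series of the kernel. It expresses the image of \<open>Kz z\<close> through the images
  of powers.\<close>

lemma sums_Hankel_Kz:
  assumes f: "f \<in> H2minus" and z: "norm z < 1" and x: "norm \<zeta> = 1"
  shows "(\<lambda>k. cnj z ^ k * hankel_power f k \<zeta>) sums ((f \<zeta> - poisson_ext f z) * Kz z \<zeta>)"
proof -
  have nz: "norm (cnj z * \<zeta>) < 1" using z x by (simp add: norm_mult)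
  have K: "(\<lambda>k. (cnj z * \<zeta>) ^ k) sums Kz z \<zeta>" using geometric_sums[OF nz] by (simp add: Kz_def)
  have D': "integrable dm (\<lambda>\<zeta>. cnj (f \<zeta>))" using H2minusD(3)[OF f] by simp
  have "summable (\<lambda>j. norm (fourier (\<lambda>\<zeta>. cnj (f \<zeta>)) j * z ^ j))" by (rule summable_fourier[OF D' z])
  hence s1: "summable (\<lambda>j. norm (neg_coef f j * cnj z ^ j))" by (simp add: neg_coef_eq_fourier norm_mult norm_power)
  have s2: "summable (\<lambda>k. norm ((cnj z * \<zeta>) ^ k))" using nz by (simp add: norm_power)
  have "(\<lambda>k. \<Sum>j\<le>k. (neg_coef f j * cnj z ^ j) * (cnj z * \<zeta>) ^ (k - j)) sums ((\<Sum>j. neg_coef f j * cnj z ^ j) * (\<Sum>k. (cnj z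
    * \<zeta>) ^ k))"
    by (rule Cauchy_product_sums[OF s1 s2])
  hence "(\<lambda>k. \<Sum>j\<le>k. (neg_coef f j * cnj z ^ j) * (cnj z * \<zeta>) ^ (k - j)) sums (poisson_ext f z * Kz z \<zeta>)"
    using sums_unique[OF K] sums_unique[OF poisson_H2minus(2)[OF f z]] by simp
  from sums_diff[OF sums_mult[OF K, of "f \<zeta>"] this]
  have "(\<lambda>k. f \<zeta> * (cnj z * \<zeta>) ^ k - (\<Sum>j\<le>k. (neg_coef f j * cnj z ^ j) * (cnj z * \<zeta>) ^ (k - j))) sums (f \<zeta> * Kz z \<zeta>
    - poisson_ext f z * Kz z \<zeta>)" .
  moreover have "f \<zeta> * (cnj z * \<zeta>) ^ k - (\<Sum>j\<le>k. (neg_coef f j * cnj z ^ j) * (cnj z * \<zeta>) ^ (k - j))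
    = cnj z ^ k * hankel_power f k \<zeta>" for k
  proof -
    have "(\<Sum>j\<le>k. (neg_coef f j * cnj z ^ j) * (cnj z * \<zeta>) ^ (k - j)) = cnj z ^ k * (\<Sum>j\<le>k. neg_coef f j * \<zeta> ^ (k - j))"
      unfolding sum_distrib_left
    proof (rule sum.cong[OF refl])
      fix j assume "j \<in> {..k}"
      hence "cnj z ^ k = cnj z ^ j * cnj z ^ (k - j)" by (simp flip: power_add)
      thus "(neg_coef f j * cnj z ^ j) * (cnj z * \<zeta>) ^ (k - j) = cnj z ^ k * (neg_coef f j * \<zeta> ^ (k - j))"
        by (simp only: power_mult_distrib mult_ac)
    qed
    thus ?thesis by (simp add: hankel_power_def power_mult_distrib algebra_simps)
  qed
  ultimately show ?thesis by (simp add: left_diff_distrib)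
qed

text \<open>The kernel is not a polynomial, and the extension is tied to the Hankel operator on
  polynomials only. The bound is therefore carried from partial sums of the kernel to the kernel by
  Fatou's lemma; the factor 2 comes from comparing squared norms of partial sum and kernel.\<close>

theorem bounded_imp_SUP_finite:
  assumes f: "f \<in> H2minus" and B: "Hankel_extends_bounded f w1 w2"
    and [measurable]: "w1 \<in> borel_measurable borel" "w2 \<in> borel_measurable borel"
    and w1: "AE \<zeta> in dm. 0 \<le> w1 \<zeta>" "integrable dm w1" and w2: "AE \<zeta> in dm. 0 \<le> w2 \<zeta>"
  shows "(SUP z\<in>ball 0 1. normL2 w2 (Hankel f (Kz z)) / normL2 w1 (Kz z)) < \<infinity>"
proof -
  have [measurable]: "f \<in> borel_measurable borel" by (rule H2minusD[OF f])
  from B obtain T and C :: real where T: "\<And>g. g \<in> H2w w1 \<Longrightarrow> normL2 w2 (T g) \<le> ennreal C * normL2 w1 g"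
    "\<And>p. p \<in> analytic_polys \<Longrightarrow> AE \<zeta> in dm. T p \<zeta> = Hankel f p \<zeta>"
    unfolding Hankel_extends_bounded_def by blast
  \<comment> \<open>A negative C is not excluded by the definition; \<open>ennreal C\<close> is then
    0.\<close>
  define D where "D = (max C 0)\<^sup>2"
  have pb: "sqnormL2 w2 (Hankel f p) \<le> ennreal D * sqnormL2 w1 p" if p: "p \<in> analytic_polys" for p
  proof -
    obtain x where x: "sqnormL2 w1 p = ennreal x" "0 \<le> x"
      using analytic_poly_sqnorm_finite[OF p _ w1] by (cases "sqnormL2 w1 p") auto
    have "sqnormL2 w2 (Hankel f p) = sqnormL2 w2 (T p)" using T(2)[OF p] by (intro sqnormL2_cong_AE) (auto elim: eventually_mono)
    moreover have "normL2 w2 (T p) \<le> ennreal C * normL2 w1 p" by (intro T(1) analytic_poly_H2w p w1) measurable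
    moreover have "ennreal C * normL2 w1 p \<le> ennreal (max C 0) * ennreal (sqrt x)"
      unfolding normL2_def x using x(2) by (intro mult_mono ennreal_leI) (auto simp: ennsqrt_def)
    ultimately have "ennsqrt (sqnormL2 w2 (Hankel f p)) \<le> ennreal (max C 0) * ennreal (sqrt x)" by (simp add: normL2_def)
    hence "sqnormL2 w2 (Hankel f p) \<le> (ennreal (max C 0) * ennreal (sqrt x)) * (ennreal (max C 0) * ennreal (sqrt x))"
      unfolding ennsqrt_le_iff .
    also have "\<dots> = ennreal (D * x)" using x(2) by (simp add: D_def ennreal_mult[symmetric] power2_eq_square)
    also have "\<dots> = ennreal D * sqnormL2 w1 p" using x by (simp add: D_def ennreal_mult)
    finally show ?thesis .
  qed
  have K: "sqnormL2 w2 (Hankel f (Kz z)) \<le> ennreal (2 * D) * sqnormL2 w1 (Kz z)" if "z \<in> ball 0 1" for z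
  proof -
    have z: "norm z < 1" using that by simp
    define p where "p = (\<lambda>n \<zeta>. \<Sum>k<n. cnj z ^ k * \<zeta> ^ k)"
    have p: "p n \<in> analytic_polys" for n unfolding p_def by (rule analytic_poly_power)
    have [measurable]: "p n \<in> borel_measurable borel" for n by (rule analytic_polys_measurable[OF p])
    define W where "W = (\<integral>\<zeta>. w1 \<zeta> \<partial>dm)"
    have W: "W \<ge> 0" unfolding W_def using w1 by (intro integral_nonneg_AE)
    \<comment> \<open>The squared uniform bound for the tail of the geometric series, times the
      total mass of the weight.\<close>
    define e where "e = (\<lambda>n. (norm z ^ n / (1 - norm z))\<^sup>2 * W)"
    have pe: "sqnormL2 w1 (p n) \<le> 2 * sqnormL2 w1 (Kz z) + 2 * ennreal (e n)" for n
    proof -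
      have b: "norm (p n \<zeta> - Kz z \<zeta>) \<le> norm z ^ n / (1 - norm z)" if x: "norm \<zeta> = 1" for \<zeta>
      proof -
        have nz: "1 - cnj z * \<zeta> \<noteq> 0" by (rule circle_denom(2)[OF x z])
        have "p n \<zeta> = (\<Sum>k<n. (cnj z * \<zeta>) ^ k)" by (simp add: p_def power_mult_distrib)
        also have "\<dots> = (1 - (cnj z * \<zeta>) ^ n) / (1 - cnj z * \<zeta>)" using nz by (subst sum_gp_strict) auto
        finally have "p n \<zeta> - Kz z \<zeta> = - ((cnj z * \<zeta>) ^ n * Kz z \<zeta>)" by (simp add: Kz_def diff_divide_distrib)
        hence "norm (p n \<zeta> - Kz z \<zeta>) = norm z ^ n * norm (Kz z \<zeta>)" using x by (simp add: norm_mult norm_power)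
        also have "\<dots> \<le> norm z ^ n * (1 / (1 - norm z))" by (intro mult_left_mono Kz_bound z x) auto
        finally show ?thesis by simp
      qed
      have "sqnormL2 w1 (p n) = sqnormL2 w1 (\<lambda>\<zeta>. Kz z \<zeta> + (p n \<zeta> - Kz z \<zeta>))" by simp
      also have "\<dots> \<le> 2 * sqnormL2 w1 (Kz z) + 2 * sqnormL2 w1 (\<lambda>\<zeta>. p n \<zeta> - Kz z \<zeta>)"
        by (rule sqnormL2_add_le) (use w1 in auto)
      also have "sqnormL2 w1 (\<lambda>\<zeta>. p n \<zeta> - Kz z \<zeta>) \<le> (\<integral>\<^sup>+\<zeta>. ennreal ((norm z ^ n / (1 - norm z))\<^sup>2 * w1 \<zeta>) \<partial>dm)"
        unfolding sqnormL2_def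
      proof (rule nn_integral_mono_AE)
        show "AE \<zeta> in dm. ennreal ((cmod (p n \<zeta> - Kz z \<zeta>))\<^sup>2 * w1 \<zeta>) \<le> ennreal ((norm z ^ n / (1 - norm z))\<^sup>2 * w1 \<zeta>)"
          using AE_dm_circle w1(1) by eventually_elim (intro ennreal_leI mult_right_mono power_mono b, auto)
      qed
      also have "\<dots> = ennreal (e n)"
        using w1 by (subst nn_integral_eq_integral) (auto simp: e_def W_def)
      finally show ?thesis by (simp add: add_left_mono mult_left_mono)
    qed
    have e0: "e \<longlonglongrightarrow> 0"
    proof -
      have "e \<longlonglongrightarrow> (0 / (1 - norm z))\<^sup>2 * W" unfolding e_def
        using z by (intro tendsto_intros LIMSEQ_power_zero) auto
      thus ?thesis by simp
    qed
    have "sqnormL2 w2 (Hankel f (Kz z)) = sqnormL2 w2 (\<lambda>\<zeta>. (f \<zeta> - poisson_ext f z) * Kz z \<zeta>)"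
      by (rule sqnormL2_cong_AE[OF Hankel_Kz[OF f z]])
    also have "\<dots> = (\<integral>\<^sup>+\<zeta>. liminf (\<lambda>n. ennreal ((norm (\<Sum>k<n. cnj z ^ k * hankel_power f k \<zeta>))\<^sup>2 * w2 \<zeta>)) \<partial>dm)"
      unfolding sqnormL2_def
    proof (rule nn_integral_cong_AE)
      show "AE \<zeta> in dm. ennreal ((cmod ((f \<zeta> - poisson_ext f z) * Kz z \<zeta>))\<^sup>2 * w2 \<zeta>)
        = liminf (\<lambda>n. ennreal ((norm (\<Sum>k<n. cnj z ^ k * hankel_power f k \<zeta>))\<^sup>2 * w2 \<zeta>))"
        using AE_dm_circle
      proof eventually_elim
        case (elim \<zeta>)
        from sums_Hankel_Kz[OF f z elim]
        have l: "(\<lambda>n. \<Sum>k<n. cnj z ^ k * hankel_power f k \<zeta>) \<longlonglongrightarrow> (f \<zeta> - poisson_ext f z) * Kz z \<zeta>" unfolding sums_def .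
        have "(\<lambda>n. ennreal ((norm (\<Sum>k<n. cnj z ^ k * hankel_power f k \<zeta>))\<^sup>2 * w2 \<zeta>)) \<longlonglongrightarrow> ennreal ((cmod ((f \<zeta> - poisson_ext f z)
          * Kz z \<zeta>))\<^sup>2 * w2 \<zeta>)"
          by (intro tendsto_ennrealI tendsto_mult tendsto_power tendsto_norm l tendsto_const)
        thus ?case by (intro lim_imp_Liminf[symmetric]) auto
      qed
    qed
    also have "\<dots> \<le> liminf (\<lambda>n. \<integral>\<^sup>+\<zeta>. ennreal ((norm (\<Sum>k<n. cnj z ^ k * hankel_power f k \<zeta>))\<^sup>2 * w2 \<zeta>) \<partial>dm)"
      by (rule nn_integral_liminf) measurable
    also have "\<dots> \<le> liminf (\<lambda>n. ennreal (2 * D) * sqnormL2 w1 (Kz z) + ennreal (2 * D * e n))"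
    proof (rule Liminf_mono, rule always_eventually, rule allI)
      fix n
      have "(\<integral>\<^sup>+\<zeta>. ennreal ((norm (\<Sum>k<n. cnj z ^ k * hankel_power f k \<zeta>))\<^sup>2 * w2 \<zeta>) \<partial>dm) = sqnormL2 w2 (Hankel f (p n))"
        unfolding p_def sqnormL2_cong_AE[OF Hankel_poly(1)[OF f]] by (simp add: sqnormL2_def)
      also have "\<dots> \<le> ennreal D * sqnormL2 w1 (p n)" by (rule pb[OF p])
      also have "\<dots> \<le> ennreal D * (2 * sqnormL2 w1 (Kz z) + 2 * ennreal (e n))" by (intro mult_left_mono pe) auto
      also have "\<dots> = ennreal (2 * D) * sqnormL2 w1 (Kz z) + ennreal (2 * D * e n)"
        using W by (simp add: distrib_left D_def e_def ennreal_mult mult_ac)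
      finally show "(\<integral>\<^sup>+\<zeta>. ennreal ((norm (\<Sum>k<n. cnj z ^ k * hankel_power f k \<zeta>))\<^sup>2 * w2 \<zeta>) \<partial>dm)
        \<le> ennreal (2 * D) * sqnormL2 w1 (Kz z) + ennreal (2 * D * e n)" .
    qed
    also have "\<dots> = ennreal (2 * D) * sqnormL2 w1 (Kz z)"
    proof (rule lim_imp_Liminf)
      have "(\<lambda>n. ennreal (2 * D) * sqnormL2 w1 (Kz z) + ennreal (2 * D * e n)) \<longlonglongrightarrow> ennreal (2 * D) * sqnormL2 w1 (Kz z) + ennreal (2
        * D * 0)"
        by (intro tendsto_add tendsto_const tendsto_ennrealI tendsto_mult e0)
      thus "(\<lambda>n. ennreal (2 * D) * sqnormL2 w1 (Kz z) + ennreal (2 * D * e n)) \<longlonglongrightarrow> ennreal (2 * D) * sqnormL2 w1 (Kz z)" by simp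
    qed simp
    finally show ?thesis .
  qed
  have fin: "sqnormL2 w1 (Kz z) < \<infinity>" if "z \<in> ball 0 1" for z
  proof -
    have z: "norm z < 1" using that by simp
    have "integrable dm (\<lambda>\<zeta>. (norm (Kz z \<zeta>))\<^sup>2 * w1 \<zeta>)"
      by (rule integrable_dm_bounded_mult[where B="(1 / (1 - norm z))\<^sup>2", OF _ _ w1(2)]) (use Kz_bound[OF z] in \<open>auto intro!:
        power_mono simp del: power_one_over\<close>)
    thus ?thesis using w1 by (subst sqnormL2_finite_iff) auto
  qed
  have "normL2 w2 (Hankel f (Kz z)) / normL2 w1 (Kz z) \<le> ennsqrt (ennreal (2 * D))" if zz: "z \<in> ball 0 1" for z
  proof -
    obtain y where y: "sqnormL2 w1 (Kz z) = ennreal y" "0 \<le> y" using fin[OF zz] by (cases "sqnormL2 w1 (Kz z)") auto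
    have "sqnormL2 w2 (Hankel f (Kz z)) / ennreal y \<le> ennreal (2 * D)"
    proof (cases "y = 0")
      case True thus ?thesis using K[OF zz] y by simp
    next
      case False
      hence "y > 0" using y by simp
      have "sqnormL2 w2 (Hankel f (Kz z)) / ennreal y \<le> (ennreal (2 * D) * ennreal y) / ennreal y"
        using K[OF zz] y by (intro divide_right_mono_ennreal) auto
      also have "\<dots> = ennreal (2 * D)" using \<open>y > 0\<close> by (simp add: ennreal_mult[symmetric] divide_ennreal D_def)
      finally show ?thesis .
    qed
    also have "\<dots> \<le> ennsqrt (ennreal (2 * D)) * ennsqrt (ennreal (2 * D))" by (rule le_ennsqrt_mult)
    finally show ?thesis unfolding normL2_def y(1) ennsqrt_divide[OF y(2)] ennsqrt_le_iff .
  qed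
  hence "(SUP z\<in>ball 0 1. normL2 w2 (Hankel f (Kz z)) / normL2 w1 (Kz z)) \<le> ennsqrt (ennreal (2 * D))" by (rule SUP_least)
  also have "\<dots> < \<infinity>" unfolding ennsqrt_finite_iff by simp
  finally show ?thesis .
qed

text \<open>Translates finiteness in the extended reals into real inequalities between Poisson
  extensions, with the integrability that the Bochner integrals need.\<close>

lemma Gnorm_finite_oscillation:
  assumes f: "f \<in> H2minus" and A: "poisson_A2 w Q" and v: "AE \<zeta> in dm. 0 < v \<zeta>" "integrable dm v" and G: "Gnorm f w v < \<infinity>"
  shows "\<exists>\<kappa>>0. \<forall>z\<in>ball 0 1. poisson_ext (\<lambda>\<zeta>. (norm (f \<zeta> - poisson_ext f z))\<^sup>2 * w \<zeta>) z \<le> \<kappa> * poisson_ext v z"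
    and "integrable dm (\<lambda>\<zeta>. (norm (f \<zeta>))\<^sup>2 * w \<zeta>)"
proof -
  have [measurable]: "f \<in> borel_measurable borel" "w \<in> borel_measurable borel" using H2minusD[OF f] A
    by (auto simp: poisson_A2_def)
  have w: "AE \<zeta> in dm. 0 < w \<zeta>" using A by (simp add: poisson_A2_def)
  define N where "N = (\<lambda>z. \<integral>\<^sup>+\<zeta>. ennreal ((norm (f \<zeta> - poisson_ext f z))\<^sup>2 * Poisson z \<zeta> * w \<zeta>) \<partial>dm)"
  define S where "S = (SUP z\<in>ball 0 1. N z / ennreal (poisson_ext v z))"
  have "S < \<infinity>" using G unfolding Gnorm_def ennsqrt_finite_iff S_def N_def .
  then obtain \<kappa>0 where \<kappa>0: "S = ennreal \<kappa>0" "0 \<le> \<kappa>0" by (cases S) auto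
  \<comment> \<open>Adding 1 makes the constant positive; it is later divided by.\<close>
  define \<kappa> where "\<kappa> = \<kappa>0 + 1"
  have \<kappa>: "\<kappa> > 0" using \<kappa>0 by (simp add: \<kappa>_def)
  have N: "N z \<le> ennreal (\<kappa> * poisson_ext v z)" if z: "z \<in> ball 0 1" for z
  proof -
    have pv: "poisson_ext v z > 0" using z by (intro poisson_ext_pos v) auto
    have "N z / ennreal (poisson_ext v z) \<le> ennreal \<kappa>0" unfolding \<kappa>0(1)[symmetric] S_def using z by (rule SUP_upper)
    also have "\<dots> \<le> ennreal \<kappa>" by (intro ennreal_leI) (simp add: \<kappa>_def)
    finally have *: "N z / ennreal (poisson_ext v z) \<le> ennreal \<kappa>" .
    show ?thesis
    proof (cases "N z")
      case (real a)
      thus ?thesis using * pv \<kappa> by (simp add: divide_ennreal pos_divide_le_eq ennreal_le_iff)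
    next
      case top
      thus ?thesis using * pv by (simp add: ennreal_top_divide top_unique)
    qed
  qed
  have nn: "AE \<zeta> in dm. 0 \<le> Poisson z \<zeta> * ((norm (f \<zeta> - poisson_ext f z))\<^sup>2 * w \<zeta>)" if z: "norm z < 1" for z
    using AE_dm_circle w by eventually_elim (use Poisson_pos[OF _ z] in \<open>auto intro!: mult_nonneg_nonneg simp: less_imp_le\<close>)
  have Ne: "N z = (\<integral>\<^sup>+\<zeta>. ennreal (Poisson z \<zeta> * ((norm (f \<zeta> - poisson_ext f z))\<^sup>2 * w \<zeta>)) \<partial>dm)" for z
    unfolding N_def by (simp add: mult_ac)
  have i: "integrable dm (\<lambda>\<zeta>. Poisson z \<zeta> * ((norm (f \<zeta> - poisson_ext f z))\<^sup>2 * w \<zeta>))" if z: "z \<in> ball 0 1" for z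
  proof (rule integrableI_nonneg)
    show "(\<integral>\<^sup>+\<zeta>. ennreal (Poisson z \<zeta> * ((norm (f \<zeta> - poisson_ext f z))\<^sup>2 * w \<zeta>)) \<partial>dm) < \<infinity>"
      unfolding Ne[symmetric] using N[OF z] by (auto intro: le_less_trans)
  qed (use nn z in auto)
  show "\<exists>\<kappa>>0. \<forall>z\<in>ball 0 1. poisson_ext (\<lambda>\<zeta>. (norm (f \<zeta> - poisson_ext f z))\<^sup>2 * w \<zeta>) z \<le> \<kappa> * poisson_ext v z"
  proof (intro exI[of _ \<kappa>] conjI ballI \<kappa>)
    fix z :: complex assume z: "z \<in> ball 0 1"
    have pv: "poisson_ext v z > 0" using z by (intro poisson_ext_pos v) auto
    have "ennreal (poisson_ext (\<lambda>\<zeta>. (norm (f \<zeta> - poisson_ext f z))\<^sup>2 * w \<zeta>) z) = N z"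
      unfolding Ne poisson_ext_def[of "\<lambda>\<zeta>. (norm (f \<zeta> - poisson_ext f z))\<^sup>2 * w \<zeta>"] real_scaleR_def using i[OF z] nn[of z] z
        by (intro nn_integral_eq_integral[symmetric]) auto
    also have "\<dots> \<le> ennreal (\<kappa> * poisson_ext v z)" by (rule N[OF z])
    finally show "poisson_ext (\<lambda>\<zeta>. (norm (f \<zeta> - poisson_ext f z))\<^sup>2 * w \<zeta>) z \<le> \<kappa> * poisson_ext v z"
      using \<kappa> pv by (subst (asm) ennreal_le_iff) auto
  qed
  \<comment> \<open>At z = 0 the kernel is 1 and f has mean 0, so the oscillation condition contains
    the weighted square integrability of f.\<close>
  have "poisson_ext f 0 = 0" using poisson_H2minus(1)[OF f, of 0] by simp
  thus "integrable dm (\<lambda>\<zeta>. (norm (f \<zeta>))\<^sup>2 * w \<zeta>)" using i[of 0] by (simp add: Poisson_def)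
qed

section \<open>Linearity on polynomials and the degenerate cases\<close>

lemma Hankel_lincomb:
  assumes f: "f \<in> H2minus" and p: "p \<in> analytic_polys" and q: "q \<in> analytic_polys"
  shows "AE \<zeta> in dm. Hankel f (\<lambda>x. a * p x + b * q x) \<zeta> = a * Hankel f p \<zeta> + b * Hankel f q \<zeta>"
proof -
  from p obtain c n where pe: "p = (\<lambda>\<zeta>. \<Sum>i<n. c i * \<zeta> ^ i)" by (auto simp: analytic_polys_def)
  from q obtain d m where qe: "q = (\<lambda>\<zeta>. \<Sum>i<m. d i * \<zeta> ^ i)" by (auto simp: analytic_polys_def)
  define N where "N = max n m"
  define e where "e = (\<lambda>i. a * (if i < n then c i else 0) + b * (if i < m then d i else 0))"
  have pad: "a * (\<Sum>i<n. c i * g i) + b * (\<Sum>i<m. d i * g i) = (\<Sum>i<N. e i * g i)" for g :: "nat \<Rightarrow> complex"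
    unfolding e_def by (subst sum_pad[of n N], simp add: N_def, subst sum_pad[of m N], simp add: N_def)
         (simp only: sum_distrib_left sum.distrib[symmetric] distrib_right mult.assoc)
  have "(\<lambda>x. a * p x + b * q x) = (\<lambda>\<zeta>. \<Sum>i<N. e i * \<zeta> ^ i)" unfolding pe qe by (intro ext pad)
  moreover note Hankel_poly(1)[OF f, of e N]
  ultimately have 1: "AE \<zeta> in dm. Hankel f (\<lambda>x. a * p x + b * q x) \<zeta> = (\<Sum>i<N. e i * hankel_power f i \<zeta>)" by simp
  show ?thesis
    using 1 Hankel_poly(1)[OF f, of c n] Hankel_poly(1)[OF f, of d m]
    unfolding pe[symmetric] qe[symmetric] by eventually_elim (simp only: pad)
qed

lemma Hankel_poly_H2minus: "f \<in> H2minus \<Longrightarrow> p \<in> analytic_polys \<Longrightarrow> Hankel f p \<in> H2minus"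
  using Hankel_poly(2)[of f] by (auto simp: analytic_polys_def)

lemma ennsqrt_mult_le:
  assumes "x \<le> ennreal D * y" "0 \<le> D"
  shows "ennsqrt x \<le> ennreal (sqrt D) * ennsqrt y"
  unfolding ennsqrt_le_iff
proof -
  have "x \<le> ennreal D * (ennsqrt y * ennsqrt y)" using assms(1) by (rule order_trans) (intro mult_left_mono le_ennsqrt_mult, simp)
  also have "ennreal D = ennreal (sqrt D) * ennreal (sqrt D)" using assms(2) by (simp add: ennreal_mult[symmetric])
  finally show "x \<le> (ennreal (sqrt D) * ennsqrt y) * (ennreal (sqrt D) * ennsqrt y)" by (simp only: mult_ac)
qed

text \<open>All coefficients of a null symbol vanish, so the zero operator is an extension, whatever
  the weights.\<close>

lemma Hankel_extends_bounded_zero_symbol: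
  assumes f: "f \<in> H2minus" "AE \<zeta> in dm. f \<zeta> = 0"
  shows "Hankel_extends_bounded f w1 w2"
proof -
  have c: "neg_coef f j = 0" for j
  proof -
    have "neg_coef f j = (\<integral>\<zeta>. 0 \<partial>dm)" unfolding neg_coef_def
      using f(2) H2minusD(1)[OF f(1)] by (intro integral_cong_AE) (auto simp: borel_dm elim: eventually_mono)
    thus ?thesis by simp
  qed
  have "AE \<zeta> in dm. 0 = Hankel f p \<zeta>" if p: "p \<in> analytic_polys" for p
  proof -
    from p obtain d n where pe: "p = (\<lambda>\<zeta>. \<Sum>i<n. d i * \<zeta> ^ i)" by (auto simp: analytic_polys_def)
    show ?thesis using Hankel_poly(1)[OF f(1), of d n] f(2) unfolding pe[symmetric]
      by eventually_elim (simp add: hankel_power_def c)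
  qed
  moreover have "(\<lambda>_. 0) \<in> closL2 w2 (H2minus \<inter> L2w w2)"
    using H2minus_0 by (auto simp: closL2_def L2w_def sqnormL2_def intro!: bexI[of _ "\<lambda>_. 0"])
  ultimately show ?thesis unfolding Hankel_extends_bounded_def
    by (intro exI[of _ "\<lambda>_ _. 0"] exI[of _ 0]) (auto simp: normL2_def sqnormL2_def)
qed

text \<open>A vanishing target weight still asks for a linear extension up to \<open>dm\<close>-null sets, so one
  composes with an algebraic projection onto the polynomials.\<close>

lemma Hankel_extends_bounded_zero_weight:
  assumes f: "f \<in> H2minus" and w2: "AE \<zeta> in dm. w2 \<zeta> = 0"
  shows "Hankel_extends_bounded f w1 w2"
proof -
  let ?s = "\<lambda>(a::complex) (g::complex \<Rightarrow> complex) x. a * g x"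
  interpret V: vector_space ?s
    by unfold_locales (auto simp: fun_eq_iff algebra_simps)
  interpret P: vector_space_pair ?s ?s ..
  have 0: "sqnormL2 w2 g = 0" for g
  proof -
    have "sqnormL2 w2 g = (\<integral>\<^sup>+\<zeta>. 0 \<partial>dm)" unfolding sqnormL2_def
      using w2 by (intro nn_integral_cong_AE) (auto elim: eventually_mono)
    thus ?thesis by simp
  qed
  have zp: "(\<lambda>_. 0) \<in> analytic_polys" using analytic_poly_power[of "\<lambda>_. 0" 0] by simp
  have "V.subspace analytic_polys"
    unfolding V.subspace_def
    using zp analytic_polys_lincomb[of _ _ 1 1] analytic_polys_lincomb[OF _ zp, of _ _ 0]
      by (auto simp: zero_fun_def plus_fun_def)
  \<comment> \<open>A linear left inverse of the identity on the polynomials is a projection onto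
    them. It need not be continuous: every norm with the vanishing target weight is 0.\<close>
  from P.linear_exists_left_inverse_on[OF V.linear_id this]
  obtain g where g: "range g \<subseteq> analytic_polys" "Vector_Spaces.linear ?s ?s g" "\<And>p. p \<in> analytic_polys \<Longrightarrow> g p = p" by auto
  interpret G: Vector_Spaces.linear ?s ?s g by (rule g(2))
  have lin: "g (\<lambda>x. a * u x + b * v x) = (\<lambda>x. a * g u x + b * g v x)" for a b u v
    using G.add[of "?s a u" "?s b v"] G.scale[of a u] G.scale[of b v] by (simp add: plus_fun_def)
  show ?thesis unfolding Hankel_extends_bounded_def
  proof (intro exI[of _ "\<lambda>u. Hankel f (g u)"] exI[of _ 0] conjI ballI allI)
    fix u
    have H: "Hankel f (g u) \<in> H2minus" using g(1) by (intro Hankel_poly_H2minus f) auto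
    thus "Hankel f (g u) \<in> closL2 w2 (H2minus \<inter> L2w w2)"
      using H2minusD(1)[OF H] by (auto simp: closL2_def L2w_def borel_dm 0 intro!: bexI[of _ "Hankel f (g u)"])
    fix v a b
    show "AE \<zeta> in dm. Hankel f (g (\<lambda>x. a * u x + b * v x)) \<zeta> = a * Hankel f (g u) \<zeta> + b * Hankel f (g v) \<zeta>"
      unfolding lin using g(1) by (intro Hankel_lincomb f) auto
  qed (use g(3) in \<open>auto simp: normL2_def 0\<close>)
qed

section \<open>Extension by completeness\<close>

lemma H2w_D:
  assumes "g \<in> H2w w" shows "g \<in> borel_measurable borel" "sqnormL2 w g < \<infinity>"
  using assms by (auto simp: H2w_def closL2_def L2w_def borel_dm)

lemma ennreal_le_all_eps:
  assumes "\<And>\<epsilon>::real. \<epsilon> > 0 \<Longrightarrow> x \<le> y + ennreal (c * \<epsilon>)" and c: "c > 0"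
  shows "x \<le> y"
proof (rule ennreal_le_epsilon)
  fix e :: real assume "e > 0"
  thus "x \<le> y + ennreal e" using assms(1)[of "e / c"] c by simp
qed

text \<open>Extension by density and completeness, carried out on functions rather than classes: the
  closure of the graph is shown to be total, linear, bounded and single-valued almost everywhere,
  and the operator is a choice from it.\<close>

theorem Hankel_extends_boundedI:
  assumes f: "f \<in> H2minus"
    and m1 [measurable]: "w1 \<in> borel_measurable borel" and m2 [measurable]: "w2 \<in> borel_measurable borel"
    and w1: "AE \<zeta> in dm. 0 \<le> w1 \<zeta>" "integrable dm w1" and w2: "AE \<zeta> in dm. 0 < w2 \<zeta>"
    and K0: "0 \<le> K" and K: "\<And>p. p \<in> analytic_polys \<Longrightarrow> sqnormL2 w2 (Hankel f p) \<le> ennreal K * sqnormL2 w1 p"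
  shows "Hankel_extends_bounded f w1 w2"
proof -
  have w2': "AE \<zeta> in dm. 0 \<le> w2 \<zeta>" using w2 by (auto elim: eventually_mono)
  have pm: "p \<in> borel_measurable borel" "Hankel f p \<in> borel_measurable borel" if "p \<in> analytic_polys" for p
    using analytic_polys_measurable[OF that] H2minusD(1)[OF Hankel_poly_H2minus[OF f that]] by auto
  have Hdiff: "sqnormL2 w2 (\<lambda>\<zeta>. Hankel f p \<zeta> - Hankel f q \<zeta>) \<le> ennreal K * sqnormL2 w1 (\<lambda>\<zeta>. p \<zeta> - q \<zeta>)"
    if p: "p \<in> analytic_polys" and q: "q \<in> analytic_polys" for p q
  proof -
    have "AE \<zeta> in dm. Hankel f p \<zeta> - Hankel f q \<zeta> = Hankel f (\<lambda>x. 1 * p x + (-1) * q x) \<zeta>"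
      using Hankel_lincomb[OF f p q, of 1 "-1"] by eventually_elim simp
    hence "sqnormL2 w2 (\<lambda>\<zeta>. Hankel f p \<zeta> - Hankel f q \<zeta>) = sqnormL2 w2 (Hankel f (\<lambda>x. 1 * p x + (-1) * q x))"
      by (rule sqnormL2_cong_AE)
    also have "\<dots> \<le> ennreal K * sqnormL2 w1 (\<lambda>x. 1 * p x + (-1) * q x)" by (rule K[OF analytic_polys_lincomb[OF p q]])
    finally show ?thesis by simp
  qed
  \<comment> \<open>The closed graph of the operator on polynomials, in the product of the two
    weighted spaces.\<close>
  define R where "R = (\<lambda>g h. h \<in> borel_measurable borel \<and> (\<forall>\<epsilon>>0. \<exists>p\<in>analytic_polys.
      sqnormL2 w1 (\<lambda>\<zeta>. g \<zeta> - p \<zeta>) < ennreal \<epsilon> \<and> sqnormL2 w2 (\<lambda>\<zeta>. h \<zeta> - Hankel f p \<zeta>) < ennreal \<epsilon>))"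
  have R_ex: "\<exists>h. R g h" if g: "g \<in> H2w w1" for g
  proof -
    have [measurable]: "g \<in> borel_measurable borel" by (rule H2w_D[OF g])
    \<comment> \<open>The rate 4^-n in squared norm leaves room for the factor 2^n used
      below.\<close>
    have "\<exists>p. \<forall>n::nat. p n \<in> analytic_polys \<and> sqnormL2 w1 (\<lambda>\<zeta>. g \<zeta> - p n \<zeta>) < ennreal ((1/4) ^ n)"
      using g by (intro choice) (auto simp: H2w_def closL2_def Bex_def)
    then obtain p where p: "\<And>n. p n \<in> analytic_polys" "\<And>n. sqnormL2 w1 (\<lambda>\<zeta>. g \<zeta> - p n \<zeta>) < ennreal ((1/4) ^ n)" by blast
    note [measurable] = pm[OF p(1)]
    have pd: "sqnormL2 w1 (\<lambda>\<zeta>. p m \<zeta> - p n \<zeta>) \<le> ennreal (4 * (1/4) ^ n)" if "n \<le> m" for m n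
    proof -
      have "(\<lambda>\<zeta>. p m \<zeta> - p n \<zeta>) = (\<lambda>\<zeta>. (-1) * (g \<zeta> - p m \<zeta>) + 1 * (g \<zeta> - p n \<zeta>))" by auto
      hence "sqnormL2 w1 (\<lambda>\<zeta>. p m \<zeta> - p n \<zeta>) = sqnormL2 w1 (\<lambda>\<zeta>. (-1) * (g \<zeta> - p m \<zeta>) + 1 * (g \<zeta> - p n \<zeta>))" by (simp only:)
      also have "\<dots> \<le> ennreal (2 * (norm (-1 :: complex))\<^sup>2) * sqnormL2 w1 (\<lambda>\<zeta>. g \<zeta> - p m \<zeta>) + ennreal (2
        * (norm (1 :: complex))\<^sup>2) * sqnormL2 w1 (\<lambda>\<zeta>. g \<zeta> - p n \<zeta>)"
        by (rule sqnormL2_lincomb_le) (use w1 in auto)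
      also have "\<dots> \<le> ennreal 2 * ennreal ((1/4) ^ n) + ennreal 2 * ennreal ((1/4) ^ n)"
      proof (intro add_mono mult_mono)
        have "sqnormL2 w1 (\<lambda>\<zeta>. g \<zeta> - p m \<zeta>) \<le> ennreal ((1/4) ^ m)" using p(2)[of m] by simp
        also have "\<dots> \<le> ennreal ((1/4) ^ n)" using that by (intro ennreal_leI power_decreasing) auto
        finally show "sqnormL2 w1 (\<lambda>\<zeta>. g \<zeta> - p m \<zeta>) \<le> ennreal ((1/4) ^ n)" .
      qed (use p(2)[of n] in auto)
      also have "\<dots> = ennreal (2 * (1/4) ^ n + 2 * (1/4) ^ n)"
        by (simp only: ennreal_mult[symmetric] ennreal_plus[symmetric] zero_le_power zero_le_numeral zero_le_divide_1_iff
          mult_nonneg_nonneg)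
      finally show ?thesis by simp
    qed
    define F where "F = (\<lambda>n. Hankel f (p n))"
    have [measurable]: "F n \<in> borel_measurable borel" for n unfolding F_def by measurable
    have Fd: "sqnormL2 w2 (\<lambda>\<zeta>. F m \<zeta> - F n \<zeta>) \<le> ennreal (4 * K * (1/4) ^ n)" if "n \<le> m" for m n
    proof -
      have "sqnormL2 w2 (\<lambda>\<zeta>. F m \<zeta> - F n \<zeta>) \<le> ennreal K * ennreal (4 * (1/4) ^ n)"
        unfolding F_def by (rule order_trans[OF Hdiff[OF p(1) p(1)]]) (intro mult_left_mono pd that, simp)
      also have "\<dots> = ennreal (4 * K * (1/4) ^ n)" using K0 by (simp add: ennreal_mult[symmetric] mult_ac)
      finally show ?thesis .
    qed
    \<comment> \<open>The squared increments weighted by 2^n are summable almost everywhere. Where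
      \<open>w2\<close> is positive the increments thus decay like 2^(-n/2), so the images converge
      pointwise.\<close>
    have "(\<integral>\<^sup>+\<zeta>. (\<Sum>n. ennreal (2 ^ n * ((norm (F (Suc n) \<zeta> - F n \<zeta>))\<^sup>2 * w2 \<zeta>))) \<partial>dm)
      = (\<Sum>n. \<integral>\<^sup>+\<zeta>. ennreal (2 ^ n * ((norm (F (Suc n) \<zeta> - F n \<zeta>))\<^sup>2 * w2 \<zeta>)) \<partial>dm)"
      by (rule nn_integral_suminf) measurable
    also have "\<dots> \<le> (\<Sum>n. ennreal (4 * K * (1/2) ^ n))"
    proof (rule suminf_le)
      fix n
      have "(\<integral>\<^sup>+\<zeta>. ennreal (2 ^ n * ((norm (F (Suc n) \<zeta> - F n \<zeta>))\<^sup>2 * w2 \<zeta>)) \<partial>dm)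
        = ennreal (2 ^ n) * sqnormL2 w2 (\<lambda>\<zeta>. F (Suc n) \<zeta> - F n \<zeta>)"
        unfolding sqnormL2_def by (subst nn_integral_cmult[symmetric]) (auto simp: ennreal_mult')
      also have "\<dots> \<le> ennreal (2 ^ n) * ennreal (4 * K * (1/4) ^ n)" by (intro mult_left_mono Fd) auto
      also have "\<dots> = ennreal (4 * K * (2 ^ n * (1/4) ^ n))" using K0 by (simp add: ennreal_mult[symmetric] mult_ac)
      also have "(2::real) ^ n * (1/4) ^ n = (1/2) ^ n" by (simp flip: power_mult_distrib)
      finally show "(\<integral>\<^sup>+\<zeta>. ennreal (2 ^ n * ((norm (F (Suc n) \<zeta> - F n \<zeta>))\<^sup>2 * w2 \<zeta>)) \<partial>dm) \<le> ennreal (4 * K * (1/2) ^ n)" .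
    qed auto
    also have "\<dots> = ennreal (\<Sum>n. 4 * K * (1/2) ^ n)"
      using K0 by (intro suminf_ennreal2 summable_mult summable_geometric) auto
    also have "\<dots> < \<infinity>" by simp
    finally have "AE \<zeta> in dm. (\<Sum>n. ennreal (2 ^ n * ((norm (F (Suc n) \<zeta> - F n \<zeta>))\<^sup>2 * w2 \<zeta>))) \<noteq> \<infinity>"
      by (intro nn_integral_PInf_AE) auto
    hence conv: "AE \<zeta> in dm. convergent (\<lambda>n. F n \<zeta>)"
      using w2
    proof eventually_elim
      case (elim \<zeta>)
      define S where "S = (\<Sum>n. ennreal (2 ^ n * ((norm (F (Suc n) \<zeta> - F n \<zeta>))\<^sup>2 * w2 \<zeta>)))"
      obtain M where M: "S = ennreal M" "0 \<le> M" using elim(1) unfolding S_def[symmetric] by (cases S) auto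
      have "norm (F (Suc n) \<zeta> - F n \<zeta>) \<le> sqrt (M / w2 \<zeta>) * (sqrt (1/2)) ^ n" if "n \<ge> 0" for n
      proof -
        have "ennreal (2 ^ n * ((norm (F (Suc n) \<zeta> - F n \<zeta>))\<^sup>2 * w2 \<zeta>))
          = (\<Sum>k\<in>{n}. ennreal (2 ^ k * ((norm (F (Suc k) \<zeta> - F k \<zeta>))\<^sup>2 * w2 \<zeta>)))" by simp
        also have "\<dots> \<le> S" unfolding S_def by (rule sum_le_suminf) auto
        finally have "2 ^ n * ((norm (F (Suc n) \<zeta> - F n \<zeta>))\<^sup>2 * w2 \<zeta>) \<le> M" unfolding M(1) using M(2)
          by (subst (asm) ennreal_le_iff) auto
        hence "(norm (F (Suc n) \<zeta> - F n \<zeta>))\<^sup>2 \<le> M / w2 \<zeta> * (1/2) ^ n" using elim(2) by (simp add: field_simps power_one_over)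
        hence "norm (F (Suc n) \<zeta> - F n \<zeta>) \<le> sqrt (M / w2 \<zeta> * (1/2) ^ n)" by (rule real_le_rsqrt)
        thus ?thesis by (simp only: real_sqrt_mult real_sqrt_power)
      qed
      moreover have "summable (\<lambda>n. sqrt (M / w2 \<zeta>) * (sqrt (1/2)) ^ n)"
        by (intro summable_mult summable_geometric) auto
      ultimately have "summable (\<lambda>n. F (Suc n) \<zeta> - F n \<zeta>)" by (rule summable_comparison_test'[where N=0, rotated])
      hence "convergent (\<lambda>n. \<Sum>k<n. F (Suc k) \<zeta> - F k \<zeta>)" by (simp add: summable_iff_convergent)
      moreover have "(\<Sum>k<n. F (Suc k) \<zeta> - F k \<zeta>) = F n \<zeta> - F 0 \<zeta>" for n
        by (rule sum_lessThan_telescope)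
      ultimately have "convergent (\<lambda>n. F n \<zeta> - F 0 \<zeta>)" by (simp only:)
      from convergent_add[OF this convergent_const[of "F 0 \<zeta>"]]
      show ?case by (simp only: diff_add_cancel)
    qed
    define h where "h = (\<lambda>\<zeta>. lim (\<lambda>n. F n \<zeta>))"
    have [measurable]: "h \<in> borel_measurable borel" unfolding h_def by (rule borel_measurable_lim_metric) measurable
    have hF: "sqnormL2 w2 (\<lambda>\<zeta>. h \<zeta> - F n \<zeta>) \<le> ennreal (4 * K * (1/4) ^ n)" for n
    proof -
      have "sqnormL2 w2 (\<lambda>\<zeta>. h \<zeta> - F n \<zeta>) = (\<integral>\<^sup>+\<zeta>. liminf (\<lambda>m. ennreal ((norm (F m \<zeta> - F n \<zeta>))\<^sup>2 * w2 \<zeta>)) \<partial>dm)"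
        unfolding sqnormL2_def
      proof (rule nn_integral_cong_AE)
        show "AE \<zeta> in dm. ennreal ((norm (h \<zeta> - F n \<zeta>))\<^sup>2 * w2 \<zeta>) = liminf (\<lambda>m. ennreal ((norm (F m \<zeta> - F n \<zeta>))\<^sup>2 * w2 \<zeta>))"
          using conv
        proof eventually_elim
          case (elim \<zeta>)
          have l: "(\<lambda>m. F m \<zeta>) \<longlonglongrightarrow> h \<zeta>" unfolding h_def using elim by (simp add: convergent_LIMSEQ_iff)
          have "(\<lambda>m. ennreal ((norm (F m \<zeta> - F n \<zeta>))\<^sup>2 * w2 \<zeta>)) \<longlonglongrightarrow> ennreal ((norm (h \<zeta> - F n \<zeta>))\<^sup>2 * w2 \<zeta>)"
            by (intro tendsto_ennrealI tendsto_mult tendsto_power tendsto_norm tendsto_diff l tendsto_const)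
          thus ?case by (intro lim_imp_Liminf[symmetric]) auto
        qed
      qed
      also have "\<dots> \<le> liminf (\<lambda>m. sqnormL2 w2 (\<lambda>\<zeta>. F m \<zeta> - F n \<zeta>))"
        unfolding sqnormL2_def by (rule nn_integral_liminf) measurable
      also have "\<dots> \<le> ennreal (4 * K * (1/4) ^ n)"
        by (rule Liminf_le) (auto intro!: eventually_sequentiallyI[of n] Fd)
      finally show ?thesis .
    qed
    have "R g h" unfolding R_def
    proof (intro conjI allI impI)
      fix \<epsilon> :: real assume e: "\<epsilon> > 0"
      have "(\<lambda>n. (4 * K + 1) * (1/4) ^ n) \<longlonglongrightarrow> (4 * K + 1) * 0" by (intro tendsto_intros LIMSEQ_power_zero) auto
      hence "(\<lambda>n. (4 * K + 1) * (1/4) ^ n) \<longlonglongrightarrow> 0" by simp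
      from LIMSEQ_D[OF this e] obtain n where n: "norm ((4 * K + 1) * (1/4) ^ n - 0) < \<epsilon>" by blast
      hence n: "(4 * K + 1) * (1/4) ^ n < \<epsilon>" by simp
      have "(1/4) ^ n \<le> (4 * K + 1) * (1/4) ^ n" "4 * K * (1/4) ^ n \<le> (4 * K + 1) * (1/4) ^ n"
        using K0 by (auto simp: algebra_simps)
      hence "(1/4) ^ n < \<epsilon>" "4 * K * (1/4) ^ n < \<epsilon>" using n by linarith+
      hence "sqnormL2 w1 (\<lambda>\<zeta>. g \<zeta> - p n \<zeta>) < ennreal \<epsilon>" "sqnormL2 w2 (\<lambda>\<zeta>. h \<zeta> - Hankel f (p n) \<zeta>) < ennreal \<epsilon>"
        using p(2)[of n] hF[of n] e unfolding F_def by (auto intro: less_trans ennreal_lessI le_less_trans)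
      thus "\<exists>p\<in>analytic_polys. sqnormL2 w1 (\<lambda>\<zeta>. g \<zeta> - p \<zeta>) < ennreal \<epsilon> \<and> sqnormL2 w2 (\<lambda>\<zeta>. h \<zeta> - Hankel f p \<zeta>) < ennreal \<epsilon>"
        using p(1) by blast
    qed measurable
    thus ?thesis by blast
  qed
  \<comment> \<open>The factor 4 is 2 * 2: the squared triangle inequality is used once in each of
    the two spaces.\<close>
  have R_bound: "sqnormL2 w2 h \<le> ennreal (4 * K) * sqnormL2 w1 g" if g [measurable]: "g \<in> borel_measurable borel" and R: "R g h"
    for g h
  proof (rule ennreal_le_all_eps[where c="2 + 4 * K"])
    fix \<epsilon> :: real assume e: "\<epsilon> > 0"
    have [measurable]: "h \<in> borel_measurable borel" using R by (simp add: R_def)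
    from R e obtain p where p: "p \<in> analytic_polys" "sqnormL2 w1 (\<lambda>\<zeta>. g \<zeta> - p \<zeta>)
      < ennreal \<epsilon>" "sqnormL2 w2 (\<lambda>\<zeta>. h \<zeta> - Hankel f p \<zeta>) < ennreal \<epsilon>"
      unfolding R_def by blast
    note [measurable] = pm[OF p(1)]
    have "sqnormL2 w1 p = sqnormL2 w1 (\<lambda>\<zeta>. 1 * g \<zeta> + (-1) * (g \<zeta> - p \<zeta>))" by simp
    also have "\<dots> \<le> ennreal (2 * (norm (1 :: complex))\<^sup>2) * sqnormL2 w1 g + ennreal (2 * (norm (-1 :: complex))\<^sup>2)
      * sqnormL2 w1 (\<lambda>\<zeta>. g \<zeta> - p \<zeta>)"
      by (rule sqnormL2_lincomb_le) (use w1 in auto)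
    also have "\<dots> \<le> 2 * sqnormL2 w1 g + 2 * ennreal \<epsilon>"
      using p(2) by (intro add_mono mult_mono) auto
    finally have 1: "sqnormL2 w1 p \<le> 2 * sqnormL2 w1 g + 2 * ennreal \<epsilon>" .
    have "sqnormL2 w2 h = sqnormL2 w2 (\<lambda>\<zeta>. Hankel f p \<zeta> + (h \<zeta> - Hankel f p \<zeta>))" by simp
    also have "\<dots> \<le> 2 * sqnormL2 w2 (Hankel f p) + 2 * sqnormL2 w2 (\<lambda>\<zeta>. h \<zeta> - Hankel f p \<zeta>)"
      by (rule sqnormL2_add_le) (use w2' in auto)
    also have "\<dots> \<le> 2 * (ennreal K * (2 * sqnormL2 w1 g + 2 * ennreal \<epsilon>)) + 2 * ennreal \<epsilon>"
      using p(3) by (intro add_mono mult_left_mono order_trans[OF K[OF p(1)]] 1) auto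
    also have "\<dots> = ennreal (4 * K) * sqnormL2 w1 g + (ennreal (4 * K) * ennreal \<epsilon> + 2 * ennreal \<epsilon>)"
      using K0 by (simp add: ennreal_mult distrib_left mult_ac add_ac)
    also have "ennreal (4 * K) * ennreal \<epsilon> + 2 * ennreal \<epsilon> = ennreal ((2 + 4 * K) * \<epsilon>)"
    proof -
      have "ennreal (4 * K) * ennreal \<epsilon> + ennreal 2 * ennreal \<epsilon> = ennreal (4 * K * \<epsilon> + 2 * \<epsilon>)"
        using K0 e by (subst ennreal_plus) (auto simp: ennreal_mult)
      thus ?thesis by (simp add: algebra_simps)
    qed
    finally show "sqnormL2 w2 h \<le> ennreal (4 * K) * sqnormL2 w1 g + ennreal ((2 + 4 * K) * \<epsilon>)" .
  qed (use K0 in simp)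
  have R_lin: "R (\<lambda>x. a * g x + b * g' x) (\<lambda>x. a * h x + b * h' x)"
    if g [measurable]: "g \<in> borel_measurable borel" "g' \<in> borel_measurable borel" and R: "R g h" "R g' h'" for g g' h h' a b
    unfolding R_def
  proof (intro conjI allI impI)
    have [measurable]: "h \<in> borel_measurable borel" "h' \<in> borel_measurable borel" using R by (simp_all add: R_def)
    show "(\<lambda>x. a * h x + b * h' x) \<in> borel_measurable borel" by measurable
    fix \<epsilon> :: real assume e: "\<epsilon> > 0"
    define d where "d = \<epsilon> / (2 * (norm a)\<^sup>2 + 2 * (norm b)\<^sup>2 + 1)"
    have d: "d > 0" using e by (simp add: d_def add_nonneg_pos)
    from R(1) d obtain p where p: "p \<in> analytic_polys" "sqnormL2 w1 (\<lambda>\<zeta>. g \<zeta> - p \<zeta>)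
      < ennreal d" "sqnormL2 w2 (\<lambda>\<zeta>. h \<zeta> - Hankel f p \<zeta>) < ennreal d"
      unfolding R_def by blast
    from R(2) d obtain q where q: "q \<in> analytic_polys" "sqnormL2 w1 (\<lambda>\<zeta>. g' \<zeta> - q \<zeta>)
      < ennreal d" "sqnormL2 w2 (\<lambda>\<zeta>. h' \<zeta> - Hankel f q \<zeta>) < ennreal d"
      unfolding R_def by blast
    note [measurable] = pm[OF p(1)] pm[OF q(1)]
    have "sqnormL2 w1 (\<lambda>\<zeta>. a * g \<zeta> + b * g' \<zeta> - (a * p \<zeta> + b * q \<zeta>)) = sqnormL2 w1 (\<lambda>\<zeta>. a * (g \<zeta> - p \<zeta>) + b * (g' \<zeta> - q \<zeta>))"
      by (simp add: algebra_simps)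
    also have "\<dots> \<le> ennreal (2 * (norm a)\<^sup>2) * sqnormL2 w1 (\<lambda>\<zeta>. g \<zeta> - p \<zeta>) + ennreal (2 * (norm b)\<^sup>2) * sqnormL2 w1 (\<lambda>\<zeta>. g' \<zeta>
      - q \<zeta>)"
      by (rule sqnormL2_lincomb_le) (use w1 in auto)
    also have "\<dots> < ennreal \<epsilon>" using p(2) q(2) e by (intro ennreal_small_lincomb) (auto simp: d_def)
    finally have 1: "sqnormL2 w1 (\<lambda>\<zeta>. a * g \<zeta> + b * g' \<zeta> - (a * p \<zeta> + b * q \<zeta>)) < ennreal \<epsilon>" .
    have "AE \<zeta> in dm. a * h \<zeta> + b * h' \<zeta> - Hankel f (\<lambda>x. a * p x + b * q x) \<zeta>
      = a * (h \<zeta> - Hankel f p \<zeta>) + b * (h' \<zeta> - Hankel f q \<zeta>)"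
      using Hankel_lincomb[OF f p(1) q(1), of a b] by eventually_elim (simp add: algebra_simps)
    hence "sqnormL2 w2 (\<lambda>\<zeta>. a * h \<zeta> + b * h' \<zeta> - Hankel f (\<lambda>x. a * p x + b * q x) \<zeta>)
      = sqnormL2 w2 (\<lambda>\<zeta>. a * (h \<zeta> - Hankel f p \<zeta>) + b * (h' \<zeta> - Hankel f q \<zeta>))"
      by (rule sqnormL2_cong_AE)
    also have "\<dots> \<le> ennreal (2 * (norm a)\<^sup>2) * sqnormL2 w2 (\<lambda>\<zeta>. h \<zeta> - Hankel f p \<zeta>) + ennreal (2 * (norm b)\<^sup>2)
      * sqnormL2 w2 (\<lambda>\<zeta>. h' \<zeta> - Hankel f q \<zeta>)"
      by (rule sqnormL2_lincomb_le) (use w2' in auto)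
    also have "\<dots> < ennreal \<epsilon>" using p(3) q(3) e by (intro ennreal_small_lincomb) (auto simp: d_def)
    finally have 2: "sqnormL2 w2 (\<lambda>\<zeta>. a * h \<zeta> + b * h' \<zeta> - Hankel f (\<lambda>x. a * p x + b * q x) \<zeta>) < ennreal \<epsilon>" .
    show "\<exists>p\<in>analytic_polys. sqnormL2 w1 (\<lambda>\<zeta>. a * g \<zeta> + b * g' \<zeta> - p \<zeta>)
      < ennreal \<epsilon> \<and> sqnormL2 w2 (\<lambda>\<zeta>. a * h \<zeta> + b * h' \<zeta> - Hankel f p \<zeta>) < ennreal \<epsilon>"
      by (rule bexI[where x="\<lambda>x. a * p x + b * q x"], rule conjI, rule 1, rule 2, rule analytic_polys_lincomb[OF p(1) q(1)])
  qed
  \<comment> \<open>The difference of two values belongs to the graph over 0, hence has norm 0;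
    positivity of \<open>w2\<close> makes it vanish almost everywhere.\<close>
  have R_unique: "AE \<zeta> in dm. h \<zeta> = h' \<zeta>" if g: "g \<in> borel_measurable borel" and R: "R g h" "R g h'" for g h h'
  proof -
    have [measurable]: "h \<in> borel_measurable borel" "h' \<in> borel_measurable borel" using R by (simp_all add: R_def)
    have "R (\<lambda>x. 1 * g x + (-1) * g x) (\<lambda>x. 1 * h x + (-1) * h' x)" by (rule R_lin[OF g g R])
    from R_bound[OF _ this] have "sqnormL2 w2 (\<lambda>x. h x - h' x) \<le> ennreal (4 * K) * sqnormL2 w1 (\<lambda>x. 0)" by simp
    hence "sqnormL2 w2 (\<lambda>x. h x - h' x) = 0" by (simp add: sqnormL2_def)
    hence "AE \<zeta> in dm. ennreal ((norm (h \<zeta> - h' \<zeta>))\<^sup>2 * w2 \<zeta>) = 0" unfolding sqnormL2_def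
      by (subst (asm) nn_integral_0_iff_AE) auto
    thus ?thesis using w2
    proof eventually_elim
      case (elim \<zeta>)
      hence "(norm (h \<zeta> - h' \<zeta>))\<^sup>2 * w2 \<zeta> \<le> 0" by (simp add: ennreal_eq_0_iff)
      hence "(norm (h \<zeta> - h' \<zeta>))\<^sup>2 \<le> 0" using elim(2) by (simp add: mult_le_0_iff)
      thus ?case by simp
    qed
  qed
  have R_poly: "R p (Hankel f p)" if "p \<in> analytic_polys" for p
    unfolding R_def using pm[OF that] that by (auto simp: sqnormL2_def intro!: bexI[of _ p])
  define T where "T = (\<lambda>g. SOME h. R g h)"
  have T: "R g (T g)" if "g \<in> H2w w1" for g
    unfolding T_def by (rule someI_ex[OF R_ex[OF that]])
  show ?thesis unfolding Hankel_extends_bounded_def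
  proof (intro exI[of _ T] exI[of _ "sqrt (4 * K)"] conjI ballI allI)
    fix g assume g: "g \<in> H2w w1"
    note gm = H2w_D[OF g]
    have b: "sqnormL2 w2 (T g) \<le> ennreal (4 * K) * sqnormL2 w1 g" by (rule R_bound[OF gm(1) T[OF g]])
    have Tm: "T g \<in> borel_measurable borel" using T[OF g] by (simp add: R_def)
    show "normL2 w2 (T g) \<le> ennreal (sqrt (4 * K)) * normL2 w1 g"
      unfolding normL2_def using K0 by (intro ennsqrt_mult_le b) simp
    show "T g \<in> closL2 w2 (H2minus \<inter> L2w w2)" unfolding closL2_def
    proof (intro CollectI conjI allI impI)
      have "ennreal (4 * K) * sqnormL2 w1 g < \<infinity>" using gm(2) by (simp add: ennreal_mult_less_top)
      thus "T g \<in> L2w w2" unfolding L2w_def using Tm b by (auto simp: borel_dm intro: le_less_trans)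
      fix \<epsilon> :: real assume "\<epsilon> > 0"
      then obtain p where p: "p \<in> analytic_polys" "sqnormL2 w2 (\<lambda>\<zeta>. T g \<zeta> - Hankel f p \<zeta>) < ennreal \<epsilon>"
        using T[OF g] unfolding R_def by blast
      have "sqnormL2 w2 (Hankel f p) \<le> ennreal K * sqnormL2 w1 p" by (rule K[OF p(1)])
      also have "\<dots> < \<infinity>" using analytic_poly_sqnorm_finite[OF p(1) m1 w1] by (simp add: ennreal_mult_less_top)
      finally have "Hankel f p \<in> H2minus \<inter> L2w w2"
        using Hankel_poly_H2minus[OF f p(1)] pm(2)[OF p(1)] by (simp add: L2w_def borel_dm)
      thus "\<exists>h\<in>H2minus \<inter> L2w w2. sqnormL2 w2 (\<lambda>\<zeta>. T g \<zeta> - h \<zeta>) < ennreal \<epsilon>" using p(2) by blast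
    qed
    fix g' a b assume g': "g' \<in> H2w w1"
    have gg: "(\<lambda>x. a * g x + b * g' x) \<in> H2w w1" unfolding H2w_def
      by (rule closL2_lincomb[OF analytic_polys_measurable analytic_polys_lincomb m1 w1(1) g[unfolded H2w_def] g'[unfolded
        H2w_def]])
    show "AE \<zeta> in dm. T (\<lambda>x. a * g x + b * g' x) \<zeta> = a * T g \<zeta> + b * T g' \<zeta>"
      by (rule R_unique[OF H2w_D(1)[OF gg] T[OF gg] R_lin[OF gm(1) H2w_D(1)[OF g'] T[OF g] T[OF g']]])
  next
    fix p assume p: "p \<in> analytic_polys"
    show "AE \<zeta> in dm. T p \<zeta> = Hankel f p \<zeta>"
      by (rule R_unique[OF pm(1)[OF p] T[OF analytic_poly_H2w[OF p m1 w1]] R_poly[OF p]])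
  qed
qed

text \<open>In the degenerate case \<open>inverse 0 = 0\<close> makes the reciprocal weight vanish
  almost everywhere as well, so integrability holds in both cases of the dichotomy.\<close>

lemma A2_weight:
  assumes "A2 w"
  shows "w \<in> borel_measurable borel" "AE \<zeta> in dm. 0 \<le> w \<zeta>" "integrable dm w"
    "inv_weight w \<in> borel_measurable borel" "AE \<zeta> in dm. 0 \<le> inv_weight w \<zeta>" "integrable dm (inv_weight w)"
proof -
  show [measurable]: "w \<in> borel_measurable borel" using assms by (simp add: A2_def)
  show "inv_weight w \<in> borel_measurable borel" by measurable
  show "AE \<zeta> in dm. 0 \<le> w \<zeta>" using AE_dm_circle assms by (auto simp: A2_def elim: eventually_mono)
  thus "AE \<zeta> in dm. 0 \<le> inv_weight w \<zeta>" by eventually_elim (simp add: inv_weight_def)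
  have "integrable dm w \<and> integrable dm (inv_weight w)"
    using A2_dichotomy[OF assms]
  proof
    assume z: "AE \<zeta> in dm. w \<zeta> = 0"
    have "integrable dm w \<longleftrightarrow> integrable dm (\<lambda>_. 0 :: real)" using z by (intro integrable_cong_AE) auto
    moreover have "integrable dm (inv_weight w) \<longleftrightarrow> integrable dm (\<lambda>_. 0 :: real)"
      using z by (intro integrable_cong_AE) (auto simp: inv_weight_def elim: eventually_mono)
    ultimately show ?thesis by simp
  qed (auto simp: poisson_A2_def)
  thus "integrable dm w" "integrable dm (inv_weight w)" by auto
qed

text \<open>A nonzero number divided by 0 is infinite. Finiteness at z = 0 thus forces the
  numerator, the integral of \<open>|f|^2 w\<close>, to vanish.\<close>

lemma Gnorm_finite_degenerate:
  assumes f: "f \<in> H2minus" and [measurable]: "w \<in> borel_measurable borel" and w: "AE \<zeta> in dm. 0 < w \<zeta>"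
    and v: "AE \<zeta> in dm. v \<zeta> = 0"
    and [measurable]: "v \<in> borel_measurable borel" and G: "Gnorm f w v < \<infinity>"
  shows "AE \<zeta> in dm. f \<zeta> = 0"
proof -
  have [measurable]: "f \<in> borel_measurable borel" by (rule H2minusD[OF f])
  have "poisson_ext v 0 = (\<integral>\<zeta>. 0 \<partial>dm)" unfolding poisson_ext_def
    using v by (intro integral_cong_AE) (auto elim: eventually_mono)
  hence v0: "poisson_ext v 0 = 0" by simp
  have f0: "poisson_ext f 0 = 0" using poisson_H2minus(1)[OF f, of 0] by simp
  define N where "N = (\<lambda>z. \<integral>\<^sup>+\<zeta>. ennreal ((norm (f \<zeta> - poisson_ext f z))\<^sup>2 * Poisson z \<zeta> * w \<zeta>) \<partial>dm)"
  have "(SUP z\<in>ball 0 1. N z / ennreal (poisson_ext v z)) < \<infinity>" using G unfolding Gnorm_def ennsqrt_finite_iff N_def .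
  moreover have "N 0 / ennreal (poisson_ext v 0) \<le> (SUP z\<in>ball 0 1. N z / ennreal (poisson_ext v z))" by (rule SUP_upper) simp
  ultimately have "N 0 / ennreal (poisson_ext v 0) < \<infinity>" by (rule le_less_trans[rotated])
  hence "N 0 = 0" unfolding v0 by (cases "N 0 = 0") (auto simp: ennreal_divide_zero)
  hence "AE \<zeta> in dm. ennreal ((norm (f \<zeta>))\<^sup>2 * w \<zeta>) = 0"
    unfolding N_def f0 by (subst (asm) nn_integral_0_iff_AE) (auto simp: Poisson_def)
  thus ?thesis using w
  proof eventually_elim
    case (elim \<zeta>)
    hence "(norm (f \<zeta>))\<^sup>2 * w \<zeta> \<le> 0" by (simp add: ennreal_eq_0_iff)
    hence "(norm (f \<zeta>))\<^sup>2 \<le> 0" using elim(2) by (simp add: mult_le_0_iff)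
    thus ?case by simp
  qed
qed

theorem Gnorm_finite_imp_bounded:
  assumes "A2 mu" "A2 lam" and f: "f \<in> H2minus"
    and G1: "Gnorm f lam mu < \<infinity>" and G2: "Gnorm f (inv_weight mu) (inv_weight lam) < \<infinity>"
  shows "Hankel_extends_bounded f mu lam" "Hankel_extends_bounded f (inv_weight lam) (inv_weight mu)"
proof -
  note Wm = A2_weight[OF assms(1)] and Wl = A2_weight[OF assms(2)]
  have inv0: "AE \<zeta> in dm. inv_weight w \<zeta> = 0" if "AE \<zeta> in dm. w \<zeta> = 0" for w
    using that by eventually_elim (simp add: inv_weight_def)
  \<comment> \<open>If both weights vanish, so do both target weights. If exactly one vanishes, one
    of the two conditions has a vanishing denominator and a positive numerator weight, which forces
    f = 0.\<close>
  consider "AE \<zeta> in dm. mu \<zeta> = 0" "AE \<zeta> in dm. lam \<zeta> = 0"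
    | Q where "AE \<zeta> in dm. mu \<zeta> = 0" "poisson_A2 lam Q"
    | Q where "poisson_A2 mu Q" "AE \<zeta> in dm. lam \<zeta> = 0"
    | Q1 Q2 where "poisson_A2 mu Q1" "poisson_A2 lam Q2"
    using A2_dichotomy[OF assms(1)] A2_dichotomy[OF assms(2)] by blast
  hence "Hankel_extends_bounded f mu lam \<and> Hankel_extends_bounded f (inv_weight lam) (inv_weight mu)"
  proof cases
    case 1
    thus ?thesis by (intro conjI Hankel_extends_bounded_zero_weight f inv0)
  next
    case 2
    have "AE \<zeta> in dm. f \<zeta> = 0"
      by (rule Gnorm_finite_degenerate[OF f Wl(1) _ 2(1) Wm(1) G1]) (use 2 in \<open>simp add: poisson_A2_def\<close>)
    thus ?thesis by (intro conjI Hankel_extends_bounded_zero_symbol f)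
  next
    case 3
    have "AE \<zeta> in dm. f \<zeta> = 0"
      by (rule Gnorm_finite_degenerate[OF f Wm(4) _ inv0[OF 3(2)] Wl(4) G2]) (use poisson_A2_inv[OF 3(1)] in \<open>simp add:
        poisson_A2_def\<close>)
    thus ?thesis by (intro conjI Hankel_extends_bounded_zero_symbol f)
  next
    case 4
    note I = poisson_A2_inv[OF 4(1)] poisson_A2_inv[OF 4(2)]
    have pos: "AE \<zeta> in dm. 0 < mu \<zeta>" "AE \<zeta> in dm. 0 < lam \<zeta>" "AE \<zeta> in dm. 0 < inv_weight mu \<zeta>" "AE \<zeta> in dm. 0 < inv_weight lam \<zeta>"
      using 4 I by (simp_all add: poisson_A2_def)
    note O1 = Gnorm_finite_oscillation[OF f 4(2) pos(1) Wm(3) G1]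
    note O2 = Gnorm_finite_oscillation[OF f I(1) pos(4) Wl(6) G2]
    from O1(1) obtain \<kappa>1 where \<kappa>1: "\<kappa>1 > 0" "\<And>z. z \<in> ball 0 1 \<Longrightarrow> poisson_ext (\<lambda>\<zeta>. (norm (f \<zeta> - poisson_ext f z))\<^sup>2 * lam \<zeta>) z
      \<le> \<kappa>1 * poisson_ext mu z" by blast
    from O2(1) obtain \<kappa>2 where \<kappa>2: "\<kappa>2 > 0" "\<And>z. z \<in> ball 0 1 \<Longrightarrow>
      poisson_ext (\<lambda>\<zeta>. (norm (f \<zeta> - poisson_ext f z))\<^sup>2 * inv_weight mu \<zeta>) z \<le> \<kappa>2 * poisson_ext (inv_weight lam) z" by blast
    define \<kappa> where "\<kappa> = max \<kappa>1 \<kappa>2"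
    have k: "\<kappa> > 0" using \<kappa>1(1) by (simp add: \<kappa>_def)
    have o1: "poisson_ext (\<lambda>\<zeta>. (norm (f \<zeta> - poisson_ext f z))\<^sup>2 * lam \<zeta>) z \<le> \<kappa> * poisson_ext mu z" if "z \<in> ball 0 1" for z
      by (rule order_trans[OF \<kappa>1(2)[OF that] mult_right_mono]) (use poisson_ext_pos[OF Wm(3) pos(1), of z] that in \<open>auto simp:
        \<kappa>_def\<close>)
    have o2: "poisson_ext (\<lambda>\<zeta>. (norm (f \<zeta> - poisson_ext f z))\<^sup>2 * inv_weight mu \<zeta>) z \<le> \<kappa> * poisson_ext (inv_weight lam) z"
      if "z \<in> ball 0 1" for z
      by (rule order_trans[OF \<kappa>2(2)[OF that] mult_right_mono]) (use poisson_ext_pos[OF Wl(6) pos(4), of z] that in \<open>auto simp: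
        \<kappa>_def\<close>)
    obtain K1 where K1: "K1 \<ge> 0" "\<forall>p\<in>analytic_polys. sqnormL2 lam (Hankel f p) \<le> ennreal K1 * sqnormL2 mu p"
      using Hankel_poly_bound[OF 4 f O1(2) O2(2) k o1 o2] by blast
    \<comment> \<open>Replacing (mu, lam) by (1/lam, 1/mu) exchanges the two oscillation conditions,
      so the same bound yields the second operator.\<close>
    have "\<exists>K\<ge>0. \<forall>p\<in>analytic_polys. sqnormL2 (inv_weight mu) (Hankel f p) \<le> ennreal K * sqnormL2 (inv_weight lam) p"
      by (rule Hankel_poly_bound[OF I(2,1) f O2(2) _ k o2]) (use O1(2) o1 in auto)
    then obtain K2 where K2: "K2 \<ge> 0" "\<forall>p\<in>analytic_polys. sqnormL2 (inv_weight mu) (Hankel f p)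
      \<le> ennreal K2 * sqnormL2 (inv_weight lam) p" by blast
    show ?thesis
      using Hankel_extends_boundedI[OF f Wm(1) Wl(1) Wm(2,3) pos(2) K1(1)] Hankel_extends_boundedI[OF f Wl(4) Wm(4) Wl(5,6) pos(3)
        K2(1)] K1(2) K2(2) by blast
  qed
  thus "Hankel_extends_bounded f mu lam" "Hankel_extends_bounded f (inv_weight lam) (inv_weight mu)" by auto
qed

theorem theorem1p3:
  fixes mu lam :: "complex \<Rightarrow> real" and \<phi> :: "complex \<Rightarrow> complex"
  assumes "A2 mu" and "A2 lam"
    and "\<phi> \<in> H2minus" and "\<phi> \<in> L2w lam"
  shows "(SUP z\<in>ball 0 1. normL2 lam (Hankel \<phi> (Kz z)) / normL2 mu (Kz z)) = Gnorm \<phi> lam mu \<and>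
         (SUP z\<in>ball 0 1. normL2 (inv_weight mu) (Hankel \<phi> (Kz z)) / normL2 (inv_weight lam) (Kz z))
           = Gnorm \<phi> (inv_weight mu) (inv_weight lam) \<and>
         ((Gnorm \<phi> lam mu < \<infinity> \<and> Gnorm \<phi> (inv_weight mu) (inv_weight lam) < \<infinity>) \<longleftrightarrow>
         (Hankel_extends_bounded \<phi> mu lam \<and>
          Hankel_extends_bounded \<phi> (inv_weight lam) (inv_weight mu)))"
proof -
  note Wm = A2_weight[OF assms(1)] and Wl = A2_weight[OF assms(2)]
  note E1 = Kz_SUP_eq_Gnorm[OF assms(3) Wl(1) Wm(1) Wl(2) Wm(2,3)]
  note E2 = Kz_SUP_eq_Gnorm[OF assms(3) Wm(4) Wl(4) Wm(5) Wl(5,6)]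
  have "Gnorm \<phi> lam mu < \<infinity> \<and> Gnorm \<phi> (inv_weight mu) (inv_weight lam) < \<infinity>"
    if "Hankel_extends_bounded \<phi> mu lam" "Hankel_extends_bounded \<phi> (inv_weight lam) (inv_weight mu)"
    using bounded_imp_SUP_finite[OF assms(3) that(1) Wm(1) Wl(1) Wm(2,3) Wl(2)]
      bounded_imp_SUP_finite[OF assms(3) that(2) Wl(4) Wm(4) Wl(5,6) Wm(5)]
    unfolding E1 E2 by blast
  thus ?thesis using E1 E2 Gnorm_finite_imp_bounded[OF assms(1-3)] by blast
qed

end
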